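(* Let $q\equiv1\bmod 6$ be a fixed prime power. For $\frac13<s<1$ and $g\to\infty$, $$\frac{1}{|\mathfrak H(3g)|}\sum_{\chi\in\mathfrak H(3g)}L(s,\chi)\sim M_q(s),\qquad M_q(s)=\zeta_q(3s)\prod_P\left(1-\frac{1}{|P|^{3s}(|P|+1)}\right).$$ For $s=\frac13$ and $g\to\infty$, $$\frac{1}{|\mathfrak H(3g)|}\sum_{\chi\in\mathfrak H(3g)}L(\tfrac13,\chi)\sim C_q\,g,\qquad C_q=\prod_P\left(1-\frac{1}{|P|(|P|+1)}\right).$$
   Context: Let $q$ be a prime power with $q\equiv1\bmod 6$. $\mathcal M$ is the set of monic polynomials in $\mathbb F_q[T]$; $|F|=q^{\deg F}$; $P$ always denotes a monic irreducible polynomial (prime), and products over $P$ run over all of them. $\zeta_q(s)=(1-q^{1-s})^{-1}$. Cubic characters: fix an isomorphism $\Omega$ from the cube roots of unity in $\mathbb F_q^*$ to $\mu_3=\{1,\xi_3,\xi_3^2\}\subset\mathbb C^*$, $\xi_3=e^{2\pi i/3}$. For a prime $P$ and $a\in\mathbb F_q[T]$, put $\chi_P(a)=0$ if $P\mid a$, and otherwise $\chi_P(a)=\alpha\in\mu_3$ where $a^{(q^{\deg P}-1)/3}\equiv\Omega^{-1}(\alpha)\bmod P$. For monic $F=P_1^{e_1}\cdots P_k^{e_k}$ put $\chi_F(a)=\prod_i\chi_{P_i}(a)^{e_i}$. The genus of a primitive cubic character $\chi$ is $\deg\mathrm{cond}(\chi)-2+\delta_\chi$, where $\delta_\chi=0$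 if $\chi$ is trivial on $\mathbb F_q^*$ and $\delta_\chi=1$ otherwise. $\mathfrak H(3g)$ is the set of characters $\chi_F$ of genus $3g$ with $F$ monic square-free; equivalently $\mathfrak H(3g)=\{\chi_F: F \text{ monic square-free},\ \deg F=3g+1\}$ (here $g$ is a positive integer). $L(s,\chi)=\sum_{F\in\mathcal M}\chi(F)|F|^{-s}$, which for nontrivial $\chi$ is a polynomial in $q^{-s}$ (grouping the terms by degree) and so is defined for all $s$. The notation $a_g\sim b_g$ means $a_g/b_g\to1$ as $g\to\infty$. *)

theory Defs
  imports
    "HOL-Analysis.Analysis"
    "HOL-Computational_Algebra.Computational_Algebra"
    "HOL-Number_Theory.Cong"
    "HOL-Library.Landau_Symbols"
begin

text \<open>
  The finite field is the type \<open>'k :: finite_field\<close>, so that \<open>q = CARD('k)\<close> and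
  \<open>\<bbbF>\<^sub>q[T]\<close> is \<open>'k poly\<close>.
\<close>

definition monic :: "'k::finite_field poly \<Rightarrow> bool" where
  "monic F \<longleftrightarrow> lead_coeff F = 1"

definition prime_polys :: "'k::finite_field poly set" where
  "prime_polys = {P. monic P \<and> irreducible P}"

definition poly_norm :: "'k::finite_field poly \<Rightarrow> nat" where
  "poly_norm F = CARD('k) ^ degree F"

definition cube_root_iso :: "('k::finite_field \<Rightarrow> complex) \<Rightarrow> bool" where
  "cube_root_iso \<Omega> \<longleftrightarrow>
     bij_betw \<Omega> {c. c ^ 3 = 1} {z. z ^ 3 = 1} \<and>
     (\<forall>c d. c ^ 3 = 1 \<longrightarrow> d ^ 3 = 1 \<longrightarrow> \<Omega> (c * d) = \<Omega> c * \<Omega> d)"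

text \<open>
  The description below determines \<open>\<alpha>\<close> uniquely when \<open>q \<equiv> 1 (mod 3)\<close>, \<open>P\<close> is prime and
  \<open>\<Omega>\<close> satisfies \<^const>\<open>cube_root_iso\<close>.
\<close>

definition prime_char ::
    "('k::finite_field \<Rightarrow> complex) \<Rightarrow> 'k poly \<Rightarrow> 'k poly \<Rightarrow> complex" where
  "prime_char \<Omega> P a =
     (if P dvd a then 0
      else THE \<alpha>. \<alpha> ^ 3 = 1 \<and>
             [a ^ ((CARD('k) ^ degree P - 1) div 3) =
              [: inv_into {c. c ^ 3 = 1} \<Omega> \<alpha> :]] (mod P))"

text \<open>
  The exponent is the multiplicity of \<open>P\<close> in \<open>F\<close>, for \<open>F \<noteq> 0\<close>. The library constant
  \<open>multiplicity\<close> would need a gcd structure on the coefficient field.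
\<close>

definition cubic_char ::
    "('k::finite_field \<Rightarrow> complex) \<Rightarrow> 'k poly \<Rightarrow> 'k poly \<Rightarrow> complex" where
  "cubic_char \<Omega> F a =
     (\<Prod>P | P \<in> prime_polys \<and> P dvd F. prime_char \<Omega> P a ^ Max {n. P ^ n dvd F})"

text \<open>
  The degree of the conductor: the least degree of a modulus \<open>N\<close> such that \<open>\<psi>\<close> is trivial
  on all \<open>a \<equiv> 1 (mod N)\<close> at which it does not vanish, i.e. such that \<open>\<psi>\<close> is induced by a
  character modulo \<open>N\<close>.
\<close>

definition cond_degree :: "('k::finite_field poly \<Rightarrow> complex) \<Rightarrow> nat" where
  "cond_degree \<psi> =
     (LEAST n. \<exists>N. monic N \<and> degree N = n \<and>
        (\<forall>a. \<psi> a \<noteq> 0 \<longrightarrow> [a = 1] (mod N) \<longrightarrow> \<psi> a = 1))"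

definition char_genus :: "('k::finite_field poly \<Rightarrow> complex) \<Rightarrow> int" where
  "char_genus \<psi> =
     int (cond_degree \<psi>) - 2 + (if \<forall>c. c \<noteq> 0 \<longrightarrow> \<psi> [:c:] = 1 then 0 else 1)"

text \<open>
  A set of characters, not of polynomials. For \<open>n = 3 * g\<close> the members are the characters
  \<open>\<psi>\<^sub>F\<close> with \<open>F\<close> monic, square-free and of degree \<open>3 * g + 1\<close>.
\<close>

definition cubic_family ::
    "('k::finite_field \<Rightarrow> complex) \<Rightarrow> nat \<Rightarrow> ('k poly \<Rightarrow> complex) set" where
  "cubic_family \<Omega> n =
     {\<psi>. \<exists>F. monic F \<and> squarefree F \<and> \<psi> = cubic_char \<Omega> F \<and> char_genus \<psi> = int n}"

text \<open>
  The terms are grouped by degree; for a nontrivial character only finitely many of the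
  groups are nonzero, so the series makes sense for every \<open>s\<close>.
\<close>

definition L_fun :: "complex \<Rightarrow> ('k::finite_field poly \<Rightarrow> complex) \<Rightarrow> complex" where
  "L_fun s \<psi> =
     (\<Sum>n. \<Sum>F | monic F \<and> degree F = n. \<psi> F * of_nat (poly_norm F) powr (- s))"

definition zeta_q :: "nat \<Rightarrow> complex \<Rightarrow> complex" where
  "zeta_q q s = inverse (1 - of_nat q powr (1 - s))"

text \<open>The unconditional product, i.e. the limit over all finite sets of primes.\<close>

definition prime_prod :: "('k::finite_field poly \<Rightarrow> complex) \<Rightarrow> complex" where
  "prime_prod f = Lim (finite_subsets_at_top prime_polys) (\<lambda>S. \<Prod>P\<in>S. f P)"

definition M_const :: "'k::finite_field itself \<Rightarrow> complex \<Rightarrow> complex" where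
  "M_const _ s =
     zeta_q CARD('k) (3 * s) *
     prime_prod (\<lambda>P :: 'k poly.
       1 - 1 / (of_nat (poly_norm P) powr (3 * s) * (of_nat (poly_norm P) + 1)))"

definition C_const :: "'k::finite_field itself \<Rightarrow> complex" where
  "C_const _ =
     prime_prod (\<lambda>P :: 'k poly.
       1 - 1 / (of_nat (poly_norm P) * (of_nat (poly_norm P) + 1)))"

definition family_average ::
    "('k::finite_field \<Rightarrow> complex) \<Rightarrow> nat \<Rightarrow> complex \<Rightarrow> complex" where
  "family_average \<Omega> n s =
     (\<Sum>\<psi>\<in>cubic_family \<Omega> n. L_fun s \<psi>) / of_nat (card (cubic_family \<Omega> n))"

end

theory Submission
  imports Defs "HOL-Algebra.Algebraic_Closure_Type"
begin

text \<open>
  Averaging \<open>L(s, \<chi>\<^sub>F)\<close> over square-free \<open>F\<close> of degree \<open>N = 3g + 1\<close> means averaging \<open>\<chi>\<^sub>F(a)\<close>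
  over \<open>F\<close> and over monic \<open>a\<close> of each degree \<open>m < N\<close>. Sieve square-free \<open>F\<close> by \<open>F = F' D\<^sup>2\<close> with signs
  \<open>\<mu>(D)\<close>. If \<open>2 deg D \<le> N - m\<close>, reciprocity and orthogonality in \<open>F'\<close> leave only the cubes \<open>a = A\<^sup>3\<close>,
  which give the main term. If \<open>2 deg D > N - m\<close>, Poisson summation in \<open>a\<close> leads to averages of cubic
  Gauss sums \<open>G(V, c)\<close> over the monic \<open>c\<close> of degree \<open>N\<close> divisible by \<open>D\<^sup>2\<close>.

  The bound for these averages replaces the analytic theory of metaplectic Eisenstein series by a Farey
  dissection: with \<open>\<beta> c\<^sub>0 - b\<^sub>0 \<gamma> = 1\<close>, the substitution \<open>b = r \<beta> + t b\<^sub>0\<close>, \<open>c = r \<gamma> + t c\<^sub>0\<close> satisfies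
  \<open>\<chi>\<^sub>c(b) = \<chi>\<^bsub>c\<^sub>0\<^esub>(b\<^sub>0) \<chi>\<^sub>t(r)\<close>. It expresses the average over \<open>deg c = n\<close> through averages over
  \<open>deg c\<^sub>0 \<le> deg W + 1\<close>, for which \<open>|G(W, c)|\<^sup>2 \<le> |c| |gcd(W, c)|\<close> suffices, and through sums of
  \<open>\<chi>\<^sub>t(r)\<close> over all \<open>t\<close>, in which only constant multiples of cubes \<open>r\<close> survive. This gives
  \<open>|\<Sum>\<^sub>c G(W, c)| \<le> K q\<^bsup>4n/3\<^esup> |W|\<^bsup>1/4\<^esup>\<close>. The total error is then \<open>O(q\<^sup>N)\<close> at \<open>s = 1/3\<close>, against a main
  term of order \<open>g q\<^sup>N\<close>, and \<open>o(q\<^sup>N)\<close> for \<open>s > 1/3\<close>.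

  The symbol itself is defined as a power of the resultant over the algebraic closure, so that
  reciprocity is the symmetry of the resultant; irreducible \<open>c\<close> are compared with \<open>prime_char\<close> by
  letting the Frobenius map act on the roots.
\<close>

text \<open>The critical range is deg a = m close to N, where the cutoff (N - m)/2 leaves
  orthogonality almost nothing to act on. At s = 1/3 the weight of degree m is q^(-m/3), so an error
  q^(4N/3 - e(N - m)) in degree m sums to O(q^N) exactly when e > 1/3. The estimates give e = 7/16:
  the dual sum of length N - m loses q^((N - m)/4) through the factor |W|^(1/4), while the sum over
  the moduli divisible by D^2 and over all D of degree d gains q^(-11d/8), with d > (N - m)/2, and
  11/16 - 1/4 = 7/16. The exponent 4n/3 is the one belonging to the pole that the metaplectic theory
  predicts; all the room is in the dependence on W.

  Since N = 3g + 1 is not a multiple of 3, no modulus of degree N is a cube. Hence the zero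
  frequency drops out of Poisson summation and every L-function is a polynomial in q^-s of degree
  below N. The condition q = 1 mod 6 makes (q - 1)/3 even, which rids reciprocity of the sign of the
  resultant.\<close>

hide_const (open) Divisibility.irreducible Polynomials.degree Polynomials.lead_coeff
  up_ring.coeff up_ring.monom Coset.order module.smult Divisibility.prime

section \<open>Bezout identities and coprimality for polynomials over a field\<close>

lemma field_poly_bezout:
  fixes a b :: "'a::field poly"
  shows "\<exists>u v d. u * a + v * b = d \<and> d dvd a \<and> d dvd b"
\<comment> \<open>The measure puts 0 strictly below the nonzero constants, which have the same
  degree; so the last division step decreases it too.\<close>
proof (induction "if b = 0 then 0 else Suc (degree b)" arbitrary: a b rule: less_induct)
  case less
  show ?case
  proof (cases "b = 0")
    case True
    then show ?thesis by (intro exI[of _ 1] exI[of _ 0] exI[of _ a]) auto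
  next
    case False
    have "(if a mod b = 0 then 0 else Suc (degree (a mod b))) < (if b = 0 then 0 else Suc (degree b))"
      using False degree_mod_less'[of b a] by auto
    from less[OF this] obtain u v d where
      uvd: "u * b + v * (a mod b) = d" "d dvd b" "d dvd a mod b" by blast
    have "d dvd a" using uvd(2,3) by (simp add: dvd_mod_iff)
    moreover have "v * a + (u - v * (a div b)) * b = d"
    proof -
      have "a mod b = a - a div b * b" by (simp add: minus_div_mult_eq_mod)
      with uvd(1) show ?thesis by (simp add: algebra_simps)
    qed
    ultimately show ?thesis using uvd(2) by blast
  qed
qed

lemma field_poly_coprime_bezout:
  fixes a b :: "'a::field poly"
  assumes "coprime a b"
  obtains u v where "u * a + v * b = 1"
proof -
  obtain u v d where uvd: "u * a + v * b = d" "d dvd a" "d dvd b"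
    using field_poly_bezout by blast
  from assms uvd(2,3) have "d dvd 1" by (metis coprime_def)
  then obtain e where "1 = d * e" by (elim dvdE)
  then have "(e * u) * a + (e * v) * b = 1"
    by (simp add: uvd(1)[symmetric] algebra_simps)
  then show thesis by (rule that)
qed

lemma bezout_imp_coprime:
  fixes a b :: "'a::field poly"
  assumes "u * a + v * b = 1"
  shows "coprime a b"
  by (rule coprimeI) (metis assms dvd_add dvd_mult)

lemma field_poly_coprime_mult_iff:
  fixes a b c :: "'a::field poly"
  shows "coprime (a * b) c \<longleftrightarrow> coprime a c \<and> coprime b c"
proof safe
  assume "coprime (a * b) c"
  then show "coprime a c" "coprime b c"
    by (auto simp: coprime_def intro: dvd_mult dvd_mult2)
next
  assume "coprime a c" "coprime b c"
  then obtain u v u' v' where "u * a + v * c = 1" "u' * b + v' * c = 1"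
    using field_poly_coprime_bezout by metis
  then have "(u * a + v * c) * (u' * b + v' * c) = 1" by simp
  then have "(u * u') * (a * b) + (u * a * v' + v * u' * b + v * v' * c) * c = 1"
    by (simp add: algebra_simps)
  then show "coprime (a * b) c" by (rule bezout_imp_coprime)
qed

lemma field_poly_coprime_dvd_mult:
  fixes a b c :: "'a::field poly"
  assumes "coprime a b" "a dvd b * c"
  shows "a dvd c"
proof -
  obtain u v where "u * a + v * b = 1" using assms(1) field_poly_coprime_bezout by blast
  then have "c = c * (u * a + v * b)" by simp
  also have "\<dots> = (u * c) * a + v * (b * c)" by (simp add: algebra_simps)
  also have "a dvd \<dots>" by (rule dvd_add[OF dvd_triv_right dvd_mult[OF assms(2)]])
  finally show ?thesis .
qed

lemma field_poly_coprime_mult_dvd: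
  fixes a b c :: "'a::field poly"
  assumes "coprime a b" "a dvd c" "b dvd c"
  shows "a * b dvd c"
proof -
  obtain k where "c = b * k" using assms(3) by (elim dvdE)
  with assms(1,2) have "a dvd k" using field_poly_coprime_dvd_mult by blast
  with \<open>c = b * k\<close> show ?thesis by (simp add: mult.commute mult_dvd_mono)
qed

lemma field_poly_coprime_power:
  fixes a b :: "'a::field poly"
  shows "coprime a b \<Longrightarrow> coprime (a ^ n) b"
  by (induction n) (auto simp: field_poly_coprime_mult_iff)

subsection \<open>Polynomials of bounded degree\<close>

text \<open>The condition is on coefficients so that 0 belongs to every \<open>polys_below n\<close>
  and linear closure is immediate. \<open>polys_below (degree c)\<close> serves as the residue
  system modulo \<open>c\<close>, also for \<open>c = 1\<close>.\<close>

definition polys_below :: "nat \<Rightarrow> 'k::finite_field poly set" where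
  "polys_below n = {p. \<forall>i\<ge>n. coeff p i = 0}"

definition monics :: "nat \<Rightarrow> 'k::finite_field poly set" where
  "monics n = {F. monic F \<and> degree F = n}"

lemma polys_below_iff: "p \<in> polys_below n \<longleftrightarrow> p = 0 \<or> degree p < n"
  unfolding polys_below_def mem_Collect_eq
  by (metis coeff_0 coeff_eq_0 leading_coeff_0_iff linorder_not_le order_less_le_trans)

lemma polys_below_0 [simp]: "polys_below 0 = {0}"
  by (auto simp: polys_below_iff)

lemma zero_polys_below [simp]: "0 \<in> polys_below n"
  by (simp add: polys_below_iff)

lemma polys_below_mono: "m \<le> n \<Longrightarrow> polys_below m \<subseteq> polys_below n"
  by (auto simp: polys_below_def)

lemma polys_below_add: "p \<in> polys_below n \<Longrightarrow> r \<in> polys_below n \<Longrightarrow> p + r \<in> polys_below n"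
  and polys_below_diff: "p \<in> polys_below n \<Longrightarrow> r \<in> polys_below n \<Longrightarrow> p - r \<in> polys_below n"
  and polys_below_uminus: "p \<in> polys_below n \<Longrightarrow> - p \<in> polys_below n"
  and polys_below_smult: "p \<in> polys_below n \<Longrightarrow> smult c p \<in> polys_below n"
  by (auto simp: polys_below_def)

text \<open>The sharp bound, since degrees at most m - 1 and n - 1 add up to m + n - 2. The unit
  gained over m + n is what brings products below the critical coefficient in
  \<open>e_frac_small\<close>.\<close>

lemma polys_below_mult:
  assumes "p \<in> polys_below m" "r \<in> polys_below n"
  shows "p * r \<in> polys_below (m + n - 1)"
proof (cases "p = 0 \<or> r = 0")
  case False
  then show ?thesis using assms by (auto simp: polys_below_iff degree_mult_eq)
qed auto

lemma polys_below_mult_degree: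
  assumes "p \<in> polys_below m"
  shows "p * r \<in> polys_below (m + degree r)"
proof (cases "p = 0 \<or> r = 0")
  case False
  then show ?thesis using assms by (auto simp: polys_below_iff degree_mult_eq)
qed auto

lemma polys_below_Suc:
  "polys_below (Suc n) = (\<lambda>(a, p). pCons a p) ` (UNIV \<times> polys_below n)"
proof safe
  fix p :: "'k::finite_field poly" assume p: "p \<in> polys_below (Suc n)"
  obtain a p' where "p = pCons a p'" by (cases p)
  moreover from this p have "p' \<in> polys_below n"
    unfolding polys_below_def by (auto simp: coeff_pCons split: nat.splits)
  ultimately show "p \<in> (\<lambda>(a, p). pCons a p) ` (UNIV \<times> polys_below n)" by auto
next
  fix a and p :: "'k::finite_field poly" assume "p \<in> polys_below n"
  then show "pCons a p \<in> polys_below (Suc n)"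
    by (auto simp: polys_below_def coeff_pCons split: nat.splits)
qed

lemma finite_polys_below [simp]: "finite (polys_below n)"
  by (induction n) (auto simp: polys_below_Suc)

lemma card_polys_below: "card (polys_below n :: 'k::finite_field poly set) = CARD('k) ^ n"
proof (induction n)
  case (Suc n)
  have "inj_on (\<lambda>(a, p). pCons a p) (UNIV \<times> polys_below n :: ('k \<times> 'k poly) set)"
    by (auto simp: inj_on_def)
  then show ?case using Suc by (simp add: polys_below_Suc card_image card_cartesian_product)
qed auto

lemma monicsD: "F \<in> monics n \<Longrightarrow> monic F" "F \<in> monics n \<Longrightarrow> degree F = n"
  by (auto simp: monics_def)

lemma monic_nonzero: "monic F \<Longrightarrow> F \<noteq> 0"
  by (auto simp: monic_def)

lemma monic_1 [simp]: "monic 1"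
  by (simp add: monic_def)

lemma monic_mult: "monic F \<Longrightarrow> monic G \<Longrightarrow> monic (F * G)"
  by (simp add: monic_def lead_coeff_mult)

lemma monic_mult_cancel: "monic F \<Longrightarrow> monic (F * G) \<Longrightarrow> monic G"
  by (simp add: monic_def lead_coeff_mult)

lemma monic_power: "monic F \<Longrightarrow> monic (F ^ n)"
  by (induction n) (auto intro: monic_mult)

lemma monic_prod: "(\<And>x. x \<in> A \<Longrightarrow> monic (f x)) \<Longrightarrow> monic (\<Prod>x\<in>A. f x)"
  by (induction A rule: infinite_finite_induct) (auto intro: monic_mult)

lemma degree_mult_monic: "monic F \<Longrightarrow> monic G \<Longrightarrow> degree (F * G) = degree F + degree G"
  by (simp add: degree_mult_eq monic_nonzero)

lemma monics_mult: "F \<in> monics m \<Longrightarrow> G \<in> monics n \<Longrightarrow> F * G \<in> monics (m + n)"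
  by (auto simp: monics_def monic_mult degree_mult_monic)

lemma monic_degree_0: "monic F \<Longrightarrow> degree F = 0 \<Longrightarrow> F = 1"
  by (auto simp: monic_def elim: degree_eq_zeroE)

lemma monics_0 [simp]: "monics 0 = {1}"
  by (auto simp: monics_def monic_degree_0)

lemma monic_add_below: "monic F \<Longrightarrow> p \<in> polys_below (degree F) \<Longrightarrow> F + p \<in> monics (degree F)"
  by (auto simp: polys_below_iff monics_def monic_def degree_add_eq_left
      coeff_eq_0 lead_coeff_add_le)

lemma monics_eq_image:
  fixes G :: "'k::finite_field poly"
  assumes "G \<in> monics n"
  shows "monics n = (\<lambda>p. G + p) ` polys_below n"
proof safe
  fix F :: "'k poly" assume F: "F \<in> monics n"
  have "F - G \<in> polys_below n"
    unfolding polys_below_def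
  proof safe
    fix i assume "n \<le> i"
    then show "coeff (F - G) i = 0"
      using F assms by (cases "i = n") (auto simp: monics_def monic_def coeff_eq_0)
  qed
  then show "F \<in> (\<lambda>p. G + p) ` polys_below n" by (intro image_eqI[of _ _ "F - G"]) auto
next
  fix p :: "'k poly" assume "p \<in> polys_below n"
  then show "G + p \<in> monics n" using monic_add_below[of G p] assms by (auto simp: monics_def)
qed

lemma monom_in_monics: "monom 1 n \<in> monics n"
  by (auto simp: monics_def monic_def degree_monom_eq)

lemma finite_monics [simp]: "finite (monics n)"
  by (subst monics_eq_image[OF monom_in_monics]) simp

lemma card_monics: "card (monics n :: 'k::finite_field poly set) = CARD('k) ^ n"
  by (subst monics_eq_image[OF monom_in_monics])
    (simp add: card_image card_polys_below)

lemma mod_in_polys_below: "c \<noteq> 0 \<Longrightarrow> p mod c \<in> polys_below (degree c)"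
  by (metis degree_mod_less polys_below_iff)

lemma mod_below_id: "p \<in> polys_below (degree c) \<Longrightarrow> p mod c = p"
  by (auto simp: polys_below_iff mod_poly_less)

lemma polys_below_dvd_eq_0: "p \<in> polys_below (degree c) \<Longrightarrow> c dvd p \<Longrightarrow> p = 0"
  by (metis mod_below_id dvd_eq_mod_eq_0)

lemma associated_monic:
  assumes "p \<noteq> 0"
  obtains c G where "c \<noteq> 0" "monic G" "p = smult c G"
  using that[of "lead_coeff p" "smult (inverse (lead_coeff p)) p"] assms
  by (auto simp: monic_def)

lemma monic_dvd_antisym: "monic F \<Longrightarrow> monic G \<Longrightarrow> F dvd G \<Longrightarrow> G dvd F \<Longrightarrow> F = G"
  by (metis degree_mult_monic dvdE le_add1 le_antisym dvd_imp_degree_le monic_degree_0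
      monic_mult_cancel monic_nonzero add_cancel_right_right mult.right_neutral)

lemma multiples_in_monics:
  assumes "D \<in> monics d"
  shows "{F \<in> monics n. D dvd F} = (if d \<le> n then (\<lambda>G. D * G) ` monics (n - d) else {})"
proof -
  have "\<exists>G\<in>monics (n - d). F = D * G \<and> d \<le> n" if "F \<in> monics n" "D dvd F" for F
  proof -
    from that(2) obtain G where G: "F = D * G" by (elim dvdE)
    then have mG: "monic G" using that assms monic_mult_cancel by (auto simp: monics_def)
    then have "degree G = n - d \<and> d \<le> n" using that G assms
      by (auto simp: monics_def degree_mult_monic)
    with G mG show ?thesis by (auto simp: monics_def)
  qed
  moreover have "D * G \<in> monics n" if "G \<in> monics (n - d)" "d \<le> n" for G
    using monics_mult[OF assms that(1)] that(2) by simp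
  ultimately show ?thesis by auto
qed

subsection \<open>Sums over residues\<close>

lemma bij_betw_residue_mult:
  assumes "c \<noteq> 0" "coprime u c"
  shows "bij_betw (\<lambda>b. (u * b) mod c) (polys_below (degree c)) (polys_below (degree c))"
proof -
  have "inj_on (\<lambda>b. (u * b) mod c) (polys_below (degree c))"
  proof (rule inj_onI)
    fix x y assume xy: "x \<in> polys_below (degree c)" "y \<in> polys_below (degree c)"
      and "(u * x) mod c = (u * y) mod c"
    then have "c dvd u * (x - y)" by (simp add: mod_eq_dvd_iff algebra_simps)
    then have "c dvd x - y" using assms(2) field_poly_coprime_dvd_mult coprime_commute by blast
    then show "x = y" using polys_below_dvd_eq_0[of "x - y" c] polys_below_diff[OF xy] by simp
  qed
  moreover have "(\<lambda>b. (u * b) mod c) ` polys_below (degree c) \<subseteq> polys_below (degree c)"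
    using mod_in_polys_below[OF assms(1)] by auto
  ultimately show ?thesis
    by (simp add: bij_betw_def endo_inj_surj)
qed

lemma bij_betw_residue_add:
  assumes "c \<noteq> 0"
  shows "bij_betw (\<lambda>b. (b + y) mod c) (polys_below (degree c)) (polys_below (degree c))"
proof -
  have "inj_on (\<lambda>b. (b + y) mod c) (polys_below (degree c))"
  proof (rule inj_onI)
    fix x z assume xz: "x \<in> polys_below (degree c)" "z \<in> polys_below (degree c)"
      and "(x + y) mod c = (z + y) mod c"
    then have "c dvd x - z" by (simp add: mod_eq_dvd_iff)
    then show "x = z" using polys_below_dvd_eq_0[of "x - z" c] polys_below_diff[OF xz] by simp
  qed
  moreover have "(\<lambda>b. (b + y) mod c) ` polys_below (degree c) \<subseteq> polys_below (degree c)"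
    using mod_in_polys_below[OF assms(1)] by auto
  ultimately show ?thesis
    by (simp add: bij_betw_def endo_inj_surj)
qed

lemma sum_residue_mult:
  assumes "c \<noteq> 0" "coprime u c" "\<And>b b'. b mod c = b' mod c \<Longrightarrow> f b = f b'"
  shows "(\<Sum>b\<in>polys_below (degree c). f (u * b)) = (\<Sum>b\<in>polys_below (degree c). f b)"
proof -
  have "(\<Sum>b\<in>polys_below (degree c). f (u * b)) = (\<Sum>b\<in>polys_below (degree c). f ((u * b) mod c))"
    by (intro sum.cong refl assms(3)) simp
  also have "\<dots> = (\<Sum>b\<in>polys_below (degree c). f b)"
    by (rule sum.reindex_bij_betw[OF bij_betw_residue_mult[OF assms(1,2)]])
  finally show ?thesis .
qed

lemma sum_residue_add:
  assumes "c \<noteq> 0" "\<And>b b'. b mod c = b' mod c \<Longrightarrow> f b = f b'"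
  shows "(\<Sum>b\<in>polys_below (degree c). f (b + y)) = (\<Sum>b\<in>polys_below (degree c). f b)"
proof -
  have "(\<Sum>b\<in>polys_below (degree c). f (b + y)) = (\<Sum>b\<in>polys_below (degree c). f ((b + y) mod c))"
    by (intro sum.cong refl assms(2)) simp
  also have "\<dots> = (\<Sum>b\<in>polys_below (degree c). f b)"
    by (rule sum.reindex_bij_betw[OF bij_betw_residue_add[OF assms(1)]])
  finally show ?thesis .
qed

text \<open>Division with remainder by \<open>c\<close>. Surjectivity follows from injectivity by
  counting.\<close>

lemma polys_below_division:
  fixes c :: "'k::finite_field poly"
  assumes "monic c"
  shows "bij_betw (\<lambda>(s, b). s * c + b) (monics n \<times> polys_below (degree c)) (monics (n + degree c))"
    and "bij_betw (\<lambda>(s, b). s * c + b) (polys_below n \<times> polys_below (degree c)) (polys_below (n + degree c))"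
proof -
  have inj: "inj_on (\<lambda>(s, b). s * c + b) (UNIV \<times> polys_below (degree c))"
  proof (rule inj_onI, clarify)
    fix s b s' b' :: "'k poly" assume b: "b \<in> polys_below (degree c)" "b' \<in> polys_below (degree c)"
      and eq: "s * c + b = s' * c + b'"
    have "(s * c + b) mod c = (s' * c + b') mod c" using eq by simp
    then have "b = b'" using b by (simp add: mod_below_id)
    with eq assms show "s = s' \<and> b = b'" by (auto dest: monic_nonzero)
  qed
  have 1: "(\<lambda>(s, b). s * c + b) ` (monics n \<times> polys_below (degree c)) \<subseteq> monics (n + degree c)"
  proof safe
    fix s b :: "'k poly" assume s: "s \<in> monics n" and b: "b \<in> polys_below (degree c)"
    have "s * c \<in> monics (n + degree c)" using s assms monics_mult by (auto simp: monics_def)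
    then show "s * c + b \<in> monics (n + degree c)"
      using monics_eq_image[of "s * c"] b polys_below_mono[of "degree c" "n + degree c"] by auto
  qed
  have 2: "(\<lambda>(s, b). s * c + b) ` (polys_below n \<times> polys_below (degree c)) \<subseteq> polys_below (n + degree c)"
    using polys_below_mult_degree polys_below_mono[of "degree c" "n + degree c"]
    by (fastforce intro: polys_below_add)
  have injn: "inj_on (\<lambda>(s, b). s * c + b) (A \<times> polys_below (degree c))" for A
    by (rule inj_on_subset[OF inj]) auto
  show "bij_betw (\<lambda>(s, b). s * c + b) (monics n \<times> polys_below (degree c)) (monics (n + degree c))"
    unfolding bij_betw_def
    by (intro conjI injn card_subset_eq 1)
      (auto simp: card_image[OF injn] card_cartesian_product card_monics card_polys_below power_add)
  show "bij_betw (\<lambda>(s, b). s * c + b) (polys_below n \<times> polys_below (degree c)) (polys_below (n + degree c))"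
    unfolding bij_betw_def
    by (intro conjI injn card_subset_eq 2)
      (auto simp: card_image[OF injn] card_cartesian_product card_polys_below power_add)
qed

lemma sum_monics_periodic:
  fixes f :: "'k::finite_field poly \<Rightarrow> complex"
  assumes "monic c" "degree c \<le> n" "\<And>b b'. b mod c = b' mod c \<Longrightarrow> f b = f b'"
  shows "(\<Sum>F\<in>monics n. f F) = of_nat CARD('k) ^ (n - degree c) * (\<Sum>b\<in>polys_below (degree c). f b)"
proof -
  have "(\<Sum>F\<in>monics n. f F) =
      (\<Sum>(s, b)\<in>monics (n - degree c) \<times> polys_below (degree c). f (s * c + b))"
    using sum.reindex_bij_betw[OF polys_below_division(1)[OF assms(1), of "n - degree c"], of f] assms(2)
    by (simp add: case_prod_unfold)
  also have "\<dots> = (\<Sum>(s :: 'k poly, b)\<in>monics (n - degree c) \<times> polys_below (degree c). f b)"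
    by (rule sum.cong) (auto intro!: assms(3))
  finally show ?thesis by (simp add: sum.cartesian_product[symmetric] card_monics)
qed

text \<open>The Chinese remainder theorem in a form that stays below the degree of
  \<open>c * d\<close> without reduction. It introduces twists by \<open>d\<close> modulo
  \<open>c\<close> and by \<open>c\<close> modulo \<open>d\<close>, which \<open>gauss_mult\<close>
  disposes of by reciprocity.\<close>

lemma crt_bij:
  fixes c d :: "'k::finite_field poly"
  assumes "monic c" "monic d" "coprime c d"
  shows "bij_betw (\<lambda>(x, y). x * d + y * c) (polys_below (degree c) \<times> polys_below (degree d))
           (polys_below (degree (c * d)))"
proof -
  have inj: "inj_on (\<lambda>(x, y). x * d + y * c) (polys_below (degree c) \<times> polys_below (degree d))"
  proof (rule inj_onI, clarify)
    fix x y x' y' :: "'k poly" assume xy: "x \<in> polys_below (degree c)" "x' \<in> polys_below (degree c)"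
      "y \<in> polys_below (degree d)" "y' \<in> polys_below (degree d)"
      and eq: "x * d + y * c = x' * d + y' * c"
    have e: "d * (x - x') = c * (y' - y)" using eq by (simp add: algebra_simps)
    then have "c dvd d * (x - x')" by simp
    then have "c dvd x - x'" using assms(3) field_poly_coprime_dvd_mult by blast
    then have "x - x' = 0" using polys_below_dvd_eq_0 polys_below_diff xy by blast
    with e assms(1) show "x = x' \<and> y = y'" by (auto dest: monic_nonzero)
  qed
  have sub: "(\<lambda>(x, y). x * d + y * c) ` (polys_below (degree c) \<times> polys_below (degree d))
      \<subseteq> polys_below (degree (c * d))"
    using polys_below_mult_degree[of _ "degree c" d] polys_below_mult_degree[of _ "degree d" c]
    by (auto simp: degree_mult_monic assms(1,2) add.commute intro: polys_below_add)
  show ?thesis unfolding bij_betw_def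
    by (intro conjI inj card_subset_eq sub)
      (auto simp: card_image inj card_cartesian_product card_polys_below degree_mult_monic
        assms(1,2) power_add)
qed

subsection \<open>The additive group of a finite field\<close>

definition add_closed :: "'k::finite_field set \<Rightarrow> bool" where
  "add_closed H \<longleftrightarrow> 0 \<in> H \<and> (\<forall>x\<in>H. \<forall>y\<in>H. x + y \<in> H)"

lemma add_closed_of_nat_mult: "add_closed H \<Longrightarrow> x \<in> H \<Longrightarrow> of_nat n * x \<in> H"
  by (induction n) (auto simp: add_closed_def algebra_simps)

lemma prime_CHAR_finite_field: "prime CHAR('k::finite_field)"
  using CHAR_pos[where ?'a = 'k] prime_CHAR_semidom by blast

text \<open>In characteristic p the negative of \<open>y\<close> is its (p - 1)-fold sum, so closure
  under addition already gives a subgroup.\<close>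

lemma add_closed_diff:
  fixes H :: "'k::finite_field set"
  assumes "add_closed H" "x \<in> H" "y \<in> H"
  shows "x - y \<in> H"
proof -
  have "of_nat (CHAR('k) - 1) * y \<in> H" using assms by (simp add: add_closed_of_nat_mult)
  moreover have "of_nat (CHAR('k) - 1) * y = - y"
    using prime_gt_0_nat[OF prime_CHAR_finite_field[where ?'k = 'k]]
    by (subst of_nat_diff) (auto simp: Suc_leI)
  ultimately have "x + - y \<in> H" using assms unfolding add_closed_def by metis
  then show ?thesis by simp
qed

text \<open>For \<open>x\<close> outside the subgroup \<open>H\<close> no multiple m x with 0 < m <
  p lies in \<open>H\<close>, because m is invertible modulo p. So the cosets of the p multiples of
  \<open>x\<close> are disjoint. Both uses below apply this to a maximal subgroup of some
  kind.\<close>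

lemma add_closed_extend:
  fixes H :: "'k::finite_field set"
  assumes H: "add_closed H" and x: "x \<notin> H"
  defines "f \<equiv> \<lambda>(h, i::nat). h + of_nat i * x"
  shows "inj_on f (H \<times> {..<CHAR('k)})" "add_closed (f ` (H \<times> {..<CHAR('k)}))"
    "H \<subset> f ` (H \<times> {..<CHAR('k)})"
proof -
  let ?p = "CHAR('k)"
  have p: "prime ?p" "0 < ?p" using prime_CHAR_finite_field prime_gt_0_nat by auto
  have key: "m = 0" if "of_nat m * x \<in> H" "m < ?p" for m
  proof (rule ccontr)
    assume "m \<noteq> 0"
    then have "coprime m ?p"
      using prime_imp_coprime[OF p(1), of m] that(2) nat_dvd_not_less[of m ?p] coprime_commute by blast
    then obtain u where "[m * u = 1] (mod ?p)" using cong_solve_coprime_nat[of m ?p] by auto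
    then have "of_nat (m * u) = (of_nat 1 :: 'k)" by (simp only: of_nat_eq_iff_cong_CHAR)
    then have "x = of_nat u * (of_nat m * x)" by (simp add: algebra_simps)
    with x that(1) show False using add_closed_of_nat_mult[OF H] by metis
  qed
  have le: "i = j" if "h \<in> H" "h' \<in> H" "h + of_nat i * x = h' + of_nat j * x" "i \<le> j" "j < ?p" for h h' i j
  proof -
    have "of_nat (j - i) * x = h - h'" using that(3,4) by (simp add: of_nat_diff algebra_simps)
    then have "of_nat (j - i) * x \<in> H" using add_closed_diff[OF H] that by simp
    moreover have "j - i < ?p" using that(5) by simp
    ultimately have "j - i = 0" by (rule key)
    then show ?thesis using that(4) by simp
  qed
  show "inj_on f (H \<times> {..<?p})"
  proof (rule inj_onI, clarify)
    fix h i h' j assume "h \<in> H" "h' \<in> H" "i < ?p" "j < ?p" "f (h, i) = f (h', j)"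
    then have e: "h + of_nat i * x = h' + of_nat j * x" by (simp add: f_def)
    have "i = j"
      using le[OF \<open>h \<in> H\<close> \<open>h' \<in> H\<close> e] le[OF \<open>h' \<in> H\<close> \<open>h \<in> H\<close> e[symmetric]]
        \<open>i < ?p\<close> \<open>j < ?p\<close> nat_le_linear by metis
    with e show "h = h' \<and> i = j" by simp
  qed
  show "add_closed (f ` (H \<times> {..<?p}))"
    unfolding add_closed_def
  proof safe
    have "f (0, 0) = 0" by (simp add: f_def)
    moreover have "(0, 0) \<in> H \<times> {..<?p}" using H p(2) by (simp add: add_closed_def)
    ultimately show "0 \<in> f ` (H \<times> {..<?p})" by (metis image_eqI)
  next
    fix h i h' j assume *: "h \<in> H" "h' \<in> H" "i < ?p" "j < ?p"
    have "(of_nat ((i + j) mod ?p) :: 'k) = of_nat (i + j)"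
      by (simp only: of_nat_eq_iff_cong_CHAR) (simp add: cong_def)
    then have "f (h + h', (i + j) mod ?p) = f (h, i) + f (h', j)"
      by (simp add: f_def algebra_simps)
    moreover have "(h + h', (i + j) mod ?p) \<in> H \<times> {..<?p}"
      using * H p(2) by (simp add: add_closed_def)
    ultimately show "f (h, i) + f (h', j) \<in> f ` (H \<times> {..<?p})" by (metis image_eqI)
  qed
  have "x = f (0, 1)" by (simp add: f_def)
  moreover have "1 < ?p" using p(1) prime_gt_1_nat by auto
  ultimately have "x \<in> f ` (H \<times> {..<?p})"
    using H by (intro image_eqI[of _ _ "(0, 1)"]) (auto simp: add_closed_def)
  moreover have "H \<subseteq> f ` (H \<times> {..<?p})"
  proof
    fix h assume "h \<in> H"
    then show "h \<in> f ` (H \<times> {..<?p})"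
      using p(2) by (intro image_eqI[of _ _ "(h, 0)"]) (auto simp: f_def)
  qed
  ultimately show "H \<subset> f ` (H \<times> {..<?p})" using x by auto
qed

text \<open>A maximal subgroup among those of p-power order is everything, since otherwise
  \<open>add_closed_extend\<close> would multiply its order by p.\<close>

lemma finite_field_card_CHAR_power: "\<exists>n. CARD('k::finite_field) = CHAR('k) ^ n"
proof -
  let ?p = "CHAR('k)"
  define P where "P H \<longleftrightarrow> add_closed (H :: 'k set) \<and> (\<exists>n. card H = ?p ^ n)" for H
  have "P {0}" by (auto simp: P_def add_closed_def intro!: exI[of _ 0])
  then obtain H where H: "P H" and max: "\<And>H'. P H' \<Longrightarrow> H \<subseteq> H' \<Longrightarrow> H = H'"
    using finite_has_maximal[of "Collect P"] by auto
  have "H = UNIV"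
  proof (rule ccontr)
    assume "H \<noteq> UNIV"
    then obtain x where x: "x \<notin> H" by auto
    let ?H' = "(\<lambda>(h, i::nat). h + of_nat i * x) ` (H \<times> {..<?p})"
    have "add_closed H" using H by (simp add: P_def)
    note ext = add_closed_extend[OF this x]
    obtain n where n: "card H = ?p ^ n" using H by (auto simp: P_def)
    have "card ?H' = ?p ^ Suc n"
      using n by (simp add: card_image[OF ext(1)] card_cartesian_product)
    then have "P ?H'" using ext(2) unfolding P_def by blast
    then show False using max ext(3) by blast
  qed
  with H show ?thesis by (auto simp: P_def)
qed

lemma freshmans_dream_CARD:
  fixes x y :: "'a::comm_semiring_1"
  assumes "CHAR('a) = CHAR('k::finite_field)"
  shows "(x + y) ^ CARD('k) = x ^ CARD('k) + y ^ CARD('k)"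
proof -
  obtain n where n: "CARD('k) = CHAR('a) ^ n" using finite_field_card_CHAR_power assms by metis
  show ?thesis
  proof (rule freshmans_dream'[OF _ n])
    show "prime CHAR('a)" using prime_CHAR_finite_field[where ?'k = 'k] by (simp only: assms)
  qed
qed

text \<open>A maximal proper subgroup \<open>H\<close> has index p by
  \<open>add_closed_extend\<close>, and sending h + i x to exp(2 pi i / p) to the power i is a
  character with kernel \<open>H\<close>. This takes the place of a character composed with the
  trace to the prime field.\<close>

lemma exists_additive_character:
  "\<exists>\<psi> :: 'k::finite_field \<Rightarrow> complex.
     (\<forall>x y. \<psi> (x + y) = \<psi> x * \<psi> y) \<and> (\<forall>x. norm (\<psi> x) = 1) \<and> (\<exists>x. \<psi> x \<noteq> 1)"
proof -
  let ?p = "CHAR('k)"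
  have p: "prime ?p" "0 < ?p" "1 < ?p" using prime_CHAR_finite_field prime_gt_0_nat prime_gt_1_nat by auto
  define P where "P H \<longleftrightarrow> add_closed (H :: 'k set) \<and> H \<noteq> UNIV" for H
  have "{0} \<noteq> (UNIV :: 'k set)" by (metis UNIV_I one_neq_zero singletonD)
  then have "P {0}" by (simp add: P_def add_closed_def)
  then obtain H where H: "P H" and max: "\<And>H'. P H' \<Longrightarrow> H \<subseteq> H' \<Longrightarrow> H = H'"
    using finite_has_maximal[of "Collect P"] by auto
  have cl: "add_closed H" using H by (simp add: P_def)
  obtain x where x: "x \<notin> H" using H by (auto simp: P_def)
  define f where "f = (\<lambda>(h, i::nat). h + of_nat i * x)"
  note ext = add_closed_extend[OF cl x, folded f_def]
  have "f ` (H \<times> {..<?p}) = UNIV"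
  proof (rule ccontr)
    assume "f ` (H \<times> {..<?p}) \<noteq> UNIV"
    then have "P (f ` (H \<times> {..<?p}))" using ext(2) by (simp add: P_def)
    then show False using max ext(3) by blast
  qed
  then have bij: "bij_betw f (H \<times> {..<?p}) UNIV" using ext(1) by (simp add: bij_betw_def)
  define g where "g = inv_into (H \<times> {..<?p}) f"
  have g: "g y \<in> H \<times> {..<?p}" "f (g y) = y" for y
    using bij unfolding g_def by (auto simp: bij_betw_def f_inv_into_f inv_into_into)
  have gf: "g (f z) = z" if "z \<in> H \<times> {..<?p}" for z
    using that bij unfolding g_def by (auto simp: bij_betw_def inv_into_f_f)
  define e where "e n = cis (2 * pi * real n / real ?p)" for n :: nat
  have e_add: "e (m + n) = e m * e n" for m n
    by (simp add: e_def cis_mult add_divide_distrib ring_distribs)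
  have e_p: "e ?p = 1" using p by (simp add: e_def)
  have e_mult: "e (?p * n) = 1" for n
    by (induction n) (simp_all add: e_add e_p, simp add: e_def)
  have e_mod: "e (n mod ?p) = e n" for n
    by (metis e_add e_mult mult_div_mod_eq mult_1)
  define \<psi> where "\<psi> y = e (snd (g y))" for y
  have "\<psi> (y + z) = \<psi> y * \<psi> z" for y z
  proof -
    obtain h i where hi: "g y = (h, i)" by (cases "g y")
    obtain h' j where hj: "g z = (h', j)" by (cases "g z")
    have mem: "h \<in> H" "h' \<in> H" using g(1)[of y] g(1)[of z] hi hj by auto
    have "(of_nat ((i + j) mod ?p) :: 'k) = of_nat (i + j)"
      by (simp only: of_nat_eq_iff_cong_CHAR) (simp add: cong_def)
    then have "f (h + h', (i + j) mod ?p) = f (h, i) + f (h', j)"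
      by (simp add: f_def algebra_simps)
    then have "f (h + h', (i + j) mod ?p) = y + z" using g(2) hi hj by metis
    moreover have "(h + h', (i + j) mod ?p) \<in> H \<times> {..<?p}"
      using mem cl p by (auto simp: add_closed_def)
    ultimately have "g (y + z) = (h + h', (i + j) mod ?p)" using gf by metis
    then show ?thesis by (simp add: \<psi>_def hi hj e_mod e_add)
  qed
  moreover have "norm (\<psi> y) = 1" for y by (simp add: \<psi>_def e_def)
  moreover have "\<psi> x \<noteq> 1"
  proof -
    have "x = f (0, 1)" by (simp add: f_def)
    moreover have "(0, 1) \<in> H \<times> {..<?p}" using cl p by (auto simp: add_closed_def)
    ultimately have "g x = (0, 1)" using gf by metis
    then have "\<psi> x = cis (2 * pi / real ?p)" by (simp add: \<psi>_def e_def)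
    moreover have "cis (2 * pi / real ?p) \<noteq> 1"
    proof
      assume *: "cis (2 * pi / real ?p) = 1"
      then have "cos (2 * pi / real ?p) = 1" by (metis cis.sel(1) one_complex.sel(1))
      then obtain n :: int where n: "2 * pi / real ?p = of_int n * 2 * pi"
        using cos_one_2pi_int by blast
      then have "1 / real ?p = of_int n" using pi_gt_zero by (simp add: field_simps)
      then have "real_of_int (n * int ?p) = 1" using p by (simp add: field_simps)
      then have "n * int ?p = 1" by (metis of_int_eq_1_iff)
      then have "int ?p dvd 1" by (metis dvd_triv_right)
      then show False using p by simp
    qed
    ultimately show ?thesis by simp
  qed
  ultimately show ?thesis by blast
qed

subsection \<open>Monic irreducible polynomials\<close>

lemma prime_polysD:
  assumes "P \<in> prime_polys"
  shows "monic P" "irreducible P" "prime_elem P" "P \<noteq> 0" "degree P > 0"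
proof -
  show "monic P" "irreducible P" using assms by (auto simp: prime_polys_def)
  then show "prime_elem P" "P \<noteq> 0" by (auto simp: field_poly_irreducible_imp_prime monic_nonzero)
  show "degree P > 0"
    using \<open>monic P\<close> \<open>irreducible P\<close> monic_degree_0[of P] by (metis gr0I irreducible_not_unit one_dvd)
qed

lemma prime_poly_coprime:
  assumes "P \<in> prime_polys" "\<not> P dvd f"
  shows "coprime P f"
proof -
  obtain u v d where d: "u * P + v * f = d" "d dvd P" "d dvd f"
    using field_poly_bezout by blast
  from d(2) obtain k where k: "P = d * k" by (elim dvdE)
  have "is_unit d"
  proof (rule ccontr)
    assume "\<not> is_unit d"
    then have "is_unit k" using prime_polysD(2)[OF assms(1)] k Factorial_Ring.irreducibleD by blast
    then have "P dvd d" using k by (simp add: mult_unit_dvd_iff)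
    with d(3) assms(2) show False using dvd_trans by blast
  qed
  then obtain e where "1 = d * e" by (elim dvdE)
  then have "(e * u) * P + (e * v) * f = 1"
    by (simp add: d(1)[symmetric] algebra_simps)
  then show ?thesis by (rule bezout_imp_coprime)
qed

lemma prime_poly_not_dvd_one: "P \<in> prime_polys \<Longrightarrow> \<not> P dvd 1"
  using prime_polysD(2) irreducible_not_unit by blast

lemma exists_prime_factor:
  assumes "monic F" "F \<noteq> 1"
  obtains P where "P \<in> prime_polys" "P dvd F"
proof -
  define A where "A n \<longleftrightarrow> (\<exists>G. monic G \<and> G dvd F \<and> degree G = n \<and> n > 0)" for n
  have "degree F > 0" using assms monic_degree_0 by blast
  then have ex: "A (degree F)" using assms by (auto simp: A_def)
  define n where "n = (LEAST n. A n)"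
  have "A n" unfolding n_def using ex by (rule LeastI)
  then obtain G where G: "monic G" "G dvd F" "degree G = n" "n > 0" by (auto simp: A_def)
  have min: "n \<le> m" if "A m" for m unfolding n_def using that by (rule Least_le)
  have "irreducible G"
  proof (rule Factorial_Ring.irreducibleI)
    show "G \<noteq> 0" using G(1) by (rule monic_nonzero)
    show "\<not> is_unit G" using G by (auto simp: is_unit_iff_degree monic_nonzero)
    fix a b assume ab: "G = a * b"
    then have nz: "a \<noteq> 0" "b \<noteq> 0" using monic_nonzero[OF G(1)] by auto
    obtain c a' where a': "c \<noteq> 0" "monic a'" "a = smult c a'" using associated_monic[OF nz(1)] by blast
    show "is_unit a \<or> is_unit b"
    proof (cases "degree a = 0")
      case True
      then show ?thesis using nz by (simp add: is_unit_iff_degree)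
    next
      case False
      have "a' dvd a" using a' by (simp add: dvd_smult)
      then have "a' dvd F" using ab G(2) by (metis dvd_mult2 dvd_trans)
      then have "A (degree a)" using a' False by (auto simp: A_def)
      then have "n \<le> degree a" by (rule min)
      then have "degree b = 0" using ab G(3) nz by (simp add: degree_mult_eq)
      then show ?thesis using nz by (simp add: is_unit_iff_degree)
    qed
  qed
  with G that show thesis by (auto simp: prime_polys_def)
qed

text \<open>The form in which factorization into primes is mostly used below.\<close>

lemma monic_prime_induct [consumes 1, case_names one prime_mult]:
  assumes "monic F" "Q 1"
    and "\<And>P G. P \<in> prime_polys \<Longrightarrow> monic G \<Longrightarrow> Q G \<Longrightarrow> Q (P * G)"
  shows "Q F"
  using assms(1)
proof (induction "degree F" arbitrary: F rule: less_induct)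
  case less
  show ?case
  proof (cases "F = 1")
    case True
    then show ?thesis using assms(2) by simp
  next
    case False
    obtain P where P: "P \<in> prime_polys" "P dvd F" using exists_prime_factor[OF less.prems False] by blast
    from P(2) obtain G where G: "F = P * G" by (elim dvdE)
    have mG: "monic G" using monic_mult_cancel prime_polysD(1)[OF P(1)] less.prems G by blast
    have "degree G < degree F"
      using G degree_mult_monic[OF prime_polysD(1)[OF P(1)] mG] prime_polysD(5)[OF P(1)] by simp
    then show ?thesis using less.hyps mG assms(3)[OF P(1) mG] G by simp
  qed
qed

lemma prime_dvd_prime_eq:
  assumes "P \<in> prime_polys" "P' \<in> prime_polys" "P dvd P'"
  shows "P = P'"
proof -
  have "P' dvd P"
    using assms by (meson irreducibleD' prime_polysD(2) prime_poly_not_dvd_one dvd_trans)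
  then show ?thesis using assms monic_dvd_antisym prime_polysD(1) by blast
qed

lemma not_coprime_imp_prime_dvd:
  assumes "monic F" "\<not> coprime F b"
  shows "\<exists>P\<in>prime_polys. P dvd F \<and> P dvd b"
proof (rule ccontr)
  assume *: "\<not> ?thesis"
  have "coprime F b"
    using assms(1) *
  proof (induction rule: monic_prime_induct)
    case (prime_mult P G)
    have "coprime P b" using prime_mult by (intro prime_poly_coprime) auto
    moreover have "coprime G b" using prime_mult by (meson dvd_mult)
    ultimately show ?case by (simp add: field_poly_coprime_mult_iff)
  qed auto
  with assms(2) show False by simp
qed

lemma coprime_iff_primes:
  assumes "monic F"
  shows "coprime F b \<longleftrightarrow> (\<forall>P\<in>prime_polys. P dvd F \<longrightarrow> \<not> P dvd b)"
  using not_coprime_imp_prime_dvd[OF assms] by (meson coprime_common_divisor prime_poly_not_dvd_one)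

subsection \<open>Resultants over the algebraic closure\<close>

lemma map_poly_hom_mult:
  assumes "f 0 = 0" "\<And>x y. f (x + y) = f x + f y" "\<And>x y. f (x * y) = f x * f y"
  shows "map_poly f (p * r) = map_poly f p * map_poly (f :: 'a::comm_ring_1 \<Rightarrow> 'b::comm_ring_1) r"
proof (rule poly_eqI)
  fix n
  have "f (sum g A) = (\<Sum>i\<in>A. f (g i))" for g and A :: "nat set"
    by (induction A rule: infinite_finite_induct) (auto simp: assms)
  then show "coeff (map_poly f (p * r)) n = coeff (map_poly f p * map_poly f r) n"
    by (simp add: coeff_map_poly coeff_mult assms)
qed

lemma map_poly_hom_add:
  assumes "f 0 = 0" "\<And>x y. f (x + y) = f x + f y"
  shows "map_poly f (p + r) = map_poly f p + map_poly (f :: 'a::comm_ring_1 \<Rightarrow> 'b::comm_ring_1) r"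
  by (rule poly_eqI) (simp add: coeff_map_poly assms)

lemma map_poly_hom_poly:
  fixes f :: "'a::comm_ring_1 \<Rightarrow> 'b::comm_ring_1"
  assumes "f 0 = 0" "\<And>x y. f (x + y) = f x + f y" "\<And>x y. f (x * y) = f x * f y"
  shows "poly (map_poly f p) (f x) = f (poly p x)"
  by (induction p) (auto simp: map_poly_pCons assms)

definition ac_eval :: "'k::finite_field poly \<Rightarrow> 'k alg_closure \<Rightarrow> 'k alg_closure" where
  "ac_eval p x = poly (map_poly to_ac p) x"

lemma ac_eval_mult: "ac_eval (p * r) x = ac_eval p x * ac_eval r x"
  by (simp add: ac_eval_def map_poly_hom_mult)

lemma ac_eval_add: "ac_eval (p + r) x = ac_eval p x + ac_eval r x"
  by (simp add: ac_eval_def map_poly_hom_add)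

lemma ac_eval_1 [simp]: "ac_eval 1 x = 1"
  by (simp add: ac_eval_def)

lemma ac_eval_0 [simp]: "ac_eval 0 x = 0"
  by (simp add: ac_eval_def)

lemma ac_eval_const [simp]: "ac_eval [:a:] x = to_ac a"
  by (simp add: ac_eval_def map_poly_pCons)

lemma ac_eval_diff: "ac_eval (p - r) x = ac_eval p x - ac_eval r x"
  using ac_eval_add[of "p - r" r x] by simp

lemma ac_eval_power: "ac_eval (p ^ n) x = ac_eval p x ^ n"
  by (induction n) (auto simp: ac_eval_mult)

lemma ac_eval_dvd: "p dvd r \<Longrightarrow> ac_eval p x = 0 \<Longrightarrow> ac_eval r x = 0"
  by (auto simp: ac_eval_mult elim: dvdE)

lemma coprime_no_common_root: "coprime p r \<Longrightarrow> ac_eval p x = 0 \<Longrightarrow> ac_eval r x \<noteq> 0"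
proof
  assume "coprime p r" and z: "ac_eval p x = 0" "ac_eval r x = 0"
  then obtain u v where "u * p + v * r = 1" using field_poly_coprime_bezout by blast
  then have "ac_eval (u * p + v * r) x = ac_eval 1 x" by simp
  then show False using z by (simp add: ac_eval_mult ac_eval_add)
qed

definition ac_roots :: "'k::finite_field poly \<Rightarrow> 'k alg_closure multiset" where
  "ac_roots c = proots (map_poly to_ac c)"

lemma map_poly_to_ac_eq_0 [simp]: "map_poly to_ac c = 0 \<longleftrightarrow> c = 0"
  by (auto simp: poly_eq_iff coeff_map_poly)

lemma degree_map_poly_to_ac [simp]: "degree (map_poly to_ac c) = degree c"
  by (cases "c = 0") (auto intro: degree_map_poly)

lemma set_ac_roots: "c \<noteq> 0 \<Longrightarrow> set_mset (ac_roots c) = {x. ac_eval c x = 0}"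
  by (simp add: ac_roots_def ac_eval_def)

lemma prod_linear_proots: "proots (\<Prod>x\<in>#A. [:- x, 1:] :: 'a::idom poly) = A"
proof (induction A)
  case (add x A)
  have "(\<Prod>x\<in>#A. [:- x, 1:] :: 'a poly) \<noteq> 0" by auto
  then show ?case using add by (simp add: proots_mult del: mult_pCons_left)
qed auto

lemma ac_factorization:
  assumes "monic c"
  shows "map_poly to_ac c = (\<Prod>x\<in>#ac_roots c. [:- x, 1:])" "size (ac_roots c) = degree c"
proof -
  have "lead_coeff (map_poly to_ac c) = 1"
    using assms by (simp add: coeff_map_poly monic_def)
  then obtain A where A: "size A = degree c" "map_poly to_ac c = (\<Prod>x\<in>#A. [:- x, 1:])"
    using alg_closed_imp_factorization[of "map_poly to_ac c"] assms monic_nonzero by auto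
  moreover from this have "ac_roots c = A" by (simp only: ac_roots_def prod_linear_proots)
  ultimately show "map_poly to_ac c = (\<Prod>x\<in>#ac_roots c. [:- x, 1:])" "size (ac_roots c) = degree c"
    by simp_all
qed

lemma ac_roots_mult: "c \<noteq> 0 \<Longrightarrow> d \<noteq> 0 \<Longrightarrow> ac_roots (c * d) = ac_roots c + ac_roots d"
  by (simp add: ac_roots_def map_poly_hom_mult proots_mult)

lemma ac_roots_1 [simp]: "ac_roots 1 = {#}"
  by (simp add: ac_roots_def)

text \<open>The resultant of \<open>c\<close> and \<open>b\<close> for monic \<open>c\<close>, with
  roots counted by multiplicity. For prime \<open>c\<close> it is the norm of \<open>b\<close> from
  the residue field, see \<open>prime_ac_norm\<close>.\<close>

definition ac_norm :: "'k::finite_field poly \<Rightarrow> 'k poly \<Rightarrow> 'k alg_closure" where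
  "ac_norm c b = (\<Prod>x\<in>#ac_roots c. ac_eval b x)"

lemma ac_norm_mult_right: "ac_norm c (a * b) = ac_norm c a * ac_norm c b"
  by (simp add: ac_norm_def ac_eval_mult prod_mset.distrib)

lemma ac_norm_mult_left: "c \<noteq> 0 \<Longrightarrow> d \<noteq> 0 \<Longrightarrow> ac_norm (c * d) b = ac_norm c b * ac_norm d b"
  by (simp add: ac_norm_def ac_roots_mult)

lemma ac_norm_1_left [simp]: "ac_norm 1 b = 1"
  by (simp add: ac_norm_def)

lemma ac_norm_const: "monic c \<Longrightarrow> ac_norm c [:a:] = to_ac a ^ degree c"
  by (simp add: ac_norm_def ac_factorization(2))

lemma ac_eval_eq_prod: "monic b \<Longrightarrow> ac_eval b x = (\<Prod>y\<in>#ac_roots b. x - y)"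
  unfolding ac_eval_def by (subst ac_factorization(1))
    (auto simp: poly_prod_mset image_mset.compositionality o_def)

lemma prod_mset_swap:
  "(\<Prod>x\<in>#A. \<Prod>y\<in>#B. f x y) = (\<Prod>y\<in>#B. \<Prod>x\<in>#A. f x y :: 'a::comm_monoid_mult)"
  by (induction A) (auto simp: prod_mset.distrib)

text \<open>Both resultants are products of differences over all pairs of roots; exchanging the
  roles reverses each of the deg c * deg b differences.\<close>

lemma ac_norm_swap:
  fixes b c :: "'k::finite_field poly"
  assumes "monic c" "monic b"
  shows "ac_norm c b = (-1) ^ (degree c * degree b) * ac_norm b c"
proof -
  have neg: "(\<Prod>x\<in>#A. - g x) = (-1) ^ size A * (\<Prod>x\<in>#A. g x)"
    for g :: "'k alg_closure \<Rightarrow> 'k alg_closure" and A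
    by (induction A) auto
  have "ac_norm c b = (\<Prod>y\<in>#ac_roots b. \<Prod>x\<in>#ac_roots c. x - y)"
    unfolding ac_norm_def ac_eval_eq_prod[OF assms(2)] by (rule prod_mset_swap)
  also have "\<dots> = (\<Prod>y\<in>#ac_roots b. (-1) ^ degree c * ac_eval c y)"
  proof (intro arg_cong[of _ _ prod_mset] image_mset_cong)
    fix y
    have "(\<Prod>x\<in>#ac_roots c. x - y) = (\<Prod>x\<in>#ac_roots c. - (y - x))" by simp
    also have "\<dots> = (-1) ^ degree c * ac_eval c y"
      unfolding neg ac_eval_eq_prod[OF assms(1)] ac_factorization(2)[OF assms(1)] ..
    finally show "(\<Prod>x\<in>#ac_roots c. x - y) = (-1) ^ degree c * ac_eval c y" .
  qed
  also have "\<dots> = (-1) ^ (degree c * degree b) * ac_norm b c"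
    by (simp add: prod_mset.distrib ac_norm_def ac_factorization(2)[OF assms(2)] power_mult)
  finally show ?thesis .
qed

lemma ac_norm_eq_0_iff:
  assumes "monic c"
  shows "ac_norm c b = 0 \<longleftrightarrow> \<not> coprime c b"
proof
  assume "ac_norm c b = 0"
  then have "\<exists>x\<in>#ac_roots c. ac_eval b x = 0" unfolding ac_norm_def by auto
  then obtain x where "x \<in># ac_roots c" "ac_eval b x = 0" by blast
  then show "\<not> coprime c b"
    using coprime_no_common_root set_ac_roots[OF monic_nonzero[OF assms]] by blast
next
  assume "\<not> coprime c b"
  then obtain P where P: "P \<in> prime_polys" "P dvd c" "P dvd b"
    using not_coprime_imp_prime_dvd[OF assms] by blast
  have "degree (map_poly to_ac P) > 0" using prime_polysD(5)[OF P(1)] by simp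
  then obtain x where "ac_eval P x = 0"
    using alg_closed_imp_poly_has_root unfolding ac_eval_def by blast
  then have "ac_eval c x = 0" "ac_eval b x = 0" using ac_eval_dvd P by blast+
  then have "x \<in># ac_roots c" "ac_eval b x = 0"
    using set_ac_roots[OF monic_nonzero[OF assms]] by auto
  then show "ac_norm c b = 0" unfolding ac_norm_def by (auto intro!: image_eqI[of _ _ x])
qed

lemma root_of_prime_factor:
  assumes "monic c" "ac_eval c x = 0"
  shows "\<exists>P\<in>prime_polys. P dvd c \<and> ac_eval P x = 0"
  using assms
proof (induction rule: monic_prime_induct)
  case (prime_mult P G)
  then have "ac_eval P x = 0 \<or> ac_eval G x = 0" by (simp add: ac_eval_mult)
  then show ?case using prime_mult.IH prime_mult.hyps(1) by (meson dvd_mult dvd_triv_left)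
qed auto

text \<open>Every root of \<open>c\<close> is a root of a prime divisor of \<open>c\<close>, so
  congruence modulo the radical of \<open>c\<close> suffices. This stronger form of periodicity is
  what \<open>gauss_eq_0\<close> exploits.\<close>

lemma ac_norm_cong:
  assumes "monic c" "\<And>P. P \<in> prime_polys \<Longrightarrow> P dvd c \<Longrightarrow> P dvd b - b'"
  shows "ac_norm c b = ac_norm c b'"
  unfolding ac_norm_def
proof (intro arg_cong[of _ _ prod_mset] image_mset_cong)
  fix x assume "x \<in># ac_roots c"
  then have "ac_eval c x = 0" using set_ac_roots[OF monic_nonzero[OF assms(1)]] by auto
  then obtain P where "P \<in> prime_polys" "P dvd c" "ac_eval P x = 0"
    using root_of_prime_factor[OF assms(1)] by blast
  then have "ac_eval (b - b') x = 0" using assms(2) ac_eval_dvd by blast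
  then show "ac_eval b x = ac_eval b' x" by (simp add: ac_eval_diff)
qed

subsection \<open>The Frobenius map\<close>

context
  fixes frob :: "'k::finite_field alg_closure \<Rightarrow> 'k alg_closure"
  defines "frob \<equiv> (\<lambda>x. x ^ CARD('k))"
begin

lemma frob_simps:
  "frob 0 = 0" "frob 1 = 1" "frob (x + y) = frob x + frob y" "frob (x * y) = frob x * frob y"
  "frob (- x) = - frob x" "frob (to_ac a) = to_ac a"
proof -
  show z: "frob 0 = 0" "frob 1 = 1" "frob (x * y) = frob x * frob y"
    by (simp_all add: frob_def power_mult_distrib)
  show add: "frob (x + y) = frob x + frob y" for x y
    unfolding frob_def by (rule freshmans_dream_CARD) simp
  show "frob (- x) = - frob x" using add[of x "- x"] z by (simp add: eq_neg_iff_add_eq_0 add.commute)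
  show "frob (to_ac a) = to_ac a"
    unfolding frob_def to_ac_power[symmetric] finite_field_power_card_eq_same ..
qed

lemma frob_inj: "frob x = frob y \<Longrightarrow> x = y"
proof -
  assume "frob x = frob y"
  then have "frob (x + - y) = 0" by (simp only: frob_simps) simp
  then show "x = y" by (simp add: frob_def)
qed

text \<open>Fixed points are roots of X^q - X, which has at most q roots, and the base field already
  supplies q of them.\<close>

lemma frob_fixed: "frob x = x \<Longrightarrow> x \<in> range to_ac"
proof (rule ccontr)
  assume x: "frob x = x" "x \<notin> range to_ac"
  define p :: "'k alg_closure poly" where "p = monom 1 CARD('k) - monom 1 1"
  have "card {0, 1::'k} \<le> CARD('k)" by (intro card_mono) auto
  then have card: "CARD('k) > 1" by simp
  have "degree p = CARD('k)"
    unfolding p_def diff_conv_add_uminus using card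
    by (subst degree_add_eq_left) (auto simp: degree_monom_eq)
  moreover have "p \<noteq> 0" using \<open>degree p = CARD('k)\<close> card by auto
  moreover have "insert x (range to_ac) \<subseteq> {y. poly p y = 0}"
    using x(1) frob_simps(6) by (auto simp: p_def poly_monom frob_def)
  ultimately have "card (insert x (range to_ac :: 'k alg_closure set)) \<le> CARD('k)"
    using card_poly_roots_bound[of p] poly_roots_finite[of p] card_mono order_trans by metis
  then show False using x(2) by (simp add: card_image inj_to_ac)
qed

lemma frob_ac_roots:
  fixes c :: "'k poly"
  assumes "monic c"
  shows "image_mset frob (ac_roots c) = ac_roots c"
proof -
  have "map_poly frob (map_poly to_ac c) = map_poly to_ac c"
    by (rule poly_eqI) (simp add: coeff_map_poly frob_simps)
  moreover have "map_poly frob (\<Prod>x\<in>#A. [:- x, 1:]) = (\<Prod>x\<in>#image_mset frob A. [:- x, 1:])" for A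
    by (induction A) (auto simp: map_poly_hom_mult frob_simps map_poly_pCons map_poly_1'
        simp del: mult_pCons_left)
  ultimately have "(\<Prod>x\<in>#image_mset frob (ac_roots c). [:- x, 1:]) = (\<Prod>x\<in>#ac_roots c. [:- x, 1:])"
    using ac_factorization(1)[OF assms] by metis
  then show ?thesis by (metis prod_linear_proots)
qed

lemma frob_ac_eval: "frob (ac_eval b x) = ac_eval b (frob x)"
proof -
  have "map_poly frob (map_poly to_ac b) = map_poly to_ac b"
    by (rule poly_eqI) (simp add: coeff_map_poly frob_simps)
  then show ?thesis
    unfolding ac_eval_def using map_poly_hom_poly[of frob "map_poly to_ac b" x] frob_simps by metis
qed

lemma ac_norm_in_range:
  fixes b c :: "'k poly"
  assumes "monic c"
  shows "ac_norm c b \<in> range to_ac"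
proof (rule frob_fixed)
  have "frob (prod_mset A) = prod_mset (image_mset frob A)" for A
    by (induction A) (auto simp: frob_simps)
  then have "frob (ac_norm c b) = (\<Prod>x\<in>#ac_roots c. ac_eval b (frob x))"
    by (simp add: ac_norm_def image_mset.compositionality o_def frob_ac_eval)
  also have "\<dots> = (\<Prod>x\<in>#image_mset frob (ac_roots c). ac_eval b x)"
    by (simp add: image_mset.compositionality o_def)
  finally show "frob (ac_norm c b) = ac_norm c b"
    by (simp add: frob_ac_roots[OF assms] ac_norm_def)
qed

lemma frob_funpow: "(frob ^^ i) x = x ^ (CARD('k) ^ i)"
  by (induction i) (auto simp: frob_def power_mult[symmetric] mult.commute)

text \<open>The orbit of \<open>x\<close> consists of distinct roots of \<open>P\<close>, so its
  length is at most the degree of \<open>P\<close>. Conversely the polynomial with this orbit as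
  roots is fixed by Frobenius, hence has coefficients in the base field and is divisible by
  \<open>P\<close>.\<close>

lemma prime_ac_roots:
  fixes P :: "'k poly"
  assumes P: "P \<in> prime_polys" and x: "ac_eval P x = 0"
  shows "ac_roots P = image_mset (\<lambda>i. (frob ^^ i) x) (mset_set {..<degree P})"
proof -
  define t where "t i = (frob ^^ i) x" for i
  have mP: "monic P" and nz: "P \<noteq> 0" using prime_polysD P by auto
  have t0: "t 0 = x" and tS: "t (Suc i) = frob (t i)" for i by (auto simp: t_def)
  have tadd: "t (i + j) = (frob ^^ i) (t j)" for i j by (simp add: t_def funpow_add)
  have inji: "(frob ^^ i) y = (frob ^^ i) z \<Longrightarrow> y = z" for i y z
    by (induction i) (auto dest: frob_inj)
  have root: "ac_eval P (t i) = 0" for i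
    by (induction i) (use x frob_ac_eval frob_simps(1) in \<open>metis t0 tS\<close>)+
  have fin: "finite {y. ac_eval P y = 0}"
    unfolding ac_eval_def using nz by (intro poly_roots_finite) simp
  \<comment> \<open>The orbit lies in a finite set, so it repeats; injectivity of
    \<open>frob\<close> then lets it return to its starting point.\<close>
  have "\<not> inj t"
    using root finite_subset[OF _ fin, of "range t"] range_inj_infinite by blast
  then obtain i j where ij: "t i = t j" "i < j" unfolding inj_def by (metis linorder_neqE_nat)
  then have "(frob ^^ i) (t (j - i)) = (frob ^^ i) (t 0)" by (metis tadd le_add_diff_inverse less_imp_le add_0_right)
  then have "t (j - i) = x" using inji t0 by blast
  then have ex: "\<exists>e>0. t e = x" using ij(2) by (intro exI[of _ "j - i"]) auto
  define e where "e = (LEAST e. e > 0 \<and> t e = x)"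
  have e: "e > 0" "t e = x" using LeastI_ex[OF ex] unfolding e_def by auto
  have min: "e \<le> m" if "m > 0" "t m = x" for m unfolding e_def using that by (intro Least_le) auto
  have "inj_on t {..<e}"
  proof (rule linorder_inj_onI)
    fix i j assume *: "i < j" "i \<in> {..<e}" "j \<in> {..<e}"
    show "t i \<noteq> t j"
    proof
      assume "t i = t j"
      then have "(frob ^^ i) (t (j - i)) = (frob ^^ i) (t 0)"
        using *(1) by (metis tadd le_add_diff_inverse less_imp_le add_0_right)
      then have "t (j - i) = x" using inji t0 by blast
      then have "e \<le> j - i" using *(1) by (intro min) auto
      then show False using * by auto
    qed
  qed auto
  then have "card (t ` {..<e}) = e" by (simp add: card_image)
  moreover have "card (t ` {..<e}) \<le> card {y. ac_eval P y = 0}"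
    using root fin by (intro card_mono) auto
  moreover have "card {y. ac_eval P y = 0} \<le> degree P"
    using card_poly_roots_bound[of "map_poly to_ac P"] nz by (simp add: ac_eval_def)
  ultimately have le: "e \<le> degree P" by simp
  define f where "f = (\<Prod>i<e. [:- t i, 1:])"
  have "map_poly frob (\<Prod>i\<in>A. [:- t i, 1:]) = (\<Prod>i\<in>A. [:- t (Suc i), 1:])" for A :: "nat set"
    by (induction A rule: infinite_finite_induct)
      (auto simp: map_poly_hom_mult frob_simps map_poly_pCons map_poly_1' tS
        simp del: mult_pCons_left)
  then have "map_poly frob f = (\<Prod>i<e. [:- t (Suc i), 1:])" by (simp add: f_def)
  \<comment> \<open>Shifting the orbit by one exchanges the factor of \<open>t 0\<close> for that of
    \<open>t e\<close>, and both are \<open>x\<close>.\<close>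
  also have "\<dots> = f"
  proof -
    obtain e' where e': "e = Suc e'" using e(1) gr0_implies_Suc by blast
    have "(\<Prod>i<e. [:- t (Suc i), 1:]) = (\<Prod>i<e'. [:- t (Suc i), 1:]) * [:- t 0, 1:]"
      using e(2) by (simp add: e' t0)
    also have "\<dots> = f" by (simp only: f_def e' prod.lessThan_Suc_shift mult.commute)
    finally show ?thesis .
  qed
  finally have fixf: "map_poly frob f = f" .
  define g where "g = map_poly of_ac f"
  have fg: "map_poly to_ac g = f"
  proof (rule poly_eqI)
    fix n
    have "frob (coeff f n) = coeff f n" using fixf by (metis coeff_map_poly frob_simps(1))
    then show "coeff (map_poly to_ac g) n = coeff f n"
      using to_ac_of_ac[OF frob_fixed] by (simp add: g_def coeff_map_poly)
  qed
  have degf: "degree f = e"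
    unfolding f_def by (subst degree_prod_eq_sum_degree) auto
  have lf: "lead_coeff f = 1" by (simp add: f_def lead_coeff_prod)
  have "degree g = e" using degf fg by (metis degree_map_poly_to_ac)
  moreover have "to_ac (lead_coeff g) = 1"
    using lf fg degf \<open>degree g = e\<close> by (metis coeff_map_poly to_ac_0)
  ultimately have mg: "monic g" by (simp add: monic_def)
  have "ac_eval g x = 0"
    unfolding ac_eval_def fg f_def poly_prod using e(1) t0 by (auto intro!: bexI[of _ 0])
  then have "P dvd g" using prime_poly_coprime[OF P] coprime_no_common_root x by blast
  then obtain h where h: "g = P * h" by (elim dvdE)
  then have mh: "monic h" using monic_mult_cancel mP mg by blast
  have "degree h = 0" using h degree_mult_monic[OF mP mh] \<open>degree g = e\<close> le by simp
  then have "g = P" "e = degree P"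
    using h monic_degree_0[OF mh] \<open>degree g = e\<close> by auto
  moreover have "f = (\<Prod>y\<in>#image_mset t (mset_set {..<e}). [:- y, 1:])"
    by (simp add: f_def image_mset.compositionality o_def prod_unfold_prod_mset)
  ultimately have "ac_roots P = image_mset t (mset_set {..<degree P})"
    unfolding ac_roots_def using fg prod_linear_proots by metis
  then show ?thesis by (simp add: t_def[abs_def])
qed

end

lemma geometric_sum_nat: "(\<Sum>i<n. q ^ i) * (q - 1) = q ^ n - (1::nat)" if "q > 0"
proof (induction n)
  case (Suc n)
  have "q ^ n \<ge> 1" using that by simp
  then show ?case using Suc that by (cases q) (auto simp: algebra_simps)
qed auto

text \<open>The roots are the Frobenius conjugates of \<open>x\<close>, so the norm is a power of
  \<open>ac_eval b x\<close> with exponent (q^d - 1)/(q - 1). Raised further to the power (q - 1)/3,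
  it acquires the exponent in \<open>prime_char\<close>.\<close>

lemma prime_ac_norm:
  fixes P :: "'k::finite_field poly"
  assumes P: "P \<in> prime_polys" and x: "ac_eval P x = 0"
  shows "ac_norm P b = ac_eval b x ^ (\<Sum>i<degree P. CARD('k) ^ i)"
proof -
  have fe: "ac_eval b x ^ (CARD('k) ^ i) = ac_eval b (x ^ (CARD('k) ^ i))" for i
  proof (induction i)
    case (Suc i)
    have "ac_eval b x ^ (CARD('k) ^ Suc i) = (ac_eval b x ^ (CARD('k) ^ i)) ^ CARD('k)"
      by (simp add: power_mult[symmetric] mult.commute)
    also have "\<dots> = ac_eval b ((x ^ (CARD('k) ^ i)) ^ CARD('k))"
      unfolding Suc by (rule frob_ac_eval)
    finally show ?case by (simp add: power_mult[symmetric] mult.commute)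
  qed auto
  show ?thesis
    unfolding ac_norm_def prime_ac_roots[OF P x] frob_funpow
    by (simp add: image_mset.compositionality o_def prod_unfold_prod_mset[symmetric] fe[symmetric] power_sum)
qed

subsection \<open>The cubic residue symbol\<close>

lemma finite_prime_divisors:
  fixes F :: "'k::finite_field poly"
  assumes "F \<noteq> 0"
  shows "finite {P \<in> prime_polys. P dvd F}"
proof (rule finite_subset)
  show "{P \<in> prime_polys. P dvd F} \<subseteq> (\<Union>n\<le>degree F. monics n)"
  proof
    fix P assume "P \<in> {P \<in> prime_polys. P dvd F}"
    then have "P \<in> prime_polys" "P dvd F" by auto
    then have "P \<in> monics (degree P)" "degree P \<le> degree F"
      using prime_polysD(1) dvd_imp_degree_le assms by (auto simp: monics_def)
    then show "P \<in> (\<Union>n\<le>degree F. monics n)" by blast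
  qed
qed simp

lemma power_dvd_bounded:
  fixes P F :: "'k::finite_field poly"
  assumes "P \<in> prime_polys" "F \<noteq> 0"
  shows "{n. P ^ n dvd F} \<subseteq> {..degree F}"
proof
  fix n assume "n \<in> {n. P ^ n dvd F}"
  then have "degree (P ^ n) \<le> degree F" using assms by (auto intro: dvd_imp_degree_le)
  moreover have "degree (P ^ n) = n * degree P"
    using prime_polysD(1)[OF assms(1)] by (simp add: monic_def degree_power_eq prime_polysD[OF assms(1)])
  moreover have "n \<le> n * degree P"
    using prime_polysD(5)[OF assms(1)] by (cases "degree P") auto
  ultimately show "n \<in> {..degree F}" unfolding atMost_iff by linarith
qed

lemma prime_power_decomp:
  assumes "P \<in> prime_polys" "monic F"
  obtains n G where "F = P ^ n * G" "monic G" "\<not> P dvd G"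
proof -
  have fin: "finite {n. P ^ n dvd F}"
    using power_dvd_bounded[OF assms(1) monic_nonzero[OF assms(2)]] finite_subset by blast
  have ne: "0 \<in> {n. P ^ n dvd F}" by simp
  define n where "n = Max {n. P ^ n dvd F}"
  have "n \<in> {n. P ^ n dvd F}" unfolding n_def using Max_in[OF fin] ne by blast
  then obtain G where G: "F = P ^ n * G" by (auto elim: dvdE)
  have mG: "monic G"
    using G assms monic_mult_cancel monic_power prime_polysD(1) by blast
  have "\<not> P dvd G"
  proof
    assume "P dvd G"
    then have "P ^ Suc n dvd F" using G by (simp add: mult.commute mult_dvd_mono)
    then have "Suc n \<le> n" unfolding n_def using fin by (intro Max_ge) auto
    then show False by simp
  qed
  with G mG that show thesis by blast
qed

lemma Max_power_dvd_prime_mult: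
  assumes "P \<in> prime_polys" "monic G"
  shows "Max {n. P ^ n dvd P * G} = Suc (Max {n. P ^ n dvd G})"
proof -
  have "{n. P ^ n dvd P * G} = insert 0 (Suc ` {n. P ^ n dvd G})"
  proof safe
    fix n assume "P ^ n dvd P * G" "n \<notin> Suc ` {n. P ^ n dvd G}"
    then show "n = 0" using prime_polysD(4)[OF assms(1)] by (cases n) auto
  qed (use prime_polysD(4)[OF assms(1)] in auto)
  moreover have fin: "finite {n. P ^ n dvd G}"
    using power_dvd_bounded[OF assms(1) monic_nonzero[OF assms(2)]] finite_subset by blast
  moreover have "0 \<in> {n. P ^ n dvd G}" by simp
  then have "{n. P ^ n dvd G} \<noteq> {}" by blast
  ultimately show ?thesis
    by (simp add: mono_Max_commute[symmetric] mono_Suc)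
qed

lemma power_dvd_other_prime_mult:
  assumes "P \<in> prime_polys" "P' \<in> prime_polys" "P \<noteq> P'"
  shows "P' ^ n dvd P * G \<longleftrightarrow> P' ^ n dvd G"
proof
  have "\<not> P' dvd P" using prime_dvd_prime_eq assms by blast
  then have "coprime (P' ^ n) P"
    using prime_poly_coprime[OF assms(2)] field_poly_coprime_power by blast
  then show "P' ^ n dvd P * G \<Longrightarrow> P' ^ n dvd G" by (rule field_poly_coprime_dvd_mult)
qed auto

lemma prime_dvd_mult_iff_poly:
  "P \<in> prime_polys \<Longrightarrow> P dvd a * b \<longleftrightarrow> P dvd a \<or> P dvd b"
  using prime_polysD(3) prime_elem_dvd_mult_iff by blast

text \<open>The dichotomy behind orthogonality: an exponent not divisible by 3 makes the local
  character at that prime nontrivial.\<close>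

lemma cube_or_bad_prime:
  fixes c :: "'k::finite_field poly"
  assumes "monic c"
  shows "(\<exists>A. monic A \<and> c = A ^ 3) \<or>
    (\<exists>P i G. P \<in> prime_polys \<and> c = P ^ i * G \<and> monic G \<and> \<not> P dvd G \<and> \<not> 3 dvd i)"
  using assms
proof (induction "degree c" arbitrary: c rule: less_induct)
  case less
  show ?case
  proof (cases "c = 1")
    case True
    then show ?thesis by (intro disjI1 exI[of _ 1]) auto
  next
    case False
    obtain P where P: "P \<in> prime_polys" "P dvd c" using exists_prime_factor[OF less.prems False] by blast
    obtain i G where iG: "c = P ^ i * G" "monic G" "\<not> P dvd G"
      using prime_power_decomp[OF P(1) less.prems] by blast
    show ?thesis
    proof (cases "3 dvd i")
      case False
      with iG P(1) show ?thesis by blast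
    next
      case True
      then obtain j where j: "i = 3 * j" by (elim dvdE)
      have "i \<noteq> 0" using iG P(2) by (metis mult_1 power_0)
      have mP: "monic (P ^ i)" using P(1) monic_power prime_polysD(1) by blast
      have "degree (P ^ i) > 0"
        using \<open>i \<noteq> 0\<close> prime_polysD[OF P(1)] by (simp add: degree_power_eq)
      then have "degree G < degree c" using iG degree_mult_monic[OF mP iG(2)] by simp
      from less.hyps[OF this iG(2)] show ?thesis
      proof (elim disjE exE conjE)
        fix A assume "monic A" "G = A ^ 3"
        then have "monic (P ^ j * A)" "c = (P ^ j * A) ^ 3"
          using iG(1) j P(1) prime_polysD(1)
          by (auto intro: monic_mult monic_power simp: power_mult_distrib power_mult[symmetric] mult.commute)
        then show ?thesis by blast
      next
        fix P' i' G' assume P': "P' \<in> prime_polys" "G = P' ^ i' * G'" "monic G'" "\<not> P' dvd G'" "\<not> 3 dvd i'"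
        then have "i' \<noteq> 0" by (metis dvd_0_right)
        then have "P' dvd G" using P'(2) by (simp add: dvd_power)
        then have "P \<noteq> P'" using iG(3) by blast
        then have "\<not> P' dvd P ^ i"
          using prime_dvd_prime_eq[OF P'(1) P(1)] prime_elem_dvd_power prime_polysD(3)[OF P'(1)] by blast
        then have "\<not> P' dvd P ^ i * G'" using P' prime_dvd_mult_iff_poly by blast
        moreover have "c = P' ^ i' * (P ^ i * G')" using iG(1) P'(2) by (simp add: mult_ac)
        ultimately show ?thesis using P' mP monic_mult by blast
      qed
    qed
  qed
qed

section \<open>The symbol as a power of the resultant and its agreement with the given
  characters\<close>

locale cubic_symbol =
  fixes \<Omega> :: "'k::finite_field \<Rightarrow> complex" and third :: nat
  assumes card_eq: "CARD('k) = 3 * third + 1" and even_third: "even third"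
    and cube_root_iso: "cube_root_iso \<Omega>"
begin

lemma card_minus_one: "CARD('k) - 1 = 3 * third" "CARD('k) \<ge> 7"
proof -
  have "card {0, 1::'k} \<le> CARD('k)" by (intro card_mono) auto
  then have "third \<noteq> 0" using card_eq by auto
  with even_third have "third \<ge> 2" by (cases "third = 1") auto
  then show "CARD('k) - 1 = 3 * third" "CARD('k) \<ge> 7" using card_eq by auto
qed

lemma Omega_bij: "bij_betw \<Omega> {c. c ^ 3 = 1} {z. z ^ 3 = 1}"
  and Omega_mult: "c ^ 3 = 1 \<Longrightarrow> d ^ 3 = 1 \<Longrightarrow> \<Omega> (c * d) = \<Omega> c * \<Omega> d"
  using cube_root_iso by (auto simp: cube_root_iso_def)

lemma Omega_cube: "c ^ 3 = 1 \<Longrightarrow> \<Omega> c ^ 3 = 1"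
  using Omega_bij by (auto simp: bij_betw_def)

lemma Omega_1 [simp]: "\<Omega> 1 = 1"
proof -
  have "\<Omega> 1 = \<Omega> 1 * \<Omega> 1" using Omega_mult[of 1 1] by simp
  moreover have "\<Omega> 1 \<noteq> 0" using Omega_cube[of 1] by auto
  ultimately show ?thesis by simp
qed

lemma third_cube:
  assumes "x \<noteq> (0 :: 'k)"
  shows "(x ^ third) ^ 3 = 1"
proof -
  have "x * x ^ (CARD('k) - 1) = x ^ CARD('k)"
    using card_minus_one(2) by (cases "CARD('k)") auto
  also have "\<dots> = x" by (rule finite_field_power_card_eq_same)
  finally have "x ^ (CARD('k) - 1) = 1" using assms by simp
  then show ?thesis by (simp only: card_minus_one(1) power_mult[symmetric] mult.commute)
qed

text \<open>The cubic residue character of the constant field, extended by 0.\<close>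

definition omega :: "'k \<Rightarrow> complex" where
  "omega x = (if x = 0 then 0 else \<Omega> (x ^ third))"

lemma omega_simps [simp]: "omega 0 = 0" "omega 1 = 1"
  by (simp_all add: omega_def)

lemma omega_mult: "omega (x * y) = omega x * omega y"
  by (auto simp: omega_def power_mult_distrib Omega_mult third_cube)

lemma omega_power: "omega (x ^ n) = omega x ^ n"
  by (induction n) (auto simp: omega_mult)

lemma omega_cube: "x \<noteq> 0 \<Longrightarrow> omega x ^ 3 = 1"
  by (simp add: omega_def Omega_cube third_cube)

lemma omega_eq_0_iff [simp]: "omega x = 0 \<longleftrightarrow> x = 0"
  using omega_cube[of x] by (cases "x = 0") auto

text \<open>Here the evenness of \<open>third\<close> enters; it removes the sign in
  \<open>ac_norm_swap\<close>, so that \<open>chi_swap\<close> is reciprocity without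
  correction.\<close>

lemma omega_minus: "omega (- x) = omega x"
proof -
  have "(-1 :: 'k) ^ third = 1" using even_third by simp
  then have "omega (-1) = 1" by (simp add: omega_def)
  then show ?thesis using omega_mult[of "-1" x] by simp
qed

lemma norm_cube_root: "z ^ 3 = 1 \<Longrightarrow> norm (z :: complex) = 1"
  by (metis norm_ge_zero norm_one norm_power power_eq_1_iff zero_neq_numeral)

definition chi :: "'k poly \<Rightarrow> 'k poly \<Rightarrow> complex" where
  "chi c b = omega (of_ac (ac_norm c b))"

lemma of_ac_mult_range:
  assumes "x \<in> range to_ac" "y \<in> range to_ac"
  shows "of_ac (x * y) = of_ac x * of_ac y"
proof -
  obtain a b where ab: "x = to_ac a" "y = to_ac b" using assms by auto
  have "of_ac (to_ac (a * b)) = a * b" by (rule of_ac_to_ac)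
  then show ?thesis using ab by simp
qed

lemma chi_mult_right: "monic c \<Longrightarrow> chi c (a * b) = chi c a * chi c b"
  by (simp add: chi_def ac_norm_mult_right of_ac_mult_range ac_norm_in_range omega_mult)

lemma chi_mult_left: "monic c \<Longrightarrow> monic d \<Longrightarrow> chi (c * d) b = chi c b * chi d b"
  by (simp add: chi_def ac_norm_mult_left monic_nonzero of_ac_mult_range ac_norm_in_range omega_mult)

lemma chi_1_left [simp]: "chi 1 b = 1"
  by (simp add: chi_def)

lemma chi_const: "monic c \<Longrightarrow> chi c [:a:] = omega a ^ degree c"
proof -
  assume "monic c"
  then have "ac_norm c [:a:] = to_ac (a ^ degree c)" by (simp add: ac_norm_const)
  then show ?thesis by (simp only: chi_def of_ac_to_ac omega_power)
qed

lemma chi_1_right [simp]: "monic c \<Longrightarrow> chi c 1 = 1"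
  using chi_const[of c 1] by (simp add: one_pCons)

lemma chi_power_right: "monic c \<Longrightarrow> chi c (a ^ n) = chi c a ^ n"
  by (induction n) (auto simp: chi_mult_right)

lemma chi_power_left: "monic c \<Longrightarrow> chi (c ^ n) b = chi c b ^ n"
  by (induction n) (auto simp: chi_mult_left monic_power)

lemma chi_eq_0_iff:
  assumes "monic c"
  shows "chi c b = 0 \<longleftrightarrow> \<not> coprime c b"
proof -
  have "of_ac (ac_norm c b) = 0 \<longleftrightarrow> ac_norm c b = 0"
    using to_ac_of_ac[OF ac_norm_in_range[OF assms, of b]] by (metis of_ac_0 to_ac_0)
  then show ?thesis by (simp add: chi_def ac_norm_eq_0_iff[OF assms])
qed

lemma chi_cube:
  assumes "monic c" "coprime c b"
  shows "chi c b ^ 3 = 1"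
  using chi_eq_0_iff[OF assms(1), of b] assms(2) unfolding chi_def by (auto intro: omega_cube)

lemma norm_chi: "monic c \<Longrightarrow> norm (chi c b) = (if coprime c b then 1 else 0)"
  by (auto simp: chi_eq_0_iff norm_cube_root chi_cube)

lemma norm_chi_le: "monic c \<Longrightarrow> norm (chi c b) \<le> 1"
  by (simp add: norm_chi)

lemma chi_cong_primes:
  "monic c \<Longrightarrow> (\<And>P. P \<in> prime_polys \<Longrightarrow> P dvd c \<Longrightarrow> P dvd b - b') \<Longrightarrow> chi c b = chi c b'"
  unfolding chi_def by (rule arg_cong[of _ _ "\<lambda>x. omega (of_ac x)"], rule ac_norm_cong)

lemma chi_cong: "monic c \<Longrightarrow> b mod c = b' mod c \<Longrightarrow> chi c b = chi c b'"
  by (rule chi_cong_primes, assumption, unfold mod_eq_dvd_iff, rule dvd_trans)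

lemma chi_swap: "monic c \<Longrightarrow> monic b \<Longrightarrow> chi c b = chi b c"
proof -
  assume cb: "monic c" "monic b"
  obtain x where x: "ac_norm b c = to_ac x" using ac_norm_in_range[OF cb(2)] by blast
  have "ac_norm c b = to_ac ((-1) ^ (degree c * degree b) * x)"
    by (simp add: ac_norm_swap[OF cb] x)
  then have "chi c b = omega ((-1) ^ (degree c * degree b) * x)" by (simp only: chi_def of_ac_to_ac)
  also have "\<dots> = omega x"
    by (cases "even (degree c * degree b)") (auto simp: omega_minus)
  finally show ?thesis by (simp add: chi_def x)
qed

lemma chi_smult_right: "monic c \<Longrightarrow> chi c (smult a b) = omega a ^ degree c * chi c b"
  using chi_mult_right[of c "[:a:]" b] by (simp add: chi_const)

lemma prime_char_exponent: "(\<Sum>i<d. CARD('k) ^ i) * third = (CARD('k) ^ d - 1) div 3"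
proof -
  have "(\<Sum>i<d. CARD('k) ^ i) * (3 * third) = CARD('k) ^ d - 1"
    using geometric_sum_nat[of "CARD('k)" d] card_minus_one by simp
  then show ?thesis by (metis mult.left_commute nonzero_mult_div_cancel_left zero_neq_numeral)
qed

text \<open>Modulo a prime \<open>P\<close>, constants and powers of \<open>b\<close> can be
  compared at one root \<open>x\<close> of \<open>P\<close>: there \<open>prime_ac_norm\<close>
  turns the power of the norm into the power of \<open>b\<close> required by
  \<open>prime_char\<close>.\<close>

lemma prime_char_cong:
  assumes P: "P \<in> prime_polys" and nd: "\<not> P dvd b"
  defines "w \<equiv> of_ac (ac_norm P b) ^ third"
  shows "[b ^ ((CARD('k) ^ degree P - 1) div 3) = [:w:]] (mod P)" "w ^ 3 = 1" "chi P b = \<Omega> w"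
proof -
  let ?m = "(CARD('k) ^ degree P - 1) div 3"
  have mP: "monic P" using prime_polysD P by auto
  have nz: "of_ac (ac_norm P b) \<noteq> 0"
    using chi_eq_0_iff[OF mP, of b] prime_poly_coprime[OF P nd] by (auto simp: chi_def)
  show "w ^ 3 = 1" unfolding w_def using third_cube[OF nz] .
  show "chi P b = \<Omega> w" using nz by (simp add: chi_def omega_def w_def)
  have "degree (map_poly to_ac P) > 0" using prime_polysD(5)[OF P] by simp
  then obtain x where x: "ac_eval P x = 0"
    using alg_closed_imp_poly_has_root unfolding ac_eval_def by blast
  have "to_ac w = ac_norm P b ^ third"
    unfolding w_def to_ac_power to_ac_of_ac[OF ac_norm_in_range[OF mP]] ..
  also have "\<dots> = ac_eval b x ^ ?m"
    by (simp add: prime_ac_norm[OF P x] power_mult[symmetric] prime_char_exponent)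
  finally have "ac_eval (b ^ ?m - [:w:]) x = 0" by (simp add: ac_eval_diff ac_eval_power)
  then have "P dvd b ^ ?m - [:w:]" using prime_poly_coprime[OF P] coprime_no_common_root x by blast
  then show "[b ^ ?m = [:w:]] (mod P)" by (simp add: cong_iff_dvd_diff)
qed

lemma prime_char_eq_chi:
  assumes P: "P \<in> prime_polys"
  shows "prime_char \<Omega> P b = chi P b"
proof (cases "P dvd b")
  case True
  have "\<not> coprime P b" using True prime_poly_not_dvd_one[OF P] by (metis coprime_common_divisor dvd_refl)
  then have "chi P b = 0" using chi_eq_0_iff prime_polysD(1)[OF P] by blast
  then show ?thesis using True by (simp add: prime_char_def)
next
  case False
  note pc = prime_char_cong[OF P False]
  let ?w = "of_ac (ac_norm P b) ^ third"
  let ?inv = "inv_into {c. c ^ 3 = 1} \<Omega>"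
  have inv: "?inv (\<Omega> ?w) = ?w"
    using Omega_bij pc(2) by (auto simp: bij_betw_def inv_into_f_f)
  have "(THE \<alpha>. \<alpha> ^ 3 = 1 \<and> [b ^ ((CARD('k) ^ degree P - 1) div 3) = [:?inv \<alpha>:]] (mod P)) = \<Omega> ?w"
  proof (rule the_equality)
    show "\<Omega> ?w ^ 3 = 1 \<and> [b ^ ((CARD('k) ^ degree P - 1) div 3) = [:?inv (\<Omega> ?w):]] (mod P)"
      using pc Omega_cube by (simp add: inv)
  next
    fix \<alpha> assume \<alpha>: "\<alpha> ^ 3 = 1 \<and> [b ^ ((CARD('k) ^ degree P - 1) div 3) = [:?inv \<alpha>:]] (mod P)"
    then have "[[:?w:] = [:?inv \<alpha>:]] (mod P)" using pc(1) cong_sym cong_trans by blast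
    then have "P dvd [:?w - ?inv \<alpha>:]" by (simp add: cong_iff_dvd_diff)
    then have "[:?w - ?inv \<alpha>:] = 0"
      using prime_polysD(5)[OF P] polys_below_dvd_eq_0[of "[:?w - ?inv \<alpha>:]" P] by (simp add: polys_below_iff)
    then have "?inv \<alpha> = ?w" by simp
    moreover have "\<Omega> (?inv \<alpha>) = \<alpha>" using \<alpha> Omega_bij by (auto simp: bij_betw_def intro: f_inv_into_f)
    ultimately show "\<alpha> = \<Omega> ?w" by simp
  qed
  then show ?thesis using False pc(3) by (simp add: prime_char_def)
qed

text \<open>Multiplication of the modulus by a prime raises one multiplicity by one and leaves the
  others alone, which matches the multiplicativity of \<open>chi\<close> in its modulus.\<close>

lemma cubic_char_eq_chi:
  assumes "monic F"
  shows "cubic_char \<Omega> F b = chi F b"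
  using assms
proof (induction rule: monic_prime_induct)
  case one
  have "{P. P \<in> prime_polys \<and> P dvd 1} = ({} :: 'k poly set)" using prime_poly_not_dvd_one by blast
  then show ?case unfolding cubic_char_def by (simp only: prod.empty chi_1_left)
next
  case (prime_mult P G)
  let ?S = "{P. P \<in> prime_polys \<and> P dvd G}"
  have fin: "finite ?S" using finite_prime_divisors[OF monic_nonzero[OF prime_mult(2)]] by simp
  have S: "{P'. P' \<in> prime_polys \<and> P' dvd P * G} = insert P (?S - {P})"
  proof (intro equalityI subsetI)
    fix R assume "R \<in> {P'. P' \<in> prime_polys \<and> P' dvd P * G}"
    then have R: "R \<in> prime_polys" "R dvd P \<or> R dvd G" using prime_dvd_mult_iff_poly[of R P G] by auto
    then show "R \<in> insert P (?S - {P})"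
      using prime_dvd_prime_eq[OF R(1) prime_mult(1)] by (cases "R = P") auto
  next
    fix R assume "R \<in> insert P (?S - {P})"
    then show "R \<in> {P'. P' \<in> prime_polys \<and> P' dvd P * G}" using prime_mult(1) by auto
  qed
  define e where "e F P' = prime_char \<Omega> P' b ^ Max {n. P' ^ n dvd F}" for F P'
  have cc: "cubic_char \<Omega> F b = (\<Prod>P'\<in>{P. P \<in> prime_polys \<and> P dvd F}. e F P')" for F
    by (simp only: cubic_char_def e_def)
  have "cubic_char \<Omega> (P * G) b = (\<Prod>P'\<in>insert P (?S - {P}). e (P * G) P')"
    by (simp only: cc S)
  also have "\<dots> = e (P * G) P * (\<Prod>P'\<in>?S - {P}. e (P * G) P')"
    by (rule prod.insert[OF finite_Diff[OF fin]]) blast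
  also have "(\<Prod>P'\<in>?S - {P}. e (P * G) P') = (\<Prod>P'\<in>?S - {P}. e G P')"
  proof (rule prod.cong[OF refl])
    fix P' assume "P' \<in> ?S - {P}"
    then have "P' \<in> prime_polys" "P \<noteq> P'" by blast+
    note power_dvd_other_prime_mult[OF prime_mult(1) this]
    then show "e (P * G) P' = e G P'"
      unfolding e_def by (simp only:)
  qed
  also have "e (P * G) P = prime_char \<Omega> P b * e G P"
    unfolding e_def Max_power_dvd_prime_mult[OF prime_mult(1,2)] by (rule power_Suc)
  also have "prime_char \<Omega> P b * e G P * (\<Prod>P'\<in>?S - {P}. e G P') =
      prime_char \<Omega> P b * (e G P * (\<Prod>P'\<in>?S - {P}. e G P'))" by (rule mult.assoc)
  also have "e G P * (\<Prod>P'\<in>?S - {P}. e G P') = cubic_char \<Omega> G b"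
  proof (cases "P \<in> ?S")
    case True
    show ?thesis unfolding cc by (rule prod.remove[OF fin True, of "e G", symmetric])
  next
    case False
    then have nd: "\<not> P dvd G" using prime_mult(1) by blast
    have "{n. P ^ n dvd G} = {0}"
    proof safe
      fix n assume "P ^ n dvd G"
      then show "n = 0" using nd by (cases n) (auto dest: dvd_mult_left)
    qed auto
    then have "e G P = 1" by (simp add: e_def)
    moreover have "?S - {P} = ?S" using False by blast
    ultimately show ?thesis unfolding cc by simp
  qed
  finally show ?case
    using prime_mult
    by (simp add: prime_char_eq_chi chi_mult_left[OF prime_polysD(1)[OF prime_mult(1)] prime_mult(2)])
qed

text \<open>Otherwise all q^d - 1 nonzero residues modulo \<open>P\<close> would give roots of X^m -
  1 with m = (q^d - 1)/3.\<close>

lemma prime_nonresidue: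
  assumes P: "P \<in> prime_polys"
  shows "\<exists>b. \<not> P dvd b \<and> chi P b \<noteq> 1"
proof (rule ccontr)
  assume "\<not> ?thesis"
  then have all1: "chi P b = 1" if "\<not> P dvd b" for b using that by blast
  let ?d = "degree P" and ?q = "CARD('k)"
  let ?m = "(?q ^ ?d - 1) div 3"
  have "degree (map_poly to_ac P) > 0" using prime_polysD(5)[OF P] by simp
  then obtain x where x: "ac_eval P x = 0"
    using alg_closed_imp_poly_has_root unfolding ac_eval_def by blast
  have inj: "inj_on (\<lambda>b. ac_eval b x) (polys_below ?d)"
  proof (rule inj_onI)
    fix b b' assume b: "b \<in> polys_below ?d" "b' \<in> polys_below ?d" "ac_eval b x = ac_eval b' x"
    then have "ac_eval (b - b') x = 0" by (simp add: ac_eval_diff)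
    then have "P dvd b - b'" using prime_poly_coprime[OF P] coprime_no_common_root x by blast
    then show "b = b'" using polys_below_dvd_eq_0 polys_below_diff[OF b(1,2)] by force
  qed
  have qd: "?q ^ ?d \<ge> 7"
    using card_minus_one(2) prime_polysD(5)[OF P] self_le_power[of ?q ?d] by linarith
  then have m: "?m > 0" "?m < ?q ^ ?d - 1" by auto
  define p :: "'k alg_closure poly" where "p = monom 1 ?m - 1"
  have degp: "degree p = ?m"
    unfolding p_def diff_conv_add_uminus using m by (subst degree_add_eq_left) (auto simp: degree_monom_eq)
  then have "p \<noteq> 0" using m by auto
  have "(\<lambda>b. ac_eval b x) ` (polys_below ?d - {0}) \<subseteq> {y. poly p y = 0}"
  proof safe
    fix b :: "'k poly" assume b: "b \<in> polys_below ?d" "b \<noteq> 0"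
    then have nd: "\<not> P dvd b" using polys_below_dvd_eq_0 by blast
    note pc = prime_char_cong[OF P nd]
    have "\<Omega> (of_ac (ac_norm P b) ^ third) = \<Omega> 1" using all1[OF nd] pc(3) by simp
    then have w: "of_ac (ac_norm P b) ^ third = 1"
      by (rule inj_onD[OF bij_betw_imp_inj_on[OF Omega_bij]]) (use pc(2) in simp_all)
    then have "P dvd b ^ ?m - 1" using pc(1) by (simp add: cong_iff_dvd_diff w one_pCons[symmetric])
    then have "ac_eval (b ^ ?m - 1) x = 0" using ac_eval_dvd x by blast
    then show "poly p (ac_eval b x) = 0" by (simp add: p_def poly_monom ac_eval_diff ac_eval_power)
  qed
  then have "card ((\<lambda>b. ac_eval b x) ` (polys_below ?d - {0})) \<le> card {y. poly p y = 0}"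
    using poly_roots_finite[OF \<open>p \<noteq> 0\<close>] by (rule card_mono[rotated])
  also have "\<dots> \<le> ?m" using card_poly_roots_bound[OF \<open>p \<noteq> 0\<close>] degp by simp
  finally have "?q ^ ?d - 1 \<le> ?m"
    by (subst (asm) card_image) (auto intro: inj_on_subset[OF inj] simp: card_polys_below)
  with m show False by simp
qed

text \<open>The Chinese remainder theorem gives a \<open>b\<close> that is a nonresidue modulo
  \<open>P\<close> and 1 modulo \<open>G\<close>; then only the i-th power of the local symbol at
  \<open>P\<close> remains. The congruence modulo \<open>G\<close> is kept in the conclusion for the
  computation of the conductor.\<close>

lemma prime_power_nonresidue:
  assumes "P \<in> prime_polys" "monic G" "\<not> P dvd G" "\<not> 3 dvd i"
  obtains b where "b mod G = 1 mod G" "chi P b \<noteq> 0" "chi (P ^ i * G) b \<noteq> 1" "coprime (P ^ i * G) b"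
proof -
  note mP = prime_polysD(1)[OF assms(1)]
  obtain b0 where b0: "\<not> P dvd b0" "chi P b0 \<noteq> 1" using prime_nonresidue[OF assms(1)] by blast
  obtain u v where uv: "u * P + v * G = 1"
    using field_poly_coprime_bezout[OF prime_poly_coprime[OF assms(1,3)]] by blast
  define b where "b = b0 * (v * G) + u * P"
  have vG: "v * G = 1 - u * P" and uP: "u * P = 1 - v * G" using uv by (auto simp: algebra_simps)
  have "b - b0 = (u - b0 * u) * P" unfolding b_def vG by (simp add: algebra_simps)
  then have 1: "chi P b = chi P b0" by (intro chi_cong mP) (simp add: mod_eq_dvd_iff)
  have "b - 1 = (b0 * v - v) * G" unfolding b_def uP by (simp add: algebra_simps)
  then have bG: "b mod G = 1 mod G" by (simp add: mod_eq_dvd_iff)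
  then have 2: "chi G b = 1" using chi_cong[OF assms(2)] assms(2) by simp
  have nz: "chi P b0 \<noteq> 0" using chi_eq_0_iff[OF mP] prime_poly_coprime[OF assms(1) b0(1)] by simp
  have cube: "chi P b0 ^ 3 = 1" using chi_cube[OF mP prime_poly_coprime[OF assms(1) b0(1)]] .
  have eq: "chi (P ^ i * G) b = chi P b0 ^ i"
    by (simp add: chi_mult_left chi_power_left mP monic_power assms(2) 1 2)
  have "chi P b0 ^ i \<noteq> 1"
  proof
    assume i1: "chi P b0 ^ i = 1"
    \<comment> \<open>The exponent \<open>i\<close> is invertible modulo 3, so the i-th power of a
      cube root of unity determines it.\<close>
    have "coprime i 3" using assms(4) prime_imp_coprime[of 3 i] by (simp add: coprime_commute)
    then obtain k l :: nat where kl: "i * k = 3 * l + 1"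
      using coprime_bezout_strong[of i 3] by auto
    have "chi P b0 ^ (i * k) = 1" using i1 by (simp add: power_mult)
    moreover have "chi P b0 ^ (3 * l + 1) = chi P b0" using cube by (simp add: power_mult)
    ultimately show False using b0(2) kl by simp
  qed
  moreover have "coprime (P ^ i * G) b"
    using chi_eq_0_iff[of "P ^ i * G" b] eq nz mP assms(2) by (simp add: monic_mult monic_power)
  ultimately show thesis using that[of b] eq bG 1 nz by simp
qed

lemma noncube_nontrivial:
  assumes "monic c" "\<nexists>A. monic A \<and> c = A ^ 3"
  obtains b where "coprime c b" "chi c b \<noteq> 1"
proof -
  obtain P i G where PG: "P \<in> prime_polys" "c = P ^ i * G" "monic G" "\<not> P dvd G" "\<not> 3 dvd i"
    using cube_or_bad_prime[OF assms(1)] assms(2) by blast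
  obtain b where "chi (P ^ i * G) b \<noteq> 1" "coprime (P ^ i * G) b"
    using prime_power_nonresidue[OF PG(1,3-5)] by blast
  then show thesis using that PG(2) by simp
qed

lemma sum_chi_noncube:
  assumes "monic c" "\<nexists>A. monic A \<and> c = A ^ 3"
  shows "(\<Sum>b\<in>polys_below (degree c). chi c b) = 0"
proof -
  obtain u where u: "coprime c u" "chi c u \<noteq> 1" using noncube_nontrivial[OF assms] by blast
  have "(\<Sum>b\<in>polys_below (degree c). chi c b) = (\<Sum>b\<in>polys_below (degree c). chi c (u * b))"
    by (rule sum_residue_mult[symmetric])
      (use assms(1) u in \<open>auto simp: monic_nonzero coprime_commute intro: chi_cong\<close>)
  also have "\<dots> = chi c u * (\<Sum>b\<in>polys_below (degree c). chi c b)"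
    by (simp add: chi_mult_right assms(1) sum_distrib_left)
  finally show ?thesis using u(2) by (metis mult_cancel_right1)
qed

lemma sum_chi_monics_noncube:
  assumes "monic c" "\<nexists>A. monic A \<and> c = A ^ 3" "degree c \<le> n"
  shows "(\<Sum>F\<in>monics n. chi c F) = 0"
proof -
  have "(\<Sum>F\<in>monics n. chi c F) =
      of_nat CARD('k) ^ (n - degree c) * (\<Sum>b\<in>polys_below (degree c). chi c b)"
    by (rule sum_monics_periodic[OF assms(1,3) chi_cong[OF assms(1)]])
  then show ?thesis using sum_chi_noncube[OF assms(1,2)] by simp
qed

end

subsection \<open>Additive characters and Gauss sums\<close>

lemma sum_polys_below_shift:
  fixes f :: "'k::finite_field poly \<Rightarrow> complex"
  assumes "y \<in> polys_below k"
  shows "(\<Sum>V\<in>polys_below k. f (V + y)) = (\<Sum>V\<in>polys_below k. f V)"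
proof (rule sum.reindex_bij_betw)
  show "bij_betw (\<lambda>V. V + y) (polys_below k) (polys_below k)"
    by (rule bij_betwI[where g = "\<lambda>V. V - y"])
      (use assms in \<open>auto intro: polys_below_add polys_below_diff\<close>)
qed

lemma coeff_mult_monic_top:
  assumes "y \<in> polys_below (Suc m)" "monic d"
  shows "coeff (y * d) (m + degree d) = coeff y m"
proof (cases "degree y = m")
  case True
  then show ?thesis using assms(2) coeff_mult_degree_sum[of y d] by (simp add: monic_def)
next
  case False
  show ?thesis
  proof (cases "y = 0")
    case False
    then have "degree y < m" using assms(1) \<open>degree y \<noteq> m\<close> by (auto simp: polys_below_iff)
    moreover from this have "degree (y * d) < m + degree d"
      using degree_mult_le[of y d] by linarith
    ultimately show ?thesis by (simp add: coeff_eq_0)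
  qed simp
qed

lemma exists_gcd_cofactors:
  fixes W c :: "'k::finite_field poly"
  assumes "monic c"
  obtains g W1 c1 where "monic g" "monic c1" "W = g * W1" "c = g * c1" "coprime W1 c1"
proof -
  obtain u v d where d: "u * W + v * c = d" "d dvd W" "d dvd c" using field_poly_bezout by blast
  have "d \<noteq> 0" using d(3) monic_nonzero[OF assms] by auto
  then obtain a g where g: "a \<noteq> 0" "monic g" "d = smult a g" using associated_monic by blast
  then have "g dvd W" "g dvd c" using d(2,3) by (metis dvd_smult dvd_refl dvd_trans)+
  then obtain W1 c1 where W1: "W = g * W1" "c = g * c1" by (elim dvdE)
  have "g * (u * W1 + v * c1) = g * [:a:]" using d(1) g(3) W1 by (simp add: algebra_simps)
  then have "u * W1 + v * c1 = [:a:]" using monic_nonzero[OF g(2)] by (simp only: mult_cancel_left) simp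
  then have "smult (inverse a) u * W1 + smult (inverse a) v * c1 = 1"
    using g(1) by (simp add: smult_add_right[symmetric] one_pCons)
  then have "coprime W1 c1" by (rule bezout_imp_coprime)
  moreover have "monic c1" using monic_mult_cancel g(2) assms W1(2) by blast
  ultimately show thesis using that g(2) W1 by blast
qed

locale cubic_gauss = cubic_symbol \<Omega> third
  for \<Omega> :: "'k::finite_field \<Rightarrow> complex" and third +
  fixes \<psi> :: "'k \<Rightarrow> complex"
  assumes psi_add: "\<psi> (x + y) = \<psi> x * \<psi> y"
    and norm_psi: "norm (\<psi> x) = 1"
    and psi_nontrivial: "\<exists>x. \<psi> x \<noteq> 1"
begin

lemma psi_0 [simp]: "\<psi> 0 = 1"
proof -
  have "\<psi> 0 = \<psi> 0 * \<psi> 0" using psi_add[of 0 0] by simp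
  moreover have "\<psi> 0 \<noteq> 0" using norm_psi[of 0] by auto
  ultimately show ?thesis by simp
qed

text \<open>The additive character of the completion at infinity, evaluated at the fraction \<open>x / c\<close>:
  it is \<open>\<psi>\<close> applied to the coefficient of \<open>1 / T\<close>.\<close>

definition e_frac :: "'k poly \<Rightarrow> 'k poly \<Rightarrow> complex" where
  "e_frac x c = \<psi> (coeff (x mod c) (degree c - 1))"

lemma e_frac_add: "e_frac (x + y) c = e_frac x c * e_frac y c"
  by (simp add: e_frac_def poly_mod_add_left psi_add)

lemma e_frac_cong: "x mod c = y mod c \<Longrightarrow> e_frac x c = e_frac y c"
  by (simp add: e_frac_def)

lemma e_frac_0 [simp]: "e_frac 0 c = 1"
  by (simp add: e_frac_def)

lemma norm_e_frac [simp]: "norm (e_frac x c) = 1"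
  by (simp add: e_frac_def norm_psi)

lemma e_frac_nonzero [simp]: "e_frac x c \<noteq> 0"
  using norm_e_frac[of x c] by (metis norm_zero zero_neq_one)

lemma e_frac_mult_self [simp]: "e_frac (x * c) c = 1" "e_frac (c * x) c = 1"
  by (simp_all add: e_frac_def)

lemma e_frac_uminus: "e_frac (- x) c = cnj (e_frac x c)"
proof -
  have "e_frac (- x) c * e_frac x c = 1" using e_frac_add[of "- x" x c] by simp
  moreover have "cnj (e_frac x c) * e_frac x c = 1"
    by (simp add: mult.commute[of "cnj _"] complex_norm_square[symmetric])
  ultimately show ?thesis by (metis e_frac_nonzero mult_cancel_right)
qed

lemma e_frac_below: "x \<in> polys_below (degree c) \<Longrightarrow> e_frac x c = \<psi> (coeff x (degree c - 1))"
  by (simp add: e_frac_def mod_below_id)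

lemma e_frac_small: "x \<in> polys_below (degree c - 1) \<Longrightarrow> e_frac x c = 1"
  using e_frac_below[of x c] polys_below_mono[of "degree c - 1" "degree c"]
  by (auto simp: polys_below_def)

text \<open>So \<open>e_frac\<close> depends only on the fraction: multiplying by a monic
  \<open>d\<close> moves the critical coefficient up by the degree of \<open>d\<close>. For
  \<open>c = 1\<close> the truncated index is harmless since the remainder is 0.\<close>

lemma e_frac_cancel:
  assumes "monic c" "monic d"
  shows "e_frac (x * d) (c * d) = e_frac x c"
proof (cases "degree c = 0")
  case True
  then have "c = 1" using assms(1) monic_degree_0 by blast
  then show ?thesis by (simp add: e_frac_def)
next
  case False
  then obtain m where m: "degree c = Suc m" using not0_implies_Suc by blast
  have "(x * d) mod (c * d) = (x mod c) * d" by (rule mod_mult_mult2)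
  moreover have "degree (c * d) - 1 = m + degree d" using degree_mult_monic[OF assms] m by simp
  moreover have "x mod c \<in> polys_below (Suc m)"
    using mod_in_polys_below[OF monic_nonzero[OF assms(1)], of x] m by simp
  ultimately have "coeff ((x * d) mod (c * d)) (degree (c * d) - 1) = coeff (x mod c) m"
    by (simp only: coeff_mult_monic_top[OF _ assms(2)])
  then show ?thesis by (simp only: e_frac_def m diff_Suc_1)
qed

lemma e_frac_top_nontrivial:
  assumes "degree x = degree c - 1 - i" "x \<noteq> 0" "degree c > i"
  obtains a where "e_frac (monom a i * x) c \<noteq> 1"
proof -
  obtain z where z: "\<psi> z \<noteq> 1" using psi_nontrivial by blast
  define a where "a = z / lead_coeff x"
  have "a \<noteq> 0" using z assms(2) by (auto simp: a_def)
  then have nz: "monom a i * x \<noteq> 0" using assms(2) by simp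
  have deg: "degree (monom a i * x) = degree c - 1"
    using assms \<open>a \<noteq> 0\<close> by (subst degree_mult_eq) (auto simp: degree_monom_eq)
  have "coeff (monom a i * x) (degree c - 1) = a * lead_coeff x"
    using deg lead_coeff_mult[of "monom a i" x] \<open>a \<noteq> 0\<close> by (simp add: degree_monom_eq lead_coeff_monom)
  also have "\<dots> = z" using assms(2) by (simp add: a_def)
  finally have top: "coeff (monom a i * x) (degree c - 1) = z" .
  have "monom a i * x \<in> polys_below (degree c)" using deg assms(3) by (simp add: polys_below_iff)
  then have "e_frac (monom a i * x) c = \<psi> z" by (simp only: e_frac_below top)
  with z show thesis by (intro that[of a]) metis
qed

text \<open>Orthogonality on the space \<open>polys_below k\<close>. If \<open>x\<close> is too
  large, a monomial of degree below \<open>k\<close> lifts its leading term to the critical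
  coefficient, and translation by a suitable multiple of that monomial kills the sum.\<close>

lemma sum_e_frac:
  assumes "x \<in> polys_below (degree c)" "k \<le> degree c"
  shows "(\<Sum>V\<in>polys_below k. e_frac (V * x) c) =
    (if x \<in> polys_below (degree c - k) then of_nat (CARD('k) ^ k) else 0)"
proof (cases "x \<in> polys_below (degree c - k)")
  case True
  have "e_frac (V * x) c = 1" if "V \<in> polys_below k" for V
    using polys_below_mult[OF that True] assms(2) by (intro e_frac_small) simp
  then show ?thesis using True by (simp add: card_polys_below)
next
  case False
  then have x: "x \<noteq> 0" "\<not> degree x < degree c - k" by (auto simp: polys_below_iff)
  then have dx: "degree x < degree c" using assms(1) by (auto simp: polys_below_iff)
  define i where "i = degree c - 1 - degree x"
  have i: "degree x = degree c - 1 - i" "degree c > i" "i < k" using dx x(2) by (auto simp: i_def)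
  obtain a where a: "e_frac (monom a i * x) c \<noteq> 1"
    using e_frac_top_nontrivial[OF i(1) x(1) i(2)] by blast
  have mem: "monom a i \<in> polys_below k" using i(3) by (auto simp: polys_below_def)
  let ?s = "\<Sum>V\<in>polys_below k. e_frac (V * x) c"
  have "?s = (\<Sum>V\<in>polys_below k. e_frac ((V + monom a i) * x) c)"
    by (rule sum_polys_below_shift[OF mem, symmetric])
  also have "\<dots> = ?s * e_frac (monom a i * x) c"
    by (simp add: distrib_right e_frac_add sum_distrib_right)
  finally have "?s = 0" using a by (metis mult_cancel_left1)
  then show ?thesis using False by simp
qed

lemma e_frac_nontrivial:
  assumes "monic D" "\<not> D dvd W"
  obtains y where "e_frac (W * y) D \<noteq> 1"
proof -
  let ?x = "W mod D"
  have x: "?x \<noteq> 0" using assms(2) by (simp add: dvd_eq_mod_eq_0)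
  have "?x \<in> polys_below (degree D)" using mod_in_polys_below monic_nonzero[OF assms(1)] by blast
  then have "degree ?x < degree D" using x by (simp add: polys_below_iff)
  then obtain a where "e_frac (monom a (degree D - 1 - degree ?x) * ?x) D \<noteq> 1"
    using e_frac_top_nontrivial[of ?x D "degree D - 1 - degree ?x"] x by auto
  moreover have "e_frac (monom a (degree D - 1 - degree ?x) * ?x) D =
      e_frac (W * monom a (degree D - 1 - degree ?x)) D"
    by (rule e_frac_cong) (metis mod_mult_right_eq mult.commute)
  ultimately show thesis using that by metis
qed

definition gauss :: "'k poly \<Rightarrow> 'k poly \<Rightarrow> complex" where
  "gauss W c = (\<Sum>b\<in>polys_below (degree c). chi c b * e_frac (W * b) c)"

lemma gauss_summand_cong:
  assumes "monic c" "b mod c = b' mod c"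
  shows "chi c b * e_frac (W * b) c = chi c b' * e_frac (W * b') c"
proof -
  have "(W * b) mod c = (W * b') mod c" using assms(2) by (metis mod_mult_right_eq)
  then show ?thesis using chi_cong[OF assms] e_frac_cong by metis
qed

lemma gauss_1 [simp]: "gauss W 1 = 1"
  by (simp add: gauss_def e_frac_def)

text \<open>Substituting u b for b brings out the inverse of \<open>chi c u\<close>, which is its
  square because the value is a cube root of unity.\<close>

lemma gauss_unit_mult:
  assumes "monic c" "coprime c u"
  shows "gauss (u * W) c = chi c u ^ 2 * gauss W c"
proof -
  have "(\<Sum>b\<in>polys_below (degree c). chi c (u * b) * e_frac (W * (u * b)) c) = gauss W c"
    unfolding gauss_def
    by (rule sum_residue_mult[where f = "\<lambda>b. chi c b * e_frac (W * b) c",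
        OF monic_nonzero[OF assms(1)] assms(2)[unfolded coprime_commute[of c]] gauss_summand_cong[OF assms(1)]])
  moreover have "(\<Sum>b\<in>polys_below (degree c). chi c (u * b) * e_frac (W * (u * b)) c) =
      chi c u * gauss (u * W) c"
    by (simp add: gauss_def sum_distrib_left chi_mult_right[OF assms(1)] mult_ac)
  ultimately have "chi c u ^ 2 * (chi c u * gauss (u * W) c) = chi c u ^ 2 * gauss W c" by simp
  moreover have "chi c u ^ 2 * (chi c u * gauss (u * W) c) = chi c u ^ 3 * gauss (u * W) c"
    by (simp add: power3_eq_cube power2_eq_square)
  ultimately show ?thesis using chi_cube[OF assms] by simp
qed

text \<open>The Chinese remainder theorem leaves the factor \<open>chi c d * chi d c\<close>, which
  reciprocity turns into the square of \<open>chi d c\<close>. By \<open>gauss_unit_mult\<close>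
  this square is the same as multiplying the frequency of the second sum by
  \<open>c\<close>.\<close>

lemma gauss_mult:
  assumes "monic c" "monic d" "coprime c d"
  shows "gauss W (c * d) = gauss W c * gauss (W * c) d"
proof -
  let ?A = "polys_below (degree c)" and ?B = "polys_below (degree d)"
  have split: "chi (c * d) (x * d + y * c) * e_frac (W * (x * d + y * c)) (c * d) =
      chi c d * (chi c x * e_frac (W * x) c) * (chi d c * (chi d y * e_frac (W * y) d))" for x y
  proof -
    have "chi c (x * d + y * c) = chi c (x * d)" by (rule chi_cong[OF assms(1)]) simp
    moreover have "chi d (x * d + y * c) = chi d (y * c)" by (rule chi_cong[OF assms(2)]) simp
    moreover have "W * (x * d + y * c) = (W * x) * d + (W * y) * c" by (simp add: algebra_simps)
    moreover have "e_frac ((W * x) * d) (c * d) = e_frac (W * x) c" by (rule e_frac_cancel[OF assms(1,2)])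
    moreover have "e_frac ((W * y) * c) (c * d) = e_frac (W * y) d"
      using e_frac_cancel[OF assms(2,1), of "W * y"] by (simp only: mult.commute[of d c])
    ultimately show ?thesis
      by (simp only: chi_mult_left[OF assms(1,2)] e_frac_add chi_mult_right[OF assms(1)]
          chi_mult_right[OF assms(2)] mult_ac)
  qed
  define f where "f b = chi (c * d) b * e_frac (W * b) (c * d)" for b
  have "gauss W (c * d) = (\<Sum>b\<in>polys_below (degree (c * d)). f b)" by (simp only: gauss_def f_def)
  also have "\<dots> = (\<Sum>z\<in>?A \<times> ?B. f ((\<lambda>(x, y). x * d + y * c) z))"
    by (rule sum.reindex_bij_betw[OF crt_bij[OF assms], symmetric])
  also have "\<dots> = (\<Sum>(x, y)\<in>?A \<times> ?B.
      chi (c * d) (x * d + y * c) * e_frac (W * (x * d + y * c)) (c * d))"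
    by (simp only: case_prod_unfold f_def)
  also have "\<dots> = (\<Sum>x\<in>?A. \<Sum>y\<in>?B.
      chi c d * (chi c x * e_frac (W * x) c) * (chi d c * (chi d y * e_frac (W * y) d)))"
    by (simp only: split sum.cartesian_product)
  also have "\<dots> = chi c d * gauss W c * (chi d c * gauss W d)"
    unfolding gauss_def sum_distrib_left sum_distrib_right by (rule sum.swap)
  also have "\<dots> = gauss W c * (chi d c ^ 2 * gauss W d)"
    unfolding chi_swap[OF assms(1,2)] by (simp add: power2_eq_square mult_ac)
  also have "chi d c ^ 2 * gauss W d = gauss (W * c) d"
    using gauss_unit_mult[OF assms(2), of c W] assms(3) by (simp add: coprime_commute mult.commute)
  finally show ?thesis .
qed

text \<open>Translating b by \<open>c * y\<close> does not change the symbol, since \<open>c\<close>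
  contains every prime of \<open>D * c\<close>, but multiplies the additive character by a constant,
  which differs from 1 for a suitable \<open>y\<close>.\<close>

lemma gauss_eq_0:
  assumes "monic D" "monic c" "\<And>P. P \<in> prime_polys \<Longrightarrow> P dvd D \<Longrightarrow> P dvd c" "\<not> D dvd W"
  shows "gauss W (D * c) = 0"
proof -
  obtain y where y: "e_frac (W * y) D \<noteq> 1" using e_frac_nontrivial[OF assms(1,4)] by blast
  have mon: "monic (D * c)" using assms(1,2) by (rule monic_mult)
  let ?f = "\<lambda>b. chi (D * c) b * e_frac (W * b) (D * c)"
  have "gauss W (D * c) = (\<Sum>b\<in>polys_below (degree (D * c)). ?f (b + c * y))"
    unfolding gauss_def
    by (rule sum_residue_add[OF monic_nonzero[OF mon], symmetric]) (rule gauss_summand_cong[OF mon])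
  also have "\<dots> = (\<Sum>b\<in>polys_below (degree (D * c)). ?f b * e_frac (W * y) D)"
  proof (rule sum.cong[OF refl])
    fix b
    have "chi (D * c) (b + c * y) = chi (D * c) b"
    proof (rule chi_cong_primes[OF mon])
      fix P assume "P \<in> prime_polys" "P dvd D * c"
      then have "P dvd c" using assms(3) prime_dvd_mult_iff_poly by blast
      then show "P dvd b + c * y - b" by simp
    qed
    moreover have "e_frac (W * (b + c * y)) (D * c) = e_frac (W * b) (D * c) * e_frac (W * y) D"
      using e_frac_cancel[OF assms(1,2), of "W * y"]
      by (simp add: distrib_left e_frac_add mult_ac)
    ultimately show "?f (b + c * y) = ?f b * e_frac (W * y) D" by simp
  qed
  also have "\<dots> = gauss W (D * c) * e_frac (W * y) D" by (simp add: gauss_def sum_distrib_right)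
  finally show ?thesis using y by (metis mult_cancel_left1)
qed

lemma sum_chi_zero:
  assumes "monic c" "coprime c u" "chi c u \<noteq> 1"
  shows "(\<Sum>b\<in>polys_below (degree c). chi c b) = 0"
proof -
  have "(\<Sum>b\<in>polys_below (degree c). chi c b) = (\<Sum>b\<in>polys_below (degree c). chi c (u * b))"
    by (rule sum_residue_mult[OF monic_nonzero[OF assms(1)]
        assms(2)[unfolded coprime_commute[of c]] chi_cong[OF assms(1)], symmetric])
  also have "\<dots> = chi c u * (\<Sum>b\<in>polys_below (degree c). chi c b)"
    by (simp add: chi_mult_right assms(1) sum_distrib_left)
  finally show ?thesis using assms(3) by (metis mult_cancel_right1)
qed

text \<open>High exponents vanish by \<open>gauss_eq_0\<close> with D = P^(t+1). If
  \<open>P ^ j\<close> divides the frequency, the additive character is trivial and a complete sum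
  of a character remains, which is nontrivial unless 3 divides j.\<close>

lemma
  assumes P: "P \<in> prime_polys"
  shows gauss_prime_power_high: "\<not> P ^ Suc t dvd W \<Longrightarrow> j \<ge> t + 2 \<Longrightarrow> gauss W (P ^ j) = 0"
    and gauss_prime_power_low: "P ^ j dvd W \<Longrightarrow> \<not> 3 dvd j \<Longrightarrow> gauss W (P ^ j) = 0"
proof -
  note mP = prime_polysD(1)[OF P]
  show "gauss W (P ^ j) = 0" if W: "\<not> P ^ Suc t dvd W" and j: "j \<ge> t + 2"
  proof -
    obtain i where i: "j = Suc t + Suc i" using j less_iff_Suc_add[of "Suc t" j] by auto
    have "gauss W (P ^ Suc t * P ^ Suc i) = 0"
    proof (rule gauss_eq_0)
      fix R assume R: "R \<in> prime_polys" "R dvd P ^ Suc t"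
      then have "R dvd P" using prime_elem_dvd_power prime_polysD(3) by blast
      then show "R dvd P ^ Suc i" by simp
    qed (use mP monic_power W in blast)+
    then show ?thesis unfolding i power_add .
  qed
  show "gauss W (P ^ j) = 0" if W: "P ^ j dvd W" and j: "\<not> 3 dvd j"
  proof -
    have "\<not> P dvd 1" using prime_poly_not_dvd_one[OF P] .
    then obtain u where u: "chi (P ^ j * 1) u \<noteq> 1" "coprime (P ^ j * 1) u"
      using prime_power_nonresidue[OF P monic_1 _ j] by blast
    obtain k where k: "W = P ^ j * k" using W by (elim dvdE)
    have "e_frac (W * b) (P ^ j) = 1" for b unfolding k by (simp only: mult.assoc e_frac_mult_self)
    then have "gauss W (P ^ j) = (\<Sum>b\<in>polys_below (degree (P ^ j)). chi (P ^ j) b)"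
      by (simp add: gauss_def)
    also have "\<dots> = 0"
      by (rule sum_chi_zero[OF monic_power[OF mP]]) (use u in simp_all)
    finally show ?thesis .
  qed
qed

text \<open>A second moment over all frequencies u W with u modulo c. Units u all give the same
  absolute value, and orthogonality bounds the whole moment by the number of units times |c| |g|;
  the number of units then cancels.\<close>

lemma norm_gauss_sq_le:
  assumes "monic g" "monic c1" "coprime W1 c1"
  shows "norm (gauss (g * W1) (g * c1)) ^ 2 \<le> real CARD('k) ^ degree (g * c1) * real CARD('k) ^ degree g"
proof -
  let ?c = "g * c1" and ?W = "g * W1"
  let ?N = "degree ?c" and ?q = "real CARD('k)"
  let ?B = "polys_below ?N :: 'k poly set"
  have mon: "monic ?c" using assms by (intro monic_mult)
  define U where "U = {b \<in> ?B. coprime ?c b}"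
  have finU: "finite U" by (simp add: U_def)
  have "1 mod ?c \<in> U"
  proof -
    have "chi ?c (1 mod ?c) = chi ?c 1" by (rule chi_cong[OF mon]) simp
    then have "chi ?c (1 mod ?c) \<noteq> 0" using mon by simp
    then show ?thesis
      using chi_eq_0_iff[OF mon] mod_in_polys_below[OF monic_nonzero[OF mon]] by (auto simp: U_def)
  qed
  then have Upos: "card U > 0" using finU by (auto simp: card_gt_0_iff)
  have 1: "real (card U) * norm (gauss ?W ?c) ^ 2 \<le> (\<Sum>u\<in>?B. norm (gauss (u * ?W) ?c) ^ 2)"
  proof -
    have "norm (gauss (u * ?W) ?c) = norm (gauss ?W ?c)" if "u \<in> U" for u
      using that gauss_unit_mult[OF mon, of u ?W] norm_chi[OF mon, of u]
      by (simp add: U_def norm_mult norm_power)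
    then have "real (card U) * norm (gauss ?W ?c) ^ 2 = (\<Sum>u\<in>U. norm (gauss (u * ?W) ?c) ^ 2)"
      by simp
    also have "\<dots> \<le> (\<Sum>u\<in>?B. norm (gauss (u * ?W) ?c) ^ 2)"
      by (rule sum_mono2) (auto simp: U_def)
    finally show ?thesis .
  qed
  \<comment> \<open>\<open>c1\<close> is the modulus divided by its common factor \<open>g\<close>
    with the frequency, so these are the \<open>b'\<close> for which the sum over all u survives;
    there are at most |g| of them.\<close>
  define S where "S = (\<lambda>b. {b' \<in> ?B. c1 dvd b - b'})"
  have cardS: "card (S b) \<le> CARD('k) ^ degree g" if b: "b \<in> ?B" for b
  proof -
    have "S b \<subseteq> (\<lambda>k. b - c1 * k) ` polys_below (degree g)"
    proof
      fix b' assume "b' \<in> S b"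
      then have b': "b' \<in> ?B" "c1 dvd b - b'" by (auto simp: S_def)
      then obtain k where k: "b - b' = c1 * k" by (elim dvdE)
      have "c1 * k \<in> ?B" using polys_below_diff[OF b b'(1)] k by simp
      then have "k \<in> polys_below (degree g)"
        using monic_nonzero[OF assms(2)] degree_mult_monic[OF assms(1,2)]
        by (cases "k = 0") (auto simp: polys_below_iff degree_mult_eq)
      moreover have "b' = b - c1 * k" using k by (simp add: algebra_simps)
      ultimately show "b' \<in> (\<lambda>k. b - c1 * k) ` polys_below (degree g)" by blast
    qed
    then have "card (S b) \<le> card ((\<lambda>k. b - c1 * k) ` (polys_below (degree g) :: 'k poly set))"
      by (rule card_mono[rotated]) simp
    also have "\<dots> \<le> CARD('k) ^ degree g"
      using card_image_le[OF finite_polys_below, of "\<lambda>k. b - c1 * k" "degree g"]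
      by (simp add: card_polys_below)
    finally show ?thesis .
  qed
  define h where "h b b' = chi ?c b * cnj (chi ?c b')" for b b'
  define E where "E b b' = (\<Sum>u\<in>?B. e_frac (u * (?W * (b - b'))) ?c)" for b b'
  have E: "E b b' = (if b' \<in> S b then of_nat (CARD('k) ^ ?N) else 0)" if "b' \<in> ?B" for b b'
  proof -
    define x where "x = (?W * (b - b')) mod ?c"
    have xmem: "x \<in> polys_below ?N"
      unfolding x_def by (rule mod_in_polys_below[OF monic_nonzero[OF mon]])
    have "E b b' = (\<Sum>u\<in>?B. e_frac (u * x) ?c)"
      unfolding E_def x_def by (intro sum.cong refl e_frac_cong) (rule mod_mult_right_eq[symmetric])
    also have "\<dots> = (if x = 0 then of_nat (CARD('k) ^ ?N) else 0)"
      using sum_e_frac[OF xmem order_refl] by (simp only: diff_self_eq_0 polys_below_0 singleton_iff)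
    also have "x = 0 \<longleftrightarrow> ?c dvd ?W * (b - b')" by (simp only: dvd_eq_mod_eq_0 x_def)
    also have "\<dots> \<longleftrightarrow> c1 dvd W1 * (b - b')" using monic_nonzero[OF assms(1)] by (simp add: mult.assoc)
    also have "\<dots> \<longleftrightarrow> c1 dvd b - b'"
      by (rule iffI, rule field_poly_coprime_dvd_mult[OF assms(3)[unfolded coprime_commute[of W1]]],
          assumption, rule dvd_mult)
    finally show ?thesis using that unfolding S_def by simp
  qed
  have "of_real (\<Sum>u\<in>?B. norm (gauss (u * ?W) ?c) ^ 2) =
      (\<Sum>u\<in>?B. gauss (u * ?W) ?c * cnj (gauss (u * ?W) ?c))"
    by (simp only: of_real_sum complex_norm_square)
  also have "\<dots> = (\<Sum>u\<in>?B. \<Sum>b\<in>?B. \<Sum>b'\<in>?B. h b b' * e_frac (u * (?W * (b - b'))) ?c)"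
  proof (rule sum.cong[OF refl])
    fix u
    have e: "e_frac (u * ?W * b) ?c * cnj (e_frac (u * ?W * b') ?c) = e_frac (u * (?W * (b - b'))) ?c" for b b'
    proof -
      have "u * (?W * (b - b')) = u * ?W * b + - (u * ?W * b')" by (simp add: algebra_simps)
      then show ?thesis by (simp only: e_frac_add e_frac_uminus)
    qed
    have four: "(x * y) * (z * w) = (x * z) * (y * w)" for x y z w :: complex
      by (simp add: mult_ac)
    have "gauss (u * ?W) ?c * cnj (gauss (u * ?W) ?c) = (\<Sum>b\<in>?B. \<Sum>b'\<in>?B.
        (chi ?c b * e_frac (u * ?W * b) ?c) * cnj (chi ?c b' * e_frac (u * ?W * b') ?c))"
      by (simp only: gauss_def cnj_sum sum_product)
    also have "\<dots> = (\<Sum>b\<in>?B. \<Sum>b'\<in>?B. h b b' * e_frac (u * (?W * (b - b'))) ?c)"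
      unfolding h_def complex_cnj_mult e[symmetric] by (intro sum.cong refl) (rule four)
    finally show "gauss (u * ?W) ?c * cnj (gauss (u * ?W) ?c) =
      (\<Sum>b\<in>?B. \<Sum>b'\<in>?B. h b b' * e_frac (u * (?W * (b - b'))) ?c)" .
  qed
  also have "\<dots> = (\<Sum>b\<in>?B. \<Sum>b'\<in>?B. h b b' * E b b')"
    unfolding E_def sum_distrib_left by (subst sum.swap, rule sum.cong[OF refl], rule sum.swap)
  finally have eq: "of_real (\<Sum>u\<in>?B. norm (gauss (u * ?W) ?c) ^ 2) =
      (\<Sum>b\<in>?B. \<Sum>b'\<in>?B. h b b' * E b b')" .
  have "(\<Sum>u\<in>?B. norm (gauss (u * ?W) ?c) ^ 2) = norm (\<Sum>b\<in>?B. \<Sum>b'\<in>?B. h b b' * E b b')"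
    unfolding eq[symmetric] norm_of_real by (intro abs_of_nonneg[symmetric] sum_nonneg zero_le_power2)
  also have "\<dots> \<le> (\<Sum>b\<in>?B. \<Sum>b'\<in>?B. norm (h b b' * E b b'))"
    by (intro order_trans[OF norm_sum] sum_mono order_refl)
  also have "\<dots> \<le> (\<Sum>b\<in>?B. if b \<in> U then ?q ^ degree g * ?q ^ ?N else 0)"
  proof (rule sum_mono)
    fix b assume b: "b \<in> ?B"
    show "(\<Sum>b'\<in>?B. norm (h b b' * E b b')) \<le> (if b \<in> U then ?q ^ degree g * ?q ^ ?N else 0)"
    proof (cases "b \<in> U")
      case True
      have "(\<Sum>b'\<in>?B. norm (h b b' * E b b')) \<le> (\<Sum>b'\<in>?B. if b' \<in> S b then ?q ^ ?N else 0)"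
      proof (rule sum_mono)
        fix b' assume b': "b' \<in> ?B"
        have le: "norm (h b b') \<le> 1"
          unfolding h_def norm_mult complex_mod_cnj by (intro mult_le_one norm_chi_le mon norm_ge_zero)
        have "norm (E b b') = (if b' \<in> S b then ?q ^ ?N else 0)"
          unfolding E[OF b'] by (simp add: norm_power)
        then show "norm (h b b' * E b b') \<le> (if b' \<in> S b then ?q ^ ?N else 0)"
          unfolding norm_mult using mult_right_mono[OF le, of "?q ^ ?N"] by (cases "b' \<in> S b") simp_all
      qed
      also have "\<dots> = real (card (S b)) * ?q ^ ?N"
      proof -
        have "{b' \<in> ?B. b' \<in> S b} = S b" by (auto simp: S_def)
        then show ?thesis by (simp add: sum.If_cases Int_def)
      qed
      also have "\<dots> \<le> ?q ^ degree g * ?q ^ ?N"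
      proof (rule mult_right_mono)
        have "real (card (S b)) \<le> real (CARD('k) ^ degree g)" using cardS[OF b] by (rule of_nat_mono)
        then show "real (card (S b)) \<le> ?q ^ degree g" by simp
      qed simp
      finally show ?thesis using True by simp
    next
      case False
      then have "chi ?c b = 0" using b chi_eq_0_iff[OF mon] by (auto simp: U_def)
      then show ?thesis using False by (simp add: h_def)
    qed
  qed
  also have "\<dots> = real (card U) * (?q ^ degree g * ?q ^ ?N)"
  proof -
    have "{b \<in> ?B. b \<in> U} = U" by (auto simp: U_def)
    then show ?thesis by (simp add: sum.If_cases Int_def)
  qed
  finally have "real (card U) * norm (gauss ?W ?c) ^ 2 \<le> real (card U) * (?q ^ degree g * ?q ^ ?N)"
    using 1 by linarith
  then show ?thesis using Upos by (simp add: mult.commute)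
qed

text \<open>The phase at V is the additive character of -V T^m / c. Summation over V therefore
  detects the b for which b - T^m has degree below m, that is the monic b of degree m.\<close>

lemma poisson:
  assumes "monic c" "m < degree c"
  shows "(\<Sum>V\<in>polys_below (degree c - m). \<psi> (- coeff V (degree c - 1 - m)) * gauss V c) =
    of_nat (CARD('k) ^ (degree c - m)) * (\<Sum>a\<in>monics m. chi c a)"
proof -
  let ?N = "degree c" and ?T = "monom 1 m :: 'k poly"
  have T: "?T \<in> polys_below ?N" using assms(2) by (auto simp: polys_below_def)
  have psi: "\<psi> (- coeff V (?N - 1 - m)) = e_frac (- (V * ?T)) c" if V: "V \<in> polys_below (?N - m)" for V
  proof -
    have "- (V * ?T) \<in> polys_below ?N"
      using polys_below_uminus[OF polys_below_mult_degree[OF V, of ?T]] assms(2) by (simp add: degree_monom_eq)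
    moreover have "coeff (V * ?T) (?N - 1) = coeff V (?N - 1 - m)"
    proof -
      have "coeff (?T * V) (?N - 1) = coeff V (?N - 1 - m)" using assms(2) by (simp add: coeff_monom_mult)
      then show ?thesis by (simp only: mult.commute)
    qed
    ultimately show ?thesis by (simp add: e_frac_below)
  qed
  have "(\<Sum>V\<in>polys_below (?N - m). \<psi> (- coeff V (?N - 1 - m)) * gauss V c) =
      (\<Sum>V\<in>polys_below (?N - m). \<Sum>b\<in>polys_below ?N. chi c b * e_frac (V * (b - ?T)) c)"
  proof (rule sum.cong[OF refl])
    fix V :: "'k poly" assume V: "V \<in> polys_below (?N - m)"
    have ef: "e_frac (V * (b - ?T)) c = e_frac (- (V * ?T)) c * e_frac (V * b) c" for b :: "'k poly"
    proof -
      have "V * (b - ?T) = - (V * ?T) + V * b" by (simp add: algebra_simps)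
      then show ?thesis by (simp only: e_frac_add)
    qed
    show "\<psi> (- coeff V (?N - 1 - m)) * gauss V c =
        (\<Sum>b\<in>polys_below ?N. chi c b * e_frac (V * (b - ?T)) c)"
      unfolding psi[OF V] gauss_def sum_distrib_left ef by (intro sum.cong refl) (rule mult.left_commute)
  qed
  also have "\<dots> = (\<Sum>b\<in>polys_below ?N. chi c b * (\<Sum>V\<in>polys_below (?N - m). e_frac (V * (b - ?T)) c))"
    by (subst sum.swap) (simp add: sum_distrib_left)
  also have "\<dots> = (\<Sum>b\<in>polys_below ?N. if b \<in> monics m then of_nat (CARD('k) ^ (?N - m)) * chi c b else 0)"
  proof (rule sum.cong[OF refl])
    fix b :: "'k poly" assume b: "b \<in> polys_below ?N"
    have "b - ?T \<in> polys_below m \<longleftrightarrow> b \<in> monics m"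
    proof
      assume "b - ?T \<in> polys_below m"
      then have "?T + (b - ?T) \<in> monics m"
        unfolding monics_eq_image[OF monom_in_monics] by blast
      then show "b \<in> monics m" by simp
    next
      assume "b \<in> monics m"
      then show "b - ?T \<in> polys_below m" unfolding monics_eq_image[OF monom_in_monics] by auto
    qed
    moreover have "?N - (?N - m) = m" using assms(2) by simp
    ultimately show "chi c b * (\<Sum>V\<in>polys_below (?N - m). e_frac (V * (b - ?T)) c) =
        (if b \<in> monics m then of_nat (CARD('k) ^ (?N - m)) * chi c b else 0)"
      using sum_e_frac[OF polys_below_diff[OF b T], of "?N - m"] by simp
  qed
  also have "\<dots> = of_nat (CARD('k) ^ (?N - m)) * (\<Sum>a\<in>monics m. chi c a)"
  proof -
    have "monics m \<subseteq> (polys_below ?N :: 'k poly set)"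
      using assms(2) by (auto simp: monics_def polys_below_iff)
    then have "polys_below ?N \<inter> monics m = (monics m :: 'k poly set)" by blast
    then show ?thesis by (simp add: sum.If_cases sum_distrib_left Int_def[symmetric])
  qed
  finally show ?thesis .
qed

end

subsection \<open>Farey dissection\<close>

lemma polys_below_le: "p \<in> polys_below m \<Longrightarrow> m \<le> n \<Longrightarrow> p \<in> polys_below n"
  using polys_below_mono by blast

context cubic_gauss
begin

text \<open>By reciprocity the symbol is periodic in its modulus, up to the leading coefficient of
  \<open>r\<close>, whose contribution depends only on the degree of the modulus; hence the equality
  of degrees.\<close>

lemma chi_left_cong:
  assumes "monic c" "monic t" "degree c = degree t" "r \<noteq> 0" "r dvd c - t"
  shows "chi c r = chi t r"
proof -
  obtain a r1 where r: "a \<noteq> 0" "monic r1" "r = smult a r1" using associated_monic[OF assms(4)] by blast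
  have "r1 dvd c - t" using assms(5) r(1) unfolding r(3) by (simp add: smult_dvd_iff)
  then have "chi r1 c = chi r1 t" by (intro chi_cong[OF r(2)]) (simp add: mod_eq_dvd_iff)
  then show ?thesis
    unfolding r(3) by (simp only: chi_smult_right assms(1-3) chi_swap[OF _ r(2)])
qed

text \<open>The symbol at a fraction \<open>b / c\<close> near \<open>b\<^sub>0 / c\<^sub>0\<close>: the change of variables is in
  \<open>SL\<^sub>2(\<bbbF>\<^sub>q[T])\<close>, and the degree condition makes all symbols at infinity cancel.
  The induction is the Euclidean algorithm on \<open>(b\<^sub>0, c\<^sub>0)\<close>.\<close>

lemma chi_farey:
  assumes "monic c0" "monic t" "\<beta> * c0 - b0 * \<gamma> = 1" "r \<noteq> 0"
    and "r * \<gamma> \<in> polys_below (degree t + degree c0)"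
  shows "chi (r * \<gamma> + t * c0) (r * \<beta> + t * b0) = chi c0 b0 * chi t r"
  using assms
proof (induction "degree c0" arbitrary: b0 c0 \<beta> \<gamma> r rule: less_induct)
  case less
  define c where "c = r * \<gamma> + t * c0"
  have tc0: "monic (t * c0)" "degree (t * c0) = degree t + degree c0"
    using less.prems(1,2) by (simp_all add: monic_mult degree_mult_monic)
  have c: "monic c" "degree c = degree t + degree c0"
    using monic_add_below[OF tc0(1), of "r * \<gamma>"] less.prems(5) tc0(2)
    unfolding c_def by (simp_all add: monics_def add.commute)
  show ?case
  proof (cases "degree c0 = 0")
    case True
    then have c01: "c0 = 1" using monic_degree_0 less.prems(1) by blast
    have \<beta>: "\<beta> = 1 + b0 * \<gamma>" using less.prems(3) c01 by (simp add: algebra_simps)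
    have "r * \<beta> + t * b0 - r = b0 * c" by (simp add: \<beta> c_def c01 algebra_simps)
    then have "c dvd r * \<beta> + t * b0 - r" by simp
    then have "chi c (r * \<beta> + t * b0) = chi c r" by (intro chi_cong[OF c(1)]) (simp only: mod_eq_dvd_iff)
    also have "\<dots> = chi t r"
      using less.prems c c01 by (intro chi_left_cong) (simp_all add: c_def)
    finally show ?thesis by (simp add: c_def c01)
  next
    case False
    define l b1 \<beta>1 where "l = b0 div c0" and "b1 = b0 mod c0" and "\<beta>1 = \<beta> - l * \<gamma>"
    have b0: "b0 = l * c0 + b1" by (simp add: l_def b1_def)
    have det: "\<beta>1 * c0 - b1 * \<gamma> = 1"
      using less.prems(3) unfolding b0 \<beta>1_def by (simp add: algebra_simps)
    have b1n: "b1 \<noteq> 0"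
    proof
      assume "b1 = 0"
      then have "\<beta>1 * c0 = 1" using det by simp
      then have "is_unit c0" by (metis dvd_triv_right)
      then show False using False less.prems(1) by (simp add: is_unit_iff_degree monic_nonzero)
    qed
    have \<gamma>n: "\<gamma> \<noteq> 0"
    proof
      assume "\<gamma> = 0"
      then have "\<beta>1 * c0 = 1" using det by simp
      then have "is_unit c0" by (metis dvd_triv_right)
      then show False using False less.prems(1) by (simp add: is_unit_iff_degree monic_nonzero)
    qed
    have "b1 \<in> polys_below (degree c0)"
      unfolding b1_def using mod_in_polys_below monic_nonzero[OF less.prems(1)] by blast
    then have degb1: "degree b1 < degree c0" using b1n by (simp add: polys_below_iff)
    obtain a B where B: "a \<noteq> 0" "monic B" "b1 = smult a B" using associated_monic[OF b1n] by blast
    then have degB: "degree B = degree b1" by simp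
    \<comment> \<open>The degree condition passes to the next Euclidean step, because the
      determinant forces deg \<beta>1 + deg c0 <= deg b1 + deg \<gamma>.\<close>
    have small: "r * \<beta>1 \<in> polys_below (degree t + degree B)"
    proof (cases "\<beta>1 = 0")
      case False
      have eq: "\<beta>1 * c0 = 1 + b1 * \<gamma>" using det by (simp add: algebra_simps)
      have "degree \<beta>1 + degree c0 = degree (1 + b1 * \<gamma>)"
        unfolding eq[symmetric] using False less.prems(1) by (simp add: degree_mult_eq monic_nonzero)
      also have "\<dots> \<le> degree b1 + degree \<gamma>"
        using degree_add_le[of 1 "degree b1 + degree \<gamma>" "b1 * \<gamma>"] degree_mult_le[of b1 \<gamma>] by simp
      finally have 1: "degree \<beta>1 + degree c0 \<le> degree b1 + degree \<gamma>" .
      have "degree (r * \<gamma>) < degree t + degree c0"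
        using less.prems(4,5) \<gamma>n by (simp add: polys_below_iff)
      then have "degree r + degree \<gamma> < degree t + degree c0"
        using less.prems(4) \<gamma>n by (simp add: degree_mult_eq)
      with 1 have "degree r + degree \<beta>1 < degree t + degree B" using degB by linarith
      then show ?thesis using False less.prems(4) by (simp add: polys_below_iff degree_mult_eq)
    qed simp
    \<comment> \<open>Reciprocity exchanges numerator and denominator, so \<open>B\<close> becomes
      the new denominator and \<open>c0\<close> the new numerator. The scalar and the signs keep
      \<open>B\<close> monic and the determinant equal to 1.\<close>
    define r' \<beta>' \<gamma>' where "r' = smult (- inverse a) r" and "\<beta>' = smult (- a) \<gamma>" and "\<gamma>' = - \<beta>1"
    have det': "\<beta>' * B - c0 * \<gamma>' = 1"
      using det unfolding \<beta>'_def \<gamma>'_def B(3) by (simp add: algebra_simps)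
    have r'n: "r' \<noteq> 0" using less.prems(4) B(1) by (simp add: r'_def)
    have r'\<gamma>': "r' * \<gamma>' = smult (inverse a) (r * \<beta>1)" by (simp add: r'_def \<gamma>'_def)
    have "r' * \<gamma>' \<in> polys_below (degree t + degree B)"
      unfolding r'\<gamma>' using small by (rule polys_below_smult)
    moreover have "degree B < degree c0" using degB degb1 by simp
    ultimately have IH: "chi (r' * \<gamma>' + t * B) (r' * \<beta>' + t * c0) = chi B c0 * chi t r'"
      using less.hyps[of B \<beta>' c0 \<gamma>' r'] B(2) less.prems(2) det' r'n by blast
    define b'' where "b'' = r' * \<gamma>' + t * B"
    have tB: "monic (t * B)" "degree (t * B) = degree t + degree B"
      using B(2) less.prems(2) by (simp_all add: monic_mult degree_mult_monic)
    have mb'': "monic b''"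
      using monic_add_below[OF tB(1), of "r' * \<gamma>'"] \<open>r' * \<gamma>' \<in> polys_below (degree t + degree B)\<close> tB(2)
      unfolding b''_def by (simp add: monics_def add.commute)
    have c': "r' * \<beta>' + t * c0 = c" using B(1) by (simp add: r'_def \<beta>'_def c_def)
    have ab'': "smult a b'' = r * \<beta>1 + t * b1"
      unfolding b''_def r'\<gamma>' B(3) using B(1) by (simp add: smult_add_right)
    have "r * \<beta> + t * b0 - smult a b'' = l * c"
      unfolding ab'' c_def b0 \<beta>1_def by (simp add: algebra_simps)
    then have "c dvd r * \<beta> + t * b0 - smult a b''" by simp
    then have "chi c (r * \<beta> + t * b0) = chi c (smult a b'')"
      by (intro chi_cong[OF c(1)]) (simp only: mod_eq_dvd_iff)
    also have "\<dots> = omega a ^ degree c * chi b'' c"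
      by (simp only: chi_smult_right[OF c(1)] chi_swap[OF c(1) mb''])
    also have "chi b'' c = chi B c0 * chi t r'" using IH unfolding b''_def c' .
    also have "chi B c0 = chi c0 B" by (rule chi_swap[OF B(2) less.prems(1)])
    also have "chi t r' = omega (inverse a) ^ degree t * chi t r"
      unfolding r'_def by (simp only: chi_smult_right[OF less.prems(2)] omega_minus)
    also have "omega a ^ degree c * (chi c0 B * (omega (inverse a) ^ degree t * chi t r)) =
        (omega a * omega (inverse a)) ^ degree t * (omega a ^ degree c0 * chi c0 B) * chi t r"
      by (simp add: c(2) power_add power_mult_distrib mult_ac)
    also have "omega a * omega (inverse a) = 1"
      using omega_mult[of a "inverse a"] B(1) by simp
    also have "omega a ^ degree c0 * chi c0 B = chi c0 b1"
      by (simp only: B(3) chi_smult_right[OF less.prems(1)])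
    also have "chi c0 b1 = chi c0 b0"
      by (rule chi_cong[OF less.prems(1)]) (simp add: b1_def)
    finally show ?thesis by (simp add: c_def)
  qed
qed

section \<open>The arcs around reduced fractions of small denominator\<close>

definition reduced_fractions :: "nat \<Rightarrow> ('k poly \<times> 'k poly) set" where
  "reduced_fractions n = {(b, c). c \<in> monics n \<and> b \<in> polys_below n \<and> coprime c b}"

lemma reduced_fractionsD:
  assumes "(b, c) \<in> reduced_fractions n"
  shows "monic c" "degree c = n" "b \<in> polys_below n" "coprime c b" "c \<noteq> 0"
  using assms by (auto simp: reduced_fractions_def monics_def monic_nonzero)

lemma finite_reduced_fractions [simp]: "finite (reduced_fractions n)"
  by (rule finite_subset[of _ "polys_below n \<times> monics n"]) (auto simp: reduced_fractions_def)

lemma exists_cofactors: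
  assumes "(b0, c0) \<in> reduced_fractions j"
  shows "\<exists>\<beta> \<gamma>. \<beta> * c0 - b0 * \<gamma> = 1 \<and> \<gamma> \<in> polys_below j"
proof -
  note c0 = reduced_fractionsD[OF assms]
  obtain u v where uv: "u * c0 + v * b0 = 1" using field_poly_coprime_bezout[OF c0(4)] by blast
  define \<gamma> where "\<gamma> = (- v) mod c0"
  have "c0 dvd \<gamma> + v" unfolding \<gamma>_def using mod_eq_dvd_iff[of "(- v) mod c0" c0 "- v"] by simp
  then obtain k where k: "\<gamma> + v = c0 * k" by (elim dvdE)
  have "(u + b0 * k) * c0 - b0 * \<gamma> = u * c0 + b0 * (c0 * k) - b0 * \<gamma>" by (simp add: algebra_simps)
  also have "\<dots> = u * c0 + v * b0" unfolding k[symmetric] by (simp add: algebra_simps)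
  finally have "(u + b0 * k) * c0 - b0 * \<gamma> = 1" using uv by simp
  moreover have "\<gamma> \<in> polys_below j" unfolding \<gamma>_def using mod_in_polys_below[OF c0(5)] c0(2) by blast
  ultimately show ?thesis by blast
qed

definition cofactors :: "'k poly \<times> 'k poly \<Rightarrow> 'k poly \<times> 'k poly" where
  "cofactors x = (SOME y. fst y * snd x - fst x * snd y = 1 \<and> snd y \<in> polys_below (degree (snd x)))"

lemma cofactors:
  assumes "(b0, c0) \<in> reduced_fractions j"
  shows "fst (cofactors (b0, c0)) * c0 - b0 * snd (cofactors (b0, c0)) = 1"
    and "snd (cofactors (b0, c0)) \<in> polys_below j"
proof -
  note c0 = reduced_fractionsD[OF assms]
  obtain \<beta> \<gamma> where "\<beta> * c0 - b0 * \<gamma> = 1 \<and> \<gamma> \<in> polys_below j" using exists_cofactors[OF assms] by blast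
  then have "\<exists>y. fst y * snd (b0, c0) - fst (b0, c0) * snd y = 1 \<and> snd y \<in> polys_below (degree (snd (b0, c0)))"
    using c0(2) by (intro exI[of _ "(\<beta>, \<gamma>)"]) simp
  from someI_ex[OF this, folded cofactors_def]
  show "fst (cofactors (b0, c0)) * c0 - b0 * snd (cofactors (b0, c0)) = 1"
    and "snd (cofactors (b0, c0)) \<in> polys_below j" using c0(2) by simp_all
qed

text \<open>The fraction 0/1 is included: it is the only reduced fraction with j = 0.\<close>

definition farey_fractions :: "nat \<Rightarrow> ('k poly \<times> 'k poly) set" where
  "farey_fractions Q = (\<Union>j\<le>Q. reduced_fractions j)"

text \<open>In the coordinates of \<open>farey_map\<close>, r = c0 b - b0 c. The bound on r
  therefore says that b/c is closer to b0/c0 than 1/(|c0| q^Q), the quality of Dirichlet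
  approximation, and r is nonzero since the denominator degree of b/c is n > Q.\<close>

definition farey_arc :: "nat \<Rightarrow> nat \<Rightarrow> 'k poly \<times> 'k poly \<Rightarrow> ('k poly \<times> 'k poly) set" where
  "farey_arc n Q x = {(r, t). r \<noteq> 0 \<and> r \<in> polys_below (n - Q) \<and> t \<in> monics (n - degree (snd x)) \<and> coprime t r}"

definition farey_map :: "('k poly \<times> 'k poly) \<times> ('k poly \<times> 'k poly) \<Rightarrow> 'k poly \<times> 'k poly" where
  "farey_map = (\<lambda>((b0, c0), (r, t)).
     (r * fst (cofactors (b0, c0)) + t * b0, r * snd (cofactors (b0, c0)) + t * c0))"

text \<open>Since the substitution has determinant 1, r and t are recovered by the inverse matrix,
  and a Bezout identity for t and r becomes one for c and b.\<close>

lemma farey_map_props: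
  assumes x: "(b0, c0) \<in> reduced_fractions j" and j: "j \<le> Q" "Q < n"
    and rt: "(r, t) \<in> farey_arc n Q (b0, c0)"
  defines "\<beta> \<equiv> fst (cofactors (b0, c0))" and "\<gamma> \<equiv> snd (cofactors (b0, c0))"
  defines "b \<equiv> r * \<beta> + t * b0" and "c \<equiv> r * \<gamma> + t * c0"
  shows "(b, c) \<in> reduced_fractions n" "r = c0 * b - b0 * c" "t = \<beta> * c - \<gamma> * b"
    "r * \<gamma> \<in> polys_below n"
proof -
  note c0 = reduced_fractionsD[OF x]
  have det: "\<beta> * c0 - b0 * \<gamma> = 1" and \<gamma>: "\<gamma> \<in> polys_below j"
    using cofactors[OF x] by (simp_all add: \<beta>_def \<gamma>_def)
  have r: "r \<noteq> 0" "r \<in> polys_below (n - Q)" and t: "t \<in> monics (n - j)" "coprime t r"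
    using rt c0(2) by (auto simp: farey_arc_def)
  show "r = c0 * b - b0 * c"
  proof -
    have "c0 * b - b0 * c = r * (\<beta> * c0 - b0 * \<gamma>)" by (simp add: b_def c_def algebra_simps)
    then show ?thesis by (simp add: det)
  qed
  note r_eq = this
  show "t = \<beta> * c - \<gamma> * b"
  proof -
    have "\<beta> * c - \<gamma> * b = t * (\<beta> * c0 - b0 * \<gamma>)" by (simp add: b_def c_def algebra_simps)
    then show ?thesis by (simp add: det)
  qed
  note t_eq = this
  show r\<gamma>: "r * \<gamma> \<in> polys_below n"
    by (rule polys_below_le[OF polys_below_mult[OF r(2) \<gamma>]]) (use j in linarith)
  have "t * c0 \<in> monics n" using monics_mult[OF t(1), of c0 j] c0(1,2) j by (simp add: monics_def)
  from monics_eq_image[OF this] r\<gamma> have c: "c \<in> monics n" by (auto simp: c_def add.commute)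
  have r\<beta>: "r * \<beta> \<in> polys_below n"
  proof (cases "\<beta> = 0 \<or> j = 0")
    case True
    show ?thesis
    proof (cases "\<beta> = 0")
      case False
      with True have "j = 0" by simp
      then have "c0 = 1" "b0 = 0" using c0(1,2,3) monic_degree_0 by auto
      then have "\<beta> = 1" using det by simp
      then show ?thesis using r(2) polys_below_mono[of "n - Q" n] by auto
    qed simp
  next
    case False
    \<comment> \<open>The bound on \<gamma> is built into \<open>cofactors\<close>; the determinant
      equation yields the same bound for \<beta> once j > 0.\<close>
    have eq: "\<beta> * c0 = 1 + b0 * \<gamma>" using det by (simp add: algebra_simps)
    have "1 + b0 * \<gamma> \<in> polys_below (j + j)"
    proof (rule polys_below_add)
      show "1 \<in> polys_below (j + j)" using False by (simp add: polys_below_iff)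
      show "b0 * \<gamma> \<in> polys_below (j + j)"
        using polys_below_mult[OF c0(3) \<gamma>] polys_below_mono[of "j + j - 1" "j + j"] by auto
    qed
    then have "\<beta> * c0 \<in> polys_below (j + j)" unfolding eq .
    then have "\<beta> \<in> polys_below j" using False c0 by (auto simp: polys_below_iff degree_mult_eq)
    from polys_below_mult[OF r(2) this] show ?thesis
      by (rule polys_below_le) (use j in linarith)
  qed
  have "b0 * t \<in> polys_below n" using polys_below_mult_degree[OF c0(3), of t] t(1) j by (simp add: monics_def)
  then have b: "b \<in> polys_below n" unfolding b_def using r\<beta> by (simp add: polys_below_add mult.commute)
  obtain u v where uv: "u * t + v * r = 1" using field_poly_coprime_bezout[OF t(2)] by blast
  have "(u * \<beta> - v * b0) * c + (v * c0 - u * \<gamma>) * b = u * (\<beta> * c - \<gamma> * b) + v * (c0 * b - b0 * c)"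
    by (simp add: algebra_simps)
  then have "(u * \<beta> - v * b0) * c + (v * c0 - u * \<gamma>) * b = 1" using uv r_eq t_eq by simp
  then have "coprime c b" by (rule bezout_imp_coprime)
  with b c show "(b, c) \<in> reduced_fractions n" by (simp add: reduced_fractions_def)
qed

text \<open>The ultrametric inequality makes the arcs disjoint: two approximations produce a
  multiple of \<open>c\<close> of degree below n, which must be 0, and then the two reduced
  fractions coincide.\<close>

lemma farey_unique:
  assumes x: "(b0, c0) \<in> reduced_fractions j" "j \<le> Q" and y: "(b1, c1) \<in> reduced_fractions i" "i \<le> Q"
    and Q: "Q < n" and c: "c \<in> monics n"
    and r: "c0 * b - b0 * c \<in> polys_below (n - Q)" "c1 * b - b1 * c \<in> polys_below (n - Q)"
  shows "b0 = b1 \<and> c0 = c1"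
proof -
  note c0 = reduced_fractionsD[OF x(1)] and c1 = reduced_fractionsD[OF y(1)]
  define z where "z = (c0 * b - b0 * c) * c1 - (c1 * b - b1 * c) * c0"
  have "z \<in> polys_below n" unfolding z_def
  proof (rule polys_below_diff)
    show "(c0 * b - b0 * c) * c1 \<in> polys_below n"
      by (rule polys_below_le[OF polys_below_mult_degree[OF r(1)]]) (use c1(2) y(2) Q in linarith)
    show "(c1 * b - b1 * c) * c0 \<in> polys_below n"
      by (rule polys_below_le[OF polys_below_mult_degree[OF r(2)]]) (use c0(2) x(2) Q in linarith)
  qed
  moreover have z: "z = c * (b1 * c0 - b0 * c1)" unfolding z_def by (simp add: algebra_simps)
  ultimately have "z = 0" using polys_below_dvd_eq_0[of z c] c by (simp add: monics_def)
  then have eq: "b1 * c0 = b0 * c1" using z c by (auto simp: monics_def monic_nonzero)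
  have "c0 dvd b0 * c1" unfolding eq[symmetric] by simp
  then have "c0 dvd c1" using c0(4) field_poly_coprime_dvd_mult by blast
  moreover have "c1 dvd b1 * c0" unfolding eq by simp
  then have "c1 dvd c0" using c1(4) field_poly_coprime_dvd_mult by blast
  ultimately have "c0 = c1" using monic_dvd_antisym c0(1) c1(1) by blast
  with eq c0(5) show ?thesis by simp
qed

text \<open>The pigeonhole principle for q^(Q+1) multipliers and q^Q values, followed by cancelling
  the common factor. The remainder r stays nonzero because \<open>c\<close> has degree n > Q and is
  prime to \<open>b\<close>.\<close>

lemma dirichlet_approximation:
  assumes bc: "(b, c) \<in> reduced_fractions n" and Q: "Q < n"
  obtains b0 c0 j where "(b0, c0) \<in> reduced_fractions j" "j \<le> Q"
    "c0 * b - b0 * c \<noteq> 0" "c0 * b - b0 * c \<in> polys_below (n - Q)"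
proof -
  note c = reduced_fractionsD[OF bc]
  define M :: "'k poly" where "M = monom 1 (n - Q)"
  have degM: "degree M = n - Q" by (simp add: M_def degree_monom_eq)
  have Mn: "M \<noteq> 0" by (simp add: M_def)
  \<comment> \<open>\<open>f\<close> keeps the top Q of the n coefficients of b x modulo c; equal
    values leave a difference of degree below n - Q.\<close>
  define f where "f x = ((b * x) mod c) div M" for x
  have "f ` polys_below (Suc Q) \<subseteq> polys_below Q"
  proof
    fix y assume "y \<in> f ` polys_below (Suc Q)"
    then obtain x where y: "y = f x" by blast
    have 1: "(b * x) mod c \<in> polys_below n" using mod_in_polys_below[OF c(5)] c(2) by blast
    define p where "p = (b * x) mod c"
    have "y * M = p - p mod M" unfolding y f_def p_def by (simp add: minus_mod_eq_div_mult)
    moreover have "p - p mod M \<in> polys_below n"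
      using polys_below_diff[OF 1[folded p_def] polys_below_le[OF mod_in_polys_below[OF Mn]]] degM by simp
    ultimately have "y * M \<in> polys_below n" by simp
    then show "y \<in> polys_below Q"
      using Mn degM Q by (cases "y = 0") (auto simp: polys_below_iff degree_mult_eq)
  qed
  then have "card (f ` polys_below (Suc Q)) \<le> card (polys_below Q :: 'k poly set)"
    by (rule card_mono[OF finite_polys_below])
  also have "\<dots> < card (polys_below (Suc Q) :: 'k poly set)"
    using card_minus_one(2) by (simp add: card_polys_below)
  finally have "\<not> inj_on f (polys_below (Suc Q))" using card_image by force
  then obtain x y where xy: "x \<in> polys_below (Suc Q)" "y \<in> polys_below (Suc Q)" "x \<noteq> y" "f x = f y"
    by (auto simp: inj_on_def)
  define z where "z = x - y"
  have z: "z \<noteq> 0" "z \<in> polys_below (Suc Q)" using xy by (auto simp: z_def intro: polys_below_diff)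
  define s where "s = (b * z) mod c"
  have "s = (b * x) mod c - (b * y) mod c" by (simp add: s_def z_def algebra_simps poly_mod_diff_left)
  also have "\<dots> = ((b * x) mod c) mod M - ((b * y) mod c) mod M"
    using xy(4) unfolding f_def by (metis add_diff_cancel_left div_mult_mod_eq)
  finally have s: "s \<in> polys_below (n - Q)"
    using mod_in_polys_below[OF Mn] degM by (simp add: polys_below_diff)
  obtain a z1 where z1: "a \<noteq> 0" "monic z1" "z = smult a z1" using associated_monic[OF z(1)] by blast
  define y1 where "y1 = smult (inverse a) ((b * z) div c)"
  obtain g b0 c0 where g: "monic g" "monic c0" "y1 = g * b0" "z1 = g * c0" "coprime b0 c0"
    using exists_gcd_cofactors[OF z1(2)] by blast
  define r where "r = c0 * b - b0 * c"
  have "g * r = b * z1 - y1 * c" unfolding r_def g(3,4) by (simp add: algebra_simps)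
  also have "\<dots> = smult (inverse a) (b * z - (b * z) div c * c)"
    unfolding y1_def z1(3) using z1(1) by (simp add: smult_diff_right)
  also have "\<dots> = smult (inverse a) s" by (simp add: s_def minus_div_mult_eq_mod)
  finally have gr: "g * r = smult (inverse a) s" .
  have deg_c0: "degree c0 \<le> Q"
  proof -
    have "degree c0 \<le> degree z1" unfolding g(4) using degree_mult_monic[OF g(1,2)] by simp
    also have "\<dots> = degree z" using z1 by simp
    finally show ?thesis using z by (simp add: polys_below_iff)
  qed
  have rn: "r \<noteq> 0"
  proof
    assume "r = 0"
    then have "c dvd b * c0" by (simp add: r_def mult.commute)
    then have "c dvd c0" using c(4) field_poly_coprime_dvd_mult by blast
    then have "degree c \<le> degree c0" using monic_nonzero[OF g(2)] by (rule dvd_imp_degree_le)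
    then show False using deg_c0 Q c(2) by simp
  qed
  have rb: "r \<in> polys_below (n - Q)"
  proof -
    have "g * r \<in> polys_below (n - Q)" unfolding gr using s by (rule polys_below_smult)
    then have "degree (g * r) < n - Q" using rn monic_nonzero[OF g(1)] by (simp add: polys_below_iff)
    then show ?thesis using rn monic_nonzero[OF g(1)] by (simp add: polys_below_iff degree_mult_eq)
  qed
  have "b0 \<in> polys_below (degree c0)"
  proof (cases "b0 = 0")
    case False
    have "b0 * c = b * c0 - r" by (simp add: r_def algebra_simps)
    moreover have "b * c0 - r \<in> polys_below (n + degree c0)"
      by (rule polys_below_diff[OF polys_below_mult_degree[OF c(3)] polys_below_le[OF rb]]) simp
    ultimately have "b0 * c \<in> polys_below (n + degree c0)" by (simp only:)
    then have "degree (b0 * c) < n + degree c0" using False c(5) by (auto simp: polys_below_iff)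
    then show ?thesis using False c(5,2) by (simp add: degree_mult_eq polys_below_iff)
  qed simp
  then have "(b0, c0) \<in> reduced_fractions (degree c0)"
    using g(2,5) by (simp add: reduced_fractions_def monics_def coprime_commute)
  then show thesis using that deg_c0 rn rb unfolding r_def by blast
qed

text \<open>Dirichlet approximation gives surjectivity and disjointness of the arcs gives
  injectivity, so the dissection is exact and has no minor arcs.\<close>

lemma bij_betw_farey_map:
  assumes Q: "Q < n"
  shows "bij_betw farey_map (Sigma (farey_fractions Q) (farey_arc n Q)) (reduced_fractions n)"
  unfolding bij_betw_def
proof (intro conjI equalityI subsetI)
  show "inj_on farey_map (Sigma (farey_fractions Q) (farey_arc n Q))"
  proof (rule inj_onI)
    fix v w assume v: "v \<in> Sigma (farey_fractions Q) (farey_arc n Q)"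
      and w: "w \<in> Sigma (farey_fractions Q) (farey_arc n Q)" and eq': "farey_map v = farey_map w"
    obtain b0 c0 r t where v': "v = ((b0, c0), (r, t))" by (metis surj_pair)
    obtain b1 c1 r' t' where w': "w = ((b1, c1), (r', t'))" by (metis surj_pair)
    have x: "(b0, c0) \<in> farey_fractions Q" "(b1, c1) \<in> farey_fractions Q"
      and a: "(r, t) \<in> farey_arc n Q (b0, c0)" "(r', t') \<in> farey_arc n Q (b1, c1)"
      and eq: "farey_map ((b0, c0), r, t) = farey_map ((b1, c1), r', t')"
      using v w eq' unfolding v' w' by simp_all
    obtain j i where j: "(b0, c0) \<in> reduced_fractions j" "j \<le> Q" and i: "(b1, c1) \<in> reduced_fractions i" "i \<le> Q"
      using x by (auto simp: farey_fractions_def)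
    obtain b c where bc: "farey_map ((b0, c0), r, t) = (b, c)" by (cases "farey_map ((b0, c0), r, t)")
    note p0 = farey_map_props[OF j Q a(1)] and p1 = farey_map_props[OF i Q a(2)]
    have bc0: "r * fst (cofactors (b0, c0)) + t * b0 = b" "r * snd (cofactors (b0, c0)) + t * c0 = c"
      using bc by (simp_all add: farey_map_def)
    have bc1: "r' * fst (cofactors (b1, c1)) + t' * b1 = b" "r' * snd (cofactors (b1, c1)) + t' * c1 = c"
      using bc eq by (simp_all add: farey_map_def)
    note p0 = p0[unfolded bc0] and p1 = p1[unfolded bc1]
    have "c0 * b - b0 * c \<in> polys_below (n - Q)" "c1 * b - b1 * c \<in> polys_below (n - Q)"
      using a p0(2) p1(2) by (simp_all add: farey_arc_def)
    moreover have "c \<in> monics n" using p0(1) by (simp add: reduced_fractions_def)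
    ultimately have same: "b0 = b1 \<and> c0 = c1" using farey_unique[OF j i Q] by blast
    moreover have "r = r'" using same p0(2) p1(2) by metis
    moreover have "t = t'" using same p0(3) p1(3) by metis
    ultimately show "v = w" unfolding v' w' by simp
  qed
next
  fix y assume "y \<in> farey_map ` Sigma (farey_fractions Q) (farey_arc n Q)"
  then obtain b0 c0 r t where x: "(b0, c0) \<in> farey_fractions Q" "(r, t) \<in> farey_arc n Q (b0, c0)"
    and y: "y = farey_map ((b0, c0), (r, t))" by auto
  obtain j where "(b0, c0) \<in> reduced_fractions j" "j \<le> Q" using x(1) by (auto simp: farey_fractions_def)
  from farey_map_props(1)[OF this Q x(2)] show "y \<in> reduced_fractions n" by (simp add: y farey_map_def)
next
  fix y assume y: "y \<in> reduced_fractions n"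
  obtain b c where bc: "y = (b, c)" by (cases y)
  note yc = reduced_fractionsD[OF y[unfolded bc]]
  obtain b0 c0 j where x: "(b0, c0) \<in> reduced_fractions j" "j \<le> Q"
    "c0 * b - b0 * c \<noteq> 0" "c0 * b - b0 * c \<in> polys_below (n - Q)"
    using dirichlet_approximation[OF y[unfolded bc] Q] by blast
  note c0 = reduced_fractionsD[OF x(1)]
  define \<beta> \<gamma> where "\<beta> = fst (cofactors (b0, c0))" and "\<gamma> = snd (cofactors (b0, c0))"
  have det: "\<beta> * c0 - b0 * \<gamma> = 1" and \<gamma>: "\<gamma> \<in> polys_below j"
    using cofactors[OF x(1)] by (simp_all add: \<beta>_def \<gamma>_def)
  define r t where "r = c0 * b - b0 * c" and "t = \<beta> * c - \<gamma> * b"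
  have c_eq: "r * \<gamma> + t * c0 = c"
  proof -
    have "r * \<gamma> + t * c0 = c * (\<beta> * c0 - b0 * \<gamma>)" by (simp add: r_def t_def algebra_simps)
    then show ?thesis by (simp add: det)
  qed
  have b_eq: "r * \<beta> + t * b0 = b"
  proof -
    have "r * \<beta> + t * b0 = b * (\<beta> * c0 - b0 * \<gamma>)" by (simp add: r_def t_def algebra_simps)
    then show ?thesis by (simp add: det)
  qed
  have r\<gamma>: "- (r * \<gamma>) \<in> polys_below n"
    by (rule polys_below_uminus, rule polys_below_le[OF polys_below_mult[OF x(4) \<gamma>, folded r_def]])
      (use x(2) Q in linarith)
  have "c \<in> monics n" using yc by (simp add: monics_def)
  from monics_eq_image[OF this] r\<gamma> have "c + - (r * \<gamma>) \<in> monics n" by blast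
  moreover have "c + - (r * \<gamma>) = c0 * t" using c_eq by (simp add: algebra_simps)
  ultimately have "c0 * t \<in> monics n" by simp
  then have "monic t" "degree c0 + degree t = n"
    using monic_mult_cancel[OF c0(1), of t] degree_mult_monic[OF c0(1), of t] by (auto simp: monics_def)
  then have t: "t \<in> monics (n - degree c0)" by (simp add: monics_def)
  obtain u v where uv: "u * c + v * b = 1" using field_poly_coprime_bezout[OF yc(4)] by blast
  have "(u * c0 + v * b0) * t + (u * \<gamma> + v * \<beta>) * r = u * (r * \<gamma> + t * c0) + v * (r * \<beta> + t * b0)"
    by (simp add: algebra_simps)
  then have "(u * c0 + v * b0) * t + (u * \<gamma> + v * \<beta>) * r = 1" using uv c_eq b_eq by simp
  then have "coprime t r" by (rule bezout_imp_coprime)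
  then have "(r, t) \<in> farey_arc n Q (b0, c0)" using x(3,4) t by (simp add: farey_arc_def r_def)
  moreover have "(b0, c0) \<in> farey_fractions Q" using x(1,2) by (auto simp: farey_fractions_def)
  moreover have "farey_map ((b0, c0), (r, t)) = y"
    using b_eq c_eq by (simp add: farey_map_def bc \<beta>_def \<gamma>_def)
  ultimately show "y \<in> farey_map ` Sigma (farey_fractions Q) (farey_arc n Q)" by (metis SigmaI image_eqI)
qed

definition gauss_avg :: "'k poly \<Rightarrow> nat \<Rightarrow> complex" where
  "gauss_avg W n = (\<Sum>c\<in>monics n. gauss W c)"

definition symbol_sum :: "nat \<Rightarrow> nat \<Rightarrow> complex" where
  "symbol_sum m R = (\<Sum>r\<in>polys_below R - {0}. \<Sum>t\<in>monics m. chi t r)"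

lemma gauss_avg_reduced_fractions:
  "gauss_avg W n = (\<Sum>(b, c)\<in>reduced_fractions n. chi c b * e_frac (W * b) c)"
proof -
  have "gauss_avg W n = (\<Sum>c\<in>monics n. \<Sum>b\<in>polys_below n. chi c b * e_frac (W * b) c)"
    unfolding gauss_avg_def gauss_def by (intro sum.cong refl) (simp add: monics_def)
  also have "\<dots> = (\<Sum>(c, b)\<in>monics n \<times> polys_below n. chi c b * e_frac (W * b) c)"
    by (rule sum.cartesian_product)
  also have "\<dots> = (\<Sum>(c, b)\<in>(\<lambda>(b, c). (c, b)) ` reduced_fractions n. chi c b * e_frac (W * b) c)"
  proof (rule sum.mono_neutral_right)
    show "(\<lambda>(b, c). (c, b)) ` reduced_fractions n \<subseteq> monics n \<times> polys_below n"
      by (auto simp: reduced_fractions_def)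
    show "\<forall>i\<in>monics n \<times> polys_below n - (\<lambda>(b, c). (c, b)) ` reduced_fractions n.
        (case i of (c, b) \<Rightarrow> chi c b * e_frac (W * b) c) = 0"
    proof (clarify)
      fix c b :: "'k poly"
      assume c: "c \<in> monics n" "b \<in> polys_below n" "(c, b) \<notin> (\<lambda>(b, c). (c, b)) ` reduced_fractions n"
      have "\<not> coprime c b"
      proof
        assume "coprime c b"
        then have "(b, c) \<in> reduced_fractions n" using c(1,2) by (simp add: reduced_fractions_def)
        then have "(c, b) \<in> (\<lambda>(b, c). (c, b)) ` reduced_fractions n" by (intro image_eqI[of _ _ "(b, c)"]) auto
        with c(3) show False by blast
      qed
      then show "chi c b * e_frac (W * b) c = 0" using chi_eq_0_iff[of c b] c(1) by (simp add: monics_def)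
    qed
  qed simp
  also have "\<dots> = (\<Sum>(b, c)\<in>reduced_fractions n. chi c b * e_frac (W * b) c)"
    by (subst sum.reindex) (auto simp: inj_on_def case_prod_unfold o_def)
  finally show ?thesis .
qed

lemma farey_terms:
  assumes x: "(b0, c0) \<in> reduced_fractions j" "j \<le> Q" "Q < n"
    and a: "(r, t) \<in> farey_arc n Q (b0, c0)"
    and W: "W \<in> polys_below Q"
    and bc: "farey_map ((b0, c0), (r, t)) = (b, c)"
  shows "chi c b * e_frac (W * b) c = (chi c0 b0 * e_frac (W * b0) c0) * chi t r"
proof -
  define \<beta> \<gamma> where "\<beta> = fst (cofactors (b0, c0))" and "\<gamma> = snd (cofactors (b0, c0))"
  have b: "b = r * \<beta> + t * b0" and c: "c = r * \<gamma> + t * c0"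
    using bc by (simp_all add: farey_map_def \<beta>_def \<gamma>_def)
  note p = farey_map_props[OF x a, folded \<beta>_def \<gamma>_def, folded b c]
  note c0 = reduced_fractionsD[OF x(1)] and cc = reduced_fractionsD[OF p(1)]
  have t: "monic t" "degree t = n - j" and r: "r \<noteq> 0" "r \<in> polys_below (n - Q)"
    using a c0(2) by (auto simp: farey_arc_def monics_def)
  have "r * \<gamma> \<in> polys_below (degree t + degree c0)" using p(4) t(2) c0(2) x(2,3) by simp
  then have chi: "chi c b = chi c0 b0 * chi t r"
    unfolding b c using cofactors(1)[OF x(1)]
    by (intro chi_farey c0(1) t(1) r(1)) (simp_all add: \<beta>_def \<gamma>_def)
  have "e_frac (W * b) c = e_frac ((W * b) * c0) (c * c0)"
    by (rule e_frac_cancel[OF cc(1) c0(1), symmetric])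
  also have "(W * b) * c0 = (W * b0) * c + W * r"
  proof -
    have "b * c0 = b0 * c + r" using p(2) by (simp add: algebra_simps)
    then show ?thesis by (simp only: mult.assoc distrib_left)
  qed
  also have "e_frac ((W * b0) * c + W * r) (c * c0) = e_frac ((W * b0) * c) (c * c0) * e_frac (W * r) (c * c0)"
    by (rule e_frac_add)
  \<comment> \<open>From deg W < Q and deg r < n - Q it follows that deg (W r) <= n - 2, below the
    critical coefficient n + j - 1 even for j = 0.\<close>
  also have "e_frac (W * r) (c * c0) = 1"
  proof (rule e_frac_small)
    show "W * r \<in> polys_below (degree (c * c0) - 1)"
      by (rule polys_below_le[OF polys_below_mult[OF W r(2)]])
        (use cc(2) c0(2) x(2,3) degree_mult_monic[OF cc(1) c0(1)] in linarith)
  qed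
  also have "e_frac ((W * b0) * c) (c * c0) = e_frac (W * b0) c0"
    using e_frac_cancel[OF c0(1) cc(1), of "W * b0"] by (simp only: mult.commute[of c c0])
  finally show ?thesis by (simp add: chi mult_ac)
qed

lemma symbol_sum_arc:
  assumes "degree (snd x) = j"
  shows "(\<Sum>(r, t)\<in>farey_arc n Q x. chi t r) = symbol_sum (n - j) (n - Q)"
proof -
  have "symbol_sum (n - j) (n - Q) =
      (\<Sum>(r, t)\<in>(polys_below (n - Q) - {0}) \<times> monics (n - j). chi t r)"
    unfolding symbol_sum_def by (rule sum.cartesian_product)
  also have "\<dots> = (\<Sum>(r, t)\<in>farey_arc n Q x. chi t r)"
  proof (rule sum.mono_neutral_right)
    show "\<forall>i\<in>(polys_below (n - Q) - {0}) \<times> monics (n - j) - farey_arc n Q x. (case i of (r, t) \<Rightarrow> chi t r) = 0"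
    proof
      fix i assume i: "i \<in> (polys_below (n - Q) - {0}) \<times> monics (n - j) - farey_arc n Q x"
      obtain r t where rt: "i = (r, t)" by (cases i)
      have "r \<in> polys_below (n - Q)" "r \<noteq> 0" "t \<in> monics (n - j)" "(r, t) \<notin> farey_arc n Q x"
        using i rt by auto
      then have "\<not> coprime t r" "monic t" using assms by (auto simp: farey_arc_def monics_def)
      then show "(case i of (r, t) \<Rightarrow> chi t r) = 0" using chi_eq_0_iff unfolding rt by simp
    qed
  qed (use assms in \<open>auto simp: farey_arc_def\<close>)
  finally show ?thesis by simp
qed

text \<open>On the Farey arc around \<open>b\<^sub>0 / c\<^sub>0\<close> the additive character is constant because \<open>deg W < Q\<close>,
  and the cubic symbol factors by \<open>chi_farey\<close>.\<close>

lemma gauss_avg_farey: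
  assumes "Q < n" "W \<in> polys_below Q"
  shows "gauss_avg W n = (\<Sum>j\<le>Q. gauss_avg W j * symbol_sum (n - j) (n - Q))"
proof -
  let ?g = "\<lambda>(b, c). chi c b * e_frac (W * b) c"
  have fin: "finite (farey_arc n Q x)" for x
    by (rule finite_subset[of _ "polys_below (n - Q) \<times> monics (n - degree (snd x))"]) (auto simp: farey_arc_def)
  have finF: "finite (farey_fractions Q)" by (simp add: farey_fractions_def)
  have "gauss_avg W n = (\<Sum>z\<in>Sigma (farey_fractions Q) (farey_arc n Q). ?g (farey_map z))"
    unfolding gauss_avg_reduced_fractions
    by (rule sum.reindex_bij_betw[OF bij_betw_farey_map[OF assms(1)], symmetric])
  also have "\<dots> = (\<Sum>x\<in>farey_fractions Q. \<Sum>y\<in>farey_arc n Q x. ?g (farey_map (x, y)))"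
    by (subst sum.Sigma) (use fin finF in \<open>auto simp: case_prod_unfold\<close>)
  also have "\<dots> = (\<Sum>x\<in>farey_fractions Q. ?g x * symbol_sum (n - degree (snd x)) (n - Q))"
  proof (rule sum.cong[OF refl])
    fix x assume x: "x \<in> farey_fractions Q"
    obtain b0 c0 where x': "x = (b0, c0)" by (cases x)
    obtain j where j: "(b0, c0) \<in> reduced_fractions j" "j \<le> Q" using x x' by (auto simp: farey_fractions_def)
    have "(\<Sum>y\<in>farey_arc n Q x. ?g (farey_map (x, y))) = (\<Sum>y\<in>farey_arc n Q x. ?g x * (case y of (r, t) \<Rightarrow> chi t r))"
    proof (rule sum.cong[OF refl])
      fix y assume y: "y \<in> farey_arc n Q x"
      obtain r t where y': "y = (r, t)" by (cases y)
      obtain b c where bc: "farey_map ((b0, c0), (r, t)) = (b, c)" by (cases "farey_map ((b0, c0), (r, t))")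
      have "(r, t) \<in> farey_arc n Q (b0, c0)" using y x' y' by simp
      from farey_terms[OF j assms(1) this assms(2) bc]
      show "?g (farey_map (x, y)) = ?g x * (case y of (r, t) \<Rightarrow> chi t r)"
        unfolding x' y' bc prod.case .
    qed
    also have "\<dots> = ?g x * (\<Sum>(r, t)\<in>farey_arc n Q x. chi t r)" by (rule sum_distrib_left[symmetric])
    also have "(\<Sum>(r, t)\<in>farey_arc n Q x. chi t r) = symbol_sum (n - degree (snd x)) (n - Q)"
      by (rule symbol_sum_arc) simp
    finally show "(\<Sum>y\<in>farey_arc n Q x. ?g (farey_map (x, y))) = ?g x * symbol_sum (n - degree (snd x)) (n - Q)" .
  qed
  also have "\<dots> = (\<Sum>j\<le>Q. \<Sum>x\<in>reduced_fractions j. ?g x * symbol_sum (n - degree (snd x)) (n - Q))"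
    unfolding farey_fractions_def
  proof (rule sum.UNION_disjoint)
    show "\<forall>i\<in>{..Q}. finite (reduced_fractions i)" by simp
    show "\<forall>i\<in>{..Q}. \<forall>j\<in>{..Q}. i \<noteq> j \<longrightarrow> reduced_fractions i \<inter> reduced_fractions j = {}"
      by (auto simp: reduced_fractions_def monics_def)
  qed simp
  also have "\<dots> = (\<Sum>j\<le>Q. gauss_avg W j * symbol_sum (n - j) (n - Q))"
  proof (rule sum.cong[OF refl])
    fix j
    have "(\<Sum>x\<in>reduced_fractions j. ?g x * symbol_sum (n - degree (snd x)) (n - Q)) =
        (\<Sum>x\<in>reduced_fractions j. ?g x * symbol_sum (n - j) (n - Q))"
      by (rule sum.cong[OF refl]) (auto simp: reduced_fractions_def monics_def)
    also have "\<dots> = gauss_avg W j * symbol_sum (n - j) (n - Q)"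
      unfolding gauss_avg_reduced_fractions by (rule sum_distrib_right[symmetric])
    finally show "(\<Sum>x\<in>reduced_fractions j. ?g x * symbol_sum (n - degree (snd x)) (n - Q)) =
        gauss_avg W j * symbol_sum (n - j) (n - Q)" .
  qed
  finally show ?thesis .
qed

definition q :: real where "q = real (3 * third + 1)"

lemma card_q [simp]: "real CARD('k) = q"
  by (simp add: q_def card_eq)

lemma q_ge_7: "q \<ge> 7" "q > 1" "q > 0" "q \<ge> 0" "q \<noteq> 0" "q \<ge> 1"
proof -
  have "real 7 \<le> real CARD('k)" using card_minus_one(2) by (rule of_nat_mono)
  then have "q \<ge> 7" by simp
  then show "q \<ge> 7" "q > 1" "q > 0" "q \<ge> 0" "q \<noteq> 0" "q \<ge> 1" by simp_all
qed

lemma q_powr_nat: "q powr real n = q ^ n"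
  using q_ge_7 by (simp add: powr_realpow)

text \<open>As R <= m, the sum over t covers complete periods modulo r, so only constant multiples
  of cubes contribute. There are at most q^(1 + K) of these, where K is R/3 rounded up, and they are
  bounded trivially; q^2 absorbs the constants and the rounding.\<close>

lemma norm_symbol_sum_le:
  assumes "R \<le> m"
  shows "norm (symbol_sum m R) \<le> q ^ 2 * q ^ m * q powr (real R / 3)"
proof -
  define C where "C = {r \<in> polys_below R - {0}. \<exists>a A. monic A \<and> r = smult a (A ^ 3 :: 'k poly)}"
  have zero: "(\<Sum>t\<in>monics m. chi t r) = 0" if r: "r \<in> polys_below R - {0}" "r \<notin> C" for r
  proof -
    obtain a r1 where r1: "a \<noteq> 0" "monic r1" "r = smult a r1" using associated_monic r(1) by blast
    have nc: "\<nexists>A. monic A \<and> r1 = A ^ 3" using r r1 by (auto simp: C_def)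
    have deg: "degree r1 \<le> m" using r(1) r1 assms by (auto simp: polys_below_iff)
    have "(\<Sum>t\<in>monics m. chi t r) = (\<Sum>t\<in>monics m. omega a ^ m * chi r1 t)"
      by (rule sum.cong[OF refl]) (simp add: r1(3) monics_def chi_smult_right chi_swap[OF _ r1(2)])
    also have "\<dots> = omega a ^ m * (\<Sum>t\<in>monics m. chi r1 t)" by (rule sum_distrib_left[symmetric])
    also have "\<dots> = 0" using sum_chi_monics_noncube[OF r1(2) nc deg] by simp
    finally show ?thesis .
  qed
  define K where "K = (R + 2) div 3"
  have CK: "C \<subseteq> (\<lambda>(a, A). smult a (A ^ 3)) ` (UNIV \<times> polys_below K)"
  proof
    fix r assume "r \<in> C"
    then obtain a A where r: "r \<in> polys_below R" "r \<noteq> 0" "monic A" "r = smult a (A ^ 3)" by (auto simp: C_def)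
    then have "a \<noteq> 0" by auto
    then have "degree r = 3 * degree A" using r(3,4) by (simp add: degree_power_eq monic_nonzero)
    then have "degree A < K" using r(1,2) unfolding K_def by (simp add: polys_below_iff)
    then have "A \<in> polys_below K" by (simp add: polys_below_iff)
    then show "r \<in> (\<lambda>(a, A). smult a (A ^ 3)) ` (UNIV \<times> polys_below K)"
      using r(4) by (intro image_eqI[of _ _ "(a, A)"]) auto
  qed
  have "card C \<le> card ((\<lambda>(a, A). smult a (A ^ 3)) ` (UNIV \<times> polys_below K) :: 'k poly set)"
    using CK by (rule card_mono[rotated]) simp
  also have "\<dots> \<le> card (UNIV \<times> polys_below K :: ('k \<times> 'k poly) set)" by (rule card_image_le) simp
  also have "\<dots> = CARD('k) * CARD('k) ^ K" by (simp add: card_cartesian_product card_polys_below)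
  finally have "real (card C) \<le> real (CARD('k) * CARD('k) ^ K)" by (rule of_nat_mono)
  then have cardC: "real (card C) \<le> q powr (1 + real K)" using q_ge_7 by (simp add: powr_add powr_realpow)
  have "real K \<le> (real R + 2) / 3" unfolding K_def by (simp add: real_of_nat_div)
  then have "q powr (1 + real K) \<le> q powr (2 + real R / 3)" using q_ge_7 by (intro powr_mono) auto
  with cardC have cardC': "real (card C) \<le> q ^ 2 * q powr (real R / 3)"
    using q_ge_7 by (simp add: powr_add)
  have "symbol_sum m R = (\<Sum>r\<in>C. \<Sum>t\<in>monics m. chi t r)"
    unfolding symbol_sum_def
  proof (rule sum.mono_neutral_right)
    show "C \<subseteq> polys_below R - {0}" by (auto simp: C_def)
    show "\<forall>r\<in>polys_below R - {0} - C. (\<Sum>t\<in>monics m. chi t r) = 0" using zero by blast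
  qed simp
  also have "norm \<dots> \<le> (\<Sum>r\<in>C. q ^ m)"
  proof (rule sum_norm_le)
    fix r assume "r \<in> C"
    have "norm (\<Sum>t\<in>monics m. chi t r) \<le> (\<Sum>t\<in>(monics m :: 'k poly set). 1)"
      by (rule sum_norm_le) (simp add: norm_chi_le monics_def)
    then show "norm (\<Sum>t\<in>monics m. chi t r) \<le> q ^ m" by (simp add: card_monics)
  qed
  also have "\<dots> = real (card C) * q ^ m" by simp
  also have "\<dots> \<le> (q ^ 2 * q powr (real R / 3)) * q ^ m" using cardC' q_ge_7 by (intro mult_right_mono) auto
  finally show ?thesis by (simp add: mult_ac)
qed

end

subsection \<open>Products of distinct primes\<close>

lemma prime_not_dvd_prod_primes:
  assumes "finite S" "S \<subseteq> prime_polys" "P \<in> prime_polys" "P \<notin> S"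
  shows "\<not> P dvd \<Prod>S"
  using assms
proof (induction S rule: finite_induct)
  case (insert R S)
  then have "P \<noteq> R" "R \<in> prime_polys" by auto
  then have "\<not> P dvd R" using prime_dvd_prime_eq insert.prems(2) by blast
  moreover have "\<not> P dvd \<Prod>S" using insert by simp
  ultimately show ?case using insert prime_dvd_mult_iff_poly[of P R "\<Prod>S"] by simp
qed (simp add: prime_poly_not_dvd_one)

lemma prod_primes_dvd:
  assumes "finite S" "S \<subseteq> prime_polys" "\<And>P. P \<in> S \<Longrightarrow> P dvd W"
  shows "\<Prod>S dvd W"
  using assms
proof (induction S rule: finite_induct)
  case (insert P S)
  have "coprime P (\<Prod>S)"
    using prime_poly_coprime[of P] prime_not_dvd_prod_primes[of S P] insert by auto
  moreover have "P dvd W" "\<Prod>S dvd W" using insert by auto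
  ultimately have "P * \<Prod>S dvd W" by (rule field_poly_coprime_mult_dvd)
  then show ?case using insert by simp
qed simp

lemma monic_prod_primes: "S \<subseteq> prime_polys \<Longrightarrow> monic (\<Prod>S)"
  by (rule monic_prod) (auto dest: prime_polysD)

lemma degree_prod_primes:
  assumes "finite S" "S \<subseteq> prime_polys"
  shows "degree (\<Prod>S) = (\<Sum>P\<in>S. degree P)"
  using assms
proof (induction S rule: finite_induct)
  case (insert P S)
  have "degree (P * \<Prod>S) = degree P + degree (\<Prod>S)"
    using insert prime_polysD(1) monic_prod_primes by (intro degree_mult_monic) auto
  then show ?case using insert by simp
qed simp

definition prime_divisors :: "'k::finite_field poly \<Rightarrow> 'k poly set" where
  "prime_divisors W = {P \<in> prime_polys. P dvd W}"

lemma finite_prime_divisors_set [simp]: "W \<noteq> 0 \<Longrightarrow> finite (prime_divisors W)"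
  unfolding prime_divisors_def by (rule finite_prime_divisors)

definition smooth :: "'k::finite_field poly set \<Rightarrow> 'k poly set" where
  "smooth S = {h. monic h \<and> prime_divisors h \<subseteq> S}"

definition smooth_upto :: "'k::finite_field poly set \<Rightarrow> nat \<Rightarrow> 'k poly set" where
  "smooth_upto S n = {h \<in> smooth S. degree h \<le> n}"

lemma finite_smooth_upto [simp]: "finite (smooth_upto S n)"
proof (rule finite_subset)
  show "smooth_upto S n \<subseteq> (\<Union>i\<le>n. monics i)"
    by (auto simp: smooth_upto_def smooth_def monics_def)
qed simp

lemma smooth_empty: "smooth {} = {1}"
proof -
  have "h = 1" if "monic h" "prime_divisors h \<subseteq> {}" for h :: "'a poly"
    using exists_prime_factor[OF that(1)] that(2) unfolding prime_divisors_def by blast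
  then show ?thesis using prime_poly_not_dvd_one by (auto simp: smooth_def prime_divisors_def)
qed

context cubic_gauss
begin

lemma q_powr_mono: "a \<le> b \<Longrightarrow> q powr a \<le> q powr b"
  using q_ge_7 by (intro powr_mono) auto

lemma q_powr_mult_nat: "q powr (a * real i) = (q powr a) ^ i"
  using q_ge_7 by (subst powr_powr[symmetric], subst powr_realpow) auto

lemma q_powr_half: "q powr (- 1 / 2) \<le> 1 / 2"
proof -
  have "q powr (1 / 2) \<ge> 2"
    using q_ge_7 real_le_rsqrt[of 2 q] by (simp add: powr_half_sqrt)
  moreover have "q powr (- 1 / 2) = 1 / q powr (1 / 2)" by (simp add: powr_minus_divide)
  ultimately show ?thesis using frac_le[of 1 1 2 "q powr (1 / 2)"] by simp
qed

lemma geometric_half_le: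
  fixes x :: real
  assumes "0 \<le> x" "x \<le> 1 / 2"
  shows "(\<Sum>i\<le>n. x ^ i) \<le> 2"
proof -
  have "(\<Sum>i\<le>n. x ^ i) \<le> (\<Sum>i\<le>n. (1 / 2) ^ i)" using assms by (intro sum_mono power_mono) auto
  also have "\<dots> = 2 - (1 / 2) ^ n" by (induction n) (auto simp: field_simps)
  also have "\<dots> \<le> 2" by simp
  finally show ?thesis .
qed

text \<open>A truncated Euler product: each prime contributes a geometric series of ratio |P|^(-1/2)
  <= 1/2, hence at most 2. These powers of 2 are the only loss from common factors and are later
  absorbed by \<open>prime_count_bound\<close>.\<close>

lemma sum_smooth_le:
  assumes "finite S" "S \<subseteq> prime_polys"
  shows "(\<Sum>h\<in>smooth_upto S n. q powr (- real (degree (h :: 'k poly)) / 2)) \<le> 2 ^ card S"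
  using assms
proof (induction S rule: finite_induct)
  case empty
  have "smooth_upto {} n = ({1} :: 'k poly set)" unfolding smooth_upto_def smooth_empty by auto
  then show ?case using q_ge_7 by simp
next
  case (insert P S)
  then have P: "P \<in> prime_polys" and S: "S \<subseteq> prime_polys" by auto
  note mP = prime_polysD(1)[OF P]
  let ?w = "\<lambda>h :: 'k poly. q powr (- real (degree h) / 2)"
  let ?f = "\<lambda>(i, h). P ^ i * h"
  have sub: "smooth_upto (insert P S) n \<subseteq> ?f ` ({..n} \<times> smooth_upto S n)"
  proof
    fix h assume h: "h \<in> smooth_upto (insert P S) n"
    then have mh: "monic h" and ph: "prime_divisors h \<subseteq> insert P S" and dh: "degree h \<le> n"
      by (auto simp: smooth_upto_def smooth_def)
    obtain i G where G: "h = P ^ i * G" "monic G" "\<not> P dvd G" using prime_power_decomp[OF P mh] by blast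
    have "degree h = degree (P ^ i) + degree G" unfolding G(1) using mP G(2) by (simp add: degree_mult_monic monic_power)
    moreover have "degree (P ^ i) = i * degree P" using mP by (simp add: degree_power_eq monic_nonzero)
    moreover have "i \<le> i * degree P" using prime_polysD(5)[OF P] by (cases "degree P") auto
    ultimately have "i \<le> n" "degree G \<le> n" using dh by linarith+
    moreover have "prime_divisors G \<subseteq> S"
      using ph G(1,3) unfolding prime_divisors_def by auto
    ultimately show "h \<in> ?f ` ({..n} \<times> smooth_upto S n)"
      using G by (intro image_eqI[of _ _ "(i, G)"]) (auto simp: smooth_upto_def smooth_def)
  qed
  have "(\<Sum>h\<in>smooth_upto (insert P S) n. ?w h) \<le> (\<Sum>h\<in>?f ` ({..n} \<times> smooth_upto S n). ?w h)"
    using sub by (intro sum_mono2) auto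
  also have "\<dots> \<le> (\<Sum>z\<in>{..n} \<times> smooth_upto S n. ?w (?f z))"
    using sum_image_le[of "{..n} \<times> smooth_upto S n" ?w ?f] by (simp add: o_def)
  also have "\<dots> = (\<Sum>(i, h)\<in>{..n} \<times> smooth_upto S n. (q powr (- real (degree P) / 2)) ^ i * ?w h)"
  proof (rule sum.cong[OF refl], clarify)
    fix i h assume "h \<in> smooth_upto S n"
    then have mh: "monic h" by (auto simp: smooth_upto_def smooth_def)
    have "degree (P ^ i * h) = i * degree P + degree h"
      using mP mh by (simp add: degree_mult_monic monic_power degree_power_eq monic_nonzero)
    then have "- real (degree (P ^ i * h)) / 2 = (- real (degree P) / 2) * real i + (- real (degree h) / 2)"
      by (simp add: field_simps)
    then have "?w (P ^ i * h) = q powr ((- real (degree P) / 2) * real i) * ?w h"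
      by (simp only: powr_add)
    also have "q powr ((- real (degree P) / 2) * real i) = (q powr (- real (degree P) / 2)) ^ i"
      by (rule q_powr_mult_nat)
    finally show "?w (P ^ i * h) = (q powr (- real (degree P) / 2)) ^ i * ?w h" .
  qed
  also have "\<dots> = (\<Sum>i\<le>n. (q powr (- real (degree P) / 2)) ^ i) * (\<Sum>h\<in>smooth_upto S n. ?w h)"
    by (simp only: sum_product sum.cartesian_product)
  also have "\<dots> \<le> 2 * 2 ^ card S"
  proof (intro mult_mono)
    have "q powr (- real (degree P) / 2) \<le> q powr (- 1 / 2)"
      using prime_polysD(5)[OF P] by (intro q_powr_mono) simp
    with q_powr_half have "q powr (- real (degree P) / 2) \<le> 1 / 2" by linarith
    then show "(\<Sum>i\<le>n. (q powr (- real (degree P) / 2)) ^ i) \<le> 2" by (intro geometric_half_le) auto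
    show "(\<Sum>h\<in>smooth_upto S n. ?w h) \<le> 2 ^ card S" by (rule insert.IH[OF S])
  qed (auto intro: sum_nonneg)
  finally show ?case using insert by simp
qed

text \<open>The divisor bound. Primes with |P|^\<epsilon> < s have bounded degree, so they
  contribute a bounded factor, and each other prime is dominated by its own |P|^\<epsilon>.\<close>

lemma prime_count_bound:
  assumes "\<epsilon> > 0" "(s::real) \<ge> 1"
  shows "\<exists>K>0. \<forall>S. finite S \<longrightarrow> S \<subseteq> (prime_polys :: 'k poly set) \<longrightarrow>
    s ^ card S \<le> K * q powr (\<epsilon> * real (\<Sum>P\<in>S. degree P))"
proof -
  obtain p0 :: nat where p0: "real p0 \<ge> log q s / \<epsilon>" using real_arch_simple by blast
  have sp: "s \<le> q powr (\<epsilon> * real p)" if "p \<ge> p0" for p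
  proof -
    have "log q s \<le> \<epsilon> * real p"
      using p0 that assms(1) by (simp add: pos_divide_le_eq mult.commute) (meson mult_left_mono of_nat_le_iff order_trans less_imp_le)
    then have "q powr (log q s) \<le> q powr (\<epsilon> * real p)" by (rule q_powr_mono)
    then show ?thesis using q_ge_7 assms(2) by (simp add: powr_log_cancel)
  qed
  define B where "B = (\<Union>i<p0. monics i :: 'k poly set)"
  have finB: "finite B" by (simp add: B_def)
  show ?thesis
  proof (intro exI[of _ "s ^ card B"] conjI allI impI)
    show "0 < s ^ card B" using assms(2) by simp
    fix S :: "'k poly set" assume S: "finite S" "S \<subseteq> prime_polys"
    have "s ^ card S = s ^ card (S \<inter> B) * s ^ card (S - B)"
      unfolding power_add[symmetric] card_Int_Diff[OF S(1), of B, symmetric] ..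
    also have "s ^ card (S \<inter> B) \<le> s ^ card B"
      using assms(2) finB by (intro power_increasing card_mono) auto
    also have "s ^ card (S - B) = (\<Prod>P\<in>S - B. s)" by simp
    also have "\<dots> \<le> (\<Prod>P\<in>S - B. q powr (\<epsilon> * real (degree P)))"
    proof (rule prod_mono, intro conjI)
      fix P assume P: "P \<in> S - B"
      then have "monic P" using S(2) prime_polysD(1) by blast
      then have "degree P \<ge> p0" using P by (force simp: B_def monics_def)
      then show "s \<le> q powr (\<epsilon> * real (degree P))" by (rule sp)
      show "0 \<le> s" using assms(2) by simp
    qed
    also have "\<dots> = q powr (\<Sum>P\<in>S - B. \<epsilon> * real (degree P))"
      using q_ge_7 S(1) by (simp add: powr_sum)
    also have "\<dots> \<le> q powr (\<epsilon> * real (\<Sum>P\<in>S. degree P))"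
    proof (rule q_powr_mono)
      have "(\<Sum>P\<in>S - B. \<epsilon> * real (degree P)) \<le> (\<Sum>P\<in>S. \<epsilon> * real (degree P))"
        using assms(1) S(1) by (intro sum_mono2) auto
      then show "(\<Sum>P\<in>S - B. \<epsilon> * real (degree P)) \<le> \<epsilon> * real (\<Sum>P\<in>S. degree P)"
        by (simp add: sum_distrib_left)
    qed
    finally show "s ^ card S \<le> s ^ card B * q powr (\<epsilon> * real (\<Sum>P\<in>S. degree P))"
      using assms(2) by (simp add: mult_left_mono)
  qed
qed

lemma prime_divisor_count_bound:
  assumes "\<epsilon> > 0" "(s::real) \<ge> 1"
  shows "\<exists>K>0. \<forall>W. W \<noteq> 0 \<longrightarrow> s ^ card (prime_divisors (W :: 'k poly)) \<le> K * q powr (\<epsilon> * real (degree W))"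
proof -
  obtain K where K: "K > 0" "\<And>S. finite S \<Longrightarrow> S \<subseteq> (prime_polys :: 'k poly set) \<Longrightarrow>
    s ^ card S \<le> K * q powr (\<epsilon> * real (\<Sum>P\<in>S. degree P))"
    using prime_count_bound[OF assms] by blast
  have "s ^ card (prime_divisors W) \<le> K * q powr (\<epsilon> * real (degree W))" if W: "W \<noteq> 0" for W :: "'k poly"
  proof -
    let ?S = "prime_divisors W"
    have S: "finite ?S" "?S \<subseteq> prime_polys" using W by (simp, simp add: prime_divisors_def)
    have "\<Prod>?S dvd W" using S by (intro prod_primes_dvd) (auto simp: prime_divisors_def)
    then have "degree (\<Prod>?S) \<le> degree W" using W by (rule dvd_imp_degree_le)
    then have "(\<Sum>P\<in>?S. degree P) \<le> degree W" by (simp add: degree_prod_primes[OF S])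
    then have "real (\<Sum>P\<in>?S. degree P) \<le> real (degree W)" by (rule of_nat_mono)
    then have le: "\<epsilon> * real (\<Sum>P\<in>?S. degree P) \<le> \<epsilon> * real (degree W)"
      by (rule mult_left_mono) (use assms(1) in simp)
    have "K * q powr (\<epsilon> * real (\<Sum>P\<in>?S. degree P)) \<le> K * q powr (\<epsilon> * real (degree W))"
      by (rule mult_left_mono[OF q_powr_mono[OF le]]) (use K(1) in simp)
    with K(2)[OF S] show ?thesis by linarith
  qed
  with K(1) show ?thesis by blast
qed

subsection \<open>Bounds for averages of Gauss sums\<close>

lemma norm_gauss_le_gcd:
  assumes "monic c"
  obtains g where "monic g" "g dvd c" "g dvd W"
    "norm (gauss W c) \<le> q powr ((real (degree c) + real (degree g)) / 2)"
proof -
  obtain g W1 c1 where g: "monic g" "monic c1" "W = g * W1" "c = g * c1" "coprime W1 c1"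
    using exists_gcd_cofactors[OF assms] by blast
  have "norm (gauss W c) ^ 2 \<le> q ^ degree c * q ^ degree g"
    using norm_gauss_sq_le[OF g(1,2,5)] unfolding g(3,4) by simp
  also have "\<dots> = (q powr ((real (degree c) + real (degree g)) / 2)) ^ 2"
  proof -
    have "(q powr ((real (degree c) + real (degree g)) / 2)) ^ 2 = q powr (real (degree c) + real (degree g))"
      using q_ge_7 by (simp add: power2_eq_square powr_add[symmetric])
    then show ?thesis by (simp add: powr_add q_powr_nat)
  qed
  finally have "norm (gauss W c) \<le> q powr ((real (degree c) + real (degree g)) / 2)"
    by (rule power2_le_imp_le) simp
  then show thesis using that[of g] g by simp
qed

text \<open>No cancellation between moduli is used. Those divisible by g number q^(j - deg g) and
  each costs at most q^((j + deg g)/2), which leaves a factor |g|^(-1/2); the sum over all g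
  composed of primes of \<open>W\<close> then costs one factor 2 per prime.\<close>

lemma norm_gauss_avg_le_trivial:
  assumes "W \<noteq> 0"
  shows "norm (gauss_avg W j) \<le> 2 ^ card (prime_divisors W) * q powr (3 * real j / 2)"
proof -
  let ?D = "smooth_upto (prime_divisors W) j"
  let ?w = "\<lambda>g :: 'k poly. q powr ((real j + real (degree g)) / 2)"
  have "norm (gauss_avg W j) \<le> (\<Sum>c\<in>monics j. \<Sum>g\<in>?D. if g dvd c then ?w g else 0)"
    unfolding gauss_avg_def
  proof (rule sum_norm_le)
    fix c :: "'k poly" assume c: "c \<in> monics j"
    obtain g where g: "monic g" "g dvd c" "g dvd W"
      "norm (gauss W c) \<le> q powr ((real (degree c) + real (degree g)) / 2)"
      using norm_gauss_le_gcd[of c W] c monicsD(1) by blast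
    have "prime_divisors g \<subseteq> prime_divisors W" using g(3) dvd_trans unfolding prime_divisors_def by blast
    moreover have "degree g \<le> j" using dvd_imp_degree_le[OF g(2)] c monic_nonzero by (auto simp: monics_def)
    ultimately have gD: "g \<in> ?D" using g(1) by (auto simp: smooth_upto_def smooth_def)
    have "norm (gauss W c) \<le> (if g dvd c then ?w g else 0)" using g c by (simp add: monics_def)
    also have "\<dots> \<le> (\<Sum>g\<in>?D. if g dvd c then ?w g else 0)"
      using gD by (intro member_le_sum) auto
    finally show "norm (gauss W c) \<le> (\<Sum>g\<in>?D. if g dvd c then ?w g else 0)" .
  qed
  also have "\<dots> = (\<Sum>g\<in>?D. \<Sum>c\<in>monics j. if g dvd c then ?w g else 0)" by (rule sum.swap)
  also have "\<dots> = (\<Sum>g\<in>?D. q powr (3 * real j / 2) * q powr (- real (degree g) / 2))"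
  proof (rule sum.cong[OF refl])
    fix g assume g: "g \<in> ?D"
    then have mg: "g \<in> monics (degree g)" "degree g \<le> j" by (auto simp: smooth_upto_def smooth_def monics_def)
    have "card {c \<in> monics j. g dvd c} = CARD('k) ^ (j - degree g)"
    proof -
      have "inj_on (\<lambda>G. g * G) (monics (j - degree g))"
        using monic_nonzero[OF monicsD(1)[OF mg(1)]] by (simp add: inj_on_def)
      then show ?thesis
        unfolding multiples_in_monics[OF mg(1)] using mg(2) by (simp add: card_image card_monics)
    qed
    then have "real (card {c \<in> monics j. g dvd c}) = q ^ (j - degree g)" by simp
    also have "\<dots> = q powr (real j - real (degree g))"
      using mg(2) by (simp add: q_powr_nat[symmetric] of_nat_diff)
    finally have card: "real (card {c \<in> monics j. g dvd c}) = q powr (real j - real (degree g))" .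
    have "(\<Sum>c\<in>monics j. if g dvd c then ?w g else 0) = real (card {c \<in> monics j. g dvd c}) * ?w g"
      by (simp add: sum.If_cases Int_def)
    also have "\<dots> = q powr ((real j - real (degree g)) + (real j + real (degree g)) / 2)"
      unfolding card by (rule powr_add[symmetric])
    also have "(real j - real (degree g)) + (real j + real (degree g)) / 2 =
        3 * real j / 2 + (- real (degree g) / 2)" by (simp add: field_simps)
    finally show "(\<Sum>c\<in>monics j. if g dvd c then ?w g else 0) =
        q powr (3 * real j / 2) * q powr (- real (degree g) / 2)" by (simp only: powr_add)
  qed
  also have "\<dots> = q powr (3 * real j / 2) * (\<Sum>g\<in>?D. q powr (- real (degree g) / 2))"
    by (rule sum_distrib_left[symmetric])
  also have "\<dots> \<le> q powr (3 * real j / 2) * 2 ^ card (prime_divisors W)"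
    using assms by (intro mult_left_mono sum_smooth_le) (auto simp: prime_divisors_def finite_prime_divisors)
  finally show ?thesis by (simp add: mult.commute)
qed

text \<open>Q = deg W + 1 is the smallest order for which the additive character is constant on
  arcs. The arcs with denominator degree j contribute the exponent 3j/2 + (n - j) + (n - Q)/3 = 4n/3
  + Q/6 - (Q - j)/2, so j = Q dominates. For n <= Q the trivial exponent 3n/2 is at most 4n/3 +
  Q/6.\<close>

lemma norm_gauss_avg_le:
  assumes "W \<noteq> 0"
  shows "norm (gauss_avg W n) \<le>
    2 * q ^ 3 * 2 ^ card (prime_divisors W) * q powr (4 * real n / 3 + real (degree W) / 6)"
proof -
  define Q where "Q = Suc (degree W)"
  let ?t = "2 ^ card (prime_divisors W) :: real"
  have WQ: "W \<in> polys_below Q" by (simp add: Q_def polys_below_iff)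
  have main: "norm (gauss_avg W n) \<le> 2 * q ^ 2 * ?t * q powr (4 * real n / 3 + real Q / 6)"
  proof (cases "n \<le> Q")
    case True
    have "norm (gauss_avg W n) \<le> ?t * q powr (3 * real n / 2)"
      by (rule norm_gauss_avg_le_trivial[OF assms])
    also have "\<dots> \<le> ?t * q powr (4 * real n / 3 + real Q / 6)"
      using True by (intro mult_left_mono q_powr_mono) auto
    also have "\<dots> \<le> (2 * q ^ 2) * (?t * q powr (4 * real n / 3 + real Q / 6))"
    proof -
      have "1 \<le> q ^ 2" using q_ge_7 by (intro one_le_power) auto
      then show ?thesis using mult_right_mono[of 1 "2 * q ^ 2" "?t * q powr (4 * real n / 3 + real Q / 6)"] by simp
    qed
    finally show ?thesis by (simp add: mult_ac)
  next
    case False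
    then have Qn: "Q < n" by simp
    have "norm (gauss_avg W n) \<le> (\<Sum>j\<le>Q. norm (gauss_avg W j * symbol_sum (n - j) (n - Q)))"
      unfolding gauss_avg_farey[OF Qn WQ] by (rule norm_sum)
    also have "\<dots> \<le> (\<Sum>j\<le>Q. q ^ 2 * ?t * q powr (4 * real n / 3 + real Q / 6) *
        (q powr (- 1 / 2)) ^ (Q - j))"
    proof (rule sum_mono)
      fix j assume "j \<in> {..Q}"
      then have j: "j \<le> Q" by simp
      have "norm (gauss_avg W j * symbol_sum (n - j) (n - Q)) \<le>
          (?t * q powr (3 * real j / 2)) * (q ^ 2 * q ^ (n - j) * q powr (real (n - Q) / 3))"
        unfolding norm_mult using j Qn q_ge_7
        by (intro mult_mono norm_gauss_avg_le_trivial[OF assms] norm_symbol_sum_le) auto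
      also have "\<dots> = q ^ 2 * ?t * (q powr (3 * real j / 2) * q powr (real (n - j)) * q powr (real (n - Q) / 3))"
        by (simp only: q_powr_nat mult_ac)
      also have "q powr (3 * real j / 2) * q powr (real (n - j)) * q powr (real (n - Q) / 3) =
          q powr (3 * real j / 2 + real (n - j) + real (n - Q) / 3)" by (simp only: powr_add)
      also have "3 * real j / 2 + real (n - j) + real (n - Q) / 3 =
          (4 * real n / 3 + real Q / 6) + (- 1 / 2) * real (Q - j)"
      proof -
        have "real (n - j) = real n - real j" "real (n - Q) = real n - real Q" "real (Q - j) = real Q - real j"
          using j Qn by (simp_all add: of_nat_diff)
        then show ?thesis by argo
      qed
      also have "q powr ((4 * real n / 3 + real Q / 6) + (- 1 / 2) * real (Q - j)) =
          q powr (4 * real n / 3 + real Q / 6) * (q powr (- 1 / 2)) ^ (Q - j)"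
        unfolding q_powr_mult_nat[symmetric] by (rule powr_add)
      finally show "norm (gauss_avg W j * symbol_sum (n - j) (n - Q)) \<le>
          q ^ 2 * ?t * q powr (4 * real n / 3 + real Q / 6) * (q powr (- 1 / 2)) ^ (Q - j)"
        by (simp only: mult_ac)
    qed
    also have "\<dots> = q ^ 2 * ?t * q powr (4 * real n / 3 + real Q / 6) *
        (\<Sum>j\<le>Q. (q powr (- 1 / 2)) ^ (Q - j))" by (rule sum_distrib_left[symmetric])
    also have "(\<Sum>j\<le>Q. (q powr (- 1 / 2)) ^ (Q - j)) = (\<Sum>j\<le>Q. (q powr (- 1 / 2)) ^ j)"
      by (rule sum.reindex_bij_witness[of _ "\<lambda>i. Q - i" "\<lambda>i. Q - i"]) auto
    also have "q ^ 2 * ?t * q powr (4 * real n / 3 + real Q / 6) * \<dots> \<le>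
        q ^ 2 * ?t * q powr (4 * real n / 3 + real Q / 6) * 2"
      using q_ge_7 q_powr_half by (intro mult_left_mono geometric_half_le) auto
    finally show ?thesis by (simp add: mult_ac)
  qed
  also have "q powr (4 * real n / 3 + real Q / 6) \<le> q * q powr (4 * real n / 3 + real (degree W) / 6)"
  proof -
    have "q powr (4 * real n / 3 + real Q / 6) \<le> q powr (1 + (4 * real n / 3 + real (degree W) / 6))"
      unfolding Q_def by (intro q_powr_mono) simp
    then show ?thesis using q_ge_7 by (simp add: powr_add)
  qed
  then have "2 * q ^ 2 * ?t * q powr (4 * real n / 3 + real Q / 6) \<le>
      2 * q ^ 2 * ?t * (q * q powr (4 * real n / 3 + real (degree W) / 6))"
    using q_ge_7 by (intro mult_left_mono) auto
  finally show ?thesis by (simp add: power2_eq_square power3_eq_cube mult_ac)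
qed

text \<open>Raising the exponent of |W| from 1/6 to 1/4 leaves 1/12 to absorb the factor 2 for each
  prime divisor of \<open>W\<close>.\<close>

lemma gauss_avg_bound:
  "\<exists>K>0. \<forall>W n. W \<noteq> 0 \<longrightarrow> norm (gauss_avg W n) \<le> K * q powr (4 * real n / 3 + real (degree W) / 4)"
proof -
  obtain K where K: "K > 0" "\<And>W :: 'k poly. W \<noteq> 0 \<Longrightarrow>
      2 ^ card (prime_divisors W) \<le> K * q powr (1 / 12 * real (degree W))"
    using prime_divisor_count_bound[of "1 / 12" 2] by auto
  show ?thesis
  proof (intro exI[of _ "2 * q ^ 3 * K"] conjI allI impI)
    show "0 < 2 * q ^ 3 * K" using K(1) q_ge_7 by simp
    fix W :: "'k poly" and n assume W: "W \<noteq> 0"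
    have "norm (gauss_avg W n) \<le>
        2 * q ^ 3 * 2 ^ card (prime_divisors W) * q powr (4 * real n / 3 + real (degree W) / 6)"
      by (rule norm_gauss_avg_le[OF W])
    also have "\<dots> \<le> 2 * q ^ 3 * (K * q powr (1 / 12 * real (degree W))) * q powr (4 * real n / 3 + real (degree W) / 6)"
      using K(2)[OF W] q_ge_7 by (intro mult_right_mono mult_left_mono) auto
    also have "\<dots> = 2 * q ^ 3 * K * q powr (1 / 12 * real (degree W) + (4 * real n / 3 + real (degree W) / 6))"
      by (simp only: powr_add mult_ac)
    also have "1 / 12 * real (degree W) + (4 * real n / 3 + real (degree W) / 6) = 4 * real n / 3 + real (degree W) / 4"
      by (simp add: field_simps)
    finally show "norm (gauss_avg W n) \<le> 2 * q ^ 3 * K * q powr (4 * real n / 3 + real (degree W) / 4)" .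
  qed
qed

section \<open>Averages over moduli prime to a finite set of primes\<close>

definition coprime_monics :: "'k poly set \<Rightarrow> nat \<Rightarrow> 'k poly set" where
  "coprime_monics S n = {c \<in> monics n. \<forall>P\<in>S. \<not> P dvd c}"

definition gauss_avg_coprime :: "'k poly set \<Rightarrow> 'k poly \<Rightarrow> nat \<Rightarrow> complex" where
  "gauss_avg_coprime S W n = (\<Sum>c\<in>coprime_monics S n. gauss W c)"

lemma finite_coprime_monics [simp]: "finite (coprime_monics S n)"
  by (simp add: coprime_monics_def)

lemma gauss_avg_coprime_empty: "gauss_avg_coprime {} W n = gauss_avg W n"
  by (simp add: gauss_avg_coprime_def gauss_avg_def coprime_monics_def)

lemma gauss_cube_mult:
  assumes "monic c" "coprime c u"
  shows "gauss (u ^ 3 * W) c = gauss W c"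
proof -
  have "coprime c (u ^ 3)" using field_poly_coprime_power[of u c 3] assms(2) by (simp add: coprime_commute)
  then have "gauss (u ^ 3 * W) c = chi c (u ^ 3) ^ 2 * gauss W c" by (rule gauss_unit_mult[OF assms(1)])
  then show ?thesis using chi_cube[OF assms] by (simp add: chi_power_right[OF assms(1)])
qed

text \<open>Cubes in the frequency are invisible to moduli prime to them. This brings the exponent
  of \<open>P\<close> in \<open>W\<close> below 3, as \<open>gauss_avg_coprime_insert\<close>
  requires.\<close>

lemma gauss_avg_coprime_cube_mult:
  assumes "\<And>c. monic c \<Longrightarrow> \<forall>P\<in>S. \<not> P dvd c \<Longrightarrow> coprime c u"
  shows "gauss_avg_coprime S (u ^ 3 * W) n = gauss_avg_coprime S W n"
  unfolding gauss_avg_coprime_def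
  by (rule sum.cong[OF refl], rule gauss_cube_mult) (use assms in \<open>auto simp: coprime_monics_def monics_def\<close>)

text \<open>Sieving one prime out of the moduli: only the exponents \<open>0\<close> and \<open>t + 1\<close> of \<open>P\<close> in the
  modulus contribute, where \<open>t < 3\<close> is the exponent of \<open>P\<close> in \<open>W\<close>.\<close>

lemma gauss_avg_coprime_insert:
  assumes P: "P \<in> prime_polys" "P \<notin> S" and S: "S \<subseteq> prime_polys"
    and t: "P ^ t dvd W" "\<not> P ^ Suc t dvd W" "t < 3"
  shows "gauss_avg_coprime S W n = gauss_avg_coprime (insert P S) W n +
    (if Suc t * degree P \<le> n then gauss W (P ^ Suc t) *
       gauss_avg_coprime (insert P S) (W * P ^ Suc t) (n - Suc t * degree P) else 0)"
proof -
  note mP = prime_polysD(1)[OF P(1)]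
  let ?d = "Suc t * degree P"
  let ?I = "coprime_monics (insert P S)"
  have degPt: "degree (P ^ i) = i * degree P" for i
    using mP by (simp add: degree_power_eq monic_nonzero)
  have PS: "\<not> R dvd P ^ i" if "R \<in> S" for R i
  proof
    assume "R dvd P ^ i"
    then have "R dvd P" using prime_elem_dvd_power prime_polysD(3) S that by blast
    then show False using prime_dvd_prime_eq[of R P] P S that by blast
  qed
  define A where "A = (if ?d \<le> n then (\<lambda>c. P ^ Suc t * c) ` ?I (n - ?d) else {})"
  have A_sub: "A \<subseteq> coprime_monics S n - ?I n"
  proof
    fix x assume "x \<in> A"
    then obtain c where c: "?d \<le> n" "x = P ^ Suc t * c" "c \<in> ?I (n - ?d)"
      unfolding A_def by (auto split: if_splits)
    have "P ^ Suc t \<in> monics ?d" using degPt[of "Suc t"] monic_power[OF mP, of "Suc t"]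
      unfolding monics_def mem_Collect_eq by blast
    then have "x \<in> monics n"
      using monics_mult[of "P ^ Suc t" ?d c "n - ?d"] c by (simp add: coprime_monics_def)
    moreover have "\<not> R dvd x" if "R \<in> S" for R
      using PS[OF that, of "Suc t"] c(2,3) that S prime_dvd_mult_iff_poly[of R "P ^ Suc t" c]
      by (auto simp: coprime_monics_def)
    moreover have "P dvd x" unfolding c(2) by simp
    ultimately show "x \<in> coprime_monics S n - ?I n" by (auto simp: coprime_monics_def)
  qed
  have zero: "gauss W x = 0" if x: "x \<in> coprime_monics S n - ?I n - A" for x
  proof -
    have mx: "monic x" "degree x = n" and Px: "P dvd x" and Sx: "\<forall>R\<in>S. \<not> R dvd x"
      using x by (auto simp: coprime_monics_def monics_def)
    obtain i c where ic: "x = P ^ i * c" "monic c" "\<not> P dvd c" using prime_power_decomp[OF P(1) mx(1)] by blast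
    have i0: "i \<noteq> 0" using ic Px by (metis mult_1 power_0)
    have "i \<noteq> Suc t"
    proof
      assume i: "i = Suc t"
      have "n = ?d + degree c"
        using mx(2) degree_mult_monic[OF monic_power[OF mP] ic(2), of i] degPt[of i] unfolding ic(1) i by simp
      moreover have "\<forall>R\<in>S. \<not> R dvd c" using Sx unfolding ic(1) by (meson dvd_mult)
      ultimately have "x \<in> A" using ic i by (auto simp: A_def coprime_monics_def monics_def)
      with x show False by blast
    qed
    then have "i \<le> t \<or> i \<ge> t + 2" by linarith
    then have "gauss W (P ^ i) = 0"
    proof
      assume "i \<le> t"
      then have "P ^ i dvd W" using t(1) le_imp_power_dvd dvd_trans by blast
      moreover have "\<not> 3 dvd i" using i0 \<open>i \<le> t\<close> t(3) by (auto dest: dvd_imp_le)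
      ultimately show ?thesis by (rule gauss_prime_power_low[OF P(1)])
    next
      assume "i \<ge> t + 2"
      then show ?thesis by (rule gauss_prime_power_high[OF P(1) t(2)])
    qed
    moreover have "coprime (P ^ i) c" using prime_poly_coprime[OF P(1) ic(3)] by (rule field_poly_coprime_power)
    ultimately show ?thesis unfolding ic(1) by (simp add: gauss_mult[OF monic_power[OF mP] ic(2)])
  qed
  have "?I n \<subseteq> coprime_monics S n" by (auto simp: coprime_monics_def)
  then have "gauss_avg_coprime S W n = gauss_avg_coprime (insert P S) W n +
      (\<Sum>c\<in>coprime_monics S n - ?I n. gauss W c)"
    unfolding gauss_avg_coprime_def using sum.subset_diff[of "?I n" "coprime_monics S n" "gauss W"]
    by (simp add: add.commute)
  also have "(\<Sum>c\<in>coprime_monics S n - ?I n. gauss W c) = (\<Sum>c\<in>A. gauss W c)"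
    by (rule sum.mono_neutral_right) (use A_sub zero in auto)
  also have "\<dots> = (if ?d \<le> n then gauss W (P ^ Suc t) *
       gauss_avg_coprime (insert P S) (W * P ^ Suc t) (n - ?d) else 0)"
  proof (cases "?d \<le> n")
    case True
    have inj: "inj_on (\<lambda>c. P ^ Suc t * c) (?I (n - ?d))"
      using mP by (auto simp: inj_on_def monic_nonzero)
    have "(\<Sum>c\<in>A. gauss W c) = (\<Sum>c\<in>?I (n - ?d). gauss W (P ^ Suc t * c))"
      unfolding A_def if_P[OF True] by (simp only: sum.reindex[OF inj] o_def)
    also have "\<dots> = (\<Sum>c\<in>?I (n - ?d). gauss W (P ^ Suc t) * gauss (W * P ^ Suc t) c)"
    proof (rule sum.cong[OF refl])
      fix c assume "c \<in> ?I (n - ?d)"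
      then have "monic c" "\<not> P dvd c" by (auto simp: coprime_monics_def monics_def)
      moreover from this have "coprime (P ^ Suc t) c"
        using prime_poly_coprime[OF P(1)] field_poly_coprime_power by blast
      ultimately show "gauss W (P ^ Suc t * c) = gauss W (P ^ Suc t) * gauss (W * P ^ Suc t) c"
        by (intro gauss_mult monic_power mP)
    qed
    also have "\<dots> = gauss W (P ^ Suc t) * gauss_avg_coprime (insert P S) (W * P ^ Suc t) (n - ?d)"
      unfolding gauss_avg_coprime_def by (rule sum_distrib_left[symmetric])
    finally show ?thesis using True by simp
  next
    case False
    then show ?thesis by (simp add: A_def)
  qed
  finally show ?thesis .
qed

text \<open>The common factor of \<open>W\<close> and P^(t+1) is exactly P^t, so the squared bound
  is |P|^(2t+1).\<close>

lemma norm_gauss_prime_power_le: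
  assumes P: "P \<in> prime_polys" and t: "P ^ t dvd W" "\<not> P ^ Suc t dvd W"
  shows "norm (gauss W (P ^ Suc t)) \<le> q powr ((real t + 1 / 2) * real (degree P))"
proof -
  note mP = prime_polysD(1)[OF P]
  obtain W1 where W1: "W = P ^ t * W1" using t(1) by (elim dvdE)
  have "\<not> P dvd W1"
  proof
    assume "P dvd W1"
    then have "P ^ Suc t dvd W" unfolding W1 by (simp add: mult.commute mult_dvd_mono)
    with t(2) show False by blast
  qed
  then have "coprime W1 P" using prime_poly_coprime[OF P] coprime_commute by blast
  have Suc: "P ^ Suc t = P ^ t * P" by (simp add: mult.commute)
  have degPt: "degree (P ^ i) = i * degree P" for i
    using mP by (simp add: degree_power_eq monic_nonzero)
  have "norm (gauss W (P ^ Suc t)) ^ 2 \<le> q ^ degree (P ^ t * P) * q ^ degree (P ^ t)"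
    using norm_gauss_sq_le[OF monic_power[OF mP, of t] mP \<open>coprime W1 P\<close>] unfolding W1 Suc by simp
  also have "\<dots> = q ^ (Suc t * degree P) * q ^ (t * degree P)" by (simp only: Suc[symmetric] degPt)
  also have "\<dots> = q powr real (Suc t * degree P + t * degree P)"
    by (simp only: q_powr_nat power_add)
  also have "\<dots> = (q powr ((real t + 1 / 2) * real (degree P))) ^ 2"
  proof -
    have "(q powr ((real t + 1 / 2) * real (degree P))) ^ 2 =
        q powr ((real t + 1 / 2) * real (degree P) + (real t + 1 / 2) * real (degree P))"
      by (simp only: power2_eq_square powr_add)
    also have "(real t + 1 / 2) * real (degree P) + (real t + 1 / 2) * real (degree P) =
        real (Suc t * degree P + t * degree P)" by (simp add: algebra_simps)
    finally show ?thesis by simp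
  qed
  finally show ?thesis by (rule power2_le_imp_le) simp
qed

text \<open>Inductions on S, on n and on the degree of \<open>W\<close>. The sum for
  \<open>insert P S\<close> at n equals the sum for S at n minus a multiple of itself at n - (t + 1)
  deg P with frequency W P^(t+1). The exponent of this second term changes by (t + 1/2)p - (4/3 -
  1/4)(t + 1)p <= -7p/12 with p = deg P, so its factor is at most q^(-1/2) <= 1/2. Hence the bound
  2L reproduces itself from L + 2L/2.\<close>

lemma norm_gauss_avg_coprime_le:
  assumes K: "K > 0" "\<And>W n. W \<noteq> 0 \<Longrightarrow> norm (gauss_avg W n) \<le> K * q powr (4 * real n / 3 + real (degree W) / 4)"
    and S: "finite S" "S \<subseteq> prime_polys" and W: "W \<noteq> 0"
  shows "norm (gauss_avg_coprime S W n) \<le> 2 ^ card S * K * q powr (4 * real n / 3 + real (degree W) / 4)"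
  using S W
proof (induction S arbitrary: W n rule: finite_induct)
  case empty
  then show ?case using K(2) by (simp add: gauss_avg_coprime_empty)
next
  case (insert P S)
  then have P: "P \<in> prime_polys" "P \<notin> S" and S: "S \<subseteq> prime_polys" by auto
  note mP = prime_polysD(1)[OF P(1)]
  define B where "B W n = q powr (4 * real n / 3 + real (degree W) / 4)" for W :: "'k poly" and n
  define L where "L = 2 ^ card S * K"
  have L: "L > 0" using K(1) by (simp add: L_def)
  have IH: "norm (gauss_avg_coprime S W n) \<le> L * B W n" if "W \<noteq> 0" for W n
    using insert.IH[OF S that] by (simp add: L_def B_def)
  have "\<forall>W. W \<noteq> 0 \<longrightarrow> norm (gauss_avg_coprime (insert P S) W n) \<le> 2 * L * B W n"
  proof (induction n rule: less_induct)
    case (less n)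
    show ?case
    proof (intro allI impI)
      fix W :: "'k poly" assume "W \<noteq> 0"
      then show "norm (gauss_avg_coprime (insert P S) W n) \<le> 2 * L * B W n"
      proof (induction "degree W" arbitrary: W rule: less_induct)
        case (less W)
        note outer = \<open>\<And>y. y < n \<Longrightarrow> \<forall>W. W \<noteq> 0 \<longrightarrow> norm (gauss_avg_coprime (insert P S) W y) \<le> 2 * L * B W y\<close>
        show ?case
        \<comment> \<open>Removing P^3 lowers the degree of \<open>W\<close> at the same n, which is
          why the innermost induction is on that degree.\<close>
        proof (cases "P ^ 3 dvd W")
          case True
          then obtain V where V: "W = P ^ 3 * V" by (elim dvdE)
          have Vn: "V \<noteq> 0" using V less.prems by auto
          have "degree W = degree (P ^ 3) + degree V"
            unfolding V using Vn mP by (intro degree_mult_eq) (simp_all add: monic_nonzero)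
          then have deg: "degree V < degree W"
            using prime_polysD(5)[OF P(1)] mP by (simp add: degree_power_eq monic_nonzero)
          have "gauss_avg_coprime (insert P S) W n = gauss_avg_coprime (insert P S) V n"
            unfolding V using prime_poly_coprime[OF P(1)]
            by (intro gauss_avg_coprime_cube_mult) (simp add: coprime_commute)
          also have "norm \<dots> \<le> 2 * L * B V n" by (rule less.hyps[OF deg Vn])
          also have "\<dots> \<le> 2 * L * B W n"
            using L deg unfolding B_def by (intro mult_left_mono q_powr_mono) auto
          finally show ?thesis .
        next
          case False
          define t where "t = (if \<not> P dvd W then 0 else if \<not> P ^ 2 dvd W then 1 else 2 :: nat)"
          have t: "P ^ t dvd W" "\<not> P ^ Suc t dvd W" "t < 3"
            using False by (auto simp: t_def numeral_eq_Suc)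
          let ?d = "Suc t * degree P"
          have rec: "gauss_avg_coprime (insert P S) W n = gauss_avg_coprime S W n -
              (if ?d \<le> n then gauss W (P ^ Suc t) *
                gauss_avg_coprime (insert P S) (W * P ^ Suc t) (n - ?d) else 0)"
            using gauss_avg_coprime_insert[OF P S t] by simp
          have second: "norm (if ?d \<le> n then gauss W (P ^ Suc t) *
                gauss_avg_coprime (insert P S) (W * P ^ Suc t) (n - ?d) else 0) \<le> L * B W n"
          proof (cases "?d \<le> n")
            case True
            have lt: "n - ?d < n" using True prime_polysD(5)[OF P(1)] by simp
            have nz: "W * P ^ Suc t \<noteq> 0" using less.prems mP by (simp add: monic_nonzero)
            have deg: "degree (W * P ^ Suc t) = degree W + ?d"
              using degree_mult_eq[OF less.prems monic_nonzero[OF monic_power[OF mP, of "Suc t"]]]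
                degree_power_eq[OF monic_nonzero[OF mP], of "Suc t"] by (simp only:)
            have "norm (gauss W (P ^ Suc t) * gauss_avg_coprime (insert P S) (W * P ^ Suc t) (n - ?d)) \<le>
                q powr ((real t + 1 / 2) * real (degree P)) * (2 * L * B (W * P ^ Suc t) (n - ?d))"
              unfolding norm_mult using outer[OF lt] nz
              by (intro mult_mono norm_gauss_prime_power_le[OF P(1) t(1,2)]) auto
            also have "\<dots> = 2 * L * q powr ((real t + 1 / 2) * real (degree P) +
                (4 * real (n - ?d) / 3 + real (degree W + ?d) / 4))"
              unfolding B_def deg by (simp only: powr_add mult_ac)
            also have "\<dots> \<le> 2 * L * q powr (- 1 / 2 + (4 * real n / 3 + real (degree W) / 4))"
            proof (intro mult_left_mono q_powr_mono)
              define p where "p = real (degree P)"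
              have p: "p \<ge> 1" using prime_polysD(5)[OF P(1)] by (simp add: p_def)
              have tp: "real t * p \<ge> 0" using p by simp
              have d: "real (n - ?d) = real n - (real t * p + p)" "real (degree W + ?d) = real (degree W) + (real t * p + p)"
                using True by (simp_all add: of_nat_diff p_def algebra_simps)
              have e: "(real t + 1 / 2) * real (degree P) = real t * p + p / 2"
                by (simp add: p_def algebra_simps)
              show "(real t + 1 / 2) * real (degree P) + (4 * real (n - ?d) / 3 + real (degree W + ?d) / 4) \<le>
                  - 1 / 2 + (4 * real n / 3 + real (degree W) / 4)"
                unfolding d e using p tp by argo
            qed (use L in simp)
            also have "\<dots> = 2 * L * (q powr (- 1 / 2) * B W n)" by (simp only: powr_add B_def)
            also have "\<dots> \<le> 2 * L * (1 / 2 * B W n)"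
              using L q_powr_half unfolding B_def by (intro mult_left_mono mult_right_mono) auto
            finally show ?thesis using True by simp
          next
            case False
            then show ?thesis using L by (simp add: B_def)
          qed
          have "norm (gauss_avg_coprime (insert P S) W n) \<le> L * B W n + L * B W n"
            unfolding rec by (rule order_trans[OF norm_triangle_ineq4 add_mono[OF IH[OF less.prems] second]])
          then show ?thesis by simp
        qed
      qed
    qed
  qed
  then have "norm (gauss_avg_coprime (insert P S) W n) \<le> 2 * L * B W n" using insert.prems(2) by blast
  also have "2 * L * B W n = 2 ^ card (insert P S) * K * q powr (4 * real n / 3 + real (degree W) / 4)"
    using insert.hyps by (simp add: L_def B_def)
  finally show ?case .
qed

end

subsection \<open>Moduli divisible by a square\<close>

text \<open>Uniqueness comes from coprimality: the two smooth parts divide each other, being prime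
  to the other cofactor.\<close>

lemma smooth_mult_coprime_bij:
  fixes S :: "'k::finite_field poly set"
  assumes "S \<subseteq> prime_polys"
  shows "bij_betw (\<lambda>(h, c). h * c)
    (Sigma (smooth_upto S n) (\<lambda>h. {c \<in> monics (n - degree h). \<forall>P\<in>S. \<not> P dvd c})) (monics n)"
    (is "bij_betw ?f ?A _")
  unfolding bij_betw_def
proof (intro conjI equalityI subsetI)
  have cop: "coprime h c" if "h \<in> smooth S" "\<forall>P\<in>S. \<not> P dvd c" for h c :: "'k poly"
    using that coprime_iff_primes[of h c] by (auto simp: smooth_def prime_divisors_def)
  show "inj_on ?f ?A"
  proof (rule inj_onI)
    fix x y assume x: "x \<in> ?A" and y: "y \<in> ?A" and eq: "?f x = ?f y"
    obtain h c h' c' where xy: "x = (h, c)" "y = (h', c')" by (metis surj_pair)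
    have h: "h \<in> smooth S" "\<forall>P\<in>S. \<not> P dvd c" and h': "h' \<in> smooth S" "\<forall>P\<in>S. \<not> P dvd c'"
      using x y by (auto simp: xy smooth_upto_def)
    have eq': "h * c = h' * c'" using eq by (simp add: xy)
    have "h dvd c' * h'" using eq' by (metis dvd_triv_left mult.commute)
    then have "h dvd h'" using field_poly_coprime_dvd_mult[OF cop[OF h(1) h'(2)]] by blast
    moreover have "h' dvd c * h" using eq' by (metis dvd_triv_left mult.commute)
    then have "h' dvd h" using field_poly_coprime_dvd_mult[OF cop[OF h'(1) h(2)]] by blast
    ultimately have "h = h'" using monic_dvd_antisym h(1) h'(1) by (auto simp: smooth_def)
    moreover from this have "c = c'" using eq' h(1) by (auto simp: smooth_def monic_nonzero)
    ultimately show "x = y" by (simp add: xy)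
  qed
next
  fix F assume "F \<in> ?f ` ?A"
  then obtain h c where hc: "F = h * c" "h \<in> smooth S" "degree h \<le> n" "c \<in> monics (n - degree h)"
    by (auto simp: smooth_upto_def)
  have "h \<in> monics (degree h)" using hc(2) by (simp add: smooth_def monics_def)
  from monics_mult[OF this hc(4)] show "F \<in> monics n" using hc by simp
next
  fix F :: "'k poly" assume F: "F \<in> monics n"
  have "\<exists>h c. F = h * c \<and> h \<in> smooth S \<and> monic c \<and> (\<forall>P\<in>S. \<not> P dvd c)"
    using monicsD(1)[OF F]
  proof (induction rule: monic_prime_induct)
    case one
    have "\<forall>P\<in>S. \<not> P dvd 1" using assms prime_poly_not_dvd_one by blast
    moreover have "1 \<in> smooth S" using prime_poly_not_dvd_one by (auto simp: smooth_def prime_divisors_def)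
    ultimately show ?case by (intro exI[of _ 1]) simp
  next
    case (prime_mult P G)
    then obtain h c where hc: "G = h * c" "h \<in> smooth S" "monic c" "\<forall>R\<in>S. \<not> R dvd c" by blast
    show ?case
    proof (cases "P \<in> S")
      case True
      have "R \<in> S" if R: "R \<in> prime_polys" "R dvd P * h" for R
      proof -
        have "R dvd P \<or> R dvd h" using R prime_dvd_mult_iff_poly by blast
        then show ?thesis
        proof
          assume "R dvd P"
          then show ?thesis using prime_dvd_prime_eq[OF R(1) prime_mult(1)] True by blast
        next
          assume "R dvd h"
          then show ?thesis using hc(2) R(1) by (auto simp: smooth_def prime_divisors_def)
        qed
      qed
      then have "P * h \<in> smooth S" using hc(2) monic_mult prime_polysD(1)[OF prime_mult(1)]
        by (auto simp: smooth_def prime_divisors_def)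
      then show ?thesis using hc by (intro exI[of _ "P * h"] exI[of _ c]) (simp add: mult.assoc)
    next
      case False
      have "\<not> R dvd P * c" if R: "R \<in> S" for R
      proof -
        have "R \<in> prime_polys" using R assms by blast
        moreover have "R \<noteq> P" using False R by blast
        ultimately have "\<not> R dvd P" using prime_dvd_prime_eq prime_mult(1) by blast
        then show ?thesis using hc(4) R \<open>R \<in> prime_polys\<close> prime_dvd_mult_iff_poly by blast
      qed
      moreover have "monic (P * c)" using hc(3) monic_mult prime_polysD(1)[OF prime_mult(1)] by blast
      ultimately show ?thesis using hc by (intro exI[of _ h] exI[of _ "P * c"]) (simp add: mult_ac)
    qed
  qed
  then obtain h c where hc: "F = h * c" "h \<in> smooth S" "monic c" "\<forall>P\<in>S. \<not> P dvd c" by blast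
  have "n = degree h + degree c"
    using monicsD(2)[OF F] hc degree_mult_monic[of h c] by (auto simp: smooth_def)
  then show "F \<in> ?f ` ?A"
    using hc by (intro image_eqI[of _ _ "(h, c)"]) (auto simp: smooth_upto_def monics_def)
qed

context cubic_gauss
begin

context
  fixes S :: "'k poly set" and D :: "'k poly" and d :: nat
  assumes S: "finite S" "S \<subseteq> prime_polys"
  defines "D \<equiv> \<Prod>S" and "d \<equiv> degree (\<Prod>S)"
begin

lemma D: "monic D" "degree D = d" "D \<in> monics d"
  using monic_prod_primes[OF S(2)] by (simp_all add: D_def d_def monics_def)

lemma prime_dvd_D: "P \<in> prime_polys \<Longrightarrow> P dvd D \<longleftrightarrow> P \<in> S"
  using prime_not_dvd_prod_primes[OF S] dvd_prodI[OF S(1), of _ id] unfolding D_def by auto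

text \<open>With F = h c, h built from primes of S and c prime to S, twisted multiplicativity gives
  the factor at c the frequency D V D^2 h = D^3 h V, from which the cube drops out.\<close>

lemma sum_gauss_square_multiples:
  assumes "V \<noteq> 0"
  shows "(\<Sum>F\<in>monics n. gauss (D * V) (F * D ^ 2)) =
    (\<Sum>h\<in>smooth_upto S n. gauss (D * V) (D ^ 2 * h) * gauss_avg_coprime S (h * V) (n - degree h))"
proof -
  let ?C = "\<lambda>h. {c \<in> monics (n - degree h). \<forall>P\<in>S. \<not> P dvd c} :: 'k poly set"
  have fin: "finite (?C h)" for h by simp
  have "(\<Sum>F\<in>monics n. gauss (D * V) (F * D ^ 2)) =
      (\<Sum>z\<in>Sigma (smooth_upto S n) ?C. gauss (D * V) ((\<lambda>(h, c). h * c) z * D ^ 2))"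
    by (rule sum.reindex_bij_betw[OF smooth_mult_coprime_bij[OF S(2)], symmetric])
  also have "\<dots> = (\<Sum>h\<in>smooth_upto S n. \<Sum>c\<in>?C h. gauss (D * V) (h * c * D ^ 2))"
    by (subst sum.Sigma) (auto simp: case_prod_unfold)
  also have "\<dots> = (\<Sum>h\<in>smooth_upto S n. gauss (D * V) (D ^ 2 * h) * gauss_avg_coprime S (h * V) (n - degree h))"
  proof (rule sum.cong[OF refl])
    fix h assume "h \<in> smooth_upto S n"
    then have h: "monic h" "prime_divisors h \<subseteq> S" by (auto simp: smooth_upto_def smooth_def)
    have "(\<Sum>c\<in>?C h. gauss (D * V) (h * c * D ^ 2)) =
        (\<Sum>c\<in>?C h. gauss (D * V) (D ^ 2 * h) * gauss (h * V) c)"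
    proof (rule sum.cong[OF refl])
      fix c assume "c \<in> ?C h"
      then have c: "monic c" "\<forall>P\<in>S. \<not> P dvd c" by (auto simp: monics_def)
      have Dh: "monic (D ^ 2 * h)" using D(1) h(1) by (intro monic_mult monic_power)
      have cD: "coprime c D"
        using coprime_iff_primes[OF c(1), of D] prime_dvd_D c(2) by blast
      have "coprime (D ^ 2) c"
        by (rule field_poly_coprime_power) (use cD in \<open>simp only: coprime_commute\<close>)
      moreover have "coprime h c"
        using coprime_iff_primes[OF h(1), of c] h(2) c(2) by (auto simp: prime_divisors_def)
      ultimately have "coprime (D ^ 2 * h) c" by (simp only: field_poly_coprime_mult_iff)
      then have "gauss (D * V) ((D ^ 2 * h) * c) = gauss (D * V) (D ^ 2 * h) * gauss (D * V * (D ^ 2 * h)) c"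
        by (rule gauss_mult[OF Dh c(1)])
      also have "D * V * (D ^ 2 * h) = D ^ 3 * (h * V)" by (simp add: power2_eq_square power3_eq_cube mult_ac)
      also have "gauss (D ^ 3 * (h * V)) c = gauss (h * V) c" by (rule gauss_cube_mult[OF c(1) cD])
      finally show "gauss (D * V) (h * c * D ^ 2) = gauss (D * V) (D ^ 2 * h) * gauss (h * V) c"
        by (simp only: mult_ac)
    qed
    then show "(\<Sum>c\<in>?C h. gauss (D * V) (h * c * D ^ 2)) =
        gauss (D * V) (D ^ 2 * h) * gauss_avg_coprime S (h * V) (n - degree h)"
      by (simp only: gauss_avg_coprime_def coprime_monics_def sum_distrib_left)
  qed
  finally show ?thesis .
qed

text \<open>The common factor g of frequency and modulus is split as k E with k dividing D and E
  prime to D/k; then E divides V and |g| <= |D| |E|. Replacing the one E by a sum over all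
  admissible E makes the bound summable over V.\<close>

lemma norm_gauss_square_le:
  assumes h: "h \<in> smooth S" and V: "V \<noteq> 0" "degree V \<le> v"
  shows "norm (gauss (D * V) (D ^ 2 * h)) \<le>
    (\<Sum>E\<in>smooth_upto S v. if E dvd V then q powr ((3 * real d + real (degree h) + real (degree E)) / 2) else 0)"
proof -
  let ?w = "\<lambda>E :: 'k poly. q powr ((3 * real d + real (degree h) + real (degree E)) / 2)"
  have mh: "monic h" using h by (simp add: smooth_def)
  have Dh: "monic (D ^ 2 * h)" using D(1) mh by (intro monic_mult monic_power)
  have degDh: "degree (D ^ 2 * h) = 2 * d + degree h"
    using degree_mult_monic[OF monic_power[OF D(1), of 2] mh] degree_power_eq[OF monic_nonzero[OF D(1)], of 2] D(2)
    by simp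
  obtain g where g: "monic g" "g dvd D ^ 2 * h" "g dvd D * V"
    "norm (gauss (D * V) (D ^ 2 * h)) \<le> q powr ((real (degree (D ^ 2 * h)) + real (degree g)) / 2)"
    using norm_gauss_le_gcd[OF Dh, of "D * V"] by blast
  obtain k E D1 where k: "monic k" "monic D1" "g = k * E" "D = k * D1" "coprime E D1"
    using exists_gcd_cofactors[OF D(1), of g] by blast
  have mE: "monic E" using k(1,3) g(1) monic_mult_cancel by blast
  have "k * E dvd k * (D1 * V)" using g(3) unfolding k(3,4) by (simp add: mult.assoc)
  then have "E dvd D1 * V" using monic_nonzero[OF k(1)] by simp
  then have EV: "E dvd V" using k(5) field_poly_coprime_dvd_mult by blast
  have "degree E \<le> v" using dvd_imp_degree_le[OF EV V(1)] V(2) by simp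
  moreover have "prime_divisors E \<subseteq> S"
  proof
    fix P assume "P \<in> prime_divisors E"
    then have P: "P \<in> prime_polys" "P dvd E" by (auto simp: prime_divisors_def)
    then have "P dvd D ^ 2 * h" using g(2) k(3) by (meson dvd_mult dvd_trans)
    then have "P dvd D \<or> P dvd h"
      using prime_dvd_mult_iff_poly[OF P(1)] prime_elem_dvd_power[OF prime_polysD(3)[OF P(1)]] by blast
    then show "P \<in> S" using prime_dvd_D[OF P(1)] h P(1) by (auto simp: smooth_def prime_divisors_def)
  qed
  ultimately have E: "E \<in> smooth_upto S v" using mE by (simp add: smooth_upto_def smooth_def)
  have "degree k \<le> d" using degree_mult_monic[OF k(1,2)] D(2) k(4) by simp
  then have "degree g \<le> d + degree E" using degree_mult_monic[OF k(1) mE] k(3) by simp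
  then have "(real (degree (D ^ 2 * h)) + real (degree g)) / 2 \<le> (3 * real d + real (degree h) + real (degree E)) / 2"
    unfolding degDh by simp
  with g(4) have "norm (gauss (D * V) (D ^ 2 * h)) \<le> ?w E" using q_powr_mono by (meson order_trans)
  also have "\<dots> = (if E dvd V then ?w E else 0)" using EV by simp
  also have "\<dots> \<le> (\<Sum>E\<in>smooth_upto S v. if E dvd V then ?w E else 0)"
    using E by (intro member_le_sum) auto
  finally show ?thesis .
qed

lemma card_multiples_below:
  fixes E :: "'k poly"
  assumes "monic E" "degree E \<le> v"
  shows "real (card {V \<in> polys_below v - {0}. E dvd V}) \<le> q powr (real v - real (degree E))"
proof -
  have "{V \<in> polys_below v - {0}. E dvd V} \<subseteq> (\<lambda>U. E * U) ` polys_below (v - degree E)"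
  proof
    fix V assume V: "V \<in> {V \<in> polys_below v - {0}. E dvd V}"
    then obtain U where U: "V = E * U" by (auto elim: dvdE)
    then have "U \<noteq> 0" "E \<noteq> 0" using V by auto
    then have "degree E + degree U < v" using V U by (auto simp: polys_below_iff degree_mult_eq)
    then have "degree U < v - degree E" by linarith
    then have "U \<in> polys_below (v - degree E)" by (simp add: polys_below_iff)
    then show "V \<in> (\<lambda>U. E * U) ` polys_below (v - degree E)" using U by blast
  qed
  then have "card {V \<in> polys_below v - {0}. E dvd V} \<le> card ((\<lambda>U. E * U) ` polys_below (v - degree E))"
    by (rule card_mono[rotated]) simp
  also have "\<dots> \<le> CARD('k) ^ (v - degree E)"
    using card_image_le[OF finite_polys_below, of "\<lambda>U. E * U" "v - degree E"] by (simp add: card_polys_below)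
  finally have "real (card {V \<in> polys_below v - {0}. E dvd V}) \<le> real (CARD('k) ^ (v - degree E))"
    by (rule of_nat_mono)
  also have "\<dots> = q powr (real v - real (degree E))"
    using assms(2) by (simp add: q_powr_nat[symmetric] of_nat_diff)
  finally show ?thesis .
qed

text \<open>For fixed E the multiples V number at most q^(v - deg E), which turns |E|^(1/2) into
  |E|^(-1/2). The powers of |h| combine to |h|^(-7/12), at most |h|^(-1/2). The averages prime to S
  and the two sums over h and E each cost 2^|S|, whence the 8.\<close>

lemma sum_norm_gauss_square_multiples_le:
  assumes K: "K > 0" "\<And>W n. W \<noteq> 0 \<Longrightarrow> norm (gauss_avg W n) \<le> K * q powr (4 * real n / 3 + real (degree W) / 4)"
  shows "(\<Sum>V\<in>polys_below v - {0}. norm (\<Sum>F\<in>monics n. gauss (D * V) (F * D ^ 2))) \<le>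
    8 ^ card S * K * q powr (3 * real d / 2 + 4 * real n / 3 + 5 * real v / 4)"
proof -
  let ?t = "2 ^ card S :: real"
  let ?X = "3 * real d / 2 + 4 * real n / 3 + real v / 4"
  let ?H = "smooth_upto S n" and ?E = "smooth_upto S v"
  have 1: "norm (\<Sum>F\<in>monics n. gauss (D * V) (F * D ^ 2)) \<le>
      (\<Sum>h\<in>?H. \<Sum>E\<in>?E. if E dvd V then
        ?t * K * q powr ?X * q powr (- real (degree h) / 2) * q powr (real (degree E) / 2) else 0)"
    if V: "V \<in> polys_below v - {0}" for V
  proof -
    have Vn: "V \<noteq> 0" and dV: "degree V \<le> v" using V by (auto simp: polys_below_iff)
    show ?thesis unfolding sum_gauss_square_multiples[OF Vn]
    proof (rule sum_norm_le)
      fix h assume h: "h \<in> ?H"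
      then have hs: "h \<in> smooth S" and mh: "monic h" and dh: "degree h \<le> n"
        by (auto simp: smooth_upto_def smooth_def)
      let ?w = "\<lambda>E :: 'k poly. if E dvd V then q powr ((3 * real d + real (degree h) + real (degree E)) / 2) else 0"
      let ?b = "?t * K * q powr (4 * real (n - degree h) / 3 + real (degree (h * V)) / 4)"
      have hV: "h * V \<noteq> 0" using Vn monic_nonzero[OF mh] by simp
      have deg: "degree (h * V) = degree h + degree V" using Vn monic_nonzero[OF mh] by (rule degree_mult_eq[rotated])
      have "norm (gauss (D * V) (D ^ 2 * h) * gauss_avg_coprime S (h * V) (n - degree h)) \<le> (\<Sum>E\<in>?E. ?w E) * ?b"
        unfolding norm_mult
        by (intro mult_mono norm_gauss_square_le[OF hs Vn dV] norm_gauss_avg_coprime_le[OF K S hV])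
          (auto intro!: sum_nonneg)
      also have "\<dots> = (\<Sum>E\<in>?E. ?w E * ?b)" by (rule sum_distrib_right)
      also have "\<dots> \<le> (\<Sum>E\<in>?E. if E dvd V then
        ?t * K * q powr ?X * q powr (- real (degree h) / 2) * q powr (real (degree E) / 2) else 0)"
      proof (rule sum_mono)
        fix E assume "E \<in> ?E"
        let ?e = "(3 * real d + real (degree h) + real (degree E)) / 2"
        let ?f = "4 * real (n - degree h) / 3 + real (degree (h * V)) / 4"
        have "q powr ?e * q powr ?f \<le> q powr (?X + - real (degree h) / 2 + real (degree E) / 2)"
        proof -
          have "real (n - degree h) = real n - real (degree h)" using dh by (simp add: of_nat_diff)
          moreover have "real (degree V) \<le> real v" using dV by simp
          moreover have "real (degree h) \<ge> 0" by simp
          ultimately have "?e + ?f \<le> ?X + - real (degree h) / 2 + real (degree E) / 2"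
            unfolding deg of_nat_add by argo
          then show ?thesis unfolding powr_add[symmetric] by (rule q_powr_mono)
        qed
        then have "?t * K * (q powr ?e * q powr ?f) \<le>
            ?t * K * (q powr ?X * q powr (- real (degree h) / 2) * q powr (real (degree E) / 2))"
          using K(1) unfolding powr_add[symmetric] by (intro mult_left_mono) auto
        then show "?w E * ?b \<le> (if E dvd V then
            ?t * K * q powr ?X * q powr (- real (degree h) / 2) * q powr (real (degree E) / 2) else 0)"
          by (cases "E dvd V") (simp_all only: if_True if_False mult_zero_left mult_ac order_refl)
      qed
      finally show "norm (gauss (D * V) (D ^ 2 * h) * gauss_avg_coprime S (h * V) (n - degree h)) \<le>
        (\<Sum>E\<in>?E. if E dvd V then
        ?t * K * q powr ?X * q powr (- real (degree h) / 2) * q powr (real (degree E) / 2) else 0)" .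
    qed
  qed
  have "(\<Sum>V\<in>polys_below v - {0}. norm (\<Sum>F\<in>monics n. gauss (D * V) (F * D ^ 2))) \<le>
      (\<Sum>V\<in>polys_below v - {0}. \<Sum>h\<in>?H. \<Sum>E\<in>?E. if E dvd V then
        ?t * K * q powr ?X * q powr (- real (degree h) / 2) * q powr (real (degree E) / 2) else 0)"
    by (rule sum_mono) (rule 1)
  also have "\<dots> = (\<Sum>h\<in>?H. \<Sum>E\<in>?E. \<Sum>V\<in>polys_below v - {0}. if E dvd V then
        ?t * K * q powr ?X * q powr (- real (degree h) / 2) * q powr (real (degree E) / 2) else 0)"
    by (subst sum.swap, rule sum.cong[OF refl], rule sum.swap)
  also have "\<dots> \<le> (\<Sum>h\<in>?H. \<Sum>E\<in>?E.
      ?t * K * q powr (?X + real v) * (q powr (- real (degree h) / 2) * q powr (- real (degree E) / 2)))"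
  proof (intro sum_mono)
    fix h E assume "E \<in> ?E"
    then have E: "monic E" "degree E \<le> v" by (auto simp: smooth_upto_def smooth_def)
    let ?a = "?t * K * q powr ?X * q powr (- real (degree h) / 2) * q powr (real (degree E) / 2)"
    have "(\<Sum>V\<in>polys_below v - {0}. if E dvd V then ?a else 0) = real (card {V \<in> polys_below v - {0}. E dvd V}) * ?a"
      by (simp add: sum.If_cases Int_def)
    also have "\<dots> \<le> q powr (real v - real (degree E)) * ?a"
      using K(1) by (intro mult_right_mono card_multiples_below[OF E]) auto
    also have "\<dots> = ?t * K * q powr ?X * q powr (- real (degree h) / 2) *
        (q powr (real v - real (degree E)) * q powr (real (degree E) / 2))" by (simp only: mult_ac)
    also have "q powr (real v - real (degree E)) * q powr (real (degree E) / 2) =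
        q powr (real v + - real (degree E) / 2)"
    proof -
      have "(real v - real (degree E)) + real (degree E) / 2 = real v + - real (degree E) / 2" by argo
      then show ?thesis by (simp only: powr_add[symmetric])
    qed
    finally show "(\<Sum>V\<in>polys_below v - {0}. if E dvd V then ?a else 0) \<le>
        ?t * K * q powr (?X + real v) * (q powr (- real (degree h) / 2) * q powr (- real (degree E) / 2))"
      by (simp only: powr_add mult_ac)
  qed
  also have "\<dots> = ?t * K * q powr (?X + real v) *
      ((\<Sum>h\<in>?H. q powr (- real (degree h) / 2)) * (\<Sum>E\<in>?E. q powr (- real (degree E) / 2)))"
    by (simp only: sum_product) (simp only: sum_distrib_left[symmetric])
  also have "\<dots> \<le> ?t * K * q powr (?X + real v) * (?t * ?t)"
    using K(1) sum_smooth_le[OF S]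
    by (intro mult_left_mono mult_mono) (auto intro: sum_nonneg)
  also have "\<dots> = (?t * ?t * ?t) * K * q powr (?X + real v)" by (simp only: mult_ac)
  also have "?t * ?t * ?t = 8 ^ card S" by (simp add: power_mult_distrib[symmetric])
  also have "?X + real v = 3 * real d / 2 + 4 * real n / 3 + 5 * real v / 4" by argo
  finally show ?thesis .
qed

text \<open>After Poisson summation the zero frequency vanishes because a modulus of degree N is not
  a cube, and the frequencies not divisible by D vanish by \<open>gauss_eq_0\<close>. Writing V = D
  V' with deg V' < N - m - d, the exponent 3d/2 + 4(N - 2d)/3 + 5(N - m - d)/4 - (N - m) equals the
  stated one.\<close>

lemma norm_sum_chi_square_multiples_le:
  assumes K: "K > 0" "\<And>W n. W \<noteq> 0 \<Longrightarrow> norm (gauss_avg W n) \<le> K * q powr (4 * real n / 3 + real (degree W) / 4)"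
    and N: "m < N" "\<not> 3 dvd N" "2 * d \<le> N"
  shows "norm (\<Sum>F\<in>monics (N - 2 * d). \<Sum>a\<in>monics m. chi (F * D ^ 2) a) \<le>
    8 ^ card S * K * q powr (4 * real N / 3 + real (N - m) / 4 - 29 / 12 * real d)"
proof -
  let ?n = "N - 2 * d" and ?v = "N - m - d"
  let ?M = "monics ?n :: 'k poly set"
  define p where "p V = \<psi> (- coeff V (N - 1 - m))" for V
  have np: "norm (p V) = 1" for V by (simp add: p_def norm_psi)
  have cN: "F * D ^ 2 \<in> monics N" if "F \<in> ?M" for F
  proof -
    have "D ^ 2 \<in> monics (2 * d)"
      using D degree_power_eq[OF monic_nonzero[OF D(1)], of 2] monic_power by (simp add: monics_def)
    from monics_mult[OF that this] show ?thesis using N(3) by simp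
  qed
  have "of_nat (CARD('k) ^ (N - m)) * (\<Sum>F\<in>?M. \<Sum>a\<in>monics m. chi (F * D ^ 2) a) =
      (\<Sum>F\<in>?M. \<Sum>V\<in>polys_below (N - m). p V * gauss V (F * D ^ 2))"
    unfolding sum_distrib_left[of _ _ ?M]
  proof (rule sum.cong[OF refl])
    fix F assume "F \<in> ?M"
    then have c: "monic (F * D ^ 2)" "degree (F * D ^ 2) = N" using cN monicsD by blast+
    from poisson[OF c(1), of m] show "of_nat (CARD('k) ^ (N - m)) * (\<Sum>a\<in>monics m. chi (F * D ^ 2) a) =
        (\<Sum>V\<in>polys_below (N - m). p V * gauss V (F * D ^ 2))"
      unfolding c(2) p_def using N(1) by simp
  qed
  also have "\<dots> = (\<Sum>V\<in>polys_below (N - m). p V * (\<Sum>F\<in>?M. gauss V (F * D ^ 2)))"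
    by (subst sum.swap) (simp only: sum_distrib_left)
  also have "\<dots> = (\<Sum>V\<in>(\<lambda>V. D * V) ` (polys_below ?v - {0}). p V * (\<Sum>F\<in>?M. gauss V (F * D ^ 2)))"
  proof (rule sum.mono_neutral_right)
    show "(\<lambda>V. D * V) ` (polys_below ?v - {0}) \<subseteq> polys_below (N - m)"
    proof
      fix x assume "x \<in> (\<lambda>V. D * V) ` (polys_below ?v - {0})"
      then obtain V where V0: "x = D * V" "V \<in> polys_below ?v - {0}" by blast
      then have V: "x = D * V" "V \<noteq> 0" "degree V < ?v" by (auto simp: polys_below_iff)
      then have "degree x = d + degree V" using D(1,2) by (simp add: degree_mult_eq monic_nonzero)
      moreover have "d + degree V < N - m" using V(3) by linarith
      ultimately show "x \<in> polys_below (N - m)" by (simp add: polys_below_iff)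
    qed
    show "\<forall>V\<in>polys_below (N - m) - (\<lambda>V. D * V) ` (polys_below ?v - {0}).
        p V * (\<Sum>F\<in>?M. gauss V (F * D ^ 2)) = 0"
    proof
      fix V assume V: "V \<in> polys_below (N - m) - (\<lambda>V. D * V) ` (polys_below ?v - {0})"
      have "gauss V (F * D ^ 2) = 0" if F: "F \<in> ?M" for F
      proof (cases "V = 0")
        case True
        have c: "monic (F * D ^ 2)" "degree (F * D ^ 2) = N" using cN[OF F] monicsD by blast+
        have "\<nexists>A. monic A \<and> F * D ^ 2 = A ^ 3"
        proof
          assume "\<exists>A. monic A \<and> F * D ^ 2 = A ^ 3"
          then obtain A where "monic A" "F * D ^ 2 = A ^ 3" by blast
          then have "N = 3 * degree A" using c(2) by (simp add: degree_power_eq monic_nonzero)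
          then show False using N(2) by simp
        qed
        then show ?thesis using sum_chi_noncube[OF c(1)] True by (simp add: gauss_def)
      next
        case False
        have "\<not> D dvd V"
        proof
          assume "D dvd V"
          then obtain U where U: "V = D * U" by (elim dvdE)
          then have "U \<noteq> 0" using False by auto
          then have "d + degree U < N - m"
            using V False D(1,2) by (auto simp: U polys_below_iff degree_mult_eq monic_nonzero)
          then have "degree U < ?v" by linarith
          then have "U \<in> polys_below ?v - {0}" using \<open>U \<noteq> 0\<close> by (simp add: polys_below_iff)
          then show False using V U by blast
        qed
        then have "gauss V (D * (F * D)) = 0"
          using F D(1) by (intro gauss_eq_0 monic_mult) (auto simp: monics_def)
        then show ?thesis by (simp add: power2_eq_square mult_ac)
      qed
      then show "p V * (\<Sum>F\<in>?M. gauss V (F * D ^ 2)) = 0" by simp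
    qed
  qed simp
  also have "\<dots> = (\<Sum>V\<in>polys_below ?v - {0}. p (D * V) * (\<Sum>F\<in>?M. gauss (D * V) (F * D ^ 2)))"
    by (subst sum.reindex) (use D(1) in \<open>auto simp: inj_on_def monic_nonzero\<close>)
  finally have eq: "of_nat (CARD('k) ^ (N - m)) * (\<Sum>F\<in>?M. \<Sum>a\<in>monics m. chi (F * D ^ 2) a) =
      (\<Sum>V\<in>polys_below ?v - {0}. p (D * V) * (\<Sum>F\<in>?M. gauss (D * V) (F * D ^ 2)))" .
  have "q ^ (N - m) * norm (\<Sum>F\<in>?M. \<Sum>a\<in>monics m. chi (F * D ^ 2) a) =
      norm (\<Sum>V\<in>polys_below ?v - {0}. p (D * V) * (\<Sum>F\<in>?M. gauss (D * V) (F * D ^ 2)))"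
    unfolding eq[symmetric] norm_mult by (simp add: norm_power)
  also have "\<dots> \<le> (\<Sum>V\<in>polys_below ?v - {0}. norm (\<Sum>F\<in>?M. gauss (D * V) (F * D ^ 2)))"
    by (rule sum_norm_le) (simp add: norm_mult np)
  also have "\<dots> \<le> 8 ^ card S * K * q powr (3 * real d / 2 + 4 * real ?n / 3 + 5 * real ?v / 4)"
    by (rule sum_norm_gauss_square_multiples_le[OF K])
  finally have le: "q ^ (N - m) * norm (\<Sum>F\<in>?M. \<Sum>a\<in>monics m. chi (F * D ^ 2) a) \<le>
    8 ^ card S * K * q powr (3 * real d / 2 + 4 * real ?n / 3 + 5 * real ?v / 4)" .
  show ?thesis
  proof (cases "d \<le> N - m")
    case True
    have "real ?n = real N - 2 * real d" "real ?v = real (N - m) - real d"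
      using N(3) True by (simp_all add: of_nat_diff)
    then have "3 * real d / 2 + 4 * real ?n / 3 + 5 * real ?v / 4 =
        real (N - m) + (4 * real N / 3 + real (N - m) / 4 - 29 / 12 * real d)" by argo
    then have "q ^ (N - m) * norm (\<Sum>F\<in>?M. \<Sum>a\<in>monics m. chi (F * D ^ 2) a) \<le>
        q ^ (N - m) * (8 ^ card S * K * q powr (4 * real N / 3 + real (N - m) / 4 - 29 / 12 * real d))"
      using le by (simp only: powr_add q_powr_nat mult_ac)
    then show ?thesis using q_ge_7 by (simp only: mult_le_cancel_left_pos zero_less_power)
  next
    \<comment> \<open>For d > N - m no nonzero multiple of D is short enough to be a frequency, so
      the whole sum is 0.\<close>
    case False
    then have "?v = 0" by simp
    then have "(\<Sum>F\<in>?M. \<Sum>a\<in>monics m. chi (F * D ^ 2) a) = 0" using eq q_ge_7 by simp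
    then show ?thesis using K(1) by simp
  qed
qed

end

end

subsection \<open>Euler products\<close>

lemma prod_1_plus:
  fixes f :: "'a \<Rightarrow> 'b::comm_ring_1"
  assumes "finite S"
  shows "(\<Prod>x\<in>S. 1 + f x) = (\<Sum>T\<in>Pow S. \<Prod>x\<in>T. f x)"
  using prod_add[OF assms, of f "\<lambda>_. 1"] by (simp add: add.commute)

lemma prod_1_minus_ge:
  fixes y :: "'a \<Rightarrow> real"
  assumes "finite S" "\<And>x. x \<in> S \<Longrightarrow> 0 \<le> y x" "\<And>x. x \<in> S \<Longrightarrow> y x \<le> 1"
  shows "1 - (\<Sum>x\<in>S. y x) \<le> (\<Prod>x\<in>S. 1 - y x)"
  using assms
proof (induction S)
  case (insert a S)
  have 1: "(\<Prod>x\<in>S. 1 - y x) \<le> 1" using insert.prems by (intro prod_le_1) auto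
  have "y a * (\<Prod>x\<in>S. 1 - y x) \<le> y a * 1" using 1 insert.prems by (intro mult_left_mono) auto
  then have "1 - (y a + (\<Sum>x\<in>S. y x)) \<le> (\<Prod>x\<in>S. 1 - y x) - y a * (\<Prod>x\<in>S. 1 - y x)"
    using insert by auto
  also have "\<dots> = (1 - y a) * (\<Prod>x\<in>S. 1 - y x)" by (simp add: algebra_simps)
  finally show ?case using insert by simp
qed simp

text \<open>A finite set of primes encodes its square-free monic product D, and (-1)^card is the
  Moebius function of D.\<close>

definition prime_sets :: "nat \<Rightarrow> 'k::finite_field poly set set" where
  "prime_sets d = {T. finite T \<and> T \<subseteq> prime_polys \<and> degree (\<Prod>T) = d}"

lemma prime_divisors_prod:
  assumes "finite T" "T \<subseteq> prime_polys"
  shows "prime_divisors (\<Prod>T) = T"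
  using prime_not_dvd_prod_primes[OF assms] assms by (auto simp: prime_divisors_def dvd_prodI)

lemma inj_on_prod_primes: "inj_on \<Prod> {T. finite T \<and> T \<subseteq> (prime_polys :: 'k::finite_field poly set)}"
  by (rule inj_on_inverseI[of _ prime_divisors]) (simp add: prime_divisors_prod)

lemma prod_prime_sets: "T \<in> prime_sets d \<Longrightarrow> \<Prod>T \<in> monics d"
  by (auto simp: prime_sets_def monics_def monic_prod_primes)

lemma finite_prime_sets [simp]: "finite (prime_sets d :: 'k::finite_field poly set set)"
  and card_prime_sets_le: "card (prime_sets d :: 'k::finite_field poly set set) \<le> CARD('k) ^ d"
proof -
  have *: "inj_on \<Prod> (prime_sets d :: 'k::finite_field poly set set)"
    by (rule inj_on_subset[OF inj_on_prod_primes]) (auto simp: prime_sets_def)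
  have "\<Prod> ` prime_sets d \<subseteq> (monics d :: 'k poly set)" using prod_prime_sets by blast
  from inj_on_finite[OF * this finite_monics] card_inj_on_le[OF * this finite_monics]
  show "finite (prime_sets d :: 'k poly set set)" "card (prime_sets d :: 'k poly set set) \<le> CARD('k) ^ d"
    by (simp_all only: card_monics)
qed

context cubic_gauss
begin

text \<open>The coefficient of u^d in the formal product of 1 + f(P) u^(deg P) over all
  primes.\<close>

definition prime_set_sum :: "('k poly \<Rightarrow> real) \<Rightarrow> nat \<Rightarrow> real" where
  "prime_set_sum f d = (\<Sum>T\<in>prime_sets d. \<Prod>P\<in>T. f P)"

text \<open>The product of 1 + f(P) in multiplied-out form, which gives convergence by absolute
  summability. \<open>tendsto_euler_product\<close> identifies it with the unconditional
  product.\<close>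

definition euler_product :: "('k poly \<Rightarrow> real) \<Rightarrow> real" where
  "euler_product f = (\<Sum>\<^sub>\<infinity>T\<in>{T. finite T \<and> T \<subseteq> prime_polys}. \<Prod>P\<in>T. f P)"

text \<open>Decay like |P|^-2 leaves size q^-d for the coefficient of degree d, as there are at most
  q^d square-free monic polynomials of that degree.\<close>

definition small_on_primes :: "('k poly \<Rightarrow> real) \<Rightarrow> bool" where
  "small_on_primes f \<longleftrightarrow> (\<forall>P\<in>prime_polys. \<bar>f P\<bar> \<le> 1 / q ^ (2 * degree P))"

lemma card_prime_sets_le_q: "real (card (prime_sets d :: 'k poly set set)) \<le> q ^ d"
  using card_prime_sets_le[where ?'k = 'k, of d] by (metis card_q of_nat_le_iff of_nat_power)

lemma abs_prod_small_le:
  assumes "small_on_primes f" "T \<in> prime_sets d"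
  shows "\<bar>\<Prod>P\<in>T. f P\<bar> \<le> 1 / q ^ (2 * d)"
proof -
  have T: "finite T" "T \<subseteq> prime_polys" "degree (\<Prod>T) = d" using assms(2) by (auto simp: prime_sets_def)
  have "\<bar>\<Prod>P\<in>T. f P\<bar> = (\<Prod>P\<in>T. \<bar>f P\<bar>)" by (rule abs_prod)
  also have "\<dots> \<le> (\<Prod>P\<in>T. 1 / q ^ (2 * degree P))"
    using assms(1) T(2) unfolding small_on_primes_def by (intro prod_mono) auto
  also have "\<dots> = 1 / q ^ (2 * d)"
    unfolding T(3)[symmetric] degree_prod_primes[OF T(1,2)]
    by (simp add: prod_dividef power_sum sum_distrib_left)
  finally show ?thesis .
qed

lemma sum_abs_prod_small_le:
  assumes "small_on_primes f"
  shows "(\<Sum>T\<in>prime_sets d. \<bar>\<Prod>P\<in>T. f P\<bar>) \<le> (1 / q) ^ d"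
proof -
  have "(\<Sum>T\<in>prime_sets d. \<bar>\<Prod>P\<in>T. f P\<bar>) \<le> real (card (prime_sets d :: 'k poly set set)) * (1 / q ^ (2 * d))"
    using abs_prod_small_le[OF assms] by (rule sum_bounded_above)
  also have "\<dots> \<le> q ^ d * (1 / q ^ (2 * d))"
    using card_prime_sets_le_q[of d] q_ge_7 by (intro mult_right_mono) auto
  also have "\<dots> = (1 / q) ^ d" using q_ge_7 by (simp add: mult_2 power_add power_one_over)
  finally show ?thesis .
qed

lemma abs_prime_set_sum_le:
  assumes "small_on_primes f"
  shows "\<bar>prime_set_sum f d\<bar> \<le> (1 / q) ^ d"
  unfolding prime_set_sum_def
  by (rule order_trans[OF sum_abs sum_abs_prod_small_le[OF assms]])

lemma disjoint_prime_sets: "d \<noteq> d' \<Longrightarrow> prime_sets d \<inter> prime_sets d' = {}"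
  by (auto simp: prime_sets_def)

lemma sum_UN_prime_sets:
  "(\<Sum>T\<in>(\<Union>d\<le>n. prime_sets d). F T) = (\<Sum>d\<le>n. \<Sum>T\<in>prime_sets d. F (T :: 'k poly set))"
  for F :: "'k poly set \<Rightarrow> real"
  by (rule sum.UNION_disjoint) (simp_all add: disjoint_prime_sets)

lemma euler_product_has_sum:
  assumes "small_on_primes f"
  shows "((\<lambda>T. \<Prod>P\<in>T. f P) has_sum euler_product f) {T. finite T \<and> T \<subseteq> prime_polys}"
proof -
  let ?A = "{T. finite T \<and> T \<subseteq> (prime_polys :: 'k poly set)}"
  have "(\<lambda>T. \<Prod>P\<in>T. f P) summable_on ?A"
  proof (rule abs_summable_summable, rule nonneg_bdd_above_summable_on)
    show "bdd_above (sum (\<lambda>T. norm (\<Prod>P\<in>T. f P)) ` {F. F \<subseteq> ?A \<and> finite F})"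
    proof (rule bdd_aboveI2)
      fix B assume B: "B \<in> {F. F \<subseteq> ?A \<and> finite F}"
      define n where "n = Max ((\<lambda>T. degree (\<Prod>T)) ` B)"
      have sub: "B \<subseteq> (\<Union>d\<le>n. prime_sets d)" using B by (auto simp: prime_sets_def n_def)
      have "(\<Sum>T\<in>B. norm (\<Prod>P\<in>T. f P)) \<le> (\<Sum>T\<in>(\<Union>d\<le>n. prime_sets d). \<bar>\<Prod>P\<in>T. f P\<bar>)"
        unfolding real_norm_def using sub by (intro sum_mono2) auto
      also have "\<dots> = (\<Sum>d\<le>n. \<Sum>T\<in>prime_sets d. \<bar>\<Prod>P\<in>T. f P\<bar>)" by (rule sum_UN_prime_sets)
      also have "\<dots> \<le> (\<Sum>d\<le>n. (1 / q) ^ d)" by (intro sum_mono sum_abs_prod_small_le assms)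
      also have "\<dots> \<le> 2" using q_ge_7 by (intro geometric_half_le) auto
      finally show "(\<Sum>T\<in>B. norm (\<Prod>P\<in>T. f P)) \<le> 2" .
    qed
  qed simp
  then show ?thesis unfolding euler_product_def by (rule has_sum_infsum)
qed

lemma prime_set_sum_sums:
  assumes "small_on_primes f"
  shows "prime_set_sum f sums euler_product f"
  unfolding sums_def_le
proof -
  have "filterlim (\<lambda>n. \<Union>d\<le>n. prime_sets d) (finite_subsets_at_top {T. finite T \<and> T \<subseteq> (prime_polys :: 'k poly set)}) sequentially"
    unfolding filterlim_finite_subsets_at_top
  proof (intro allI impI)
    fix B assume B: "finite B \<and> B \<subseteq> {T. finite T \<and> T \<subseteq> (prime_polys :: 'k poly set)}"
    define n where "n = Max ((\<lambda>T. degree (\<Prod>T)) ` B)"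
    have sub: "B \<subseteq> (\<Union>d\<le>m. prime_sets d)" if "n \<le> m" for m
    proof
      fix T assume T: "T \<in> B"
      then have "degree (\<Prod>T) \<le> n" using B by (simp add: n_def)
      then show "T \<in> (\<Union>d\<le>m. prime_sets d)" using T B that by (auto simp: prime_sets_def)
    qed
    show "\<forall>\<^sub>F m in sequentially. finite (\<Union>d\<le>m. prime_sets d) \<and> B \<subseteq> (\<Union>d\<le>m. prime_sets d) \<and>
        (\<Union>d\<le>m. prime_sets d) \<subseteq> {T. finite T \<and> T \<subseteq> (prime_polys :: 'k poly set)}"
    proof (intro eventually_sequentiallyI[of n] conjI)
      fix m assume "n \<le> m"
      then show "B \<subseteq> (\<Union>d\<le>m. prime_sets d)" by (rule sub)
      show "(\<Union>d\<le>m. prime_sets d) \<subseteq> {T. finite T \<and> T \<subseteq> (prime_polys :: 'k poly set)}"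
        by (auto simp: prime_sets_def)
    qed simp
  qed
  from filterlim_compose[OF euler_product_has_sum[OF assms, unfolded has_sum_def] this]
  show "(\<lambda>n. \<Sum>d\<le>n. prime_set_sum f d) \<longlonglongrightarrow> euler_product f"
    by (simp only: sum_UN_prime_sets prime_set_sum_def)
qed

text \<open>A finite product over S expands into a sum over the subsets of S, and the power sets are
  cofinal among the finite sets of finite sets of primes.\<close>

lemma tendsto_euler_product:
  assumes "small_on_primes f"
  shows "((\<lambda>S. \<Prod>P\<in>S. 1 + f P) \<longlongrightarrow> euler_product f) (finite_subsets_at_top prime_polys)"
proof -
  have "filterlim Pow (finite_subsets_at_top {T. finite T \<and> T \<subseteq> (prime_polys :: 'k poly set)}) (finite_subsets_at_top prime_polys)"
    unfolding filterlim_finite_subsets_at_top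
  proof (intro allI impI)
    fix B assume "finite B \<and> B \<subseteq> {T. finite T \<and> T \<subseteq> (prime_polys :: 'k poly set)}"
    then have "finite (\<Union>B)" "\<Union>B \<subseteq> prime_polys" by auto
    then show "\<forall>\<^sub>F S in finite_subsets_at_top prime_polys. finite (Pow S) \<and> B \<subseteq> Pow S \<and>
        Pow S \<subseteq> {T. finite T \<and> T \<subseteq> (prime_polys :: 'k poly set)}"
      unfolding eventually_finite_subsets_at_top
      by (intro exI[of _ "\<Union>B"]) (auto intro: finite_subset)
  qed
  from filterlim_compose[OF euler_product_has_sum[OF assms, unfolded has_sum_def] this]
  have lim: "((\<lambda>S. \<Sum>T\<in>Pow S. \<Prod>P\<in>T. f P) \<longlongrightarrow> euler_product f) (finite_subsets_at_top prime_polys)" .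
  have "\<forall>\<^sub>F S in finite_subsets_at_top prime_polys. (\<Sum>T\<in>Pow S. \<Prod>P\<in>T. f P) = (\<Prod>P\<in>S. 1 + f P)"
    by (rule eventually_finite_subsets_at_top_weakI) (simp only: prod_1_plus)
  from Lim_transform_eventually[OF lim this] show ?thesis .
qed

lemma sum_inverse_norm_sq_le:
  assumes "finite S" "S \<subseteq> (prime_polys :: 'k poly set)"
  shows "(\<Sum>P\<in>S. 1 / q ^ (2 * degree P)) \<le> 1 / 2"
proof -
  define n where "n = Max (degree ` S)"
  have sub: "S \<subseteq> (\<Union>d\<in>{1..n}. monics d)"
  proof
    fix P assume P: "P \<in> S"
    then have "P \<in> prime_polys" using assms(2) by blast
    from prime_polysD(1,5)[OF this] have "P \<in> monics (degree P)" "degree P > 0" "degree P \<le> n"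
      using P assms(1) by (auto simp: monics_def n_def)
    then show "P \<in> (\<Union>d\<in>{1..n}. monics d)" by auto
  qed
  have "(\<Sum>P\<in>S. 1 / q ^ (2 * degree P)) \<le> (\<Sum>P\<in>(\<Union>d\<in>{1..n}. monics d :: 'k poly set). 1 / q ^ (2 * degree P))"
    using sub q_ge_7 by (intro sum_mono2) auto
  also have "\<dots> = (\<Sum>d\<in>{1..n}. \<Sum>P\<in>monics d. 1 / q ^ (2 * degree (P :: 'k poly)))"
    by (rule sum.UNION_disjoint) (auto simp: monics_def finite_monics[unfolded monics_def])
  also have "\<dots> = (\<Sum>d\<in>{1..n}. \<Sum>P\<in>(monics d :: 'k poly set). 1 / q ^ (2 * d))"
    by (intro sum.cong refl) (auto dest: monicsD)
  also have "\<dots> = (\<Sum>d\<in>{1..n}. (1 / q) ^ d)"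
    using q_ge_7 by (intro sum.cong refl) (simp add: card_monics mult_2 power_add power_one_over)
  also have "\<dots> = (1 / q) * (\<Sum>d<n. (1 / q) ^ d)"
    by (simp add: sum.atLeast1_atMost_eq sum_distrib_left)
  also have "\<dots> \<le> (1 / q) * (\<Sum>d\<le>n. (1 / q) ^ d)"
    using q_ge_7 by (intro mult_left_mono sum_mono2) auto
  also have "\<dots> \<le> (1 / q) * 2"
    using q_ge_7 by (intro mult_left_mono geometric_half_le) auto
  also have "\<dots> \<le> 1 / 2" using q_ge_7 by (simp add: field_simps)
  finally show ?thesis .
qed

text \<open>A finite product of factors 1 - y is at least 1 minus the sum of the y, and the sum of
  |P|^-2 is at most 1/2. So all finite products, and their limit, stay at or above 1/2.\<close>

lemma euler_product_pos:
  assumes "small_on_primes f" "\<And>P. P \<in> prime_polys \<Longrightarrow> f P \<le> 0"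
  shows "euler_product f > 0"
proof -
  have ge: "1 / 2 \<le> (\<Prod>P\<in>S. 1 + f P)" if S: "finite S" "S \<subseteq> prime_polys" for S
  proof -
    have b: "0 \<le> - f P \<and> - f P \<le> 1 / q ^ (2 * degree P)" if "P \<in> prime_polys" for P
      using assms that by (fastforce simp: small_on_primes_def)
    have le1: "1 / q ^ (2 * degree P) \<le> 1" for P :: "'k poly" using q_ge_7 by simp
    have "1 - (\<Sum>P\<in>S. - f P) \<le> (\<Prod>P\<in>S. 1 - - f P)"
      using S b order_trans[OF _ le1] by (intro prod_1_minus_ge) blast+
    moreover have "(\<Sum>P\<in>S. - f P) \<le> (\<Sum>P\<in>S. 1 / q ^ (2 * degree P))"
      using S b by (intro sum_mono) auto
    ultimately show ?thesis using sum_inverse_norm_sq_le[OF S] by simp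
  qed
  have "1 / 2 \<le> euler_product f"
    by (rule tendsto_lowerbound[OF tendsto_euler_product[OF assms(1)] _ finite_subsets_at_top_neq_bot])
      (rule eventually_finite_subsets_at_top_weakI, rule ge)
  then show ?thesis by simp
qed

lemma euler_product_split:
  assumes "small_on_primes f" "finite S" "S \<subseteq> prime_polys"
  shows "euler_product f = (\<Prod>P\<in>S. 1 + f P) * euler_product (\<lambda>P. if P \<in> S then 0 else f P)"
proof -
  let ?g = "\<lambda>P. if P \<in> S then 0 else f P"
  have g: "small_on_primes ?g" using assms(1) q_ge_7 by (auto simp: small_on_primes_def)
  have "((\<lambda>U. (\<Prod>P\<in>S. 1 + f P) * (\<Prod>P\<in>U. 1 + ?g P)) \<longlongrightarrow> (\<Prod>P\<in>S. 1 + f P) * euler_product ?g)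
      (finite_subsets_at_top prime_polys)"
    by (intro tendsto_mult tendsto_const tendsto_euler_product g)
  moreover have "\<forall>\<^sub>F U in finite_subsets_at_top prime_polys.
      (\<Prod>P\<in>S. 1 + f P) * (\<Prod>P\<in>U. 1 + ?g P) = (\<Prod>P\<in>U. 1 + f P)"
    unfolding eventually_finite_subsets_at_top
  proof (intro exI[of _ S] conjI allI impI assms(2,3))
    fix U assume U: "finite U \<and> S \<subseteq> U \<and> U \<subseteq> prime_polys"
    have "(\<Prod>P\<in>U. 1 + ?g P) = (\<Prod>P\<in>U - S. 1 + f P)"
      using U by (intro prod.mono_neutral_cong_right) auto
    then show "(\<Prod>P\<in>S. 1 + f P) * (\<Prod>P\<in>U. 1 + ?g P) = (\<Prod>P\<in>U. 1 + f P)"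
      using U prod.subset_diff[of S U "\<lambda>P. 1 + f P"] by (simp add: mult.commute)
  qed
  ultimately have "((\<lambda>U. \<Prod>P\<in>U. 1 + f P) \<longlongrightarrow> (\<Prod>P\<in>S. 1 + f P) * euler_product ?g)
      (finite_subsets_at_top prime_polys)"
    by (rule Lim_transform_eventually)
  from tendsto_unique[OF finite_subsets_at_top_neq_bot tendsto_euler_product[OF assms(1)] this] show ?thesis .
qed

lemma prime_set_sum_tail_le:
  assumes "small_on_primes f"
  shows "\<bar>euler_product f - (\<Sum>d<n. prime_set_sum f d)\<bar> \<le> 2 * (1 / q) ^ n"
proof -
  have s: "(\<lambda>d. (1 / q) ^ d) sums (1 / (1 - 1 / q))" using q_ge_7 by (intro geometric_sums) auto
  have sums: "(\<lambda>d. prime_set_sum f (d + n)) sums (euler_product f - (\<Sum>d<n. prime_set_sum f d))"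
    by (rule sums_split_initial_segment[OF prime_set_sum_sums[OF assms]])
  have s2: "(\<lambda>d. (1 / q) ^ n * (1 / q) ^ d) sums ((1 / q) ^ n * (1 / (1 - 1 / q)))"
    by (rule sums_mult[OF s])
  have le: "norm (prime_set_sum f (d + n)) \<le> (1 / q) ^ n * (1 / q) ^ d" for d
    using abs_prime_set_sum_le[OF assms, of "d + n"] by (simp add: power_add mult.commute)
  have "norm (\<Sum>d. prime_set_sum f (d + n)) \<le> (\<Sum>d. (1 / q) ^ n * (1 / q) ^ d)"
    by (rule norm_suminf_le[OF le sums_summable[OF s2]])
  then have "\<bar>euler_product f - (\<Sum>d<n. prime_set_sum f d)\<bar> \<le> (1 / q) ^ n * (1 / (1 - 1 / q))"
    unfolding sums_unique[OF sums, symmetric] sums_unique[OF s2, symmetric] by simp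
  also have "\<dots> \<le> (1 / q) ^ n * 2" using q_ge_7 by (intro mult_left_mono) (auto simp: field_simps)
  finally show ?thesis by simp
qed

end

subsection \<open>The square-free sieve\<close>

lemma prod_primes_dvd_iff:
  assumes "finite T" "T \<subseteq> prime_polys"
  shows "\<Prod>T dvd G \<longleftrightarrow> T \<subseteq> prime_divisors G"
proof
  assume "\<Prod>T dvd G"
  then show "T \<subseteq> prime_divisors G"
    using assms dvd_trans[OF dvd_prodI[OF assms(1)]] by (auto simp: prime_divisors_def)
next
  assume "T \<subseteq> prime_divisors G"
  then show "\<Prod>T dvd G" by (intro prod_primes_dvd assms) (auto simp: prime_divisors_def)
qed

lemma prod_primes_sq_dvd_iff:
  fixes G :: "'k::finite_field poly"
  assumes "finite T" "T \<subseteq> prime_polys"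
  shows "(\<Prod>T) ^ 2 dvd G \<longleftrightarrow> (\<forall>P\<in>T. P ^ 2 dvd G)"
  using assms
proof (induction T)
  case (insert P T)
  have cop: "coprime (P ^ 2) ((\<Prod>T) ^ 2)"
  proof (intro field_poly_coprime_power)
    have "coprime P (\<Prod>T)"
      using insert prime_not_dvd_prod_primes[of T P] by (intro prime_poly_coprime) auto
    then have "coprime ((\<Prod>T) ^ 2) P" by (intro field_poly_coprime_power) (simp add: coprime_commute)
    then show "coprime P ((\<Prod>T) ^ 2)" by (simp only: coprime_commute)
  qed
  have "(\<Prod>(insert P T)) ^ 2 = P ^ 2 * (\<Prod>T) ^ 2"
    using insert.hyps by (simp add: power_mult_distrib)
  then have "(\<Prod>(insert P T)) ^ 2 dvd G \<longleftrightarrow> P ^ 2 dvd G \<and> (\<Prod>T) ^ 2 dvd G"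
    using field_poly_coprime_mult_dvd[OF cop] by (auto dest: dvd_mult_left dvd_mult_right)
  then show ?case using insert by simp
qed simp

lemma squarefree_iff_primes:
  fixes G :: "'k::finite_field poly"
  assumes "G \<noteq> 0"
  shows "squarefree G \<longleftrightarrow> (\<forall>P\<in>prime_polys. \<not> P ^ 2 dvd G)"
proof
  assume "squarefree G"
  then show "\<forall>P\<in>prime_polys. \<not> P ^ 2 dvd G"
    using squarefreeD prime_poly_not_dvd_one by blast
next
  assume *: "\<forall>P\<in>prime_polys. \<not> P ^ 2 dvd G"
  show "squarefree G"
  proof (rule squarefreeI, rule ccontr)
    fix x :: "'k poly" assume x: "x ^ 2 dvd G" "\<not> x dvd 1"
    have "x \<noteq> 0" using x(1) assms by auto
    then obtain c F where F: "c \<noteq> 0" "monic F" "x = smult c F" using associated_monic by blast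
    have "F \<noteq> 1"
    proof
      assume "F = 1"
      then have "x * [:inverse c:] = 1" using F(1,3) by (simp add: one_pCons)
      then show False using x(2) dvdI by metis
    qed
    then obtain P where P: "P \<in> prime_polys" "P dvd F" using exists_prime_factor[OF F(2)] by blast
    then have "P dvd x" using F(3) dvd_smult by blast
    then have "P ^ 2 dvd G" using x(1) dvd_power_same dvd_trans by blast
    then show False using * P(1) by blast
  qed
qed

lemma finite_square_prime_divisors:
  "G \<noteq> 0 \<Longrightarrow> finite {P \<in> prime_polys. P ^ 2 dvd (G :: 'k::finite_field poly)}"
  by (rule finite_subset[OF _ finite_prime_divisors[of G]])
    (auto simp: power2_eq_square dest: dvd_mult_left)

lemma alternating_sum_Pow:
  "finite S \<Longrightarrow> (\<Sum>T\<in>Pow S. (-1) ^ card T) = (if S = {} then 1 else 0 :: complex)"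
  using prod_1_plus[of S "\<lambda>_. -1 :: complex"] by (cases "S = {}") (simp_all add: power_0_left)

lemma sum_multiples_monics:
  assumes "D \<in> monics d"
  shows "(\<Sum>G\<in>{G \<in> monics n. D dvd G}. f G) = (if d \<le> n then \<Sum>G\<in>monics (n - d). f (D * G) else 0)"
proof -
  have "D \<noteq> 0" using monic_nonzero[OF monicsD(1)[OF assms]] .
  then have "inj_on (\<lambda>G. D * G) (monics (n - d))" by (intro inj_onI) simp
  then show ?thesis unfolding multiples_in_monics[OF assms] by (simp add: sum.reindex o_def)
qed

context cubic_gauss
begin

text \<open>The alternating sum over the subsets of {P. P^2 divides G} is 1 or 0 according as this
  set is empty or not.\<close>

lemma squarefree_sieve:
  fixes f :: "'k poly \<Rightarrow> complex"
  shows "(\<Sum>G\<in>{G \<in> monics N. squarefree G}. f G) =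
    (\<Sum>d\<le>N div 2. \<Sum>T\<in>prime_sets d. (-1) ^ card T * (\<Sum>G\<in>monics (N - 2 * d). f (G * (\<Prod>T) ^ 2)))"
proof -
  let ?S = "\<lambda>G :: 'k poly. {P \<in> prime_polys. P ^ 2 dvd G}"
  let ?U = "\<Union>d\<le>N div 2. prime_sets d :: 'k poly set set"
  have D2: "(\<Prod>T) ^ 2 \<in> monics (2 * d)" if "T \<in> prime_sets d" for d and T :: "'k poly set"
    using monics_mult[OF prod_prime_sets[OF that] prod_prime_sets[OF that]]
    by (simp add: power2_eq_square mult_2)
  have Pow: "Pow (?S G) = {T \<in> ?U. (\<Prod>T) ^ 2 dvd G}" if G: "G \<in> monics N" for G
  proof (intro equalityI subsetI)
    fix T assume T: "T \<in> Pow (?S G)"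
    have G0: "G \<noteq> 0" using monic_nonzero[OF monicsD(1)[OF G]] .
    then have fin: "finite T" using T finite_square_prime_divisors by (auto intro: finite_subset)
    have dvd: "(\<Prod>T) ^ 2 dvd G" using T fin by (subst prod_primes_sq_dvd_iff) auto
    have T': "T \<in> prime_sets (degree (\<Prod>T))" using T fin by (auto simp: prime_sets_def)
    have "degree ((\<Prod>T) ^ 2) \<le> degree G" using dvd G0 by (rule dvd_imp_degree_le)
    then have "2 * degree (\<Prod>T) \<le> N" using monicsD(2)[OF D2[OF T']] monicsD(2)[OF G] by simp
    then show "T \<in> {T \<in> ?U. (\<Prod>T) ^ 2 dvd G}" using T' dvd by auto
  next
    fix T assume "T \<in> {T \<in> ?U. (\<Prod>T) ^ 2 dvd G}"
    then have "finite T" "T \<subseteq> prime_polys" "(\<Prod>T) ^ 2 dvd G" by (auto simp: prime_sets_def)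
    then show "T \<in> Pow (?S G)" using prod_primes_sq_dvd_iff[of T G] by auto
  qed
  have "(\<Sum>G\<in>{G \<in> monics N. squarefree G}. f G) = (\<Sum>G\<in>monics N. if squarefree G then f G else 0)"
    by (simp add: sum.inter_filter)
  also have "\<dots> = (\<Sum>G\<in>monics N. \<Sum>T\<in>?U. if (\<Prod>T) ^ 2 dvd G then (-1) ^ card T * f G else 0)"
  proof (rule sum.cong[OF refl])
    fix G :: "'k poly" assume G: "G \<in> monics N"
    have G0: "G \<noteq> 0" using monic_nonzero[OF monicsD(1)[OF G]] .
    have "(if squarefree G then f G else 0) = (\<Sum>T\<in>Pow (?S G). (-1) ^ card T) * f G"
      unfolding alternating_sum_Pow[OF finite_square_prime_divisors[OF G0]]
      using squarefree_iff_primes[OF G0] by auto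
    also have "\<dots> = (\<Sum>T\<in>{T \<in> ?U. (\<Prod>T) ^ 2 dvd G}. (-1) ^ card T * f G)"
      unfolding Pow[OF G] by (rule sum_distrib_right)
    also have "\<dots> = (\<Sum>T\<in>?U. if (\<Prod>T) ^ 2 dvd G then (-1) ^ card T * f G else 0)"
      by (rule sum.inter_filter) simp
    finally show "(if squarefree G then f G else 0) =
      (\<Sum>T\<in>?U. if (\<Prod>T) ^ 2 dvd G then (-1) ^ card T * f G else 0)" .
  qed
  also have "\<dots> = (\<Sum>T\<in>?U. \<Sum>G\<in>monics N. if (\<Prod>T) ^ 2 dvd G then (-1) ^ card T * f G else 0)"
    by (rule sum.swap)
  also have "\<dots> = (\<Sum>d\<le>N div 2. \<Sum>T\<in>prime_sets d. \<Sum>G\<in>monics N.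
      if (\<Prod>T) ^ 2 dvd G then (-1) ^ card T * f G else 0)"
    by (rule sum.UNION_disjoint) (simp_all add: disjoint_prime_sets)
  also have "\<dots> = (\<Sum>d\<le>N div 2. \<Sum>T\<in>prime_sets d. (-1) ^ card T * (\<Sum>G\<in>monics (N - 2 * d). f (G * (\<Prod>T) ^ 2)))"
  proof (intro sum.cong refl)
    fix d and T :: "'k poly set" assume d: "d \<in> {..N div 2}" and T: "T \<in> prime_sets d"
    have "(\<Sum>G\<in>monics N. if (\<Prod>T) ^ 2 dvd G then (-1) ^ card T * f G else 0) =
        (\<Sum>G\<in>{G \<in> monics N. (\<Prod>T) ^ 2 dvd G}. (-1) ^ card T * f G)"
      by (rule sum.inter_filter[symmetric]) simp
    also have "\<dots> = (\<Sum>G\<in>monics (N - 2 * d). (-1) ^ card T * f ((\<Prod>T) ^ 2 * G))"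
      using d by (subst sum_multiples_monics[OF D2[OF T]]) auto
    finally show "(\<Sum>G\<in>monics N. if (\<Prod>T) ^ 2 dvd G then (-1) ^ card T * f G else 0) =
        (-1) ^ card T * (\<Sum>G\<in>monics (N - 2 * d). f (G * (\<Prod>T) ^ 2))"
      by (simp only: sum_distrib_left mult.commute)
  qed
  finally show ?thesis .
qed

section \<open>Exact evaluation of the contribution of cubes\<close>

lemma three_nonzero: "(3 :: 'k) \<noteq> 0"
proof
  assume 3: "(3 :: 'k) = 0"
  obtain n where n: "CARD('k) = CHAR('k) ^ n" using finite_field_card_CHAR_power by blast
  have "n \<noteq> 0" using n card_minus_one(2) by (cases n) auto
  then have "of_nat CARD('k) = (0 :: 'k)" by (simp add: n)
  moreover have "of_nat CARD('k) = (3 * of_nat third + 1 :: 'k)" by (simp add: card_eq)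
  ultimately show False using 3 by simp
qed

text \<open>The cofactor A^2 + A B + B^2 of A - B in A^3 - B^3 has coefficient 3 in degree 2j, so it
  is nonzero. This allows summing over cubes by summing over their monic roots.\<close>

lemma monic_cube_inj:
  assumes "A \<in> monics j" "B \<in> monics j" "A ^ 3 = (B :: 'k poly) ^ 3"
  shows "A = B"
proof -
  have A: "lead_coeff A = 1" "degree A = j" and B: "lead_coeff B = 1" "degree B = j"
    using assms(1,2) by (auto simp: monics_def monic_def)
  have c: "coeff (F * G) (j + j) = 1" if "lead_coeff F = 1" "degree F = j" "lead_coeff G = 1" "degree G = j"
    for F G :: "'k poly"
    using coeff_mult_degree_sum[of F G] that by simp
  have "coeff (A * A + A * B + B * B) (j + j) = 3"
    using c A B by (simp add: coeff_add)
  then have nz: "A * A + A * B + B * B \<noteq> 0" using three_nonzero by (metis coeff_0)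
  have "(A - B) * (A * A + A * B + B * B) = A ^ 3 - B ^ 3"
    by (simp add: power3_eq_cube algebra_simps)
  then have "A - B = 0" using assms(3) nz by (metis diff_self mult_eq_0_iff)
  then show ?thesis by simp
qed

lemma of_nat_card_q: "complex_of_nat CARD('k) = of_real q"
  by (metis card_q of_real_of_nat_eq)

text \<open>Inclusion and exclusion is exact here: every product of distinct primes dividing A has
  degree at most j <= n, so its multiples are counted without rounding.\<close>

lemma card_coprime_monics:
  assumes "A \<in> monics j" "j \<le> n"
  shows "(\<Sum>F\<in>monics n. if coprime A F then 1 else 0 :: complex) =
    of_real (q ^ n * (\<Prod>P\<in>prime_divisors (A :: 'k poly). 1 - 1 / q ^ degree P))"
proof -
  have mA: "monic A" "degree A = j" using assms(1) by (auto simp: monics_def)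
  have fin: "finite (prime_divisors A)" using monic_nonzero[OF mA(1)] by simp
  have T: "finite T \<and> T \<subseteq> prime_polys \<and> \<Prod>T dvd A" if "T \<subseteq> prime_divisors A" for T
    using that finite_subset[OF that fin] prod_primes_dvd_iff[of T A] by (auto simp: prime_divisors_def)
  have "(\<Sum>F\<in>monics n. if coprime A F then 1 else 0 :: complex) =
      (\<Sum>F\<in>monics n. \<Sum>T\<in>Pow (prime_divisors A). if \<Prod>T dvd F then (-1) ^ card T else 0)"
  proof (rule sum.cong[OF refl])
    fix F :: "'k poly" assume F: "F \<in> monics n"
    have fin2: "finite (prime_divisors A \<inter> prime_divisors F)" using fin by simp
    have "(if coprime A F then 1 else 0 :: complex) = (\<Sum>T\<in>Pow (prime_divisors A \<inter> prime_divisors F). (-1) ^ card T)"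
      unfolding alternating_sum_Pow[OF fin2] using coprime_iff_primes[OF mA(1), of F]
      by (auto simp: prime_divisors_def)
    also have "Pow (prime_divisors A \<inter> prime_divisors F) = {T \<in> Pow (prime_divisors A). \<Prod>T dvd F}"
    proof -
      have "\<Prod>T dvd F \<longleftrightarrow> T \<subseteq> prime_divisors F" if "T \<subseteq> prime_divisors A" for T
        using T[OF that] by (simp add: prod_primes_dvd_iff)
      then show ?thesis by auto
    qed
    also have "(\<Sum>T\<in>\<dots>. (-1) ^ card T) = (\<Sum>T\<in>Pow (prime_divisors A). if \<Prod>T dvd F then (-1) ^ card T else 0 :: complex)"
      using fin by (intro sum.inter_filter) simp
    finally show "(if coprime A F then 1 else 0 :: complex) =
      (\<Sum>T\<in>Pow (prime_divisors A). if \<Prod>T dvd F then (-1) ^ card T else 0)" .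
  qed
  also have "\<dots> = (\<Sum>T\<in>Pow (prime_divisors A). \<Sum>F\<in>monics n. if \<Prod>T dvd F then (-1) ^ card T else 0)"
    by (rule sum.swap)
  also have "\<dots> = (\<Sum>T\<in>Pow (prime_divisors A). of_real (q ^ n * (\<Prod>P\<in>T. - (1 / q ^ degree P))))"
  proof (rule sum.cong[OF refl])
    fix T assume T0: "T \<in> Pow (prime_divisors A)"
    then have T': "finite T" "T \<subseteq> prime_polys" "\<Prod>T dvd A" using T by auto
    have D: "\<Prod>T \<in> monics (degree (\<Prod>T))" using monic_prod_primes[OF T'(2)] by (simp add: monics_def)
    have le: "degree (\<Prod>T) \<le> n"
      using dvd_imp_degree_le[OF T'(3)] monic_nonzero[OF mA(1)] mA(2) assms(2) by simp
    have "(\<Sum>F\<in>monics n. if \<Prod>T dvd F then (-1) ^ card T else 0 :: complex) =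
        (\<Sum>F\<in>{F \<in> monics n. \<Prod>T dvd F}. (-1) ^ card T)"
      by (rule sum.inter_filter[symmetric]) simp
    also have "\<dots> = of_nat (CARD('k) ^ (n - degree (\<Prod>T))) * (-1) ^ card T"
      unfolding sum_multiples_monics[OF D] using le by (simp add: card_monics)
    also have "\<dots> = of_real (q ^ (n - degree (\<Prod>T)) * (-1) ^ card T)"
      by (simp add: of_nat_card_q)
    also have "q ^ (n - degree (\<Prod>T)) = q ^ n / q ^ degree (\<Prod>T)"
      using le q_ge_7 by (simp add: power_diff)
    also have "q ^ n / q ^ degree (\<Prod>T) * (-1) ^ card T = q ^ n * (\<Prod>P\<in>T. - (1 / q ^ degree P))"
      by (simp add: degree_prod_primes[OF T'(1,2)] power_sum prod_uminus prod_dividef)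
    finally show "(\<Sum>F\<in>monics n. if \<Prod>T dvd F then (-1) ^ card T else 0 :: complex) =
        of_real (q ^ n * (\<Prod>P\<in>T. - (1 / q ^ degree P)))" .
  qed
  also have "\<dots> = of_real (q ^ n * (\<Sum>T\<in>Pow (prime_divisors A). \<Prod>P\<in>T. - (1 / q ^ degree P)))"
    by (simp only: of_real_sum sum_distrib_left)
  also have "(\<Sum>T\<in>Pow (prime_divisors A). \<Prod>P\<in>T. - (1 / q ^ degree P)) =
      (\<Prod>P\<in>prime_divisors A. 1 - 1 / q ^ degree P)"
    unfolding prod_1_plus[OF fin, symmetric] by simp
  finally show ?thesis .
qed

text \<open>When the product is expanded, a set of primes of total degree d is met by its q^(j - d)
  multiples. Truncation at d <= j is therefore exact, and is the source of the partial sums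
  \<open>partial_C\<close>.\<close>

lemma sum_prod_prime_divisors:
  "(\<Sum>A\<in>monics j. \<Prod>P\<in>prime_divisors (A :: 'k poly). 1 + f P) =
    q ^ j * (\<Sum>d\<le>j. prime_set_sum (\<lambda>P. f P / q ^ degree P) d)"
proof -
  let ?U = "\<Union>d\<le>j. prime_sets d :: 'k poly set set"
  have "(\<Sum>A\<in>monics j. \<Prod>P\<in>prime_divisors (A :: 'k poly). 1 + f P) =
      (\<Sum>A\<in>monics j. \<Sum>T\<in>?U. if \<Prod>T dvd A then \<Prod>P\<in>T. f P else 0)"
  proof (rule sum.cong[OF refl])
    fix A :: "'k poly" assume A: "A \<in> monics j"
    have A0: "A \<noteq> 0" using monic_nonzero[OF monicsD(1)[OF A]] .
    have "Pow (prime_divisors A) = {T \<in> ?U. \<Prod>T dvd A}"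
    proof (intro equalityI subsetI)
      fix T assume T: "T \<in> Pow (prime_divisors A)"
      have fin: "finite T" "T \<subseteq> prime_polys"
        using T finite_subset[OF _ finite_prime_divisors_set[OF A0], of T] by (auto simp: prime_divisors_def[of A])
      then have dvd: "\<Prod>T dvd A" using T prod_primes_dvd_iff[of T A] by simp
      then have "degree (\<Prod>T) \<le> j" using dvd_imp_degree_le[OF dvd A0] monicsD(2)[OF A] by simp
      then show "T \<in> {T \<in> ?U. \<Prod>T dvd A}" using fin dvd by (auto simp: prime_sets_def)
    next
      fix T assume "T \<in> {T \<in> ?U. \<Prod>T dvd A}"
      then show "T \<in> Pow (prime_divisors A)" using prod_primes_dvd_iff[of T A] by (auto simp: prime_sets_def)
    qed
    then show "(\<Prod>P\<in>prime_divisors A. 1 + f P) = (\<Sum>T\<in>?U. if \<Prod>T dvd A then \<Prod>P\<in>T. f P else 0)"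
      unfolding prod_1_plus[OF finite_prime_divisors_set[OF A0]] by (simp only: ) (rule sum.inter_filter, simp)
  qed
  also have "\<dots> = (\<Sum>T\<in>?U. \<Sum>A\<in>monics j. if \<Prod>T dvd A then \<Prod>P\<in>T. f P else 0)"
    by (rule sum.swap)
  also have "\<dots> = (\<Sum>d\<le>j. \<Sum>T\<in>prime_sets d. \<Sum>A\<in>monics j. if \<Prod>T dvd A then \<Prod>P\<in>T. f P else 0)"
    by (rule sum_UN_prime_sets)
  also have "\<dots> = (\<Sum>d\<le>j. q ^ j * prime_set_sum (\<lambda>P. f P / q ^ degree P) d)"
    unfolding prime_set_sum_def sum_distrib_left
  proof (intro sum.cong refl)
    fix d and T :: "'k poly set" assume d: "d \<in> {..j}" and T: "T \<in> prime_sets d"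
    have T': "finite T" "T \<subseteq> prime_polys" "degree (\<Prod>T) = d" using T by (auto simp: prime_sets_def)
    have "(\<Sum>A\<in>monics j. if \<Prod>T dvd A then \<Prod>P\<in>T. f P else 0) = (\<Sum>A\<in>{A \<in> monics j. \<Prod>T dvd A}. \<Prod>P\<in>T. f P)"
      by (rule sum.inter_filter[symmetric]) simp
    also have "\<dots> = q ^ (j - d) * (\<Prod>P\<in>T. f P)"
      unfolding sum_multiples_monics[OF prod_prime_sets[OF T]] using d by (simp add: card_monics)
    also have "\<dots> = q ^ j * ((\<Prod>P\<in>T. f P) / q ^ d)" using d q_ge_7 by (simp add: power_diff)
    also have "(\<Prod>P\<in>T. f P) / q ^ d = (\<Prod>P\<in>T. f P / q ^ degree P)"
      unfolding T'(3)[symmetric] degree_prod_primes[OF T'(1,2)] by (simp add: power_sum prod_dividef)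
    finally show "(\<Sum>A\<in>monics j. if \<Prod>T dvd A then \<Prod>P\<in>T. f P else 0) = q ^ j * (\<Prod>P\<in>T. f P / q ^ degree P)" .
  qed
  finally show ?thesis by (simp only: sum_distrib_left)
qed

text \<open>phi(A)/|A| for the Euler function of the polynomial ring.\<close>

definition phi_ratio :: "'k poly \<Rightarrow> real" where
  "phi_ratio A = (\<Prod>P\<in>prime_divisors A. 1 - 1 / q ^ degree P)"

text \<open>Since m <= N - 2d, after reciprocity the sum over F covers complete periods modulo a.
  For a = A^3 the symbol is the principal character modulo A, so F is counted with density
  phi(A)/|A| and D must be prime to A.\<close>

lemma sum_chi_square_multiples_main:
  assumes T: "T \<in> prime_sets d" and le: "m + 2 * d \<le> N"
  shows "(\<Sum>F\<in>monics (N - 2 * d). \<Sum>a\<in>monics m. chi (F * (\<Prod>T) ^ 2) a) =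
    (if 3 dvd m then of_real (q ^ (N - 2 * d) *
       (\<Sum>A\<in>monics (m div 3). if T \<inter> prime_divisors A = {} then phi_ratio A else 0)) else 0)"
proof -
  let ?n = "N - 2 * d" and ?D = "\<Prod>T"
  have T': "finite T" "T \<subseteq> prime_polys" using T by (auto simp: prime_sets_def)
  have mD: "monic ?D" using prod_prime_sets[OF T] monicsD(1) by blast
  have D2: "monic (?D ^ 2)" by (rule monic_power[OF mD])
  define f where "f a = chi (?D ^ 2) a * (\<Sum>F\<in>monics ?n. chi a F)" for a
  have eq: "(\<Sum>F\<in>monics ?n. \<Sum>a\<in>monics m. chi (F * ?D ^ 2) a) = (\<Sum>a\<in>monics m. f a)"
  proof (subst sum.swap, rule sum.cong[OF refl])
    fix a :: "'k poly" assume a: "a \<in> monics m"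
    show "(\<Sum>F\<in>monics ?n. chi (F * ?D ^ 2) a) = f a"
      unfolding f_def sum_distrib_left
    proof (rule sum.cong[OF refl])
      fix F :: "'k poly" assume F: "F \<in> monics ?n"
      show "chi (F * ?D ^ 2) a = chi (?D ^ 2) a * chi a F"
        unfolding chi_mult_left[OF monicsD(1)[OF F] D2] chi_swap[OF monicsD(1)[OF F] monicsD(1)[OF a]]
        by (rule mult.commute)
    qed
  qed
  have f0: "f a = 0" if a: "a \<in> monics m" and nc: "\<nexists>A. monic A \<and> a = A ^ 3" for a
  proof -
    have "degree a \<le> ?n" using monicsD(2)[OF a] le by simp
    from sum_chi_monics_noncube[OF monicsD(1)[OF a] nc this] show ?thesis by (simp add: f_def)
  qed
  show ?thesis
  proof (cases "3 dvd m")
    case False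
    have "f a = 0" if a: "a \<in> monics m" for a
    proof (rule f0[OF a], rule notI)
      assume "\<exists>A. monic A \<and> a = A ^ 3"
      then obtain A where A: "monic A" "a = A ^ 3" by blast
      then have "m = 3 * degree A" using monicsD(2)[OF a] by (simp add: degree_power_eq monic_nonzero)
      then show False using False by simp
    qed
    then show ?thesis unfolding eq using False by simp
  next
    case True
    define j where "j = m div 3"
    have m: "m = 3 * j" using True by (simp add: j_def)
    have cube: "A ^ 3 \<in> monics m" if "A \<in> monics j" for A :: "'k poly"
      using monics_mult[OF monics_mult[OF that that] that] unfolding power3_eq_cube m
      by (simp only: numeral_3_eq_3 mult_Suc mult_0 add_0_right add.assoc)
    have "(\<Sum>a\<in>monics m. f a) = (\<Sum>a\<in>(\<lambda>A. A ^ 3) ` monics j. f a)"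
    proof (rule sum.mono_neutral_right)
      show "(\<lambda>A. A ^ 3) ` monics j \<subseteq> (monics m :: 'k poly set)" using cube by blast
      show "\<forall>a\<in>monics m - (\<lambda>A. A ^ 3) ` monics j. f a = 0"
      proof
        fix a :: "'k poly" assume a: "a \<in> monics m - (\<lambda>A. A ^ 3) ` monics j"
        then have a': "a \<in> monics m" by blast
        show "f a = 0"
        proof (rule f0[OF a'], rule notI)
          assume "\<exists>A. monic A \<and> a = A ^ 3"
          then obtain A where A: "monic A" "a = A ^ 3" by blast
          then have "m = 3 * degree A" using monicsD(2)[OF a'] by (simp add: degree_power_eq monic_nonzero)
          then have "A \<in> monics j" using A(1) m by (simp add: monics_def)
          then show False using a A(2) by blast
        qed
      qed
    qed simp
    also have "\<dots> = (\<Sum>A\<in>monics j. f (A ^ 3))"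
      by (rule sum.reindex_cong[OF _ refl refl]) (auto intro!: inj_onI monic_cube_inj)
    also have "\<dots> = (\<Sum>A\<in>monics j. of_real (q ^ ?n * (if T \<inter> prime_divisors A = {} then phi_ratio A else 0)))"
    proof (rule sum.cong[OF refl])
      fix A :: "'k poly" assume A: "A \<in> monics j"
      have mA: "monic A" using monicsD(1)[OF A] .
      have c3: "chi A F ^ 3 = (if coprime A F then 1 else 0)" for F
        using chi_cube[OF mA] chi_eq_0_iff[OF mA] by auto
      have d3: "chi ?D A ^ 3 = (if coprime ?D A then 1 else 0)"
        using chi_cube[OF mD] chi_eq_0_iff[OF mD] by auto
      have "chi (?D ^ 2) (A ^ 3) = (chi ?D A ^ 3) ^ 2"
        by (simp add: chi_power_left[OF mD] chi_power_right[OF mD] power_mult[symmetric] mult.commute)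
      also have "\<dots> = (if coprime ?D A then 1 else 0)"
        by (simp add: d3)
      also have "coprime ?D A \<longleftrightarrow> T \<inter> prime_divisors A = {}"
      proof -
        have "coprime ?D A \<longleftrightarrow> prime_divisors ?D \<inter> prime_divisors A = {}"
          unfolding coprime_iff_primes[OF mD] by (auto simp: prime_divisors_def)
        then show ?thesis by (simp only: prime_divisors_prod[OF T'])
      qed
      finally have c1: "chi (?D ^ 2) (A ^ 3) = (if T \<inter> prime_divisors A = {} then 1 else 0)" .
      have "(\<Sum>F\<in>monics ?n. chi (A ^ 3) F) = (\<Sum>F\<in>monics ?n. if coprime A F then 1 else 0)"
        by (simp only: chi_power_left[OF mA] c3)
      also have "\<dots> = of_real (q ^ ?n * phi_ratio A)"
        unfolding phi_ratio_def by (rule card_coprime_monics[OF A]) (use le m in simp)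
      finally show "f (A ^ 3) = of_real (q ^ ?n * (if T \<inter> prime_divisors A = {} then phi_ratio A else 0))"
        unfolding f_def c1 by simp
    qed
    also have "\<dots> = of_real (q ^ ?n * (\<Sum>A\<in>monics j. if T \<inter> prime_divisors A = {} then phi_ratio A else 0))"
      by (simp only: of_real_sum sum_distrib_left)
    finally show ?thesis unfolding eq j_def using True by simp
  qed
qed

subsection \<open>Averages over square-free moduli\<close>

definition square_multiple_sum :: "nat \<Rightarrow> nat \<Rightarrow> 'k poly set \<Rightarrow> complex" where
  "square_multiple_sum N m T =
     (\<Sum>F\<in>monics (N - 2 * degree (\<Prod>T)). \<Sum>a\<in>monics m. chi (F * (\<Prod>T) ^ 2) a)"

lemma sum_squarefree_chi:
  "(\<Sum>G\<in>{G \<in> monics N. squarefree G}. \<Sum>a\<in>monics m. chi G a) =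
    (\<Sum>d\<le>N div 2. \<Sum>T\<in>prime_sets d. (-1) ^ card T * square_multiple_sum N m T)"
  unfolding squarefree_sieve square_multiple_sum_def
  by (intro sum.cong refl) (simp add: prime_sets_def)

lemma sum_power_from_le:
  fixes z :: real
  assumes "0 \<le> z" "z \<le> 1 / 2"
  shows "(\<Sum>d\<in>{a<..L}. z ^ d) \<le> 2 * z ^ Suc a"
proof -
  have inj: "inj_on (\<lambda>i. Suc a + i) {..L}" by (rule inj_onI) simp
  have "(\<Sum>d\<in>{a<..L}. z ^ d) \<le> (\<Sum>d\<in>(\<lambda>i. Suc a + i) ` {..L}. z ^ d)"
  proof (rule sum_mono2)
    show "{a<..L} \<subseteq> (\<lambda>i. Suc a + i) ` {..L}"
    proof
      fix d assume "d \<in> {a<..L}"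
      then have "d = Suc a + (d - Suc a)" "d - Suc a \<in> {..L}" by auto
      then show "d \<in> (\<lambda>i. Suc a + i) ` {..L}" by (rule image_eqI)
    qed
  qed (use assms in auto)
  also have "\<dots> = (\<Sum>i\<le>L. z ^ (Suc a + i))" by (simp only: sum.reindex[OF inj] o_def)
  also have "\<dots> = z ^ Suc a * (\<Sum>i\<le>L. z ^ i)" by (simp only: power_add sum_distrib_left)
  also have "\<dots> \<le> z ^ Suc a * 2"
    using assms by (intro mult_left_mono geometric_half_le) auto
  finally show ?thesis by simp
qed

text \<open>The choice 1/24 for absorbing 8^|T| and the count of at most q^d sets T turn -29/12 into
  -29/12 + 1/24 + 1 = -11/8 per unit of d. The geometric series starts above (N - m)/2, and 1/4 -
  11/16 = -7/16.\<close>

lemma large_part_bound: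
  "\<exists>C>0. \<forall>N m. m < N \<longrightarrow> \<not> 3 dvd N \<longrightarrow>
    norm (\<Sum>d\<in>{(N - m) div 2<..N div 2}. \<Sum>T\<in>prime_sets d. (-1) ^ card T * square_multiple_sum N m T)
      \<le> C * q powr (4 * real N / 3 - 7 / 16 * real (N - m))"
proof -
  obtain K where K: "K > 0" "\<And>W n. W \<noteq> 0 \<Longrightarrow> norm (gauss_avg W n) \<le> K * q powr (4 * real n / 3 + real (degree W) / 4)"
    using gauss_avg_bound by blast
  obtain K2 where K2: "K2 > 0" "\<And>S. finite S \<Longrightarrow> S \<subseteq> (prime_polys :: 'k poly set) \<Longrightarrow>
      8 ^ card S \<le> K2 * q powr (1 / 24 * real (\<Sum>P\<in>S. degree P))"
    using prime_count_bound[of "1 / 24" 8] by auto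
  define C where "C = 2 * K2 * K"
  have "C > 0" using K(1) K2(1) by (simp add: C_def)
  moreover have "norm (\<Sum>d\<in>{(N - m) div 2<..N div 2}. \<Sum>T\<in>prime_sets d. (-1) ^ card T * square_multiple_sum N m T)
      \<le> C * q powr (4 * real N / 3 - 7 / 16 * real (N - m))" if N: "m < N" "\<not> 3 dvd N" for N m
  proof -
    define z where "z = q powr (- 11 / 8)"
    define w where "w = 4 * real N / 3 + real (N - m) / 4"
    have z: "0 \<le> z" "z \<le> 1 / 2"
      using order_trans[OF q_powr_mono[of "- 11 / 8" "- 1 / 2"] q_powr_half] by (simp_all add: z_def)
    have one: "norm ((-1) ^ card T * square_multiple_sum N m T) \<le> K2 * K * q powr (w - 19 / 8 * real d)"
      if d: "d \<in> {(N - m) div 2<..N div 2}" and T: "T \<in> prime_sets d" for d T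
    proof -
      have T': "finite T" "T \<subseteq> prime_polys" "degree (\<Prod>T) = d" using T by (auto simp: prime_sets_def)
      have "2 * degree (\<Prod>T) \<le> N" using d T'(3) by auto
      from norm_sum_chi_square_multiples_le[OF T'(1,2) K N this]
      have "norm (square_multiple_sum N m T) \<le> 8 ^ card T * K * q powr (w - 29 / 12 * real d)"
        unfolding square_multiple_sum_def w_def T'(3) .
      also have "\<dots> \<le> (K2 * q powr (1 / 24 * real d)) * K * q powr (w - 29 / 12 * real d)"
        using K2(2)[OF T'(1,2)] K(1) unfolding degree_prod_primes[OF T'(1,2), symmetric] T'(3)
        by (intro mult_right_mono) auto
      also have "\<dots> = K2 * K * (q powr (1 / 24 * real d) * q powr (w - 29 / 12 * real d))"
        by (simp only: mult_ac)
      also have "q powr (1 / 24 * real d) * q powr (w - 29 / 12 * real d) = q powr (w - 19 / 8 * real d)"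
      proof -
        have "1 / 24 * real d + (w - 29 / 12 * real d) = w - 19 / 8 * real d" by argo
        then show ?thesis by (simp only: powr_add[symmetric])
      qed
      finally show ?thesis by (simp add: norm_mult norm_power)
    qed
    have "norm (\<Sum>d\<in>{(N - m) div 2<..N div 2}. \<Sum>T\<in>prime_sets d. (-1) ^ card T * square_multiple_sum N m T)
        \<le> (\<Sum>d\<in>{(N - m) div 2<..N div 2}. K2 * K * q powr w * z ^ d)"
    proof (rule sum_norm_le)
      fix d assume d: "d \<in> {(N - m) div 2<..N div 2}"
      have "norm (\<Sum>T\<in>prime_sets d. (-1) ^ card T * square_multiple_sum N m T) \<le>
          (\<Sum>T\<in>(prime_sets d :: 'k poly set set). K2 * K * q powr (w - 19 / 8 * real d))"
        by (rule sum_norm_le) (rule one[OF d])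
      also have "\<dots> = real (card (prime_sets d :: 'k poly set set)) * (K2 * K * q powr (w - 19 / 8 * real d))"
        by simp
      also have "\<dots> \<le> q ^ d * (K2 * K * q powr (w - 19 / 8 * real d))"
        using card_prime_sets_le_q[of d] K(1) K2(1) by (intro mult_right_mono) auto
      also have "\<dots> = K2 * K * (q powr real d * q powr (w - 19 / 8 * real d))"
        by (simp only: q_powr_nat mult_ac)
      also have "q powr real d * q powr (w - 19 / 8 * real d) = q powr w * z ^ d"
      proof -
        have "real d + (w - 19 / 8 * real d) = w + - 11 / 8 * real d" by argo
        then show ?thesis by (simp only: z_def q_powr_mult_nat[symmetric] powr_add[symmetric])
      qed
      finally show "norm (\<Sum>T\<in>prime_sets d. (-1) ^ card T * square_multiple_sum N m T)
          \<le> K2 * K * q powr w * z ^ d" by (simp only: mult.assoc)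
    qed
    also have "\<dots> = K2 * K * q powr w * (\<Sum>d\<in>{(N - m) div 2<..N div 2}. z ^ d)"
      by (simp only: sum_distrib_left)
    also have "\<dots> \<le> K2 * K * q powr w * (2 * z ^ Suc ((N - m) div 2))"
      using K(1) K2(1) by (intro mult_left_mono sum_power_from_le z) auto
    also have "z ^ Suc ((N - m) div 2) \<le> q powr (- 11 / 16 * real (N - m))"
    proof -
      have "N - m \<le> 2 * Suc ((N - m) div 2)" by presburger
      then have "real (N - m) \<le> 2 * real (Suc ((N - m) div 2))" by (metis of_nat_le_iff of_nat_mult of_nat_numeral)
      then have "- 11 / 8 * real (Suc ((N - m) div 2)) \<le> - 11 / 16 * real (N - m)" by argo
      then show ?thesis unfolding z_def q_powr_mult_nat[symmetric] by (rule q_powr_mono)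
    qed
    then have "K2 * K * q powr w * (2 * z ^ Suc ((N - m) div 2)) \<le>
        K2 * K * q powr w * (2 * q powr (- 11 / 16 * real (N - m)))"
      using K(1) K2(1) by (intro mult_left_mono) auto
    also have "\<dots> = C * (q powr w * q powr (- 11 / 16 * real (N - m)))"
      by (simp only: C_def mult_ac)
    also have "q powr w * q powr (- 11 / 16 * real (N - m)) = q powr (4 * real N / 3 - 7 / 16 * real (N - m))"
    proof -
      have "w + - 11 / 16 * real (N - m) = 4 * real N / 3 - 7 / 16 * real (N - m)" unfolding w_def by argo
      then show ?thesis by (simp only: powr_add[symmetric])
    qed
    finally show ?thesis .
  qed
  ultimately show ?thesis by blast
qed

text \<open>Adding 1 gives the Euler factor of 1/zeta_q(2), the density of square-free polynomials;
  for \<open>C_factor\<close> it gives that of the constant C_q.\<close>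

definition squarefree_factor :: "'k poly \<Rightarrow> real" where "squarefree_factor P = - 1 / q ^ (2 * degree P)"
definition C_factor :: "'k poly \<Rightarrow> real" where "C_factor P = - 1 / (q ^ degree P * (q ^ degree P + 1))"

lemma small_squarefree_factor: "small_on_primes squarefree_factor" and small_C_factor: "small_on_primes C_factor"
proof -
  show "small_on_primes squarefree_factor" using q_ge_7 by (simp add: small_on_primes_def squarefree_factor_def)
  have "1 / (q ^ n * (q ^ n + 1)) \<le> 1 / q ^ (2 * n)" for n
    using q_ge_7 by (intro frac_le) (simp_all add: mult_2 power_add distrib_left)
  then show "small_on_primes C_factor" using q_ge_7 by (simp add: small_on_primes_def C_factor_def)
qed

lemma small_squarefree_factor_off: "small_on_primes (\<lambda>P. if P \<in> S then 0 else squarefree_factor P)"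
  using small_squarefree_factor q_ge_7 by (auto simp: small_on_primes_def)

lemma phi_ratio_bounds: "0 \<le> phi_ratio A" "phi_ratio A \<le> 1"
  using q_ge_7 unfolding phi_ratio_def by (auto intro!: prod_nonneg prod_le_1)

text \<open>The local identity is (1 - |P|^-2)(1 - 1/(|P| + 1)) = 1 - 1/|P|. It separates the
  density of square-free polynomials, which cancels in the average, from a multiplicative weight on
  A.\<close>

lemma phi_ratio_mult_euler_product_off:
  assumes "A \<noteq> 0"
  shows "phi_ratio A * euler_product (\<lambda>P. if P \<in> prime_divisors A then 0 else squarefree_factor P) =
    euler_product squarefree_factor * (\<Prod>P\<in>prime_divisors A. 1 + - 1 / (q ^ degree P + 1))"
proof -
  let ?S = "prime_divisors A"
  have S: "finite ?S" "?S \<subseteq> prime_polys" using assms by (auto simp: prime_divisors_def[of A] finite_prime_divisors)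
  have eq: "(1 + squarefree_factor P) * (1 + - 1 / (q ^ degree P + 1)) = 1 - 1 / q ^ degree P" if "P \<in> ?S" for P
  proof -
    define z where "z = q ^ degree P"
    have "z > 0" using q_ge_7 by (simp add: z_def)
    then have "z + 1 \<noteq> 0" "z \<noteq> 0" by auto
    then show ?thesis unfolding squarefree_factor_def mult_2 power_add z_def[symmetric]
      by (simp add: divide_simps) (simp add: algebra_simps)
  qed
  have "euler_product squarefree_factor * (\<Prod>P\<in>?S. 1 + - 1 / (q ^ degree P + 1)) =
      (\<Prod>P\<in>?S. (1 + squarefree_factor P) * (1 + - 1 / (q ^ degree P + 1))) * euler_product (\<lambda>P. if P \<in> ?S then 0 else squarefree_factor P)"
    unfolding euler_product_split[OF small_squarefree_factor S] by (simp only: prod.distrib mult_ac)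
  also have "(\<Prod>P\<in>?S. (1 + squarefree_factor P) * (1 + - 1 / (q ^ degree P + 1))) = phi_ratio A"
    unfolding phi_ratio_def by (rule prod.cong[OF refl eq])
  finally show ?thesis by simp
qed

definition partial_C :: "nat \<Rightarrow> real" where "partial_C j = (\<Sum>d\<le>j. prime_set_sum C_factor d)"

text \<open>Division of -1/(|P| + 1) by |P| is where the local term of C_q comes from.\<close>

lemma sum_density:
  "(\<Sum>A\<in>monics j. \<Prod>P\<in>prime_divisors (A :: 'k poly). 1 + - 1 / (q ^ degree P + 1)) = q ^ j * partial_C j"
proof -
  have "(\<lambda>P :: 'k poly. - 1 / (q ^ degree P + 1) / q ^ degree P) = C_factor"
    by (rule ext) (simp add: C_factor_def mult.commute)
  then show ?thesis unfolding sum_prod_prime_divisors partial_C_def by simp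
qed

lemma small_part_eq:
  assumes "3 * j \<le> N"
  shows "(\<Sum>d\<le>(N - 3 * j) div 2. \<Sum>T\<in>prime_sets d. (-1) ^ card T * square_multiple_sum N (3 * j) T) =
    of_real (q ^ N * (\<Sum>A\<in>monics j. phi_ratio A *
      (\<Sum>d\<le>(N - 3 * j) div 2. prime_set_sum (\<lambda>P. if P \<in> prime_divisors A then 0 else squarefree_factor P) d)))"
proof -
  have one: "(-1) ^ card T * square_multiple_sum N (3 * j) T =
      of_real (q ^ N * (\<Sum>A\<in>monics j. phi_ratio A * (\<Prod>P\<in>T. if P \<in> prime_divisors A then 0 else squarefree_factor P)))"
    if d: "d \<in> {..(N - 3 * j) div 2}" and T: "T \<in> prime_sets d" for d T
  proof -
    have T': "finite T" "T \<subseteq> prime_polys" "degree (\<Prod>T) = d" using T by (auto simp: prime_sets_def)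
    have le: "3 * j + 2 * d \<le> N" using d assms by auto
    have "square_multiple_sum N (3 * j) T = of_real (q ^ (N - 2 * d) *
       (\<Sum>A\<in>monics j. if T \<inter> prime_divisors A = {} then phi_ratio A else 0))"
      using sum_chi_square_multiples_main[OF T le] unfolding square_multiple_sum_def T'(3) by simp
    then have "(-1) ^ card T * square_multiple_sum N (3 * j) T = of_real ((-1) ^ card T * (q ^ (N - 2 * d) *
       (\<Sum>A\<in>monics j. if T \<inter> prime_divisors A = {} then phi_ratio A else 0)))" by simp
    also have "(-1) ^ card T * (q ^ (N - 2 * d) *
       (\<Sum>A\<in>monics j. if T \<inter> prime_divisors A = {} then phi_ratio A else 0)) =
       q ^ N * (\<Sum>A\<in>monics j. phi_ratio A * (\<Prod>P\<in>T. if P \<in> prime_divisors A then 0 else squarefree_factor P))"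
      unfolding sum_distrib_left
    proof (rule sum.cong[OF refl])
      fix A :: "'k poly" assume "A \<in> monics j"
      have pr: "(\<Prod>P\<in>T. squarefree_factor P) = (-1) ^ card T / q ^ (2 * d)"
        unfolding T'(3)[symmetric] degree_prod_primes[OF T'(1,2)] squarefree_factor_def
        by (simp add: prod_uminus prod_dividef power_sum sum_distrib_left)
      show "(-1) ^ card T * (q ^ (N - 2 * d) * (if T \<inter> prime_divisors A = {} then phi_ratio A else 0)) =
        q ^ N * (phi_ratio A * (\<Prod>P\<in>T. if P \<in> prime_divisors A then 0 else squarefree_factor P))"
      proof (cases "T \<inter> prime_divisors A = {}")
        case True
        then have "(\<Prod>P\<in>T. if P \<in> prime_divisors A then 0 else squarefree_factor P) = (\<Prod>P\<in>T. squarefree_factor P)"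
          by (intro prod.cong) auto
        moreover have "q ^ (N - 2 * d) = q ^ N / q ^ (2 * d)" using le q_ge_7 by (simp add: power_diff)
        ultimately show ?thesis using True pr by simp
      next
        case False
        then have "(\<Prod>P\<in>T. if P \<in> prime_divisors A then 0 else squarefree_factor P) = 0"
          using T'(1) by (intro prod_zero) auto
        then show ?thesis using False by simp
      qed
    qed
    finally show ?thesis .
  qed
  have "(\<Sum>d\<le>(N - 3 * j) div 2. \<Sum>T\<in>prime_sets d. (-1) ^ card T * square_multiple_sum N (3 * j) T) =
      of_real (\<Sum>d\<le>(N - 3 * j) div 2. \<Sum>T\<in>prime_sets d.
        q ^ N * (\<Sum>A\<in>monics j. phi_ratio A * (\<Prod>P\<in>T. if P \<in> prime_divisors A then 0 else squarefree_factor P)))"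
    unfolding of_real_sum by (intro sum.cong refl) (rule one)
  also have "(\<Sum>d\<le>(N - 3 * j) div 2. \<Sum>T\<in>prime_sets d.
        q ^ N * (\<Sum>A\<in>monics j. phi_ratio A * (\<Prod>P\<in>T. if P \<in> prime_divisors A then 0 else squarefree_factor P))) =
      q ^ N * (\<Sum>d\<le>(N - 3 * j) div 2. \<Sum>A\<in>monics j. \<Sum>T\<in>prime_sets d.
         phi_ratio A * (\<Prod>P\<in>T. if P \<in> prime_divisors A then 0 else squarefree_factor P))"
    by (simp only: sum_distrib_left[symmetric] sum.swap[of _ "monics j" "prime_sets _"])
  also have "\<dots> = q ^ N * (\<Sum>A\<in>monics j. phi_ratio A *
      (\<Sum>d\<le>(N - 3 * j) div 2. prime_set_sum (\<lambda>P. if P \<in> prime_divisors A then 0 else squarefree_factor P) d))"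
    by (subst sum.swap) (simp only: sum_distrib_left prime_set_sum_def)
  finally show ?thesis .
qed

text \<open>Completing the sum over d to the full Euler product costs a tail of size q^-(g - j),
  since (3(g - j) + 1) div 2 + 1 >= g - j. For j near g this is as large as the main term, but
  against the weights at s = 1/3 it still sums over j to a bounded multiple of q^N.\<close>

lemma norm_small_part_le:
  assumes "j \<le> g" "N = 3 * g + 1"
  shows "norm ((\<Sum>d\<le>(N - 3 * j) div 2. \<Sum>T\<in>prime_sets d. (-1) ^ card T * square_multiple_sum N (3 * j) T)
      - of_real (q ^ N * (euler_product squarefree_factor * (q ^ j * partial_C j)))) \<le> q ^ N * (q ^ j * (2 * (1 / q) ^ (g - j)))"
proof -
  let ?M = "(N - 3 * j) div 2"
  let ?f = "\<lambda>A P. if P \<in> prime_divisors A then 0 else squarefree_factor P"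
  have le: "3 * j \<le> N" using assms by simp
  have one: "\<bar>phi_ratio A * (\<Sum>d\<le>?M. prime_set_sum (?f A) d) - phi_ratio A * euler_product (?f A)\<bar> \<le> 2 * (1 / q) ^ (g - j)" for A
  proof -
    have "\<bar>euler_product (?f A) - (\<Sum>d<Suc ?M. prime_set_sum (?f A) d)\<bar> \<le> 2 * (1 / q) ^ Suc ?M"
      by (rule prime_set_sum_tail_le[OF small_squarefree_factor_off])
    also have "\<dots> \<le> 2 * (1 / q) ^ (g - j)"
    proof -
      have "g - j \<le> Suc ?M" using assms by linarith
      then show ?thesis using q_ge_7 by (intro mult_left_mono power_decreasing) auto
    qed
    finally have "\<bar>(\<Sum>d\<le>?M. prime_set_sum (?f A) d) - euler_product (?f A)\<bar> \<le> 2 * (1 / q) ^ (g - j)"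
      by (simp only: lessThan_Suc_atMost abs_minus_commute)
    then have "phi_ratio A * \<bar>(\<Sum>d\<le>?M. prime_set_sum (?f A) d) - euler_product (?f A)\<bar> \<le> 1 * (2 * (1 / q) ^ (g - j))"
      using phi_ratio_bounds by (intro mult_mono) auto
    then show ?thesis using phi_ratio_bounds(1)[of A]
      by (simp add: right_diff_distrib[symmetric] abs_mult)
  qed
  have "euler_product squarefree_factor * (q ^ j * partial_C j) = (\<Sum>A\<in>monics j. phi_ratio A * euler_product (?f A))"
    unfolding sum_density[symmetric] sum_distrib_left
    by (rule sum.cong[OF refl]) (simp only: phi_ratio_mult_euler_product_off[OF monic_nonzero[OF monicsD(1)]])
  then have "norm ((\<Sum>d\<le>?M. \<Sum>T\<in>prime_sets d. (-1) ^ card T * square_multiple_sum N (3 * j) T)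
      - of_real (q ^ N * (euler_product squarefree_factor * (q ^ j * partial_C j)))) =
      \<bar>q ^ N * (\<Sum>A\<in>monics j. phi_ratio A * (\<Sum>d\<le>?M. prime_set_sum (?f A) d) - phi_ratio A * euler_product (?f A))\<bar>"
    unfolding small_part_eq[OF le] of_real_diff[symmetric] norm_of_real
    by (simp only: sum_subtractf right_diff_distrib)
  also have "\<dots> = q ^ N * \<bar>\<Sum>A\<in>monics j. phi_ratio A * (\<Sum>d\<le>?M. prime_set_sum (?f A) d) - phi_ratio A * euler_product (?f A)\<bar>"
    using q_ge_7 by (simp add: abs_mult)
  also have "\<dots> \<le> q ^ N * (\<Sum>A\<in>(monics j :: 'k poly set). 2 * (1 / q) ^ (g - j))"
    using q_ge_7 by (intro mult_left_mono order_trans[OF sum_abs] sum_mono one) auto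
  also have "\<dots> = q ^ N * (q ^ j * (2 * (1 / q) ^ (g - j)))"
    by (simp add: card_monics)
  finally show ?thesis .
qed

lemma small_part_eq_0:
  assumes "\<not> 3 dvd m" "m \<le> N"
  shows "(\<Sum>d\<le>(N - m) div 2. \<Sum>T\<in>prime_sets d. (-1) ^ card T * square_multiple_sum N m T) = 0"
proof (intro sum.neutral ballI)
  fix d and T :: "'k poly set" assume d: "d \<in> {..(N - m) div 2}" and T: "T \<in> prime_sets d"
  have le: "m + 2 * d \<le> N" using d assms(2) by auto
  have "degree (\<Prod>T) = d" using T by (simp add: prime_sets_def)
  then show "(-1) ^ card T * square_multiple_sum N m T = 0"
    using sum_chi_square_multiples_main[OF T le] assms(1) by (simp add: square_multiple_sum_def)
qed

lemma sum_squarefree_chi_bound: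
  "\<exists>C>0. \<forall>g m. m < 3 * g + 1 \<longrightarrow>
    norm ((\<Sum>G\<in>{G \<in> monics (3 * g + 1). squarefree G}. \<Sum>a\<in>monics m. chi G a)
      - (if 3 dvd m then of_real (q ^ (3 * g + 1) * (euler_product squarefree_factor * (q ^ (m div 3) * partial_C (m div 3)))) else 0))
    \<le> (if 3 dvd m then q ^ (3 * g + 1) * (q ^ (m div 3) * (2 * (1 / q) ^ (g - m div 3))) else 0) +
      C * q powr (4 * real (3 * g + 1) / 3 - 7 / 16 * real (3 * g + 1 - m))"
proof -
  obtain C where C: "C > 0" "\<And>N m. m < N \<Longrightarrow> \<not> 3 dvd N \<Longrightarrow>
    norm (\<Sum>d\<in>{(N - m) div 2<..N div 2}. \<Sum>T\<in>prime_sets d. (-1) ^ card T * square_multiple_sum N m T)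
      \<le> C * q powr (4 * real N / 3 - 7 / 16 * real (N - m))"
    using large_part_bound by blast
  show ?thesis
  proof (intro exI[of _ C] conjI C(1) allI impI)
    fix g m :: nat assume m: "m < 3 * g + 1"
    define N where "N = 3 * g + 1"
    have N: "m < N" "\<not> 3 dvd N" using m by (auto simp: N_def) presburger
    let ?F = "\<lambda>d. \<Sum>T\<in>prime_sets d. (-1) ^ card T * square_multiple_sum N m T"
    let ?main = "if 3 dvd m then of_real (q ^ N * (euler_product squarefree_factor * (q ^ (m div 3) * partial_C (m div 3)))) else 0 :: complex"
    have "{..N div 2} = {..(N - m) div 2} \<union> {(N - m) div 2<..N div 2}"
      using div_le_mono[of "N - m" N 2] by auto
    then have "(\<Sum>d\<le>N div 2. ?F d) = (\<Sum>d\<le>(N - m) div 2. ?F d) + (\<Sum>d\<in>{(N - m) div 2<..N div 2}. ?F d)"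
      by (simp only: ) (rule sum.union_disjoint, auto)
    then have "norm ((\<Sum>d\<le>N div 2. ?F d) - ?main) \<le>
        norm ((\<Sum>d\<le>(N - m) div 2. ?F d) - ?main) + norm (\<Sum>d\<in>{(N - m) div 2<..N div 2}. ?F d)"
      using norm_triangle_ineq[of "(\<Sum>d\<le>(N - m) div 2. ?F d) - ?main" "\<Sum>d\<in>{(N - m) div 2<..N div 2}. ?F d"]
      by (simp only: diff_add_eq[symmetric])
    moreover have "norm (\<Sum>d\<in>{(N - m) div 2<..N div 2}. ?F d) \<le> C * q powr (4 * real N / 3 - 7 / 16 * real (N - m))"
      by (rule C(2)[OF N])
    moreover have "norm ((\<Sum>d\<le>(N - m) div 2. ?F d) - ?main) \<le>
        (if 3 dvd m then q ^ N * (q ^ (m div 3) * (2 * (1 / q) ^ (g - m div 3))) else 0)"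
    proof (cases "3 dvd m")
      case True
      then obtain j where j: "m = 3 * j" by (elim dvdE)
      have "j \<le> g" using m j by simp
      from norm_small_part_le[OF this N_def] show ?thesis by (simp add: j)
    next
      case False
      then show ?thesis using small_part_eq_0[OF False, of N] N(1) by simp
    qed
    ultimately show "norm ((\<Sum>G\<in>{G \<in> monics (3 * g + 1). squarefree G}. \<Sum>a\<in>monics m. chi G a)
      - (if 3 dvd m then of_real (q ^ (3 * g + 1) * (euler_product squarefree_factor * (q ^ (m div 3) * partial_C (m div 3)))) else 0))
    \<le> (if 3 dvd m then q ^ (3 * g + 1) * (q ^ (m div 3) * (2 * (1 / q) ^ (g - m div 3))) else 0) +
      C * q powr (4 * real (3 * g + 1) / 3 - 7 / 16 * real (3 * g + 1 - m))"
      unfolding N_def[symmetric] sum_squarefree_chi by linarith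
  qed
qed

lemma card_squarefree:
  "complex_of_nat (card {G \<in> monics N. squarefree (G :: 'k poly)}) =
    of_real (q ^ N * (\<Sum>d\<le>N div 2. prime_set_sum squarefree_factor d))"
proof -
  have "complex_of_nat (card {G \<in> monics N. squarefree (G :: 'k poly)}) =
      (\<Sum>G\<in>{G \<in> monics N. squarefree (G :: 'k poly)}. 1)" by simp
  also have "\<dots> = (\<Sum>d\<le>N div 2. \<Sum>T\<in>(prime_sets d :: 'k poly set set). (-1) ^ card T * (\<Sum>G\<in>(monics (N - 2 * d) :: 'k poly set). 1))"
    by (rule squarefree_sieve[where f = "\<lambda>_. 1"])
  also have "\<dots> = (\<Sum>d\<le>N div 2. \<Sum>T\<in>(prime_sets d :: 'k poly set set). of_real (q ^ N * (\<Prod>P\<in>T. squarefree_factor P)))"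
  proof (intro sum.cong refl)
    fix d and T :: "'k poly set" assume d: "d \<in> {..N div 2}" and T: "T \<in> prime_sets d"
    have T': "finite T" "T \<subseteq> prime_polys" "degree (\<Prod>T) = d" using T by (auto simp: prime_sets_def)
    have pr: "(\<Prod>P\<in>T. squarefree_factor P) = (-1) ^ card T / q ^ (2 * d)"
      unfolding T'(3)[symmetric] degree_prod_primes[OF T'(1,2)] squarefree_factor_def
      by (simp add: prod_uminus prod_dividef power_sum sum_distrib_left)
    have "2 * d \<le> N" using d by auto
    then have "q ^ (N - 2 * d) = q ^ N / q ^ (2 * d)" using q_ge_7 by (simp add: power_diff)
    moreover have "(\<Sum>G\<in>(monics (N - 2 * d) :: 'k poly set). 1 :: complex) = of_real (q ^ (N - 2 * d))"
      by (simp add: card_monics of_nat_card_q)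
    ultimately show "(-1) ^ card T * (\<Sum>G\<in>(monics (N - 2 * d) :: 'k poly set). 1) = complex_of_real (q ^ N * (\<Prod>P\<in>T. squarefree_factor P))"
      by (simp add: pr)
  qed
  finally show ?thesis by (simp only: of_real_sum prime_set_sum_def sum_distrib_left)
qed

end

subsection \<open>The family of cubic characters\<close>

lemma squarefree_eq_prod_prime_divisors:
  fixes F :: "'k::finite_field poly"
  assumes "monic F" "squarefree F"
  shows "F = \<Prod>(prime_divisors F)"
proof -
  have F0: "F \<noteq> 0" using monic_nonzero[OF assms(1)] .
  have S: "finite (prime_divisors F)" "prime_divisors F \<subseteq> prime_polys"
    using F0 by (auto simp: prime_divisors_def finite_prime_divisors)
  let ?D = "\<Prod>(prime_divisors F)"
  have "?D dvd F" using prod_primes_dvd_iff[OF S, of F] by simp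
  then obtain H where H: "F = ?D * H" by (elim dvdE)
  have mD: "monic ?D" by (rule monic_prod_primes[OF S(2)])
  have mH: "monic H" using monic_mult_cancel[OF mD] H assms(1) by metis
  have "H = 1"
  proof (rule ccontr)
    assume "H \<noteq> 1"
    then obtain Q where Q: "Q \<in> prime_polys" "Q dvd H" using exists_prime_factor[OF mH] by blast
    then have "Q dvd F" using H by (metis dvd_mult)
    then have "Q dvd ?D" using Q(1) S(1) by (intro dvd_prodI) (auto simp: prime_divisors_def)
    then have "Q * Q dvd ?D * H" using Q(2) by (rule mult_dvd_mono)
    then have "Q ^ 2 dvd F" using H by (simp add: power2_eq_square)
    then show False using assms(2) Q(1) squarefree_iff_primes[OF F0] by blast
  qed
  then show ?thesis using H by simp
qed

context cubic_symbol
begin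

text \<open>Every prime divisor of F divides a modulus N of definition of the character; as F is the
  product of its prime divisors, F divides N.\<close>

lemma cond_degree_chi:
  assumes F: "monic F" "squarefree F"
  shows "cond_degree (chi F) = degree F"
  unfolding cond_degree_def
proof (rule Least_equality)
  have "chi F a = 1" if "[a = 1] (mod F)" for a
    using chi_cong[OF F(1), of a 1] that F(1) by (simp add: cong_def)
  then show "\<exists>N. monic N \<and> degree N = degree F \<and> (\<forall>a. chi F a \<noteq> 0 \<longrightarrow> [a = 1] (mod N) \<longrightarrow> chi F a = 1)"
    using F(1) by blast
next
  fix n assume "\<exists>N. monic N \<and> degree N = n \<and> (\<forall>a. chi F a \<noteq> 0 \<longrightarrow> [a = 1] (mod N) \<longrightarrow> chi F a = 1)"
  then obtain N where N: "monic N" "degree N = n"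
    "\<And>a. chi F a \<noteq> 0 \<Longrightarrow> [a = 1] (mod N) \<Longrightarrow> chi F a = 1" by blast
  have dvd: "P dvd N" if P: "P \<in> prime_divisors F" for P
  proof (rule ccontr)
    assume nd: "\<not> P dvd N"
    have P': "P \<in> prime_polys" "P dvd F" using P by (auto simp: prime_divisors_def)
    then obtain G where G: "F = P * G" by (elim dvdE)
    have mP: "monic P" using prime_polysD(1)[OF P'(1)] .
    have mG: "monic G" using monic_mult_cancel[OF mP] G F(1) by metis
    have "\<not> P dvd G"
    proof
      assume "P dvd G"
      then have "P ^ 2 dvd F" unfolding G power2_eq_square by (rule mult_dvd_mono[OF dvd_refl])
      then show False using F(2) P'(1) squarefree_iff_primes[OF monic_nonzero[OF F(1)]] by blast
    qed
    then have nd2: "\<not> P dvd G * N" using nd prime_dvd_mult_iff_poly[OF P'(1)] by blast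
    have mGN: "monic (G * N)" by (rule monic_mult[OF mG N(1)])
    \<comment> \<open>This \<open>b\<close> is 1 modulo N and modulo the cofactor \<open>G\<close>
      of \<open>P\<close> in \<open>F\<close>, yet a nonresidue modulo \<open>P\<close>, so
      \<open>chi F b\<close> differs from 1.\<close>
    obtain b where b: "b mod (G * N) = 1 mod (G * N)" "chi P b \<noteq> 0" "chi (P ^ 1 * (G * N)) b \<noteq> 1"
      using prime_power_nonresidue[OF P'(1) mGN nd2, of 1] by auto
    have d: "G * N dvd b - 1" using b(1) by (simp add: mod_eq_dvd_iff)
    have "b mod G = 1 mod G" using dvd_mult_left[OF d] by (simp add: mod_eq_dvd_iff)
    then have "chi G b = 1" using chi_cong[OF mG, of b 1] mG by simp
    then have 1: "chi F b = chi P b" by (simp add: G chi_mult_left[OF mP mG])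
    have "chi (G * N) b = 1" using chi_cong[OF mGN b(1)] mGN by simp
    then have 2: "chi P b \<noteq> 1" using b(3) by (simp add: chi_mult_left[OF mP mGN])
    have "[b = 1] (mod N)" using dvd_mult_right[OF d] by (simp add: cong_def mod_eq_dvd_iff)
    then show False using N(3)[of b] b(2) 1 2 by simp
  qed
  have "\<Prod>(prime_divisors F) dvd N"
  proof (rule prod_primes_dvd)
    show "finite (prime_divisors F)" using monic_nonzero[OF F(1)] by simp
    show "prime_divisors F \<subseteq> prime_polys" by (auto simp: prime_divisors_def)
  qed (rule dvd)
  then have "F dvd N" by (simp only: squarefree_eq_prod_prime_divisors[OF F, symmetric])
  then show "degree F \<le> n" using dvd_imp_degree_le N monic_nonzero by blast
qed

text \<open>Modulo a prime of degree 1 every residue is a constant, so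
  \<open>prime_nonresidue\<close> yields a constant noncube.\<close>

lemma omega_nontrivial: "\<exists>c. c \<noteq> 0 \<and> omega c \<noteq> 1"
proof -
  have T: "monic (monom 1 1 :: 'k poly)" "degree (monom 1 1 :: 'k poly) = 1"
    using monicsD[OF monom_in_monics[of 1]] by auto
  then have "(monom 1 1 :: 'k poly) \<noteq> 1" by auto
  then obtain P :: "'k poly" where P: "P \<in> prime_polys" "P dvd monom 1 1"
    using exists_prime_factor[OF T(1)] by blast
  have "degree P \<le> 1" using dvd_imp_degree_le[OF P(2)] monic_nonzero[OF T(1)] T(2) by simp
  then have deg: "degree P = 1" using prime_polysD(5)[OF P(1)] by simp
  obtain b where b: "\<not> P dvd b" "chi P b \<noteq> 1" using prime_nonresidue[OF P(1)] by blast
  have "b mod P \<in> polys_below 1" using mod_in_polys_below[OF prime_polysD(4)[OF P(1)], of b] deg by simp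
  then obtain c where c: "b mod P = [:c:]" by (auto simp: polys_below_iff elim: degree_eq_zeroE)
  have "chi P b = chi P (b mod P)" by (rule chi_cong[OF prime_polysD(1)[OF P(1)]]) simp
  then have "chi P b = omega c" using chi_const[OF prime_polysD(1)[OF P(1)], of c] deg c by simp
  moreover have "c \<noteq> 0" using b(1) c by (auto simp: dvd_eq_mod_eq_0)
  ultimately show ?thesis using b(2) by metis
qed

lemma chi_trivial_on_constants_iff:
  assumes "monic F"
  shows "(\<forall>c. c \<noteq> 0 \<longrightarrow> chi F [:c:] = 1) \<longleftrightarrow> 3 dvd degree F"
proof
  assume "3 dvd degree F"
  then obtain k where "degree F = 3 * k" by (elim dvdE)
  then show "\<forall>c. c \<noteq> 0 \<longrightarrow> chi F [:c:] = 1" using assms by (simp add: chi_const power_mult omega_cube)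
next
  assume *: "\<forall>c. c \<noteq> 0 \<longrightarrow> chi F [:c:] = 1"
  obtain c where c: "c \<noteq> 0" "omega c \<noteq> 1" using omega_nontrivial by blast
  define w where "w = omega c"
  have w3: "w ^ 3 = 1" "w \<noteq> 1" using c omega_cube by (auto simp: w_def)
  have "w ^ degree F = 1" using * c(1) chi_const[OF assms, of c] by (simp add: w_def)
  moreover have "w ^ degree F = w ^ (degree F mod 3)"
    using w3(1) by (metis mult_div_mod_eq mult_1 power_add power_mult power_one)
  ultimately have r: "w ^ (degree F mod 3) = 1" by simp
  have "degree F mod 3 \<noteq> 1"
  proof
    assume "degree F mod 3 = 1"
    then show False using r w3(2) by simp
  qed
  moreover have "degree F mod 3 \<noteq> 2"
  proof
    assume "degree F mod 3 = 2"
    then have "w ^ 2 = 1" using r by simp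
    then have "w ^ 3 = w" by (simp add: power3_eq_cube power2_eq_square)
    then show False using w3 by simp
  qed
  ultimately have "degree F mod 3 = 0" by presburger
  then show "3 dvd degree F" by presburger
qed

text \<open>Genus 3g allows degree 3g + 2 with trivial restriction to constants or 3g + 1 with
  nontrivial restriction. Triviality means that 3 divides the degree, which excludes the first
  case.\<close>

lemma cubic_family_eq:
  "cubic_family \<Omega> (3 * g) = chi ` {F \<in> monics (3 * g + 1). squarefree F}"
proof -
  have eq: "cubic_char \<Omega> F = chi F" if "monic F" for F
    by (rule ext) (rule cubic_char_eq_chi[OF that])
  have genus: "char_genus (chi F) = int (3 * g) \<longleftrightarrow> degree F = 3 * g + 1" if F: "monic F" "squarefree F" for F
    unfolding char_genus_def cond_degree_chi[OF F] chi_trivial_on_constants_iff[OF F(1)] by presburger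
  have "cubic_family \<Omega> (3 * g) = {\<psi>. \<exists>F. (monic F \<and> squarefree F) \<and> \<psi> = chi F \<and> degree F = 3 * g + 1}"
    unfolding cubic_family_def using eq genus by (metis (no_types, lifting))
  then show ?thesis by (auto simp: monics_def)
qed

text \<open>A square-free F is the product of the primes at which its character vanishes. So an
  average over the set of characters is one over polynomials.\<close>

lemma inj_on_chi: "inj_on chi {F. monic F \<and> squarefree F}"
proof (rule inj_onI)
  fix F G assume F: "F \<in> {F. monic F \<and> squarefree F}" and G: "G \<in> {F. monic F \<and> squarefree F}" and eq: "chi F = chi G"
  have "prime_divisors H = {P \<in> prime_polys. chi H P = 0}" if "monic H" for H
  proof -
    have "chi H P = 0 \<longleftrightarrow> P dvd H" if P: "P \<in> prime_polys" for P
      unfolding chi_eq_0_iff[OF \<open>monic H\<close>]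
    proof
      assume "\<not> coprime H P"
      then have "\<not> coprime P H" by (simp only: coprime_commute not_False_eq_True)
      then show "P dvd H" using prime_poly_coprime[OF P] by blast
    next
      assume "P dvd H"
      then show "\<not> coprime H P"
        using coprime_common_divisor[of H P P] prime_poly_not_dvd_one[OF P] dvd_refl by blast
    qed
    then show ?thesis by (auto simp: prime_divisors_def)
  qed
  then have "prime_divisors F = prime_divisors G" using F G eq by simp
  then show "F = G" using squarefree_eq_prod_prime_divisors F G by (metis mem_Collect_eq)
qed

end

context cubic_gauss
begin

text \<open>A polynomial of degree N not divisible by 3 is not a cube, so its character sums over
  degrees m >= N vanish and the series is finite.\<close>

lemma L_fun_chi:
  assumes "F \<in> monics N" "\<not> 3 dvd N"
  shows "L_fun (of_real s) (chi F) =
    (\<Sum>m<N. of_real (q powr (- (real m * s))) * (\<Sum>a\<in>monics m. chi F a))"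
proof -
  have mF: "monic F" and dF: "degree F = N" using monicsD[OF assms(1)] by auto
  have nc: "\<nexists>A. monic A \<and> F = A ^ 3"
  proof
    assume "\<exists>A. monic A \<and> F = A ^ 3"
    then obtain A where A: "monic A" "F = A ^ 3" by blast
    then have "N = 3 * degree A" using dF by (simp add: degree_power_eq monic_nonzero)
    then show False using assms(2) by simp
  qed
  have terms: "(\<Sum>a | monic a \<and> degree a = m. chi F a * of_nat (poly_norm a) powr (- of_real s)) =
      of_real (q powr (- (real m * s))) * (\<Sum>a\<in>monics m. chi F a)" for m
  proof -
    have "complex_of_nat (poly_norm a) powr (- of_real s) = of_real (q powr (- (real m * s)))"
      if "a \<in> monics m" for a :: "'k poly"
    proof -
      have "complex_of_nat (poly_norm a) = of_real (q powr real m)"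
        using monicsD(2)[OF that] by (simp add: poly_norm_def of_nat_card_q q_powr_nat)
      then have "complex_of_nat (poly_norm a) powr (- of_real s) = of_real ((q powr real m) powr (- s))"
        by (simp add: powr_of_real flip: of_real_minus)
      then show ?thesis by (simp add: powr_powr)
    qed
    then show ?thesis unfolding monics_def[symmetric] sum_distrib_left
      by (intro sum.cong refl) (simp add: mult.commute)
  qed
  have "(\<Sum>a\<in>monics m. chi F a) = 0" if "m \<notin> {..<N}" for m
    using sum_chi_monics_noncube[OF mF nc, of m] that dF by simp
  then show ?thesis
    unfolding L_fun_def terms by (intro suminf_finite) auto
qed

definition numerator :: "real \<Rightarrow> nat \<Rightarrow> complex" where
  "numerator s g = (\<Sum>m<3 * g + 1. of_real (q powr (- (real m * s))) *
     (\<Sum>G\<in>{G \<in> monics (3 * g + 1). squarefree G}. \<Sum>a\<in>monics m. chi G a))"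

lemma family_average_eq:
  "family_average \<Omega> (3 * g) (of_real s) =
    numerator s g / of_nat (card {G \<in> monics (3 * g + 1). squarefree (G :: 'k poly)})"
proof -
  let ?H = "{G \<in> monics (3 * g + 1). squarefree (G :: 'k poly)}"
  have inj: "inj_on chi ?H"
    by (rule inj_on_subset[OF inj_on_chi]) (auto simp: monics_def)
  have N: "\<not> 3 dvd 3 * g + 1" by presburger
  have "(\<Sum>\<psi>\<in>cubic_family \<Omega> (3 * g). L_fun (of_real s) \<psi>) = (\<Sum>G\<in>?H. L_fun (of_real s) (chi G))"
    unfolding cubic_family_eq sum.reindex[OF inj] o_def ..
  also have "\<dots> = (\<Sum>G\<in>?H. \<Sum>m<3 * g + 1. of_real (q powr (- (real m * s))) * (\<Sum>a\<in>monics m. chi G a))"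
    by (rule sum.cong[OF refl]) (rule L_fun_chi[OF _ N], simp)
  also have "\<dots> = numerator s g"
    unfolding numerator_def by (subst sum.swap) (simp only: sum_distrib_left)
  finally show ?thesis
    unfolding family_average_def by (simp only: cubic_family_eq card_image[OF inj])
qed

end

subsection \<open>Asymptotics\<close>

text \<open>Convolution of two geometric sequences, the common shape of both error terms:
  \<open>a\<close> measures the distance of s from 1/3, and \<open>b\<close> the decay away from the
  top degree.\<close>

definition geom_conv :: "real \<Rightarrow> real \<Rightarrow> nat \<Rightarrow> real" where
  "geom_conv a b n = (\<Sum>m\<le>n. a ^ m * b ^ (n - m))"

lemma geom_conv_le:
  assumes "0 \<le> a" "a \<le> 1" "0 \<le> b" "b < 1"
  shows "geom_conv a b n \<le> 1 / (1 - b)"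
proof (induction n)
  case 0
  show ?case using assms by (simp add: geom_conv_def divide_simps)
next
  case (Suc n)
  have "(\<Sum>m\<le>n. a ^ m * b ^ (Suc n - m)) = b * geom_conv a b n"
    unfolding geom_conv_def sum_distrib_left
    by (intro sum.cong refl) (simp add: Suc_diff_le)
  then have "geom_conv a b (Suc n) = b * geom_conv a b n + a ^ Suc n"
    by (simp add: geom_conv_def)
  also have "\<dots> \<le> b * (1 / (1 - b)) + 1"
    using Suc assms power_le_one[OF assms(1,2), of "Suc n"] by (intro add_mono mult_left_mono) auto
  also have "\<dots> = 1 / (1 - b)" using assms by (simp add: field_simps)
  finally show ?case .
qed

text \<open>These are the terms of the Cauchy product of two convergent series.\<close>

lemma geom_conv_tendsto_0:
  assumes "0 \<le> a" "a < 1" "0 \<le> b" "b < 1"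
  shows "geom_conv a b \<longlonglongrightarrow> 0"
proof -
  have "summable (\<lambda>n. \<Sum>i\<le>n. a ^ i * b ^ (n - i))"
    using assms by (intro summable_Cauchy_product) (auto intro: summable_geometric)
  then show ?thesis unfolding geom_conv_def[abs_def] by (rule summable_LIMSEQ_zero)
qed

lemma sum_over_multiples_of_3:
  fixes f :: "nat \<Rightarrow> 'a::comm_monoid_add"
  shows "(\<Sum>m<3 * g + 1. if 3 dvd m then f (m div 3) else 0) = (\<Sum>j\<le>g. f j)"
proof (induction g)
  case (Suc g)
  have "\<not> 3 dvd 3 * g + 1" "\<not> 3 dvd Suc (3 * g + 1)" "3 dvd Suc (Suc (3 * g + 1))"
    "Suc (Suc (3 * g + 1)) div 3 = Suc g" by presburger+
  moreover have "3 * Suc g + 1 = Suc (Suc (Suc (3 * g + 1)))" by simp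
  ultimately show ?case using Suc by (simp only: sum.lessThan_Suc sum.atMost_Suc if_True if_False add_0_right)
qed simp

context cubic_gauss
begin

text \<open>The base \<open>q\<^bsup>-5/48\<^esup>\<close> comes from \<open>1/3 - 7/16 = -5/48\<close>, with \<open>7/16\<close> from \<open>large_part_bound\<close>.\<close>

lemma numerator_bound:
  "\<exists>C>0. \<forall>s g. norm (numerator s g / of_real (q ^ (3 * g + 1)) -
      of_real (euler_product squarefree_factor * (\<Sum>j\<le>g. (q powr (1 - 3 * s)) ^ j * partial_C j))) \<le>
    2 * geom_conv (q powr (1 - 3 * s)) (1 / q) g +
    C * geom_conv (q powr (1 / 3 - s)) (q powr (- 5 / 48)) (3 * g + 1)"
proof -
  obtain C where C: "C > 0" "\<And>g m. m < 3 * g + 1 \<Longrightarrow>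
    norm ((\<Sum>G\<in>{G \<in> monics (3 * g + 1). squarefree G}. \<Sum>a\<in>monics m. chi G a)
      - (if 3 dvd m then of_real (q ^ (3 * g + 1) * (euler_product squarefree_factor * (q ^ (m div 3) * partial_C (m div 3)))) else 0))
    \<le> (if 3 dvd m then q ^ (3 * g + 1) * (q ^ (m div 3) * (2 * (1 / q) ^ (g - m div 3))) else 0) +
      C * q powr (4 * real (3 * g + 1) / 3 - 7 / 16 * real (3 * g + 1 - m))"
    using sum_squarefree_chi_bound by blast
  show ?thesis
  proof (intro exI[of _ C] conjI C(1) allI)
    fix s :: real and g :: nat
    define N where "N = 3 * g + 1"
    define x where "x = q powr (1 - 3 * s)"
    define y where "y = q powr (1 / 3 - s)"
    define b where "b = q powr (- 5 / 48)"
    define w where "w m = q powr (- (real m * s))" for m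
    let ?S = "\<lambda>m. \<Sum>G\<in>{G \<in> monics N. squarefree G}. \<Sum>a\<in>monics m. chi G a"
    let ?M = "\<lambda>m. if 3 dvd m then of_real (q ^ N * (euler_product squarefree_factor * (q ^ (m div 3) * partial_C (m div 3)))) else 0 :: complex"
    have of_real_mult_eq: "of_real a * of_real b = complex_of_real c" if "a * b = c" for a b c :: real
      using that by (metis of_real_mult)
    \<comment> \<open>The q^j cubes of degree 3j carry weight q^(-3js) each, which explains the
      ratio x = q^(1 - 3s).\<close>
    have wx: "w (3 * j) * q ^ j = x ^ j" for j
      unfolding w_def x_def q_powr_nat[symmetric] q_powr_mult_nat[symmetric] powr_add[symmetric]
      by (rule arg_cong[of _ _ "\<lambda>t. q powr t"]) (simp add: algebra_simps)
    have wy: "w m * q powr (4 * real N / 3 - 7 / 16 * real (N - m)) = q ^ N * (y ^ m * b ^ (N - m))" if "m < N" for m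
    proof -
      define u where "u = real (N - m)"
      have N: "real N = real m + u" using that by (simp add: u_def)
      have "- (real m * s) + (4 * real N / 3 - 7 / 16 * u) = real N + ((1 / 3 - s) * real m + - 5 / 48 * u)"
        unfolding N by (simp add: field_simps)
      then show ?thesis
        unfolding w_def y_def b_def q_powr_nat[symmetric] q_powr_mult_nat[symmetric] powr_add[symmetric] u_def
        by (rule arg_cong)
    qed
    have main: "(\<Sum>m<N. of_real (w m) * ?M m) = of_real (q ^ N * (euler_product squarefree_factor * (\<Sum>j\<le>g. x ^ j * partial_C j)))"
    proof -
      have "(\<Sum>m<N. of_real (w m) * ?M m) =
          (\<Sum>m<3 * g + 1. if 3 dvd m then of_real (q ^ N * (euler_product squarefree_factor * (x ^ (m div 3) * partial_C (m div 3)))) else 0)"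
        unfolding N_def[symmetric]
      proof (rule sum.cong[OF refl])
        fix m
        show "of_real (w m) * ?M m = (if 3 dvd m then of_real (q ^ N * (euler_product squarefree_factor * (x ^ (m div 3) * partial_C (m div 3)))) else 0)"
        proof (cases "3 dvd m")
          case True
          then have wx': "w m * q ^ (m div 3) = x ^ (m div 3)" using wx[of "m div 3"] by simp
          have "w m * (q ^ N * (euler_product squarefree_factor * (q ^ (m div 3) * partial_C (m div 3)))) =
              q ^ N * (euler_product squarefree_factor * ((w m * q ^ (m div 3)) * partial_C (m div 3)))" by (simp only: mult_ac)
          also have "\<dots> = q ^ N * (euler_product squarefree_factor * (x ^ (m div 3) * partial_C (m div 3)))" by (simp only: wx')
          finally have "of_real (w m) * complex_of_real (q ^ N * (euler_product squarefree_factor * (q ^ (m div 3) * partial_C (m div 3)))) =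
              of_real (q ^ N * (euler_product squarefree_factor * (x ^ (m div 3) * partial_C (m div 3))))"
            by (rule of_real_mult_eq)
          with True show ?thesis by (simp only: if_True)
        next
          case False
          then show ?thesis by (simp only: if_False mult_zero_right)
        qed
      qed
      also have "\<dots> = (\<Sum>j\<le>g. of_real (q ^ N * (euler_product squarefree_factor * (x ^ j * partial_C j))))"
        by (rule sum_over_multiples_of_3)
      finally show ?thesis by (simp only: of_real_sum sum_distrib_left)
    qed
    have "norm (numerator s g - of_real (q ^ N * (euler_product squarefree_factor * (\<Sum>j\<le>g. x ^ j * partial_C j)))) =
        norm (\<Sum>m<N. of_real (w m) * (?S m - ?M m))"
      unfolding main[symmetric] numerator_def N_def[symmetric] w_def[symmetric]
      by (simp only: right_diff_distrib sum_subtractf)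
    also have "\<dots> \<le> (\<Sum>m<N. (if 3 dvd m then q ^ N * (2 * (x ^ (m div 3) * (1 / q) ^ (g - m div 3))) else 0) +
        q ^ N * (C * (y ^ m * b ^ (N - m))))"
    proof (rule sum_norm_le)
      fix m assume "m \<in> {..<N}"
      then have m: "m < N" by simp
      have w0: "0 \<le> w m" by (simp add: w_def)
      have "norm (of_real (w m) * (?S m - ?M m)) = w m * norm (?S m - ?M m)"
        using w0 by (simp add: norm_mult)
      also have "\<dots> \<le> w m * ((if 3 dvd m then q ^ N * (q ^ (m div 3) * (2 * (1 / q) ^ (g - m div 3))) else 0) +
          C * q powr (4 * real N / 3 - 7 / 16 * real (N - m)))"
        using C(2)[OF m[unfolded N_def]] w0 unfolding N_def[symmetric] by (rule mult_left_mono)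
      also have "\<dots> = (if 3 dvd m then q ^ N * (2 * ((w m * q ^ (m div 3)) * (1 / q) ^ (g - m div 3))) else 0) +
          C * (w m * q powr (4 * real N / 3 - 7 / 16 * real (N - m)))"
        by (simp add: distrib_left mult_ac)
      also have "(if 3 dvd m then q ^ N * (2 * ((w m * q ^ (m div 3)) * (1 / q) ^ (g - m div 3))) else 0) =
          (if 3 dvd m then q ^ N * (2 * (x ^ (m div 3) * (1 / q) ^ (g - m div 3))) else 0)"
        using wx[of "m div 3"] by auto
      also have "C * (w m * q powr (4 * real N / 3 - 7 / 16 * real (N - m))) = q ^ N * (C * (y ^ m * b ^ (N - m)))"
        unfolding wy[OF m] by (simp only: mult_ac)
      finally show "norm (of_real (w m) * (?S m - ?M m)) \<le>
        (if 3 dvd m then q ^ N * (2 * (x ^ (m div 3) * (1 / q) ^ (g - m div 3))) else 0) +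
        q ^ N * (C * (y ^ m * b ^ (N - m)))" .
    qed
    also have "\<dots> = (\<Sum>j\<le>g. q ^ N * (2 * (x ^ j * (1 / q) ^ (g - j)))) + (\<Sum>m<N. q ^ N * (C * (y ^ m * b ^ (N - m))))"
      unfolding sum.distrib N_def sum_over_multiples_of_3[of "\<lambda>j. q ^ (3 * g + 1) * (2 * (x ^ j * (1 / q) ^ (g - j)))"] ..
    also have "\<dots> = q ^ N * (2 * geom_conv x (1 / q) g + C * (\<Sum>m<N. y ^ m * b ^ (N - m)))"
      by (simp only: geom_conv_def sum_distrib_left distrib_left)
    also have "\<dots> \<le> q ^ N * (2 * geom_conv x (1 / q) g + C * geom_conv y b N)"
    proof -
      \<comment> \<open>The nonnegative term m = N, which the L-polynomial lacks, is added to reach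
        \<open>geom_conv\<close>.\<close>
      have "(\<Sum>m<N. y ^ m * b ^ (N - m)) \<le> geom_conv y b N"
        unfolding geom_conv_def by (rule sum_mono2) (auto simp: y_def b_def)
      then show ?thesis using C(1) q_ge_7 by (intro mult_left_mono add_left_mono) auto
    qed
    finally have le: "norm (numerator s g - of_real (q ^ N * (euler_product squarefree_factor * (\<Sum>j\<le>g. x ^ j * partial_C j)))) \<le>
      q ^ N * (2 * geom_conv x (1 / q) g + C * geom_conv y b N)" .
    have qN: "q ^ N > 0" using q_ge_7 by simp
    have cancel: "of_real (q ^ N * t) / of_real (q ^ N) = (of_real t :: complex)" for t
      using q_ge_7 by simp
    have "numerator s g / of_real (q ^ N) - of_real (euler_product squarefree_factor * (\<Sum>j\<le>g. x ^ j * partial_C j)) =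
        (numerator s g - of_real (q ^ N * (euler_product squarefree_factor * (\<Sum>j\<le>g. x ^ j * partial_C j)))) / of_real (q ^ N)"
      by (simp only: diff_divide_distrib cancel)
    then have "norm (numerator s g / of_real (q ^ N) - of_real (euler_product squarefree_factor * (\<Sum>j\<le>g. x ^ j * partial_C j))) =
        norm (numerator s g - of_real (q ^ N * (euler_product squarefree_factor * (\<Sum>j\<le>g. x ^ j * partial_C j)))) / q ^ N"
      using qN by (simp only: norm_divide norm_of_real abs_of_pos)
    also have "\<dots> \<le> 2 * geom_conv x (1 / q) g + C * geom_conv y b N"
      using le qN by (simp add: divide_le_eq mult.commute)
    finally show "norm (numerator s g / of_real (q ^ (3 * g + 1)) -
      of_real (euler_product squarefree_factor * (\<Sum>j\<le>g. (q powr (1 - 3 * s)) ^ j * partial_C j))) \<le>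
      2 * geom_conv (q powr (1 - 3 * s)) (1 / q) g +
      C * geom_conv (q powr (1 / 3 - s)) (q powr (- 5 / 48)) (3 * g + 1)"
      unfolding N_def x_def y_def b_def .
  qed
qed

lemma squarefree_density:
  "(\<lambda>g. \<Sum>d\<le>(3 * g + 1) div 2. prime_set_sum squarefree_factor d) \<longlonglongrightarrow> euler_product squarefree_factor"
proof -
  have "filterlim (\<lambda>g::nat. (3 * g + 1) div 2) at_top at_top"
    by (rule filterlim_at_top_mono[OF filterlim_ident]) (auto intro!: always_eventually)
  from filterlim_compose[OF prime_set_sum_sums[OF small_squarefree_factor, unfolded sums_def_le] this]
  show ?thesis .
qed

lemma family_average_eq_quotient:
  "family_average \<Omega> (3 * g) (of_real s) =
    (numerator s g / of_real (q ^ (3 * g + 1))) / of_real (\<Sum>d\<le>(3 * g + 1) div 2. prime_set_sum squarefree_factor d)"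
  unfolding family_average_eq card_squarefree by simp

lemma euler_product_squarefree_pos: "euler_product squarefree_factor > 0" and euler_product_C_pos: "euler_product C_factor > 0"
  using q_ge_7 by (auto intro!: euler_product_pos small_squarefree_factor small_C_factor simp: squarefree_factor_def C_factor_def)

text \<open>For x = q^(1 - 3s) this is the local term -1/(|P|^(3s) (|P| + 1)) of M_q. The scaling by
  x^(deg P) multiplies the coefficient of degree d by x^d.\<close>

definition M_factor :: "real \<Rightarrow> 'k poly \<Rightarrow> real" where "M_factor x P = C_factor P * x ^ degree P"

lemma small_M_factor:
  assumes "0 \<le> x" "x \<le> 1"
  shows "small_on_primes (M_factor x)"
  unfolding small_on_primes_def
proof
  fix P :: "'k poly" assume P: "P \<in> prime_polys"
  have "\<bar>M_factor x P\<bar> = \<bar>C_factor P\<bar> * x ^ degree P" using assms by (simp add: M_factor_def abs_mult)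
  also have "\<dots> \<le> \<bar>C_factor P\<bar> * 1" using assms by (intro mult_left_mono power_le_one) auto
  also have "\<dots> \<le> 1 / q ^ (2 * degree P)" using small_C_factor P by (simp add: small_on_primes_def)
  finally show "\<bar>M_factor x P\<bar> \<le> 1 / q ^ (2 * degree P)" .
qed

lemma prime_set_sum_M_factor: "prime_set_sum (M_factor x) d = prime_set_sum C_factor d * x ^ d"
  unfolding prime_set_sum_def sum_distrib_right
proof (rule sum.cong[OF refl])
  fix T :: "'k poly set" assume T: "T \<in> prime_sets d"
  then have T': "finite T" "T \<subseteq> prime_polys" "degree (\<Prod>T) = d" by (auto simp: prime_sets_def)
  show "(\<Prod>P\<in>T. M_factor x P) = (\<Prod>P\<in>T. C_factor P) * x ^ d"
    unfolding T'(3)[symmetric] degree_prod_primes[OF T'(1,2)]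
    by (simp add: M_factor_def prod.distrib power_sum)
qed

text \<open>The terms x^k \<open>partial_C k\<close> form the Cauchy product of the coefficients of
  the Euler product in M_q with the geometric series of x, whose sum 1/(1 - x) is
  zeta_q(3s).\<close>

lemma weighted_partial_sums:
  assumes "0 \<le> x" "x < 1"
  shows "(\<lambda>g. \<Sum>j\<le>g. x ^ j * partial_C j) \<longlonglongrightarrow> euler_product (M_factor x) * (1 / (1 - x))"
proof -
  have small: "small_on_primes (M_factor x)" using assms by (intro small_M_factor) auto
  have norm: "summable (\<lambda>d. norm (prime_set_sum (M_factor x) d))"
    by (rule summable_comparison_test'[of "\<lambda>d. (1 / q) ^ d"])
      (use abs_prime_set_sum_le[OF small] q_ge_7 in \<open>auto intro!: summable_geometric\<close>)
  have geo: "(\<lambda>i. x ^ i) sums (1 / (1 - x))" using assms by (intro geometric_sums) auto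
  have "(\<lambda>k. \<Sum>i\<le>k. prime_set_sum (M_factor x) i * x ^ (k - i)) sums
      ((\<Sum>i. prime_set_sum (M_factor x) i) * (\<Sum>i. x ^ i))"
    using assms by (intro Cauchy_product_sums norm) (auto intro: summable_geometric)
  moreover have "(\<Sum>i\<le>k. prime_set_sum (M_factor x) i * x ^ (k - i)) = x ^ k * partial_C k" for k
    unfolding partial_C_def sum_distrib_left prime_set_sum_M_factor
  proof (rule sum.cong[OF refl])
    fix i assume "i \<in> {..k}"
    then have "x ^ i * x ^ (k - i) = x ^ k" by (simp add: power_add[symmetric])
    then show "prime_set_sum C_factor i * x ^ i * x ^ (k - i) = x ^ k * prime_set_sum C_factor i"
      by (metis mult.assoc mult.commute)
  qed
  ultimately show ?thesis
    unfolding sums_unique[OF prime_set_sum_sums[OF small], symmetric] sums_unique[OF geo, symmetric] sums_def_le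
    by simp
qed

text \<open>For s > 1/3 both bases in \<open>geom_conv\<close> are below 1, so the errors vanish,
  and the square-free density cancels between numerator and cardinality.\<close>

lemma average_limit:
  assumes "1 / 3 < s"
  defines "x \<equiv> q powr (1 - 3 * s)"
  shows "(\<lambda>g. family_average \<Omega> (3 * g) (of_real s)) \<longlonglongrightarrow> of_real (euler_product (M_factor x) * (1 / (1 - x)))"
proof -
  have x: "0 \<le> x" "x < 1" using assms q_ge_7 by (auto simp: x_def powr_less_one)
  define y where "y = q powr (1 / 3 - s)"
  define b where "b = q powr (- 5 / 48)"
  have y: "0 \<le> y" "y < 1" using assms q_ge_7 by (auto simp: y_def powr_less_one)
  have b: "0 \<le> b" "b < 1" using q_ge_7 by (auto simp: b_def powr_less_one)
  obtain C where C: "\<And>g. norm (numerator s g / of_real (q ^ (3 * g + 1)) -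
      of_real (euler_product squarefree_factor * (\<Sum>j\<le>g. x ^ j * partial_C j))) \<le>
    2 * geom_conv x (1 / q) g + C * geom_conv y b (3 * g + 1)"
    using numerator_bound unfolding x_def y_def b_def by blast
  have g: "filterlim (\<lambda>g::nat. 3 * g + 1) at_top at_top"
    by (rule filterlim_at_top_mono[OF filterlim_ident]) (auto intro!: always_eventually)
  have "(\<lambda>g. 2 * geom_conv x (1 / q) g + C * geom_conv y b (3 * g + 1)) \<longlonglongrightarrow> 2 * 0 + C * 0"
    using q_ge_7 x y b
    by (intro tendsto_add tendsto_mult tendsto_const geom_conv_tendsto_0
        filterlim_compose[OF geom_conv_tendsto_0 g]) auto
  then have "(\<lambda>g. 2 * geom_conv x (1 / q) g + C * geom_conv y b (3 * g + 1)) \<longlonglongrightarrow> 0" by simp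
  from Lim_null_comparison[OF always_eventually[OF allI[OF C]] this]
  have "(\<lambda>g. numerator s g / of_real (q ^ (3 * g + 1)) -
      of_real (euler_product squarefree_factor * (\<Sum>j\<le>g. x ^ j * partial_C j))) \<longlonglongrightarrow> 0" .
  moreover have "(\<lambda>g. of_real (euler_product squarefree_factor * (\<Sum>j\<le>g. x ^ j * partial_C j)) :: complex) \<longlonglongrightarrow>
      of_real (euler_product squarefree_factor * (euler_product (M_factor x) * (1 / (1 - x))))"
    by (intro tendsto_of_real tendsto_mult tendsto_const weighted_partial_sums x)
  ultimately have "(\<lambda>g. (numerator s g / of_real (q ^ (3 * g + 1)) -
      of_real (euler_product squarefree_factor * (\<Sum>j\<le>g. x ^ j * partial_C j))) + of_real (euler_product squarefree_factor * (\<Sum>j\<le>g. x ^ j * partial_C j))) \<longlonglongrightarrow>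
      0 + of_real (euler_product squarefree_factor * (euler_product (M_factor x) * (1 / (1 - x))))"
    by (rule tendsto_add)
  then have "(\<lambda>g. numerator s g / of_real (q ^ (3 * g + 1))) \<longlonglongrightarrow> of_real (euler_product squarefree_factor * (euler_product (M_factor x) * (1 / (1 - x))))"
    by (simp only: diff_add_cancel add_0)
  from tendsto_divide[OF this tendsto_of_real[OF squarefree_density]] euler_product_squarefree_pos
  have "(\<lambda>g. family_average \<Omega> (3 * g) (of_real s)) \<longlonglongrightarrow>
      of_real (euler_product squarefree_factor * (euler_product (M_factor x) * (1 / (1 - x)))) / of_real (euler_product squarefree_factor)"
    unfolding family_average_eq_quotient by simp
  also have "of_real (euler_product squarefree_factor * (euler_product (M_factor x) * (1 / (1 - x)))) / of_real (euler_product squarefree_factor) =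
      (of_real (euler_product (M_factor x) * (1 / (1 - x))) :: complex)"
    using euler_product_squarefree_pos by simp
  finally show ?thesis .
qed

text \<open>The deviations of \<open>partial_C j\<close> from its limit form a convergent geometric
  series, so their total is bounded while the main term grows linearly; the g + 1 summands count as
  g in the limit.\<close>

lemma partial_C_average: "(\<lambda>g. (\<Sum>j\<le>g. partial_C j) / real g) \<longlonglongrightarrow> euler_product C_factor"
proof -
  have one: "\<bar>partial_C j - euler_product C_factor\<bar> \<le> 2 * (1 / q) ^ j" for j
  proof -
    have "\<bar>euler_product C_factor - partial_C j\<bar> \<le> 2 * (1 / q) ^ Suc j"
      using prime_set_sum_tail_le[OF small_C_factor, of "Suc j"] by (simp only: partial_C_def lessThan_Suc_atMost)
    also have "\<dots> \<le> 2 * (1 / q) ^ j" using q_ge_7 by (intro mult_left_mono power_decreasing) auto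
    finally show ?thesis by (simp only: abs_minus_commute)
  qed
  have bound: "norm ((\<Sum>j\<le>g. partial_C j) / real g - (real g + 1) / real g * euler_product C_factor) \<le> 4 * (1 / real g)" for g
  proof -
    have "(\<Sum>j\<le>g. partial_C j) - (real g + 1) * euler_product C_factor = (\<Sum>j\<le>g. partial_C j - euler_product C_factor)"
      by (simp add: sum_subtractf)
    also have "\<bar>\<dots>\<bar> \<le> (\<Sum>j\<le>g. 2 * (1 / q) ^ j)"
      by (intro order_trans[OF sum_abs] sum_mono one)
    also have "\<dots> \<le> 2 * 2"
      unfolding sum_distrib_left[symmetric] using q_ge_7 by (intro mult_left_mono geometric_half_le) auto
    finally have "\<bar>(\<Sum>j\<le>g. partial_C j) - (real g + 1) * euler_product C_factor\<bar> / real g \<le> 4 / real g"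
      by (intro divide_right_mono) auto
    moreover have "\<bar>(\<Sum>j\<le>g. partial_C j) / real g - (real g + 1) / real g * euler_product C_factor\<bar> =
        \<bar>(\<Sum>j\<le>g. partial_C j) - (real g + 1) * euler_product C_factor\<bar> / real g"
      by (simp add: diff_divide_distrib[symmetric] abs_divide)
    ultimately show ?thesis by simp
  qed
  have inv: "(\<lambda>g. 4 * (1 / real g)) \<longlonglongrightarrow> 0"
    using tendsto_mult[OF tendsto_const[of "4::real"] lim_1_over_n] by simp
  have "(\<lambda>g. (\<Sum>j\<le>g. partial_C j) / real g - (real g + 1) / real g * euler_product C_factor) \<longlonglongrightarrow> 0"
    by (rule Lim_null_comparison[OF always_eventually[OF allI[OF bound]] inv])
  moreover have "(\<lambda>g. (real g + 1) / real g * euler_product C_factor) \<longlonglongrightarrow> 1 * euler_product C_factor"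
    by (intro tendsto_mult tendsto_const) (use LIMSEQ_Suc_n_over_n in \<open>simp add: add.commute\<close>)
  ultimately have "(\<lambda>g. ((\<Sum>j\<le>g. partial_C j) / real g - (real g + 1) / real g * euler_product C_factor) +
      (real g + 1) / real g * euler_product C_factor) \<longlonglongrightarrow> 0 + 1 * euler_product C_factor"
    by (rule tendsto_add)
  then show ?thesis by (simp only: diff_add_cancel add_0 mult_1)
qed

text \<open>At s = 1/3 the ratio of the main terms is 1, so they accumulate linearly in g, while
  both \<open>geom_conv\<close> errors are merely bounded; division by g removes them.\<close>

lemma average_limit_third:
  "(\<lambda>g. family_average \<Omega> (3 * g) (of_real (1 / 3)) / of_nat g) \<longlonglongrightarrow> of_real (euler_product C_factor)"
proof -
  define b where "b = q powr (- 5 / 48)"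
  have b: "0 \<le> b" "b < 1" using q_ge_7 by (auto simp: b_def powr_less_one)
  have q1: "0 \<le> 1 / q" "1 / q < 1" using q_ge_7 by auto
  let ?B = "\<lambda>g. \<Sum>j\<le>g. partial_C j"
  obtain C where C0: "C > 0" "\<And>s g. norm (numerator s g / of_real (q ^ (3 * g + 1)) -
      of_real (euler_product squarefree_factor * (\<Sum>j\<le>g. (q powr (1 - 3 * s)) ^ j * partial_C j))) \<le>
    2 * geom_conv (q powr (1 - 3 * s)) (1 / q) g + C * geom_conv (q powr (1 / 3 - s)) b (3 * g + 1)"
    using numerator_bound unfolding b_def by blast
  have one: "q powr (1 - 3 * (1 / 3)) = 1" "q powr (1 / 3 - 1 / 3) = 1" using q_ge_7 by simp_all
  have C: "C > 0" "norm (numerator (1 / 3) g / of_real (q ^ (3 * g + 1)) - of_real (euler_product squarefree_factor * ?B g)) \<le>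
    2 * geom_conv 1 (1 / q) g + C * geom_conv 1 b (3 * g + 1)" for g
    using C0(1) C0(2)[of "1 / 3" g] unfolding one power_one mult_1 .
  define E where "E = 2 * (1 / (1 - 1 / q)) + C * (1 / (1 - b))"
  have bound: "norm (numerator (1 / 3) g / of_real (q ^ (3 * g + 1)) / of_nat g - of_real (euler_product squarefree_factor * (?B g / real g))) \<le>
      E * (1 / real g)" for g
  proof -
    have "norm (numerator (1 / 3) g / of_real (q ^ (3 * g + 1)) - of_real (euler_product squarefree_factor * ?B g)) \<le> E"
      unfolding E_def
      using C(1) b q1 by (intro order_trans[OF C(2)] add_mono mult_left_mono geom_conv_le) auto
    then have "norm (numerator (1 / 3) g / of_real (q ^ (3 * g + 1)) - of_real (euler_product squarefree_factor * ?B g)) / real g \<le> E / real g"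
      by (intro divide_right_mono) auto
    moreover have "numerator (1 / 3) g / of_real (q ^ (3 * g + 1)) / of_nat g - of_real (euler_product squarefree_factor * (?B g / real g)) =
        (numerator (1 / 3) g / of_real (q ^ (3 * g + 1)) - of_real (euler_product squarefree_factor * ?B g)) / of_nat g"
      by (simp only: diff_divide_distrib times_divide_eq_right of_real_divide of_real_of_nat_eq)
    ultimately show ?thesis by (simp only: norm_divide norm_of_nat times_divide_eq_right mult_1_right)
  qed
  have inv: "(\<lambda>g. E * (1 / real g)) \<longlonglongrightarrow> 0"
    using tendsto_mult[OF tendsto_const[of E] lim_1_over_n] by simp
  have "(\<lambda>g. numerator (1 / 3) g / of_real (q ^ (3 * g + 1)) / of_nat g - of_real (euler_product squarefree_factor * (?B g / real g))) \<longlonglongrightarrow> 0"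
    by (rule Lim_null_comparison[OF always_eventually[OF allI[OF bound]] inv])
  moreover have "(\<lambda>g. of_real (euler_product squarefree_factor * (?B g / real g)) :: complex) \<longlonglongrightarrow> of_real (euler_product squarefree_factor * euler_product C_factor)"
    by (intro tendsto_of_real tendsto_mult tendsto_const partial_C_average)
  ultimately have "(\<lambda>g. (numerator (1 / 3) g / of_real (q ^ (3 * g + 1)) / of_nat g - of_real (euler_product squarefree_factor * (?B g / real g)))
      + of_real (euler_product squarefree_factor * (?B g / real g))) \<longlonglongrightarrow> 0 + of_real (euler_product squarefree_factor * euler_product C_factor)"
    by (rule tendsto_add)
  then have "(\<lambda>g. numerator (1 / 3) g / of_real (q ^ (3 * g + 1)) / of_nat g) \<longlonglongrightarrow> of_real (euler_product squarefree_factor * euler_product C_factor)"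
    by (simp only: diff_add_cancel add_0)
  from tendsto_divide[OF this tendsto_of_real[OF squarefree_density]] euler_product_squarefree_pos
  have "(\<lambda>g. numerator (1 / 3) g / of_real (q ^ (3 * g + 1)) / of_nat g /
      of_real (\<Sum>d\<le>(3 * g + 1) div 2. prime_set_sum squarefree_factor d)) \<longlonglongrightarrow>
      of_real (euler_product squarefree_factor * euler_product C_factor) / of_real (euler_product squarefree_factor)" by simp
  also have "of_real (euler_product squarefree_factor * euler_product C_factor) / of_real (euler_product squarefree_factor) = (of_real (euler_product C_factor) :: complex)"
    using euler_product_squarefree_pos by simp
  finally show ?thesis
    unfolding family_average_eq_quotient by (simp only: divide_divide_eq_left mult_ac)
qed

lemma prime_prod_eq:
  assumes "small_on_primes f" "\<And>P. P \<in> prime_polys \<Longrightarrow> h P = of_real (1 + f P)"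
  shows "prime_prod h = of_real (euler_product f)"
  unfolding prime_prod_def
proof (rule tendsto_Lim[OF finite_subsets_at_top_neq_bot])
  have "((\<lambda>S. of_real (\<Prod>P\<in>S. 1 + f P)) \<longlongrightarrow> (of_real (euler_product f) :: complex)) (finite_subsets_at_top prime_polys)"
    by (intro tendsto_of_real tendsto_euler_product assms(1))
  moreover have "\<forall>\<^sub>F S in finite_subsets_at_top prime_polys. of_real (\<Prod>P\<in>S. 1 + f P) = (\<Prod>P\<in>S. h P)"
  proof (rule eventually_finite_subsets_at_top_weakI)
    fix S :: "'k poly set" assume S: "finite S" "S \<subseteq> prime_polys"
    show "of_real (\<Prod>P\<in>S. 1 + f P) = (\<Prod>P\<in>S. h P)"
      unfolding of_real_prod by (rule prod.cong[OF refl]) (use S assms(2) in auto)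
  qed
  ultimately show "((\<lambda>S. \<Prod>P\<in>S. h P) \<longlongrightarrow> of_real (euler_product f)) (finite_subsets_at_top prime_polys)"
    by (rule Lim_transform_eventually)
qed

lemma C_const_eq: "C_const TYPE('k) = of_real (euler_product C_factor)"
  unfolding C_const_def
  by (rule prime_prod_eq[OF small_C_factor]) (simp add: poly_norm_def of_nat_card_q C_factor_def)

lemma M_const_eq:
  assumes "1 / 3 < s"
  defines "x \<equiv> q powr (1 - 3 * s)"
  shows "M_const TYPE('k) (of_real s) = of_real (euler_product (M_factor x) * (1 / (1 - x)))"
proof -
  have x: "0 \<le> x" "x \<le> 1" using assms q_ge_7 q_powr_mono[of "1 - 3 * s" 0] by (auto simp: x_def)
  have "complex_of_nat CARD('k) powr (1 - 3 * of_real s) = of_real x"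
  proof -
    have "1 - 3 * complex_of_real s = of_real (1 - 3 * s)" by simp
    then show ?thesis unfolding of_nat_card_q x_def using q_ge_7 by (simp only: powr_of_real)
  qed
  then have zeta: "zeta_q CARD('k) (3 * of_real s) = of_real (1 / (1 - x))"
    by (simp add: zeta_q_def divide_inverse)
  have "prime_prod (\<lambda>P :: 'k poly.
      1 - 1 / (of_nat (poly_norm P) powr (3 * of_real s) * (of_nat (poly_norm P) + 1))) = of_real (euler_product (M_factor x))"
  proof (rule prime_prod_eq[OF small_M_factor[OF x]])
    fix P :: "'k poly"
    define z where "z = q ^ degree P"
    have z: "z > 0" using q_ge_7 by (simp add: z_def)
    have n: "complex_of_nat (poly_norm P) = of_real z" by (simp add: poly_norm_def of_nat_card_q z_def)
    have "complex_of_real z powr (3 * of_real s) = of_real (z powr (3 * s))"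
    proof -
      have "3 * complex_of_real s = of_real (3 * s)" by simp
      then show ?thesis using z by (simp only: powr_of_real order.strict_implies_order)
    qed
    moreover have "z powr (3 * s) * x ^ degree P = z"
    proof -
      have "z powr (3 * s) = q powr (3 * s * real (degree P))"
        unfolding z_def q_powr_nat[symmetric] powr_powr by (simp add: mult.commute)
      moreover have "x ^ degree P = q powr ((1 - 3 * s) * real (degree P))"
        unfolding x_def q_powr_mult_nat ..
      moreover have "3 * s * real (degree P) + (1 - 3 * s) * real (degree P) = real (degree P)"
        by (simp add: algebra_simps)
      ultimately show ?thesis by (simp add: powr_add[symmetric] q_powr_nat z_def)
    qed
    then have "x ^ degree P = z / z powr (3 * s)" using z by (simp add: eq_divide_eq mult.commute)
    then have "M_factor x P = - (1 / (z powr (3 * s) * (z + 1)))"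
      using z by (simp add: M_factor_def C_factor_def z_def[symmetric])
    ultimately show "1 - 1 / (of_nat (poly_norm P) powr (3 * of_real s) * (of_nat (poly_norm P) + 1)) =
        complex_of_real (1 + M_factor x P)"
      unfolding n by simp
  qed
  then show ?thesis unfolding M_const_def zeta by (simp add: mult.commute)
qed

lemma average_asymptotics:
  shows "1 / 3 < s \<Longrightarrow> (\<lambda>g. family_average \<Omega> (3 * g) (of_real s)) \<sim>[at_top] (\<lambda>g. M_const TYPE('k) (of_real s))"
    and "(\<lambda>g. family_average \<Omega> (3 * g) (1 / 3)) \<sim>[at_top] (\<lambda>g. C_const TYPE('k) * of_nat g)"
proof -
  assume s: "1 / 3 < s"
  define x where "x = q powr (1 - 3 * s)"
  have x: "0 \<le> x" "x < 1" using s q_ge_7 by (auto simp: x_def powr_less_one)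
  have "euler_product (M_factor x) > 0"
    using x q_ge_7 by (intro euler_product_pos small_M_factor) (auto simp: M_factor_def C_factor_def divide_nonpos_nonneg)
  then have "euler_product (M_factor x) * (1 / (1 - x)) \<noteq> 0" using x by simp
  then show "(\<lambda>g. family_average \<Omega> (3 * g) (of_real s)) \<sim>[at_top] (\<lambda>g. M_const TYPE('k) (of_real s))"
    unfolding M_const_eq[OF s] x_def using average_limit[OF s]
    by (intro tendsto_imp_asymp_equiv_const) (simp_all only: of_real_eq_0_iff not_False_eq_True)
next
  have C: "complex_of_real (euler_product C_factor) \<noteq> 0" using euler_product_C_pos by simp
  have "(\<lambda>g. family_average \<Omega> (3 * g) (of_real (1 / 3)) / of_nat g / of_real (euler_product C_factor)) \<longlonglongrightarrow>
      of_real (euler_product C_factor) / of_real (euler_product C_factor)"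
    by (intro tendsto_divide tendsto_const average_limit_third C)
  then have "(\<lambda>g. family_average \<Omega> (3 * g) (1 / 3) / (C_const TYPE('k) * of_nat g)) \<longlonglongrightarrow> 1"
    using C by (simp add: C_const_eq mult.commute)
  then show "(\<lambda>g. family_average \<Omega> (3 * g) (1 / 3)) \<sim>[at_top] (\<lambda>g. C_const TYPE('k) * of_nat g)"
    by (rule asymp_equivI')
qed

end

theorem corollary1p2:
  fixes \<Omega> :: "'k::finite_field \<Rightarrow> complex"
  assumes "CARD('k) mod 6 = 1"
    and "cube_root_iso \<Omega>"
  shows "(\<forall>s::real. 1/3 < s \<and> s < 1 \<longrightarrow>
            (\<lambda>g. family_average \<Omega> (3 * g) (of_real s))
              \<sim>[at_top] (\<lambda>g. M_const TYPE('k) (of_real s))) \<and>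
         (\<lambda>g. family_average \<Omega> (3 * g) (1/3))
           \<sim>[at_top] (\<lambda>g. C_const TYPE('k) * of_nat g)"
proof -
  \<comment> \<open>The additive character is auxiliary: it enters only through the Gauss sums, so
    any nontrivial choice serves.\<close>
  obtain \<psi> :: "'k \<Rightarrow> complex" where \<psi>: "\<forall>x y. \<psi> (x + y) = \<psi> x * \<psi> y" "\<forall>x. norm (\<psi> x) = 1" "\<exists>x. \<psi> x \<noteq> 1"
    using exists_additive_character by blast
  interpret cubic_gauss \<Omega> "(CARD('k) - 1) div 3" \<psi>
  proof unfold_locales
    show "CARD('k) = 3 * ((CARD('k) - 1) div 3) + 1" "even ((CARD('k) - 1) div 3)"
      using assms(1) by presburger+
  qed (use assms(2) \<psi> in auto)
  show ?thesis using average_asymptotics by blast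
qed

end
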